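(* Let $p$ be a prime, $n\ge1$ an integer, and let $\alpha=(\alpha_1,\dots,\alpha_n)=(\beta,\dots,\beta)$ be an $n$-tuple having all entries equal to $\beta$. Assume that $(n-1)/2<\beta<n$. Then the semigroup $\exp(-t\,\mathfrak{V}^\alpha)$ on $\mathbb{Q}_p^n$ is transient and its Green function $g_\alpha(z)$ satisfies the estimates $$c_1\left(\frac1{\|z\|_{p,\alpha}}\right)^{A-1}\le g_\alpha(z)\le c_2\left(\frac1{\|z\|_{p,\alpha}}\right)^{A-1}$$ for all non-zero $z\in\mathbb{Q}_p^n$ and some constants $c_1,c_2>0$, where $A=\sum_{i=1}^n\frac1{\alpha_i}=\frac n\beta$ and $\|z\|_{p,\alpha}=\max_i\|z_i\|_p^{\alpha_i}=\max_i\|z_i\|_p^\beta$.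
   Context: $\|\cdot\|_p$ is the $p$-adic norm on $\mathbb{Q}_p$; $\mathbb{Q}_p^n$ carries the product topology and the product Haar measure (normalized on $\mathbb{Z}_p^n$). $\mathcal{V}_c$ is the space of compactly supported locally constant functions on $\mathbb{Q}_p^n$. For $f\in\mathcal{V}_c$, the Vladimirov Laplacian is $\mathfrak{V}^\alpha f(x)=\sum_{i=1}^n\mathfrak{D}^{\alpha_i}_{x_i}f(x)$, where $\mathfrak{D}^{\alpha_i}_{x_i}$ is the one-dimensional $p$-adic fractional derivative of order $\alpha_i$ acting in the variable $x_i$; on compactly supported locally constant functions on $\mathbb{Q}_p$, $\mathfrak{D}^{\beta}$ is defined through the Fourier transform of $\mathbb{Q}_p$ by $\widehat{\mathfrak{D}^\beta f}(\xi)=\|\xi\|_p^\beta\widehat f(\xi)$. The operator $(\mathfrak{V}^\alpha,\mathcal{V}_c)$ is essentially self-adjoint and non-negative definite in $L^2(\mathbb{Q}_p^n)$, and $\exp(-t\,\mathfrak{V}^\alpha)$ is a symmetric translation invariant Markov semigroup with heat kernel $p_\alpha(t,x-y)$, where $p_\alpha(t,z)=\prod_{i=1}^np_{\alpha_i}(t,z_i)$ and $p_{\alpha_i}(t,x_i-y_i)$ is the heat kernel of $\exp(-t\mathfrak{D}^{\alpha_i})$ on $\mathbb{Q}_p$. The Green function is $g_\alpha(z)=\int_0^\infty p_\alpha(t,z)\,dt$. The semigroup is transient if the function $x\mapsto\int_0^\infty e^{-t\mathfrak{V}^\alpha}f(x)\,dt$ is bounded for every non-negative bounded Borel function $f$ with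 compact support. *)

theory Defs
  imports "HOL-Analysis.Analysis" "Berlekamp_Zassenhaus.Finite_Field"
begin

definition rat_padic_abs :: "nat \<Rightarrow> rat \<Rightarrow> real" where
  "rat_padic_abs p r =
     (if r = 0 then 0
      else real p powi (int (multiplicity (int p) (snd (quotient_of r)))
                        - int (multiplicity (int p) (fst (quotient_of r)))))"

lemma rat_padic_abs_Fract:
  assumes "prime p" "a \<noteq> 0" "b \<noteq> 0"
  shows "rat_padic_abs p (of_int a / of_int b) =
           real p powi (int (multiplicity (int p) b) - int (multiplicity (int p) a))"
proof -
  obtain c d where q: "quotient_of (of_int a / of_int b) = (c, d)"
    by (meson surj_pair)
  have d: "d > 0" using q by (rule quotient_of_denom_pos)
  have eq: "of_int a / of_int b = (of_int c / of_int d :: rat)"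
    using quotient_of_div[OF q] .
  then have "(of_int (a * d) :: rat) = of_int (c * b)"
    using assms d by (simp add: field_simps)
  then have ad: "a * d = c * b" by (simp only: of_int_eq_iff)
  have c: "c \<noteq> 0" using ad assms d by auto
  have pe: "prime_elem (int p)" using assms by simp
  have "multiplicity (int p) a + multiplicity (int p) d
          = multiplicity (int p) c + multiplicity (int p) b"
    using prime_elem_multiplicity_mult_distrib[OF pe, of a d]
      prime_elem_multiplicity_mult_distrib[OF pe, of c b] ad assms d c by auto
  then have "int (multiplicity (int p) d) - int (multiplicity (int p) c)
              = int (multiplicity (int p) b) - int (multiplicity (int p) a)"
    by linarith
  then show ?thesis
    unfolding rat_padic_abs_def using assms q by simp
qed

lemma rat_padic_abs_zero [simp]: "rat_padic_abs p 0 = 0"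
  by (simp add: rat_padic_abs_def)

lemma rat_padic_abs_nonneg [simp]: "rat_padic_abs p x \<ge> 0"
  by (simp add: rat_padic_abs_def)

lemma rat_padic_abs_eq_0_iff: "prime p \<Longrightarrow> rat_padic_abs p x = 0 \<longleftrightarrow> x = 0"
  using prime_gt_0_nat[of p] by (simp add: rat_padic_abs_def)

lemma rat_exhaust_div:
  fixes x :: rat
  obtains a b where "b \<noteq> 0" "x = of_int a / of_int b"
proof -
  obtain a b where q: "quotient_of x = (a, b)" by (meson surj_pair)
  show ?thesis
    using that[of b a] quotient_of_denom_pos[OF q] quotient_of_div[OF q] by auto
qed

lemma rat_padic_abs_mult:
  assumes p: "prime p"
  shows "rat_padic_abs p (x * y) = rat_padic_abs p x * rat_padic_abs p y"
proof (cases "x = 0 \<or> y = 0")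
  case False
  obtain a b where x: "b \<noteq> 0" "x = of_int a / of_int b" by (rule rat_exhaust_div)
  obtain c d where y: "d \<noteq> 0" "y = of_int c / of_int d" by (rule rat_exhaust_div)
  have nz: "a \<noteq> 0" "c \<noteq> 0" using False x y by auto
  have xy: "x * y = of_int (a * c) / of_int (b * d)" using x y by simp
  have pe: "prime_elem (int p)" using p by simp
  have p0: "real p \<noteq> 0" using prime_gt_0_nat[OF p] by simp
  have "int (multiplicity (int p) (b * d)) - int (multiplicity (int p) (a * c))
     = (int (multiplicity (int p) b) - int (multiplicity (int p) a))
       + (int (multiplicity (int p) d) - int (multiplicity (int p) c))"
    using prime_elem_multiplicity_mult_distrib[OF pe, of b d]
      prime_elem_multiplicity_mult_distrib[OF pe, of a c] x y nz by simp
  then show ?thesis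
    unfolding xy unfolding x(2) y(2)
    using nz x(1) y(1) p p0 by (simp add: rat_padic_abs_Fract power_int_add del: of_int_mult)
qed auto

lemma rat_padic_abs_one: "prime p \<Longrightarrow> rat_padic_abs p 1 = 1"
  using rat_padic_abs_Fract[of p 1 1] by simp

lemma rat_padic_abs_minus:
  assumes p: "prime p"
  shows "rat_padic_abs p (- x) = rat_padic_abs p x"
proof -
  have "rat_padic_abs p (-1) = 1"
    using rat_padic_abs_Fract[of p "-1" 1] p by (simp add: multiplicity_unit_right)
  then show ?thesis using rat_padic_abs_mult[OF p, of "-1" x] by simp
qed

lemma rat_padic_abs_ultra:
  assumes p: "prime p"
  shows "rat_padic_abs p (x + y) \<le> max (rat_padic_abs p x) (rat_padic_abs p y)"
proof (cases "x = 0 \<or> y = 0 \<or> x + y = 0")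
  case False
  obtain a b where x: "b \<noteq> 0" "x = of_int a / of_int b" by (rule rat_exhaust_div)
  obtain c d where y: "d \<noteq> 0" "y = of_int c / of_int d" by (rule rat_exhaust_div)
  let ?m = "multiplicity (int p)"
  have xb: "x = of_int (a * d) / of_int (b * d)" using x y by simp
  have yb: "y = of_int (c * b) / of_int (b * d)" using x y by simp
  have xy: "x + y = of_int (a * d + c * b) / of_int (b * d)"
    using x y by (simp add: field_simps)
  have nz: "a * d \<noteq> 0" "c * b \<noteq> 0" "b * d \<noteq> 0" "a * d + c * b \<noteq> 0"
  proof -
    show "a * d \<noteq> 0" "c * b \<noteq> 0" "b * d \<noteq> 0" using False x y by auto
    show "a * d + c * b \<noteq> 0"
    proof
      assume "a * d + c * b = 0"
      then have "x + y = 0" unfolding xy by (simp only: of_int_0 div_0)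
      then show False using False by simp
    qed
  qed
  have pu: "\<not> is_unit (int p)" using p by auto
  have "int p ^ min (?m (a * d)) (?m (c * b)) dvd a * d + c * b"
    by (intro dvd_add multiplicity_dvd') auto
  then have ge: "min (?m (a * d)) (?m (c * b)) \<le> ?m (a * d + c * b)"
    using multiplicity_geI[OF nz(4) pu] by auto
  have p1: "1 \<le> real p" using prime_gt_0_nat[OF p] by simp
  have f: "rat_padic_abs p x = real p powi (int (?m (b * d)) - int (?m (a * d)))"
    "rat_padic_abs p y = real p powi (int (?m (b * d)) - int (?m (c * b)))"
    "rat_padic_abs p (x + y) = real p powi (int (?m (b * d)) - int (?m (a * d + c * b)))"
    unfolding xy unfolding xb yb by (intro rat_padic_abs_Fract p nz)+
  show ?thesis
  proof (cases "?m (a * d) \<le> ?m (a * d + c * b)")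
    case True
    then have "rat_padic_abs p (x + y) \<le> rat_padic_abs p x"
      unfolding f using p1 by (intro power_int_increasing) auto
    then show ?thesis by simp
  next
    case False
    then have "?m (c * b) \<le> ?m (a * d + c * b)" using ge by auto
    then have "rat_padic_abs p (x + y) \<le> rat_padic_abs p y"
      unfolding f using p1 by (intro power_int_increasing) auto
    then show ?thesis by simp
  qed
qed (auto simp: max_def)

lemma rat_padic_abs_triangle:
  assumes "prime p"
  shows "rat_padic_abs p (x + y) \<le> rat_padic_abs p x + rat_padic_abs p y"
  using rat_padic_abs_ultra[OF assms, of x y] rat_padic_abs_nonneg[of p x]
    rat_padic_abs_nonneg[of p y] by linarith

lemma rat_padic_abs_triangle3:
  assumes "prime p"
  shows "\<bar>rat_padic_abs p x - rat_padic_abs p y\<bar> \<le> rat_padic_abs p (x - y)"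
  using rat_padic_abs_triangle[OF assms, of "x - y" y]
    rat_padic_abs_triangle[OF assms, of "y - x" x]
    rat_padic_abs_minus[OF assms, of "x - y"] by (simp add: abs_le_iff)

lemma rat_padic_abs_inverse:
  assumes "prime p"
  shows "rat_padic_abs p (inverse x) = inverse (rat_padic_abs p x)"
proof (cases "x = 0")
  case False
  then have "rat_padic_abs p x * rat_padic_abs p (inverse x) = 1"
    using rat_padic_abs_mult[OF assms, of x "inverse x"] rat_padic_abs_one[OF assms] by simp
  then show ?thesis by (metis inverse_unique)
qed auto

definition padic_cauchy :: "nat \<Rightarrow> (nat \<Rightarrow> rat) \<Rightarrow> bool" where
  "padic_cauchy p X \<longleftrightarrow> (\<forall>e>0. \<exists>k. \<forall>m\<ge>k. \<forall>n\<ge>k. rat_padic_abs p (X m - X n) < e)"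

definition padic_null :: "nat \<Rightarrow> (nat \<Rightarrow> rat) \<Rightarrow> bool" where
  "padic_null p X \<longleftrightarrow> (\<lambda>n. rat_padic_abs p (X n)) \<longlonglongrightarrow> 0"

lemma padic_null_bound:
  assumes "padic_null p X" "eventually (\<lambda>n. rat_padic_abs p (Y n) \<le> c * rat_padic_abs p (X n)) sequentially"
  shows "padic_null p Y"
proof -
  have "(\<lambda>n. c * rat_padic_abs p (X n)) \<longlonglongrightarrow> c * 0"
    using assms(1) unfolding padic_null_def by (intro tendsto_intros)
  then show ?thesis
    unfolding padic_null_def
    by (intro tendsto_sandwich[of "\<lambda>_. 0", OF _ assms(2)]) auto
qed

lemma padic_null_zero [simp]: "padic_null p (\<lambda>_. 0)"
  by (simp add: padic_null_def)

lemma padic_null_add: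
  assumes "prime p" "padic_null p X" "padic_null p Y"
  shows "padic_null p (\<lambda>n. X n + Y n)"
proof -
  have lim: "(\<lambda>n. rat_padic_abs p (X n) + rat_padic_abs p (Y n)) \<longlonglongrightarrow> 0"
    using tendsto_add[OF assms(2,3)[unfolded padic_null_def]] by simp
  show ?thesis
    unfolding padic_null_def
    by (rule Lim_null_comparison[OF _ lim]) (simp add: rat_padic_abs_triangle[OF assms(1)])
qed

lemma padic_null_minus: "prime p \<Longrightarrow> padic_null p (\<lambda>n. - X n) \<longleftrightarrow> padic_null p X"
  by (simp add: padic_null_def rat_padic_abs_minus)

lemma padic_null_diff_commute:
  "prime p \<Longrightarrow> padic_null p (\<lambda>n. X n - Y n) \<longleftrightarrow> padic_null p (\<lambda>n. Y n - X n)"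
  using padic_null_minus[of p "\<lambda>n. X n - Y n"] by simp

lemma padic_cauchy_const [simp]: "padic_cauchy p (\<lambda>_. c)"
  by (simp add: padic_cauchy_def)

lemma padic_cauchy_add:
  assumes p: "prime p" and X: "padic_cauchy p X" and Y: "padic_cauchy p Y"
  shows "padic_cauchy p (\<lambda>n. X n + Y n)"
  unfolding padic_cauchy_def
proof (intro allI impI)
  fix e :: real assume e: "e > 0"
  obtain k where k: "\<forall>m\<ge>k. \<forall>n\<ge>k. rat_padic_abs p (X m - X n) < e"
    using X e unfolding padic_cauchy_def by blast
  obtain l where l: "\<forall>m\<ge>l. \<forall>n\<ge>l. rat_padic_abs p (Y m - Y n) < e"
    using Y e unfolding padic_cauchy_def by blast
  have "rat_padic_abs p (X m + Y m - (X n + Y n)) < e" if "m \<ge> max k l" "n \<ge> max k l" for m n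
  proof -
    have "rat_padic_abs p (X m + Y m - (X n + Y n)) = rat_padic_abs p ((X m - X n) + (Y m - Y n))"
      by (simp add: algebra_simps)
    also have "\<dots> \<le> max (rat_padic_abs p (X m - X n)) (rat_padic_abs p (Y m - Y n))"
      by (rule rat_padic_abs_ultra[OF p])
    also have "\<dots> < e" using that k l by auto
    finally show ?thesis .
  qed
  then show "\<exists>k. \<forall>m\<ge>k. \<forall>n\<ge>k. rat_padic_abs p (X m + Y m - (X n + Y n)) < e" by blast
qed

lemma padic_cauchy_minus:
  assumes p: "prime p" and X: "padic_cauchy p X"
  shows "padic_cauchy p (\<lambda>n. - X n)"
proof -
  have "rat_padic_abs p (- X m - - X n) = rat_padic_abs p (X m - X n)" for m n
    using rat_padic_abs_minus[OF p, of "X m - X n"] by simp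
  then show ?thesis using X unfolding padic_cauchy_def by simp
qed

lemma padic_cauchy_abs_convergent:
  assumes p: "prime p" and X: "padic_cauchy p X"
  shows "convergent (\<lambda>n. rat_padic_abs p (X n))"
proof -
  have "Cauchy (\<lambda>n. rat_padic_abs p (X n))"
    unfolding Cauchy_def dist_real_def
    using X unfolding padic_cauchy_def
    by (meson le_less_trans rat_padic_abs_triangle3[OF p])
  then show ?thesis by (simp add: Cauchy_convergent_iff)
qed

lemma padic_cauchy_bounded:
  assumes p: "prime p" and X: "padic_cauchy p X"
  obtains b where "b > 0" "\<And>n. rat_padic_abs p (X n) \<le> b"
proof -
  have "Bseq (\<lambda>n. rat_padic_abs p (X n))"
    using padic_cauchy_abs_convergent[OF p X] by (rule convergent_imp_Bseq)
  then show ?thesis using that unfolding Bseq_def by auto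
qed

lemma padic_cauchy_mult:
  assumes p: "prime p" and X: "padic_cauchy p X" and Y: "padic_cauchy p Y"
  shows "padic_cauchy p (\<lambda>n. X n * Y n)"
  unfolding padic_cauchy_def
proof (intro allI impI)
  fix e :: real assume e: "e > 0"
  obtain a where a: "a > 0" "\<And>n. rat_padic_abs p (X n) \<le> a"
    by (rule padic_cauchy_bounded[OF p X]) blast
  obtain b where b: "b > 0" "\<And>n. rat_padic_abs p (Y n) \<le> b"
    by (rule padic_cauchy_bounded[OF p Y]) blast
  obtain k where k: "\<forall>m\<ge>k. \<forall>n\<ge>k. rat_padic_abs p (X m - X n) < e / b"
    using X e b unfolding padic_cauchy_def by (meson divide_pos_pos)
  obtain l where l: "\<forall>m\<ge>l. \<forall>n\<ge>l. rat_padic_abs p (Y m - Y n) < e / a"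
    using Y e a unfolding padic_cauchy_def by (meson divide_pos_pos)
  have "rat_padic_abs p (X m * Y m - X n * Y n) < e" if "m \<ge> max k l" "n \<ge> max k l" for m n
  proof -
    have "rat_padic_abs p (X m * Y m - X n * Y n)
        = rat_padic_abs p ((X m - X n) * Y m + X n * (Y m - Y n))"
      by (simp add: algebra_simps)
    also have "\<dots> \<le> max (rat_padic_abs p (X m - X n) * rat_padic_abs p (Y m))
                         (rat_padic_abs p (X n) * rat_padic_abs p (Y m - Y n))"
      using rat_padic_abs_ultra[OF p] by (metis rat_padic_abs_mult[OF p])
    also have "\<dots> \<le> max (rat_padic_abs p (X m - X n) * b) (a * rat_padic_abs p (Y m - Y n))"
      using a b by (intro max.mono mult_left_mono mult_right_mono) auto
    also have "\<dots> < e"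
      using that k l a b by (auto simp: field_simps)
    finally show ?thesis .
  qed
  then show "\<exists>k. \<forall>m\<ge>k. \<forall>n\<ge>k. rat_padic_abs p (X m * Y m - X n * Y n) < e" by blast
qed

lemma padic_cauchy_not_null:
  assumes p: "prime p" and X: "padic_cauchy p X" and nz: "\<not> padic_null p X"
  obtains b k where "b > 0" "\<And>n. n \<ge> k \<Longrightarrow> rat_padic_abs p (X n) > b"
proof -
  obtain L where L: "(\<lambda>n. rat_padic_abs p (X n)) \<longlonglongrightarrow> L"
    using padic_cauchy_abs_convergent[OF p X] by (auto simp: convergent_def)
  have "L \<ge> 0" by (rule LIMSEQ_le_const[OF L]) auto
  moreover have "L \<noteq> 0" using nz L by (auto simp: padic_null_def)
  ultimately have "L > 0" by simp
  then have "eventually (\<lambda>n. rat_padic_abs p (X n) > L / 2) sequentially"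
    by (intro order_tendstoD(1)[OF L]) auto
  then show ?thesis
    using that[of "L / 2"] \<open>L > 0\<close> by (auto simp: eventually_sequentially)
qed

lemma rat_padic_abs_inverse_diff:
  assumes p: "prime p" and "b > 0" "rat_padic_abs p x > b" "rat_padic_abs p y > b"
  shows "rat_padic_abs p (inverse x - inverse y) \<le> (1 / b\<^sup>2) * rat_padic_abs p (x - y)"
proof -
  have nz: "x \<noteq> 0" "y \<noteq> 0" using assms by auto
  have "inverse x - inverse y = (inverse x * inverse y) * (- (x - y))"
    using nz by (simp add: field_simps)
  then have "rat_padic_abs p (inverse x - inverse y)
     = (inverse (rat_padic_abs p x) * inverse (rat_padic_abs p y)) * rat_padic_abs p (x - y)"
    by (simp only: rat_padic_abs_mult[OF p] rat_padic_abs_inverse[OF p] rat_padic_abs_minus[OF p])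
  also have "\<dots> \<le> (inverse b * inverse b) * rat_padic_abs p (x - y)"
    using assms by (intro mult_right_mono mult_mono le_imp_inverse_le) auto
  finally show ?thesis by (simp add: power2_eq_square field_simps)
qed

lemma padic_cauchy_inverse:
  assumes p: "prime p" and X: "padic_cauchy p X" and nz: "\<not> padic_null p X"
  shows "padic_cauchy p (\<lambda>n. inverse (X n))"
  unfolding padic_cauchy_def
proof (intro allI impI)
  fix e :: real assume e: "e > 0"
  obtain b k where b: "b > 0" "\<And>n. n \<ge> k \<Longrightarrow> rat_padic_abs p (X n) > b"
    by (rule padic_cauchy_not_null[OF p X nz]) blast
  have "e * b\<^sup>2 > 0" using e b by simp
  then obtain l where l: "\<forall>m\<ge>l. \<forall>n\<ge>l. rat_padic_abs p (X m - X n) < e * b\<^sup>2"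
    using X unfolding padic_cauchy_def by blast
  have "rat_padic_abs p (inverse (X m) - inverse (X n)) < e" if "m \<ge> max k l" "n \<ge> max k l" for m n
  proof -
    have "rat_padic_abs p (inverse (X m) - inverse (X n)) \<le> (1 / b\<^sup>2) * rat_padic_abs p (X m - X n)"
      using that b by (intro rat_padic_abs_inverse_diff[OF p]) auto
    also have "\<dots> < (1 / b\<^sup>2) * (e * b\<^sup>2)"
      using that l b by (intro mult_strict_left_mono) auto
    finally show ?thesis using b by simp
  qed
  then show "\<exists>k. \<forall>m\<ge>k. \<forall>n\<ge>k. rat_padic_abs p (inverse (X m) - inverse (X n)) < e" by blast
qed

lemma prime_CARD: "prime CARD('p::prime_card)"
  by (rule prime_card)


text \<open>The prime enters through the type parameter: for a type \<open>'p\<close> of prime cardinality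
  \<open>p = CARD('p)\<close>, the type \<open>'p padic\<close> is the completion of the rationals
  with respect to the p-adic absolute value: Cauchy sequences modulo null sequences.\<close>

typedef (overloaded) 'p padic_seq = "{X. padic_cauchy CARD('p::prime_card) X}"
  morphisms seq_nth Abs_padic_seq
  by (rule exI[of _ "\<lambda>_. 0"]) simp

setup_lifting type_definition_padic_seq

lemma padic_cauchy_seq_nth: "padic_cauchy CARD('p) (seq_nth (X :: 'p::prime_card padic_seq))"
  using seq_nth by blast

instantiation padic_seq :: (prime_card) comm_ring_1
begin

lift_definition zero_padic_seq :: "'a padic_seq" is "\<lambda>_. 0" by simp

lift_definition one_padic_seq :: "'a padic_seq" is "\<lambda>_. 1" by simp

lift_definition plus_padic_seq :: "'a padic_seq \<Rightarrow> 'a padic_seq \<Rightarrow> 'a padic_seq"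
  is "\<lambda>X Y n. X n + Y n" by (rule padic_cauchy_add[OF prime_CARD])

lift_definition uminus_padic_seq :: "'a padic_seq \<Rightarrow> 'a padic_seq"
  is "\<lambda>X n. - X n" by (rule padic_cauchy_minus[OF prime_CARD])

lift_definition minus_padic_seq :: "'a padic_seq \<Rightarrow> 'a padic_seq \<Rightarrow> 'a padic_seq"
  is "\<lambda>X Y n. X n - Y n"
  using padic_cauchy_add[OF prime_CARD padic_cauchy_minus[OF prime_CARD]]
    padic_cauchy_add[OF prime_CARD _ padic_cauchy_minus[OF prime_CARD]] by fastforce

lift_definition times_padic_seq :: "'a padic_seq \<Rightarrow> 'a padic_seq \<Rightarrow> 'a padic_seq"
  is "\<lambda>X Y n. X n * Y n" by (rule padic_cauchy_mult[OF prime_CARD])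

instance
  by (standard; transfer) (auto simp: algebra_simps fun_eq_iff)

end

definition seq_null :: "'p::prime_card padic_seq \<Rightarrow> bool" where
  "seq_null X \<longleftrightarrow> padic_null CARD('p) (seq_nth X)"

definition padic_rel :: "'p::prime_card padic_seq \<Rightarrow> 'p padic_seq \<Rightarrow> bool" where
  "padic_rel X Y \<longleftrightarrow> seq_null (X - Y)"

lemma seq_null_zero [simp]: "seq_null 0"
  by (simp add: seq_null_def zero_padic_seq.rep_eq)

lemma seq_null_add: "seq_null X \<Longrightarrow> seq_null Y \<Longrightarrow> seq_null (X + Y)"
  by (simp add: seq_null_def plus_padic_seq.rep_eq padic_null_add[OF prime_CARD])

lemma seq_null_minus: "seq_null X \<Longrightarrow> seq_null (- X)"
  by (simp add: seq_null_def uminus_padic_seq.rep_eq padic_null_minus[OF prime_CARD])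

lemma seq_null_mult:
  fixes X Y :: "'p::prime_card padic_seq"
  assumes "seq_null X"
  shows "seq_null (X * Y)"
proof -
  have p: "prime CARD('p)" by (rule prime_CARD)
  obtain b where b: "b > 0" "\<And>n. rat_padic_abs CARD('p) (seq_nth Y n) \<le> b"
    by (rule padic_cauchy_bounded[OF p padic_cauchy_seq_nth[of Y]]) blast
  show ?thesis
    unfolding seq_null_def times_padic_seq.rep_eq
    by (rule padic_null_bound[where X = "seq_nth X" and c = b])
      (use assms b in \<open>auto simp: seq_null_def rat_padic_abs_mult[OF p] mult.commute[of b]
        intro!: always_eventually mult_left_mono\<close>)
qed

lemma equivp_padic_rel: "equivp padic_rel"
proof (rule equivpI)
  show "reflp padic_rel" by (simp add: reflp_def padic_rel_def)
  show "symp padic_rel"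
    unfolding symp_def padic_rel_def by (metis minus_diff_eq seq_null_minus)
  show "transp padic_rel"
  proof (rule transpI)
    fix X Y Z :: "'p::prime_card padic_seq"
    assume "padic_rel X Y" "padic_rel Y Z"
    then show "padic_rel X Z"
      using seq_null_add[of "X - Y" "Y - Z"] by (simp add: padic_rel_def)
  qed
qed

quotient_type (overloaded) 'p padic = "'p::prime_card padic_seq" / padic_rel
  by (rule equivp_padic_rel)

lift_definition seq_inverse :: "'p::prime_card padic_seq \<Rightarrow> 'p padic_seq" is
  "\<lambda>X. if padic_null CARD('p) X then (\<lambda>_. 0) else (\<lambda>n. inverse (X n))"
  by (simp add: padic_cauchy_inverse[OF prime_CARD])

lemma padic_rel_seq_inverse:
  fixes X' :: "'a::prime_card padic_seq"
  assumes "\<not> padic_rel X' 0"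
  shows "padic_rel (seq_inverse X' * X') 1"
proof -
  have p: "prime CARD('a)" by (rule prime_CARD)
  let ?X = "seq_nth X'"
  have nz: "\<not> padic_null CARD('a) ?X"
    using assms by (simp add: padic_rel_def seq_null_def)
  obtain b k where b: "b > 0" "\<And>n. n \<ge> k \<Longrightarrow> rat_padic_abs CARD('a) (?X n) > b"
    by (rule padic_cauchy_not_null[OF p padic_cauchy_seq_nth nz]) blast
  have "inverse (?X n) * ?X n - 1 = 0" if "n \<ge> k" for n
    using b(1) b(2)[OF that] by (cases "?X n = 0") auto
  then have "padic_null CARD('a) (\<lambda>n. inverse (?X n) * ?X n - 1)"
    by (intro padic_null_bound[OF padic_null_zero, where c = 1])
      (auto simp: eventually_sequentially intro!: exI[of _ k])
  then show ?thesis
    using nz by (simp add: padic_rel_def seq_null_def minus_padic_seq.rep_eq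
        times_padic_seq.rep_eq one_padic_seq.rep_eq seq_inverse.rep_eq)
qed

instantiation padic :: (prime_card) field
begin

lift_definition zero_padic :: "'a padic" is 0 .

lift_definition one_padic :: "'a padic" is 1 .

lift_definition plus_padic :: "'a padic \<Rightarrow> 'a padic \<Rightarrow> 'a padic" is "(+)"
  unfolding padic_rel_def by (simp only: add_diff_add seq_null_add)

lift_definition uminus_padic :: "'a padic \<Rightarrow> 'a padic" is uminus
  unfolding padic_rel_def by (simp only: minus_diff_minus seq_null_minus)

lift_definition times_padic :: "'a padic \<Rightarrow> 'a padic \<Rightarrow> 'a padic" is "(*)"
proof -
  fix X X' Y Y' :: "'a padic_seq"
  assume "padic_rel X X'" "padic_rel Y Y'"
  then have "seq_null ((Y - Y') * X)" "seq_null ((X - X') * Y')"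
    by (simp_all add: padic_rel_def seq_null_mult)
  then have "seq_null ((Y - Y') * X + (X - X') * Y')" by (rule seq_null_add)
  also have "(Y - Y') * X + (X - X') * Y' = X * Y - X' * Y'" by (simp add: algebra_simps)
  finally show "padic_rel (X * Y) (X' * Y')" unfolding padic_rel_def .
qed

lift_definition inverse_padic :: "'a padic \<Rightarrow> 'a padic" is seq_inverse
proof -
  fix X' Y' :: "'a padic_seq"
  assume r: "padic_rel X' Y'"
  let ?p = "CARD('a)" and ?X = "seq_nth X'" and ?Y = "seq_nth Y'"
  have p: "prime ?p" by (rule prime_CARD)
  have X: "padic_cauchy ?p ?X" and Y: "padic_cauchy ?p ?Y"
    by (rule padic_cauchy_seq_nth)+
  have XY: "padic_null ?p (\<lambda>n. ?X n - ?Y n)"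
    using r by (simp add: padic_rel_def seq_null_def minus_padic_seq.rep_eq)
  have eq: "padic_null ?p ?X \<longleftrightarrow> padic_null ?p ?Y"
    using padic_null_add[OF p XY, of ?Y]
      padic_null_add[OF p _ XY[unfolded padic_null_diff_commute[OF p, of ?X ?Y]], of ?X] by auto
  show "padic_rel (seq_inverse X') (seq_inverse Y')"
  proof (cases "padic_null ?p ?X")
    case True
    then show ?thesis
      using eq by (simp add: padic_rel_def seq_null_def minus_padic_seq.rep_eq seq_inverse.rep_eq)
  next
    case False
    obtain a k where a: "a > 0" "\<And>n. n \<ge> k \<Longrightarrow> rat_padic_abs ?p (?X n) > a"
      by (rule padic_cauchy_not_null[OF p X False]) blast
    have "\<not> padic_null ?p ?Y" using False eq by simp
    from padic_cauchy_not_null[OF p Y this]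
    obtain b l where b: "b > 0" "\<And>n. n \<ge> l \<Longrightarrow> rat_padic_abs ?p (?Y n) > b" by blast
    let ?c = "min a b"
    have "rat_padic_abs ?p (inverse (?X n) - inverse (?Y n))
            \<le> (1 / ?c\<^sup>2) * rat_padic_abs ?p (?X n - ?Y n)" if "n \<ge> max k l" for n
      using that a b a(2)[of n] b(2)[of n]
      by (intro rat_padic_abs_inverse_diff[OF p]) (auto simp: min_less_iff_disj)
    then have "eventually (\<lambda>n. rat_padic_abs ?p (inverse (?X n) - inverse (?Y n))
            \<le> (1 / ?c\<^sup>2) * rat_padic_abs ?p (?X n - ?Y n)) sequentially"
      unfolding eventually_sequentially by blast
    then have "padic_null ?p (\<lambda>n. inverse (?X n) - inverse (?Y n))"
      by (rule padic_null_bound[OF XY])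
    then show ?thesis
      using False eq by (simp add: padic_rel_def seq_null_def minus_padic_seq.rep_eq seq_inverse.rep_eq)
  qed
qed

definition minus_padic :: "'a padic \<Rightarrow> 'a padic \<Rightarrow> 'a padic" where
  "minus_padic x y = x + - y"

definition divide_padic :: "'a padic \<Rightarrow> 'a padic \<Rightarrow> 'a padic" where
  "divide_padic x y = x * inverse y"

instance
proof
  fix a b c :: "'a padic"
  have p: "prime CARD('a)" by (rule prime_CARD)
  show "a + b + c = a + (b + c)" by transfer (simp add: padic_rel_def add.assoc)
  show "a + b = b + a" by transfer (simp add: padic_rel_def add.commute)
  show "0 + a = a" by transfer (simp add: padic_rel_def)
  show "- a + a = 0" by transfer (simp add: padic_rel_def)
  show "a - b = a + - b" by (rule minus_padic_def)
  show "a * b * c = a * (b * c)" by transfer (simp add: padic_rel_def mult.assoc)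
  show "a * b = b * a" by transfer (simp add: padic_rel_def mult.commute)
  show "1 * a = a" by transfer (simp add: padic_rel_def)
  show "(a + b) * c = a * c + b * c" by transfer (simp add: padic_rel_def distrib_right)
  show "(0::'a padic) \<noteq> 1"
    by transfer (auto simp: padic_rel_def seq_null_def padic_null_def uminus_padic_seq.rep_eq
        one_padic_seq.rep_eq rat_padic_abs_minus[OF p] rat_padic_abs_one[OF p] LIMSEQ_const_iff)
  show "inverse (0::'a padic) = 0"
    by transfer (simp add: padic_rel_def seq_null_def minus_padic_seq.rep_eq
        zero_padic_seq.rep_eq seq_inverse.rep_eq)
  show "a div b = a * inverse b" by (rule divide_padic_def)
  show "a \<noteq> 0 \<Longrightarrow> inverse a * a = 1"
    by transfer (rule padic_rel_seq_inverse)
qed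

end


text \<open>The p-adic norm, normalised so that \<open>p\<close> has padic_norm \<open>1/p\<close>, is obtained from the
  rationals by continuity. The overloaded \<open>norm\<close> is reserved for real normed spaces.\<close>

lift_definition padic_norm :: "'a::prime_card padic \<Rightarrow> real" is
  "\<lambda>X. lim (\<lambda>n. rat_padic_abs CARD('a) (seq_nth X n))"
proof -
  fix X Y :: "'a padic_seq"
  have p: "prime CARD('a)" by (rule prime_CARD)
  assume "padic_rel X Y"
  then have XY: "(\<lambda>n. rat_padic_abs CARD('a) (seq_nth X n - seq_nth Y n)) \<longlonglongrightarrow> 0"
    by (simp add: padic_rel_def seq_null_def padic_null_def minus_padic_seq.rep_eq)
  have lim: "(\<lambda>n. rat_padic_abs CARD('a) (seq_nth Z n))
       \<longlonglongrightarrow> lim (\<lambda>n. rat_padic_abs CARD('a) (seq_nth Z n))" for Z :: "'a padic_seq"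
    using padic_cauchy_abs_convergent[OF p padic_cauchy_seq_nth[of Z]]
    by (simp add: convergent_LIMSEQ_iff)
  have "(\<lambda>n. rat_padic_abs CARD('a) (seq_nth X n) - rat_padic_abs CARD('a) (seq_nth Y n)) \<longlonglongrightarrow> 0"
    by (rule Lim_null_comparison[OF _ XY]) (auto simp: rat_padic_abs_triangle3[OF p])
  from LIMSEQ_unique[OF this tendsto_diff[OF lim[of X] lim[of Y]]]
  show "lim (\<lambda>n. rat_padic_abs CARD('a) (seq_nth X n)) = lim (\<lambda>n. rat_padic_abs CARD('a) (seq_nth Y n))"
    by simp
qed

lemma norm_abs_padic_lim:
  fixes X :: "'p::prime_card padic_seq"
  shows "(\<lambda>n. rat_padic_abs CARD('p) (seq_nth X n)) \<longlonglongrightarrow> padic_norm (abs_padic X)"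
  using padic_cauchy_abs_convergent[OF prime_CARD padic_cauchy_seq_nth[of X]]
  by (simp add: padic_norm.abs_eq convergent_LIMSEQ_iff)

lemma padic_norm_eq_0_iff: "padic_norm x = 0 \<longleftrightarrow> x = 0" for x :: "'a::prime_card padic"
proof (induct x)
  case (1 X)
  have "padic_norm (abs_padic X) = 0 \<longleftrightarrow> seq_null X"
    unfolding seq_null_def padic_null_def
  proof
    assume "padic_norm (abs_padic X) = 0"
    then show "(\<lambda>n. rat_padic_abs CARD('a) (seq_nth X n)) \<longlonglongrightarrow> 0"
      using norm_abs_padic_lim[of X] by simp
  next
    assume "(\<lambda>n. rat_padic_abs CARD('a) (seq_nth X n)) \<longlonglongrightarrow> 0"
    with norm_abs_padic_lim[of X] show "padic_norm (abs_padic X) = 0"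
      by (rule LIMSEQ_unique)
  qed
  also have "\<dots> \<longleftrightarrow> abs_padic X = 0"
    by (simp add: zero_padic_def padic.abs_eq_iff padic_rel_def)
  finally show ?case .
qed

lemma padic_norm_minus: "padic_norm (- x) = padic_norm x" for x :: "'p::prime_card padic"
  by transfer (simp add: uminus_padic_seq.rep_eq rat_padic_abs_minus[OF prime_CARD])

lemma padic_norm_triangle: "padic_norm (x + y) \<le> padic_norm x + padic_norm y" for x y :: "'p::prime_card padic"
proof (induct x, induct y)
  case (1 Y X)
  have "padic_norm (abs_padic (X + Y)) \<le> padic_norm (abs_padic X) + padic_norm (abs_padic Y)"
    by (rule LIMSEQ_le[OF norm_abs_padic_lim tendsto_add[OF norm_abs_padic_lim norm_abs_padic_lim]])
      (auto simp: plus_padic_seq.rep_eq rat_padic_abs_triangle[OF prime_CARD])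
  then show ?case by (simp add: plus_padic.abs_eq)
qed

instantiation padic :: (prime_card) metric_space
begin

definition dist_padic :: "'a padic \<Rightarrow> 'a padic \<Rightarrow> real" where
  "dist_padic x y = padic_norm (x - y)"

definition uniformity_padic :: "('a padic \<times> 'a padic) filter" where
  "uniformity_padic = (INF e\<in>{0<..}. principal {(x, y). dist x y < e})"

definition open_padic :: "'a padic set \<Rightarrow> bool" where
  "open_padic U \<longleftrightarrow> (\<forall>x\<in>U. eventually (\<lambda>(x', y). x' = x \<longrightarrow> y \<in> U) uniformity)"

instance
proof
  fix x y z :: "'a padic"
  show "dist x y = 0 \<longleftrightarrow> x = y"
    by (simp add: dist_padic_def padic_norm_eq_0_iff)
  show "dist x y \<le> dist x z + dist y z"
    using padic_norm_triangle[of "x - z" "z - y"] padic_norm_minus[of "y - z"]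
    by (simp add: dist_padic_def)
qed (simp_all add: uniformity_padic_def open_padic_def)

end

lemma padic_of_nat: "(of_nat k :: 'p::prime_card padic) = abs_padic (of_nat k)"
  by (induct k) (simp_all add: zero_padic_def one_padic_def plus_padic.abs_eq)

lemma seq_nth_of_nat: "seq_nth (of_nat k :: 'p::prime_card padic_seq) n = of_nat k"
  by (induct k) (simp_all add: zero_padic_seq.rep_eq one_padic_seq.rep_eq plus_padic_seq.rep_eq)

instance padic :: (prime_card) field_char_0
proof
  show "inj (of_nat :: nat \<Rightarrow> 'a padic)"
  proof (rule injI)
    fix k l :: nat
    assume "(of_nat k :: 'a padic) = of_nat l"
    then have "seq_null (of_nat k - of_nat l :: 'a padic_seq)"
      by (simp add: padic_of_nat padic.abs_eq_iff padic_rel_def)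
    then have "rat_padic_abs CARD('a) (of_nat k - of_nat l) = 0"
      by (simp add: seq_null_def padic_null_def minus_padic_seq.rep_eq seq_nth_of_nat LIMSEQ_const_iff)
    then show "k = l"
      by (simp add: rat_padic_abs_eq_0_iff[OF prime_CARD])
  qed
qed

definition padic_haar :: "'p::prime_card padic measure" where
  "padic_haar = (THE \<mu>. sets \<mu> = sets borel
     \<and> (\<forall>a. \<forall>B\<in>sets borel. emeasure \<mu> ((\<lambda>x. x + a) ` B) = emeasure \<mu> B)
     \<and> emeasure \<mu> {x. padic_norm x \<le> 1} = 1)"

text \<open>\<open>'n \<Rightarrow> 'p padic\<close> with \<open>n = CARD('n)\<close> is the n-dimensional p-adic space; its
  topology is the product topology and its group operations are pointwise.\<close>

definition padic_haar_n :: "('n::finite \<Rightarrow> 'p::prime_card padic) measure" where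
  "padic_haar_n = PiM UNIV (\<lambda>_. padic_haar)"

text \<open>The fractional part is the unique rational in \<open>[0,1)\<close> with denominator a power of \<open>p\<close>
  that is congruent to \<open>x\<close> modulo the p-adic integers.\<close>

definition padic_frac :: "'p::prime_card padic \<Rightarrow> rat" where
  "padic_frac x = (THE r. 0 \<le> r \<and> r < 1 \<and> (\<exists>k. r * of_nat CARD('p) ^ k \<in> \<int>)
     \<and> padic_norm (x - of_rat r) \<le> 1)"

definition padic_char :: "'p::prime_card padic \<Rightarrow> complex" where
  "padic_char x = cis (2 * pi * of_rat (padic_frac x))"

definition padic_fourier :: "('p::prime_card padic \<Rightarrow> complex) \<Rightarrow> 'p padic \<Rightarrow> complex" where
  "padic_fourier f \<xi> = (LINT x|padic_haar. padic_char (\<xi> * x) * f x)"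

definition padic_inv_fourier :: "('p::prime_card padic \<Rightarrow> complex) \<Rightarrow> 'p padic \<Rightarrow> complex" where
  "padic_inv_fourier F x = (LINT \<xi>|padic_haar. cnj (padic_char (\<xi> * x)) * F \<xi>)"

definition padic_fractional_derivative ::
    "real \<Rightarrow> ('p::prime_card padic \<Rightarrow> complex) \<Rightarrow> 'p padic \<Rightarrow> complex" where
  "padic_fractional_derivative \<beta> f =
     padic_inv_fourier (\<lambda>\<xi>. complex_of_real (padic_norm \<xi> powr \<beta>) * padic_fourier f \<xi>)"

definition test_functions :: "('a::topological_space \<Rightarrow> complex) set" where
  "test_functions = {f. (\<forall>x. \<exists>U. open U \<and> x \<in> U \<and> (\<forall>y\<in>U. f y = f x))
     \<and> compact (closure {x. f x \<noteq> 0})}"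

definition vladimirov ::
    "('n::finite \<Rightarrow> real) \<Rightarrow> (('n \<Rightarrow> 'p::prime_card padic) \<Rightarrow> complex) \<Rightarrow> ('n \<Rightarrow> 'p padic) \<Rightarrow> complex" where
  "vladimirov \<alpha> f x =
     (\<Sum>i\<in>UNIV. padic_fractional_derivative (\<alpha> i) (\<lambda>s. f (x(i := s))) (x i))"

text \<open>Elements of \<open>L2\<close> are represented by functions, and all identities between them are
  understood almost everywhere.\<close>

definition L2_functions :: "'a measure \<Rightarrow> ('a \<Rightarrow> complex) set" where
  "L2_functions M = {f \<in> borel_measurable M. integrable M (\<lambda>x. (cmod (f x))\<^sup>2)}"

definition L2_norm :: "'a measure \<Rightarrow> ('a \<Rightarrow> complex) \<Rightarrow> real" where
  "L2_norm M f = sqrt (LINT x|M. (cmod (f x))\<^sup>2)"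

definition contraction_semigroup ::
    "'a measure \<Rightarrow> (real \<Rightarrow> ('a \<Rightarrow> complex) \<Rightarrow> 'a \<Rightarrow> complex) \<Rightarrow> bool" where
  "contraction_semigroup M T \<longleftrightarrow>
     (\<forall>t\<ge>0. \<forall>f\<in>L2_functions M. T t f \<in> L2_functions M \<and> L2_norm M (T t f) \<le> L2_norm M f) \<and>
     (\<forall>t\<ge>0. \<forall>f\<in>L2_functions M. \<forall>g\<in>L2_functions M. \<forall>a b.
        AE x in M. T t (\<lambda>x. a * f x + b * g x) x = a * T t f x + b * T t g x) \<and>
     (\<forall>f\<in>L2_functions M. AE x in M. T 0 f x = f x) \<and>
     (\<forall>s\<ge>0. \<forall>t\<ge>0. \<forall>f\<in>L2_functions M. AE x in M. T (s + t) f x = T s (T t f) x) \<and>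
     (\<forall>f\<in>L2_functions M. ((\<lambda>t. L2_norm M (\<lambda>x. T t f x - f x)) \<longlongrightarrow> 0) (at_right 0))"

definition has_generator_value ::
    "'a measure \<Rightarrow> (real \<Rightarrow> ('a \<Rightarrow> complex) \<Rightarrow> 'a \<Rightarrow> complex) \<Rightarrow> ('a \<Rightarrow> complex) \<Rightarrow> ('a \<Rightarrow> complex) \<Rightarrow> bool" where
  "has_generator_value M T f g \<longleftrightarrow>
     ((\<lambda>t. L2_norm M (\<lambda>x. (T t f x - f x) / of_real t - g x)) \<longlongrightarrow> 0) (at_right 0)"

definition has_closure_value ::
    "'a measure \<Rightarrow> ('a \<Rightarrow> complex) set \<Rightarrow> (('a \<Rightarrow> complex) \<Rightarrow> 'a \<Rightarrow> complex)
      \<Rightarrow> ('a \<Rightarrow> complex) \<Rightarrow> ('a \<Rightarrow> complex) \<Rightarrow> bool" where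
  "has_closure_value M D L f g \<longleftrightarrow>
     (\<exists>u :: nat \<Rightarrow> 'a \<Rightarrow> complex.
        (\<forall>k. u k \<in> D \<and> u k \<in> L2_functions M \<and> L (u k) \<in> L2_functions M) \<and>
        (\<lambda>k. L2_norm M (\<lambda>x. u k x - f x)) \<longlonglongrightarrow> 0 \<and>
        (\<lambda>k. L2_norm M (\<lambda>x. L (u k) x - g x)) \<longlonglongrightarrow> 0)"

text \<open>For an essentially self-adjoint non-negative operator \<open>(L, D)\<close> in \<open>L2\<close> with closure
  \<open>H\<close>, \<open>exp (-t H)\<close> is the strongly continuous contraction semigroup with generator \<open>-H\<close>.
  A semigroup is determined by its generator up to almost everywhere equality, so that the
  choice operator only selects representatives.\<close>

definition exp_semigroup ::
    "'a measure \<Rightarrow> ('a \<Rightarrow> complex) set \<Rightarrow> (('a \<Rightarrow> complex) \<Rightarrow> 'a \<Rightarrow> complex)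
      \<Rightarrow> real \<Rightarrow> ('a \<Rightarrow> complex) \<Rightarrow> 'a \<Rightarrow> complex" where
  "exp_semigroup M D L =
     (SOME T. contraction_semigroup M T \<and>
        (\<forall>f\<in>L2_functions M. \<forall>g\<in>L2_functions M.
           has_generator_value M T f (\<lambda>x. - g x) \<longleftrightarrow> has_closure_value M D L f g))"

definition vladimirov_semigroup ::
    "('n::finite \<Rightarrow> real) \<Rightarrow> real
      \<Rightarrow> (('n \<Rightarrow> 'p::prime_card padic) \<Rightarrow> complex) \<Rightarrow> ('n \<Rightarrow> 'p padic) \<Rightarrow> complex" where
  "vladimirov_semigroup \<alpha> = exp_semigroup padic_haar_n test_functions (vladimirov \<alpha>)"

text \<open>The kernel of a translation invariant semigroup is \<open>(x, y) \<mapsto> k (x - y)\<close>. Continuity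
  singles out the version for which pointwise values are meaningful.\<close>

definition heat_kernel ::
    "'a::{topological_space, minus} measure \<Rightarrow> (real \<Rightarrow> ('a \<Rightarrow> complex) \<Rightarrow> 'a \<Rightarrow> complex)
      \<Rightarrow> real \<Rightarrow> 'a \<Rightarrow> real" where
  "heat_kernel M T t =
     (THE k. continuous_on UNIV k \<and>
        (\<forall>f\<in>L2_functions M. AE x in M. T t f x = (LINT y|M. complex_of_real (k (x - y)) * f y)))"

definition green_function ::
    "'a::{topological_space, minus} measure \<Rightarrow> (real \<Rightarrow> ('a \<Rightarrow> complex) \<Rightarrow> 'a \<Rightarrow> complex)
      \<Rightarrow> 'a \<Rightarrow> ennreal" where
  "green_function M T z = (\<integral>\<^sup>+t\<in>{0<..}. ennreal (heat_kernel M T t z) \<partial>lborel)"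

text \<open>The semigroup acts on a bounded function of compact support through its heat kernel, which
  gives its values at every point.\<close>

definition transient_semigroup ::
    "'a::{topological_space, minus} measure \<Rightarrow> (real \<Rightarrow> ('a \<Rightarrow> complex) \<Rightarrow> 'a \<Rightarrow> complex) \<Rightarrow> bool" where
  "transient_semigroup M T \<longleftrightarrow>
     (\<forall>f :: 'a \<Rightarrow> real.
        f \<in> borel_measurable borel \<and> (\<forall>x. 0 \<le> f x) \<and> bounded (range f)
        \<and> compact (closure {x. f x \<noteq> 0}) \<longrightarrow>
        (\<exists>C :: real. \<forall>x.
           (\<integral>\<^sup>+t\<in>{0<..}. ennreal (LINT y|M. heat_kernel M T t (x - y) * f y) \<partial>lborel) \<le> ennreal C))"

definition padic_alpha_norm :: "('n::finite \<Rightarrow> real) \<Rightarrow> ('n \<Rightarrow> 'p::prime_card padic) \<Rightarrow> real" where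
  "padic_alpha_norm \<alpha> z = Max (range (\<lambda>i. padic_norm (z i) powr \<alpha> i))"

end

theory Submission
  imports Defs "HOL-Probability.Infinite_Product_Measure"
begin

text \<open>A Fourier multiplier on the p-adic line that depends only on the norm of the frequency is
  a superposition of averaging operators over balls. Two such averages compose to the average over
  the larger ball, so the weights of \<open>exp (-t D)\<close>, where \<open>D\<close> has order \<open>\<beta>\<close>, compose like the
  maximum of independent radii: the distribution function is \<open>exp (-t p powr (-\<beta> k))\<close> at radius
  \<open>p powr k\<close>. This gives
  the semigroup law without spectral theory and the bounds
  \<open>h\<^sub>t(x) \<le> C min (t powr (-1/\<beta>)) (t \<parallel>x\<parallel> powr (-1-\<beta>))\<close> and
  \<open>h\<^sub>t(x) \<ge> c t powr (-1/\<beta>)\<close> for \<open>\<parallel>x\<parallel> powr \<beta> \<le> t\<close>.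

  On functions constant on cubes of a given size the product semigroup has a bounded generator,
  which agrees there with the Vladimirov Laplacian. Averaging over cubes commutes with the semigroup
  and converges strongly to the identity, whence the generator is the closure of the Laplacian on
  test functions. Since a contraction semigroup is determined by its generator, this
  explicit semigroup is the abstract one.

  With \<open>s = \<parallel>z\<parallel>\<^sub>\<alpha>\<close>, the integral of the kernel over \<open>t \<ge> s\<close> is comparable to that of
  \<open>t powr (-n/\<beta>)\<close>, and over \<open>t \<le> s\<close> it is at most a multiple of that of
  \<open>s powr (-1-1/\<beta>) * t powr (1-(n-1)/\<beta>)\<close>. The former converges for \<open>\<beta> < n\<close>, the latter for
  \<open>\<beta> > (n-1)/2\<close>, and both are multiples of \<open>s powr (1-n/\<beta>)\<close>.\<close>

text \<open>Haar measure and heat kernel are defined by \<open>THE\<close>, the semigroup by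
  \<open>SOME\<close>, so nothing can be computed before existence is proved, and for
  \<open>THE\<close> also uniqueness. This is why a digit construction of Haar measure and a theory
  of generators stand beside the estimates. The superposition comes from Abel summation: a
  multiplier with value F(j) at frequencies of norm p^-j, where F vanishes at -infinity, is the sum
  over j of F(j) - F(j-1) times the indicator of the ball of radius p^-j, and that indicator
  transforms into the uniform density on the ball of radius p^j. So the total variation of F bounds
  the L1 norm of the kernel, and Schur's test turns this into an L2 operator bound. The symbol
  p^(-\<beta> j) is unbounded as j tends to -infinity. Setting F to 0 below J makes its variation
  finite and amounts to averaging over balls of radius p^J. The semigroup is a product over the
  coordinates while its generator is a sum, so the derivative at time 0 calls for a second-order
  expansion of products.\<close>

lemma card_prime_gt_1: "1 < CARD('p::prime_card)"
  using prime_gt_1_nat[OF prime_CARD[where 'p='p]] by simp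

lemma real_card_gt_1: "1 < real CARD('p::prime_card)"
  using card_prime_gt_1[where 'p='p] by linarith

lemma real_card_gt_0: "0 < real CARD('p::prime_card)"
  using real_card_gt_1[where 'p='p] by linarith

section \<open>Norm, rational approximation and completeness of the p-adic field\<close>

lemma padic_norm_eqI:
  fixes X :: "'p::prime_card padic_seq"
  assumes "(\<lambda>n. rat_padic_abs CARD('p) (seq_nth X n)) \<longlonglongrightarrow> L"
  shows "padic_norm (abs_padic X) = L"
  using norm_abs_padic_lim assms by (rule LIMSEQ_unique)

lemma padic_norm_nonneg [simp]: "0 \<le> padic_norm (x :: 'p::prime_card padic)"
  by (induct x) (auto intro: LIMSEQ_le_const[OF norm_abs_padic_lim])

lemma padic_norm_zero [simp]: "padic_norm (0 :: 'p::prime_card padic) = 0"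
  by (simp add: padic_norm_eq_0_iff)

lemma padic_norm_mult: "padic_norm (x * y) = padic_norm x * padic_norm (y :: 'p::prime_card padic)"
proof (induct x, induct y)
  case (1 Y X)
  have "padic_norm (abs_padic (X * Y)) = padic_norm (abs_padic X) * padic_norm (abs_padic Y)"
    by (rule padic_norm_eqI)
      (use tendsto_mult[OF norm_abs_padic_lim[of X] norm_abs_padic_lim[of Y]] in
        \<open>simp add: times_padic_seq.rep_eq rat_padic_abs_mult[OF prime_CARD]\<close>)
  then show ?case by (simp add: times_padic.abs_eq)
qed

lemma padic_norm_ultra:
  "padic_norm (x + y) \<le> max (padic_norm x) (padic_norm (y :: 'p::prime_card padic))"
proof (induct x, induct y)
  case (1 Y X)
  have "padic_norm (abs_padic (X + Y)) \<le> max (padic_norm (abs_padic X)) (padic_norm (abs_padic Y))"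
    by (rule LIMSEQ_le[OF norm_abs_padic_lim tendsto_max[OF norm_abs_padic_lim norm_abs_padic_lim]])
      (auto simp: plus_padic_seq.rep_eq rat_padic_abs_ultra[OF prime_CARD])
  then show ?case by (simp add: plus_padic.abs_eq)
qed

lemma padic_norm_diff_commute: "padic_norm (x - y) = padic_norm (y - x :: 'p::prime_card padic)"
  using padic_norm_minus[of "x - y"] by simp

lemma padic_norm_diff_ultra:
  "padic_norm (x - y) \<le> max (padic_norm x) (padic_norm (y :: 'p::prime_card padic))"
  using padic_norm_ultra[of x "- y"] by (simp add: padic_norm_minus)

lemma padic_norm_one [simp]: "padic_norm (1 :: 'p::prime_card padic) = 1"
proof -
  have "padic_norm (1 :: 'p padic) * padic_norm (1 :: 'p padic) = padic_norm (1 :: 'p padic)"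
    by (metis mult_1 padic_norm_mult)
  then show ?thesis by (simp add: padic_norm_eq_0_iff)
qed

lemma padic_norm_inverse:
  "padic_norm (inverse x) = inverse (padic_norm (x :: 'p::prime_card padic))"
proof (cases "x = 0")
  case False
  then have "padic_norm x * padic_norm (inverse x) = 1"
    using padic_norm_mult[of x "inverse x"] by simp
  then show ?thesis by (metis inverse_unique)
qed simp

lemma padic_norm_divide: "padic_norm (x / y) = padic_norm x / padic_norm (y :: 'p::prime_card padic)"
  by (simp add: divide_inverse padic_norm_mult padic_norm_inverse)

lemma padic_norm_of_nat:
  "padic_norm (of_nat k :: 'p::prime_card padic) = rat_padic_abs CARD('p) (of_nat k)"
  unfolding padic_of_nat by (rule padic_norm_eqI) (simp add: seq_nth_of_nat)

lemma padic_norm_of_int: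
  "padic_norm (of_int k :: 'p::prime_card padic) = rat_padic_abs CARD('p) (of_int k)"
proof (cases "k \<ge> 0")
  case True
  then show ?thesis using padic_norm_of_nat[of "nat k", where 'p='p] by simp
next
  case False
  then show ?thesis
    using padic_norm_of_nat[of "nat (- k)", where 'p='p]
      padic_norm_minus[of "of_int k :: 'p padic"] rat_padic_abs_minus[OF prime_CARD[where 'p='p], of "of_int k"]
    by simp
qed

lemma padic_norm_of_rat:
  "padic_norm (of_rat r :: 'p::prime_card padic) = rat_padic_abs CARD('p) r"
proof -
  obtain a b where r: "b \<noteq> 0" "r = of_int a / of_int b" by (rule rat_exhaust_div)
  show ?thesis
    unfolding r(2) divide_inverse of_rat_mult of_rat_inverse of_rat_of_int_eq
    by (simp add: padic_norm_mult padic_norm_inverse padic_norm_of_int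
        rat_padic_abs_mult[OF prime_CARD] rat_padic_abs_inverse[OF prime_CARD])
qed

lemma powi_le_iff: "1 < x \<Longrightarrow> x powi m \<le> x powi n \<longleftrightarrow> m \<le> (n :: int)" for x :: real
  using power_int_increasing[of m n x] power_int_strict_increasing[of n m x] by (force simp: not_le)

text \<open>Makes divisibility by powers of p a statement about balls; the residues, digit
  expansions and fractional parts below all pass through it.\<close>

lemma padic_norm_of_int_le_iff:
  "padic_norm (of_int a :: 'p::prime_card padic) \<le> real CARD('p) powi (- int m) \<longleftrightarrow> int CARD('p) ^ m dvd a"
proof (cases "a = 0")
  case False
  have "padic_norm (of_int a :: 'p padic)
      = real CARD('p) powi (- int (multiplicity (int CARD('p)) a))"
    using rat_padic_abs_Fract[OF prime_CARD[where 'p='p] False, of 1]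
    by (simp add: padic_norm_of_int)
  then have "padic_norm (of_int a :: 'p padic) \<le> real CARD('p) powi (- int m)
      \<longleftrightarrow> m \<le> multiplicity (int CARD('p)) a"
    using real_card_gt_1[where 'p='p] by (simp add: powi_le_iff)
  also have "\<dots> \<longleftrightarrow> int CARD('p) ^ m dvd a"
  proof -
    have "\<not> is_unit (int CARD('p))" using prime_CARD[where 'p='p] by auto
    then show ?thesis using False by (simp add: power_dvd_iff_le_multiplicity)
  qed
  finally show ?thesis .
qed simp

lemma padic_norm_of_int_le_1: "padic_norm (of_int a :: 'p::prime_card padic) \<le> 1"
  using padic_norm_of_int_le_iff[of a 0, where 'p='p] by simp

lemma padic_norm_card: "padic_norm (of_nat CARD('p) :: 'p::prime_card padic) = inverse (real CARD('p))"
proof -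
  have "\<not> is_unit (int CARD('p))" "int CARD('p) \<noteq> 0" using prime_CARD[where 'p='p] by auto
  then have "multiplicity (int CARD('p)) (int CARD('p)) = 1" by (rule multiplicity_self[rotated])
  then show ?thesis
    using rat_padic_abs_Fract[OF prime_CARD[where 'p='p], of "int CARD('p)" 1]
    by (simp add: padic_norm_of_nat power_int_minus)
qed

lemma padic_norm_card_powi:
  "padic_norm ((of_nat CARD('p) :: 'p::prime_card padic) powi k) = real CARD('p) powi (- k)"
proof -
  have pow: "padic_norm ((of_nat CARD('p) :: 'p padic) ^ m) = inverse (real CARD('p)) ^ m" for m
    by (induct m) (simp_all add: padic_norm_mult padic_norm_card)
  show ?thesis
    by (cases "k \<ge> 0") (simp_all add: power_int_def pow padic_norm_inverse power_inverse)
qed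

lift_definition const_seq :: "rat \<Rightarrow> 'p::prime_card padic_seq" is "\<lambda>r _. r" by simp

text \<open>\<open>of_rat\<close> comes from the field structure alone, while the completion knows
  constant sequences. Both respect sums and products, so agreement on naturals propagates to
  integers and then to quotients.\<close>

lemma of_rat_eq_abs_const: "(of_rat r :: 'p::prime_card padic) = abs_padic (const_seq r)"
proof -
  let ?c = "\<lambda>r. abs_padic (const_seq r) :: 'p padic"
  have add: "?c (a + b) = ?c a + ?c b" and mult: "?c (a * b) = ?c a * ?c b" for a b
    unfolding plus_padic.abs_eq times_padic.abs_eq
    by (rule arg_cong[of _ _ abs_padic], transfer, simp)+
  have one: "?c 1 = 1" and zero: "?c 0 = 0"
    unfolding one_padic_def zero_padic_def by (rule arg_cong[of _ _ abs_padic], transfer, simp)+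
  have nat: "?c (of_nat k) = of_nat k" for k
    by (induct k) (simp_all add: add one zero)
  have neg: "?c (- a) = - ?c a" for a
    using add[of a "- a"] zero by (simp add: eq_neg_iff_add_eq_0 add.commute)
  have int: "?c (of_int k) = of_int k" for k
    by (cases k rule: int_cases2) (simp_all add: nat neg)
  obtain a b where r: "b \<noteq> 0" "r = of_int a / of_int b" by (rule rat_exhaust_div)
  have "?c r * of_int b = of_int a"
    using mult[of r "of_int b"] r by (simp add: int)
  moreover have "of_rat r * of_int b = (of_int a :: 'p padic)"
    using r by (simp add: of_rat_divide)
  ultimately show ?thesis using r(1) by (metis mult_right_cancel of_int_eq_0_iff)
qed

lemma dist_padic_le:
  "dist (x :: 'p::prime_card padic) z \<le> max (dist x y) (dist y z)"
  using padic_norm_ultra[of "x - y" "y - z"] by (simp add: dist_padic_def)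

text \<open>The distance from the class to its n-th term is itself a limit of rational distances
  between terms, hence at most their Cauchy bound.\<close>

lemma tendsto_of_rat_padic: "(\<lambda>n. of_rat (seq_nth X n)) \<longlonglongrightarrow> (abs_padic X :: 'p::prime_card padic)"
  unfolding tendsto_iff eventually_sequentially
proof (intro allI impI)
  fix e :: real assume "e > 0"
  \<comment> \<open>Half of \<open>e\<close>, because a limit of values below a bound only satisfies
    the weak inequality.\<close>
  then obtain k where k: "\<forall>m\<ge>k. \<forall>n\<ge>k. rat_padic_abs CARD('p) (seq_nth X m - seq_nth X n) < e / 2"
    using padic_cauchy_seq_nth[of X] unfolding padic_cauchy_def by (meson half_gt_zero)
  have "dist (of_rat (seq_nth X n)) (abs_padic X) < e" if "n \<ge> k" for n
  proof -
    have "dist (of_rat (seq_nth X n)) (abs_padic X) = padic_norm (abs_padic (X - const_seq (seq_nth X n)))"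
      by (simp add: dist_commute dist_padic_def of_rat_eq_abs_const minus_padic_def
          plus_padic.abs_eq uminus_padic.abs_eq)
    also have "\<dots> \<le> e / 2"
    proof (rule LIMSEQ_le_const2[OF norm_abs_padic_lim], intro exI[of _ k] allI impI)
      fix m assume "k \<le> m"
      then show "rat_padic_abs CARD('p) (seq_nth (X - const_seq (seq_nth X n)) m) \<le> e / 2"
        using k that by (simp add: minus_padic_seq.rep_eq const_seq.rep_eq less_imp_le)
    qed
    finally show ?thesis using \<open>e > 0\<close> by simp
  qed
  then show "\<exists>N. \<forall>n\<ge>N. dist (of_rat (seq_nth X n)) (abs_padic X) < e" by blast
qed

lemma padic_rat_approx:
  assumes "e > 0"
  obtains r where "padic_norm (x - of_rat r :: 'p::prime_card padic) < e"
proof (induct x)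
  case (1 X)
  have "eventually (\<lambda>n. dist (of_rat (seq_nth X n)) (abs_padic X) < e) sequentially"
    using tendsto_of_rat_padic assms by (rule tendstoD)
  then obtain n where "dist (of_rat (seq_nth X n)) (abs_padic X) < e"
    by (auto simp: eventually_sequentially)
  then show ?case using 1 by (metis dist_commute dist_padic_def)
qed

text \<open>Each \<open>u n\<close> is replaced by a rational \<open>r n\<close> at distance below
  1/(n+1). The sequence \<open>r\<close> is Cauchy for the rational absolute value, so it represents
  an element, and this element is the limit of \<open>u\<close>.\<close>

instance padic :: (prime_card) complete_space
proof
  fix u :: "nat \<Rightarrow> 'a padic" assume u: "Cauchy u"
  have "\<exists>r. padic_norm (u n - of_rat r) < 1 / real (Suc n)" for n
    using padic_rat_approx[of "1 / real (Suc n)" "u n"] by (metis of_nat_0_less_iff zero_less_Suc zero_less_divide_1_iff)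
  then obtain r where r: "\<And>n. padic_norm (u n - of_rat (r n)) < 1 / real (Suc n)" by metis
  have lim0: "(\<lambda>n. dist (of_rat (r n)) (u n)) \<longlonglongrightarrow> 0"
    by (rule tendsto_sandwich[OF _ _ tendsto_const LIMSEQ_inverse_real_of_nat])
      (use r in \<open>auto simp: dist_commute dist_padic_def inverse_eq_divide less_imp_le\<close>)
  have "Cauchy (\<lambda>n. of_rat (r n) :: 'a padic)"
    unfolding Cauchy_def
  proof (intro allI impI)
    fix e :: real assume e: "e > 0"
    obtain M where M: "\<And>m n. m \<ge> M \<Longrightarrow> n \<ge> M \<Longrightarrow> dist (u m) (u n) < e"
      using u e unfolding Cauchy_def by blast
    obtain N where N: "\<And>n. n \<ge> N \<Longrightarrow> dist (of_rat (r n)) (u n) < e"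
      using order_tendstoD(2)[OF lim0 e] by (auto simp: eventually_sequentially)
    have "dist (of_rat (r m)) (of_rat (r n) :: 'a padic) < e" if "m \<ge> max M N" "n \<ge> max M N" for m n
    proof -
      have "dist (of_rat (r m)) (u n) < e"
        using dist_padic_le[of "of_rat (r m)" "u n" "u m"] M[of m n] N[of m] that by auto
      then show ?thesis
        using dist_padic_le[of "of_rat (r m)" "of_rat (r n)" "u n"] N[of n] that
        by (auto simp: dist_commute)
    qed
    then show "\<exists>M. \<forall>m\<ge>M. \<forall>n\<ge>M. dist (of_rat (r m)) (of_rat (r n) :: 'a padic) < e" by blast
  qed
  then have "padic_cauchy CARD('a) r"
    unfolding Cauchy_def padic_cauchy_def dist_padic_def
    by (metis of_rat_diff padic_norm_of_rat)
  then have X: "seq_nth (Abs_padic_seq r :: 'a padic_seq) = r"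
    by (intro Abs_padic_seq_inverse) simp
  have "(\<lambda>n. of_rat (r n)) \<longlonglongrightarrow> (abs_padic (Abs_padic_seq r) :: 'a padic)"
    using tendsto_of_rat_padic[of "Abs_padic_seq r :: 'a padic_seq"] by (simp add: X)
  then have "u \<longlonglongrightarrow> (abs_padic (Abs_padic_seq r) :: 'a padic)"
    unfolding tendsto_dist_iff[of u]
    by (intro tendsto_sandwich[OF _ _ tendsto_const
          tendsto_add[OF lim0 iffD1[OF tendsto_dist_iff], of "\<lambda>n. of_rat (r n)", simplified]])
      (auto intro: dist_triangle3 always_eventually)
  then show "convergent u" by (auto simp: convergent_def)
qed

text \<open>A rational closer to \<open>x\<close> than the norm of \<open>x\<close> has the same
  norm, by the ultrametric inequality, and norms of nonzero rationals are powers of p.\<close>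

lemma padic_norm_values:
  assumes "x \<noteq> (0 :: 'p::prime_card padic)"
  obtains k where "padic_norm x = real CARD('p) powi k"
proof -
  have x: "padic_norm x > 0" using assms padic_norm_eq_0_iff[of x] padic_norm_nonneg[of x] by linarith
  obtain r where r: "padic_norm (x - of_rat r) < padic_norm x" by (rule padic_rat_approx[OF x])
  have "padic_norm x \<le> padic_norm (of_rat r :: 'p padic)"
    using padic_norm_ultra[of "x - of_rat r" "of_rat r"] r by auto
  moreover have "padic_norm (of_rat r :: 'p padic) \<le> padic_norm x"
    using padic_norm_diff_ultra[of x "x - of_rat r"] r by auto
  ultimately have "padic_norm x = rat_padic_abs CARD('p) r" by (simp add: padic_norm_of_rat)
  with x that show thesis by (auto simp: rat_padic_abs_def split: if_splits)
qed

subsection \<open>Balls\<close>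

text \<open>Radii are recorded by their exponent. As the norm takes only the value 0 and powers of
  p, these are all the balls of positive radius, and nesting becomes a comparison of
  integers.\<close>

definition pball :: "'p::prime_card padic \<Rightarrow> int \<Rightarrow> 'p padic set" where
  "pball c k = {x. padic_norm (x - c) \<le> real CARD('p) powi k}"

lemma mem_pball: "x \<in> pball c k \<longleftrightarrow> padic_norm (x - c) \<le> real CARD('p) powi k" for c :: "'p::prime_card padic"
  by (simp add: pball_def)

lemma pball_center [simp]: "c \<in> pball c k"
  using real_card_gt_0 by (simp add: mem_pball less_imp_le)

lemma pball_commute: "x \<in> pball c k \<longleftrightarrow> c \<in> pball x k"
  by (simp add: mem_pball padic_norm_diff_commute)

lemma pball_mono: "j \<le> k \<Longrightarrow> pball c j \<subseteq> pball c k" for c :: "'p::prime_card padic"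
  using power_int_increasing[of j k "real CARD('p)"] real_card_gt_1[where 'p='p]
  by (force simp: mem_pball)

lemma pball_trans: "x \<in> pball y k \<Longrightarrow> y \<in> pball z k \<Longrightarrow> x \<in> pball z k" for z :: "'p::prime_card padic"
  using padic_norm_ultra[of "x - y" "y - z"] by (auto simp: mem_pball)

lemma pball_eq: "x \<in> pball c k \<Longrightarrow> pball x k = pball c k"
  using pball_trans pball_commute by blast

lemma pball_nested:
  "j \<le> k \<Longrightarrow> pball c j \<inter> pball d k \<noteq> {} \<Longrightarrow> pball c j \<subseteq> pball d k"
  using pball_mono pball_eq pball_commute by blast

lemma pball_minus: "- x \<in> pball (- c) k \<longleftrightarrow> x \<in> pball c k"
  using padic_norm_diff_commute[of x c] by (simp add: mem_pball)

lemma pball_eq_cball: "pball c k = cball c (real CARD('p) powi k)" for c :: "'p::prime_card padic"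
  by (auto simp: mem_pball dist_padic_def padic_norm_diff_commute)

lemma closed_pball: "closed (pball c k)"
  unfolding pball_eq_cball by (rule closed_cball)

lemma powi_small:
  assumes "e > 0"
  obtains k :: int where "real CARD('p::prime_card) powi k < e" "k \<le> m"
proof -
  obtain n where n: "inverse (real CARD('p)) ^ n < e"
    using real_arch_pow_inv[OF assms, of "inverse (real CARD('p))"] real_card_gt_1[where 'p='p]
    by (auto simp: inverse_less_1_iff)
  have "real CARD('p) powi (min m (- int n)) \<le> real CARD('p) powi (- int n)"
    using real_card_gt_1[where 'p='p] by (intro power_int_increasing) auto
  also have "\<dots> < e" using n by (simp add: power_int_minus power_inverse)
  finally show thesis using that[of "min m (- int n)"] by simp
qed

lemma powi_large:
  obtains k :: int where "e \<le> real CARD('p::prime_card) powi k" "k \<ge> m"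
proof -
  obtain n where n: "e < real CARD('p) ^ n"
    using real_arch_pow[OF real_card_gt_1[where 'p='p]] by blast
  have "real CARD('p) powi (int n) \<le> real CARD('p) powi (max m (int n))"
    using real_card_gt_1[where 'p='p] by (intro power_int_increasing) auto
  with n show thesis using that[of "max m (int n)"] by simp
qed

lemma open_contains_pball:
  assumes "open U" "c \<in> U"
  obtains k where "k \<le> m" "pball (c :: 'p::prime_card padic) k \<subseteq> U"
proof -
  obtain e where e: "e > 0" "ball c e \<subseteq> U" using assms openE by blast
  obtain k where "real CARD('p) powi k < e" "k \<le> m" by (rule powi_small[OF e(1), where 'p='p])
  then have "pball c k \<subseteq> U" unfolding pball_eq_cball using e(2) by (force simp: subset_iff)
  then show thesis using that \<open>k \<le> m\<close> by blast
qed

lemma open_pball: "open (pball (c :: 'p::prime_card padic) k)"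
proof -
  have "\<exists>e>0. ball x e \<subseteq> pball c k" if "x \<in> pball c k" for x
  proof (intro exI conjI)
    show "real CARD('p) powi k > 0" using real_card_gt_0[where 'p='p] by simp
    have "ball x (real CARD('p) powi k) \<subseteq> pball x k" by (auto simp: pball_eq_cball)
    then show "ball x (real CARD('p) powi k) \<subseteq> pball c k" using pball_eq[OF that] by simp
  qed
  then show ?thesis by (simp add: open_contains_ball)
qed

text \<open>Every point of a ball is a centre of it, so balls with rational centres form a countable
  basis. Second countability later identifies the product sigma-algebra with the Borel sets of the
  product space.\<close>

instance padic :: (prime_card) second_countable_topology
proof
  let ?B = "(\<lambda>(q, k). pball (of_rat q :: 'a padic) k) ` UNIV"
  have "topological_basis ?B"
  proof (rule topological_basisI)
    fix U :: "'a padic set" and x assume "open U" "x \<in> U"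
    then obtain k where k: "pball x k \<subseteq> U" by (rule open_contains_pball)
    obtain r where "padic_norm (x - of_rat r) < real CARD('a) powi k"
      using padic_rat_approx[of "real CARD('a) powi k" x] real_card_gt_0[where 'p='a] by auto
    then have x: "x \<in> pball (of_rat r) k" by (simp add: mem_pball)
    with k show "\<exists>B'\<in>?B. x \<in> B' \<and> B' \<subseteq> U"
      using pball_eq[OF x] by (intro bexI[of _ "pball (of_rat r) k"]) auto
  qed (auto simp: open_pball)
  moreover have "countable ?B" by simp
  ultimately show "\<exists>B::'a padic set set. countable B \<and> open = generate_topology B"
    using topological_basis_imp_subbasis by blast
qed

instance padic :: (prime_card) topological_ab_group_add
proof
  fix a b :: "'a padic"
  have le: "dist (x + y) (a + b) \<le> dist x a + dist y b" for x y
    using padic_norm_triangle[of "x - a" "y - b"] by (simp add: dist_padic_def algebra_simps)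
  have "((\<lambda>x. dist (fst x) a + dist (snd x) b) \<longlongrightarrow> dist a a + dist b b) (nhds a \<times>\<^sub>F nhds b)"
    by (intro tendsto_intros filterlim_fst filterlim_snd)
  then have "((\<lambda>x. dist (fst x + snd x) (a + b)) \<longlongrightarrow> 0) (nhds a \<times>\<^sub>F nhds b)"
    by (simp only: dist_self add_0_left) (rule Lim_null_comparison[rotated], auto intro!: le always_eventually)
  then show "((\<lambda>x. fst x + snd x) \<longlongrightarrow> a + b) (nhds a \<times>\<^sub>F nhds b)"
    by (simp add: tendsto_dist_iff[symmetric])
next
  fix a :: "'a padic"
  have "dist (- x) (- a) = dist x a" for x
    using padic_norm_diff_commute[of x a] by (simp add: dist_padic_def)
  then show "(uminus \<longlongrightarrow> - a) (nhds a)"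
    by (simp add: tendsto_iff eventually_nhds_metric) blast
qed

lemma continuous_on_padic_scale: "continuous_on S (\<lambda>x. a * x :: 'p::prime_card padic)"
proof (rule continuous_onI)
  fix x :: "'p padic" and e :: real assume e: "e > 0"
  have d: "dist (a * y) (a * x) = padic_norm a * dist y x" for y
    by (simp add: dist_padic_def padic_norm_mult flip: right_diff_distrib)
  show "\<exists>d>0. \<forall>x'\<in>S. dist x' x < d \<longrightarrow> dist (a * x') (a * x) \<le> e"
  proof (intro exI[of _ "e / (padic_norm a + 1)"] conjI ballI impI)
    show "e / (padic_norm a + 1) > 0" using e padic_norm_nonneg[of a] by (simp add: add_nonneg_pos)
    fix y assume "dist y x < e / (padic_norm a + 1)"
    then have "(padic_norm a + 1) * dist y x < e"
      using padic_norm_nonneg[of a] by (simp add: field_simps add_nonneg_pos)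
    moreover have "padic_norm a * dist y x \<le> (padic_norm a + 1) * dist y x"
      by (intro mult_right_mono) auto
    ultimately show "dist (a * y) (a * x) \<le> e" by (simp add: d)
  qed
qed

lemma continuous_on_padic_norm: "continuous_on S (padic_norm :: 'p::prime_card padic \<Rightarrow> real)"
proof -
  have "continuous_on S (\<lambda>x :: 'p padic. dist x 0)" by (intro continuous_intros)
  then show ?thesis by (simp add: dist_padic_def)
qed

text \<open>Residues modulo p^m: a rational close to \<open>x\<close> has, in lowest terms, a
  denominator prime to p, and division by that denominator can be carried out modulo p^m.\<close>

lemma padic_nat_approx:
  assumes "x \<in> pball (0 :: 'p::prime_card padic) 0"
  shows "\<exists>!a. a < CARD('p) ^ m \<and> x \<in> pball (of_nat a) (- int m)"
proof (rule ex_ex1I)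
  let ?p = "CARD('p)"
  have pm: "real ?p powi (- int m) > 0" using real_card_gt_0[where 'p='p] by simp
  obtain q where q: "padic_norm (x - of_rat q) < real ?p powi (- int m)"
    by (rule padic_rat_approx[OF pm])
  have "real ?p powi (- int m) \<le> real ?p powi 0"
    using real_card_gt_1[where 'p='p] by (intro power_int_increasing) auto
  then have q1: "padic_norm (of_rat q :: 'p padic) \<le> 1"
    using padic_norm_diff_ultra[of x "x - of_rat q"] q assms by (auto simp: mem_pball)
  obtain a b where ab: "quotient_of q = (a, b)" by (meson surj_pair)
  have b: "b > 0" using ab by (rule quotient_of_denom_pos)
  have qab: "q = of_int a / of_int b" using ab by (rule quotient_of_div)
  have cop: "coprime a b" using ab by (rule quotient_of_coprime)
  \<comment> \<open>Otherwise the numerator, whose norm is at most that of \<open>b\<close>, would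
    be divisible by p as well, against lowest terms.\<close>
  have nb: "\<not> int ?p dvd b"
  proof
    assume pb: "int ?p dvd b"
    have "padic_norm (of_int a :: 'p padic) \<le> padic_norm (of_int b :: 'p padic)"
    proof -
      have "padic_norm (of_int b :: 'p padic) \<noteq> 0" using b by (simp add: padic_norm_eq_0_iff)
      then have "padic_norm (of_int b :: 'p padic) > 0"
        using padic_norm_nonneg[of "of_int b :: 'p padic"] by linarith
      then show ?thesis using q1 by (simp add: qab of_rat_divide padic_norm_divide)
    qed
    also have "\<dots> \<le> real ?p powi (- int 1)"
      using pb unfolding padic_norm_of_int_le_iff by simp
    finally have "int ?p dvd a" unfolding padic_norm_of_int_le_iff by simp
    with pb cop have "is_unit (int ?p)" by (rule coprime_common_divisor[rotated -1])
    then show False using prime_CARD[where 'p='p] by auto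
  qed
  have pr: "prime (int ?p)" using prime_CARD[where 'p='p] by simp
  have "coprime b (int ?p ^ m)"
    using prime_imp_coprime[OF pr nb] by (simp add: coprime_commute)
  then obtain c where c: "[b * c = 1] (mod (int ?p ^ m))" using cong_solve_coprime_int by blast
  \<comment> \<open>The residue of \<open>a / b\<close>, since \<open>c\<close> inverts
    \<open>b\<close> modulo p^m.\<close>
  define d where "d = (c * a) mod (int ?p ^ m)"
  have ppos: "int ?p ^ m > 0" using card_prime_gt_1[where 'p='p] by simp
  have d: "0 \<le> d" "d < int ?p ^ m" unfolding d_def using ppos by auto
  have "[b * d = b * (c * a)] (mod (int ?p ^ m))"
    unfolding d_def by (intro cong_scalar_left) (simp add: cong_def)
  also have "b * (c * a) = (b * c) * a" by simp
  also have "[(b * c) * a = 1 * a] (mod (int ?p ^ m))" using c by (rule cong_scalar_right)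
  finally have "int ?p ^ m dvd a - b * d"
    by (metis cong_iff_dvd_diff cong_sym mult_1)
  then have n1: "padic_norm (of_int (a - b * d) :: 'p padic) \<le> real ?p powi (- int m)"
    unfolding padic_norm_of_int_le_iff .
  have nb1: "padic_norm (of_int b :: 'p padic) = 1"
  proof -
    have "\<not> padic_norm (of_int b :: 'p padic) \<le> real ?p powi (- int 1)"
      using nb unfolding padic_norm_of_int_le_iff by simp
    moreover obtain k where k: "padic_norm (of_int b :: 'p padic) = real ?p powi k"
      using b padic_norm_values[of "of_int b :: 'p padic"] by auto
    ultimately have "k > - 1"
      using powi_le_iff[OF real_card_gt_1[where 'p='p], of k "- 1"] by simp
    moreover have "k \<le> 0" using padic_norm_of_int_le_1[of b, where 'p='p]
      unfolding k using powi_le_iff[OF real_card_gt_1[where 'p='p], of k 0] by simp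
    ultimately show ?thesis using k by (cases "k = 0") auto
  qed
  have "of_rat q - of_int d = (of_int (a - b * d) :: 'p padic) / of_int b"
    using b by (simp add: qab of_rat_divide field_simps)
  then have "padic_norm (of_rat q - of_int d :: 'p padic) \<le> real ?p powi (- int m)"
    using n1 by (simp add: padic_norm_divide nb1)
  then have "padic_norm (x - of_int d) \<le> real ?p powi (- int m)"
    using padic_norm_ultra[of "x - of_rat q" "of_rat q - of_int d"] q by auto
  then show "\<exists>a. a < ?p ^ m \<and> x \<in> pball (of_nat a) (- int m)"
    using d by (intro exI[of _ "nat d"]) (auto simp: mem_pball nat_less_iff)
next
  fix a b assume a: "a < CARD('p) ^ m \<and> x \<in> pball (of_nat a) (- int m)"
    and b: "b < CARD('p) ^ m \<and> x \<in> pball (of_nat b) (- int m)"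
  then have "(of_nat a :: 'p padic) \<in> pball (of_nat b) (- int m)"
    using pball_trans pball_commute by blast
  then have "padic_norm (of_int (int a - int b) :: 'p padic) \<le> real CARD('p) powi (- int m)"
    by (simp add: mem_pball)
  then have "int CARD('p) ^ m dvd int a - int b" unfolding padic_norm_of_int_le_iff .
  then have "[int a = int b] (mod (int (CARD('p) ^ m)))" by (simp add: cong_iff_dvd_diff)
  then have "[a = b] (mod (CARD('p) ^ m))" by (simp only: cong_int_iff)
  then show "a = b" using a b by (simp add: cong_def)
qed

text \<open>The unit ball is complete and, by the residues modulo p^m, totally bounded; every other
  ball is an affine image of it.\<close>

lemma compact_pball: "compact (pball (c :: 'p::prime_card padic) k)"
proof -
  have "compact (pball (0 :: 'p padic) 0)"
    unfolding compact_eq_totally_bounded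
  proof (intro conjI allI impI)
    show "complete (pball (0 :: 'p padic) 0)"
      using closed_pball by (simp add: complete_eq_closed)
    fix e :: real assume "e > 0"
    then obtain j where j: "real CARD('p) powi j < e" "j \<le> 0" by (rule powi_small[where 'p='p])
    define m where "m = nat (- j)"
    have m: "- int m = j" using j by (simp add: m_def)
    have "x \<in> (\<Union>y\<in>of_nat ` {..<CARD('p) ^ m}. ball y e)" if x: "x \<in> pball (0 :: 'p padic) 0" for x
    proof -
      obtain a where a: "a < CARD('p) ^ m" "x \<in> pball (of_nat a) (- int m)"
        using padic_nat_approx[OF x, of m] by blast
      then have "x \<in> ball (of_nat a) e" using j by (auto simp: pball_eq_cball m)
      with a show ?thesis by auto
    qed
    then show "\<exists>K. finite K \<and> pball (0 :: 'p padic) 0 \<subseteq> (\<Union>y\<in>K. ball y e)"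
      by (intro exI[of _ "of_nat ` {..<CARD('p) ^ m}"]) auto
  qed
  \<comment> \<open>The norm of p is 1/p, so multiplication by p^(-k) multiplies norms by
    p^k.\<close>
  moreover have "pball c k = (\<lambda>x. (of_nat CARD('p) powi (- k)) * x + c) ` pball 0 0"
  proof (intro equalityI subsetI)
    fix x assume x: "x \<in> pball c k"
    have "of_nat CARD('p) powi k * (x - c) \<in> pball 0 0"
      using x real_card_gt_0[where 'p='p]
      by (simp add: mem_pball padic_norm_mult padic_norm_card_powi power_int_minus divide_le_eq
          flip: divide_inverse_commute)
    moreover have "x = (of_nat CARD('p) powi (- k)) * (of_nat CARD('p) powi k * (x - c)) + c"
      by (simp add: power_int_minus field_simps)
    ultimately show "x \<in> (\<lambda>x. (of_nat CARD('p) powi (- k)) * x + c) ` pball 0 0" by blast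
  next
    fix x assume "x \<in> (\<lambda>x. (of_nat CARD('p) powi (- k)) * x + c) ` pball 0 0"
    then show "x \<in> pball c k"
      using real_card_gt_0[where 'p='p]
      by (auto simp: mem_pball padic_norm_mult padic_norm_card_powi mult_left_le)
  qed
  moreover have "continuous_on (pball 0 0) (\<lambda>x. (of_nat CARD('p) powi (- k)) * x + c)"
    by (intro continuous_intros continuous_on_padic_scale)
  ultimately show ?thesis by (simp add: compact_continuous_image)
qed

subsection \<open>Haar measure\<close>

lemma pball_rat_center:
  obtains q where "(x :: 'p::prime_card padic) \<in> pball (of_rat q) k"
proof -
  have "real CARD('p) powi k > 0" using real_card_gt_0[where 'p='p] by simp
  then obtain q where "padic_norm (x - of_rat q) < real CARD('p) powi k" by (rule padic_rat_approx)
  then show thesis using that[of q] by (simp add: mem_pball)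
qed

text \<open>The generators have radius at most 1 because the measure is constructed from its values
  on such balls; small balls with rational centres still fill every open set.\<close>

lemma sets_borel_padic:
  "sets (borel :: 'p::prime_card padic measure)
    = sigma_sets UNIV ({{}} \<union> {pball c k | c k. k \<le> 0})"
    (is "_ = sigma_sets UNIV ?E")
proof
  show "sigma_sets UNIV ?E \<subseteq> sets (borel :: 'p padic measure)"
    by (rule sets.sigma_sets_subset') (auto intro: borel_open open_pball)
  have "U \<in> sigma_sets UNIV ?E" if U: "open U" for U :: "'p padic set"
  proof -
    let ?I = "{(q, k). k \<le> 0 \<and> pball (of_rat q) k \<subseteq> U}"
    have "x \<in> (\<Union>(q, k)\<in>?I. pball (of_rat q) k)" if "x \<in> U" for x
    proof -
      obtain k where k: "k \<le> 0" "pball x k \<subseteq> U" by (rule open_contains_pball[OF U \<open>x \<in> U\<close>])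
      obtain r where x: "x \<in> pball (of_rat r) k" by (rule pball_rat_center)
      with k pball_eq[OF x] show ?thesis by (intro UN_I[of "(r, k)"]) auto
    qed
    then have "U = (\<Union>(q, k)\<in>?I. pball (of_rat q) k)" by auto
    also have "\<dots> \<in> sigma_sets UNIV ?E"
      by (rule sigma_sets_UNION) (auto intro!: sigma_sets.Basic countable_image)
    finally show ?thesis .
  qed
  then show "sets (borel :: 'p padic measure) \<subseteq> sigma_sets UNIV ?E"
    unfolding borel_def by (subst sets_measure_of) (auto intro!: sigma_sets_mono)
qed

text \<open>Two balls are nested or disjoint, so together with the empty set they are stable under
  intersection; the unit balls with rational centres supply a countable cover of finite
  measure.\<close>

lemma measure_eqI_pball:
  fixes M N :: "'p::prime_card padic measure"
  assumes sets: "sets M = sets borel" "sets N = sets borel"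
    and eq: "\<And>c k. k \<le> 0 \<Longrightarrow> emeasure M (pball c k) = emeasure N (pball c k)"
    and fin: "\<And>c. emeasure M (pball c 0) \<noteq> \<infinity>"
  shows "M = N"
proof (rule measure_eqI_generator_eq_countable)
  let ?E = "{{}} \<union> {pball c k :: 'p padic set | c k. k \<le> 0}"
  show "sets M = sigma_sets UNIV ?E" "sets N = sigma_sets UNIV ?E"
    using sets by (simp_all add: sets_borel_padic)
  show "Int_stable ?E"
  proof (rule Int_stableI)
    fix A B assume A: "A \<in> ?E" and B: "B \<in> ?E"
    show "A \<inter> B \<in> ?E"
    proof (cases "A \<inter> B = {}")
      case False
      then obtain c j d k where *: "A = pball c j" "j \<le> 0" "B = pball d k" "k \<le> 0" using A B by auto
      then have "A \<subseteq> B \<or> B \<subseteq> A"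
        using False pball_nested[of j k c d] pball_nested[of k j d c] by (cases "j \<le> k") auto
      then show ?thesis using A B by (auto simp: Int_absorb1 Int_absorb2)
    qed simp
  qed
  show "emeasure M X = emeasure N X" if "X \<in> ?E" for X using that eq by auto
  let ?A = "range (\<lambda>q. pball (of_rat q) 0) :: 'p padic set set"
  show "?A \<subseteq> ?E" "countable ?A" by auto
  show "\<Union> ?A = UNIV"
  proof -
    have "\<exists>q. x \<in> pball (of_rat q) 0" for x :: "'p padic"
      by (rule pball_rat_center[of x 0]) blast
    then show ?thesis by auto
  qed
  show "emeasure M a \<noteq> \<infinity>" if "a \<in> ?A" for a using that fin by auto
qed auto

lemma mult_card_powi_mem_pball:
  "(of_nat CARD('p) powi j) * x \<in> pball ((of_nat CARD('p) powi j) * c) (k - j)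
    \<longleftrightarrow> x \<in> pball (c :: 'p::prime_card padic) k"
  using real_card_gt_0[where 'p='p]
  by (simp add: mem_pball padic_norm_mult padic_norm_card_powi power_int_diff power_int_minus
      divide_inverse flip: right_diff_distrib)

lemma padic_nat_approx_scaled:
  fixes x :: "'p::prime_card padic"
  assumes "x \<in> pball 0 k"
  shows "\<exists>!a. a < CARD('p) ^ m \<and> x \<in> pball (of_nat a * of_nat CARD('p) powi (- k)) (k - int m)"
proof -
  have "of_nat CARD('p) powi k * x \<in> pball 0 0"
    using assms mult_card_powi_mem_pball[of k x 0 k] by simp
  from padic_nat_approx[OF this, of m]
  have *: "\<exists>!a. a < CARD('p) ^ m \<and> of_nat CARD('p) powi k * x \<in> pball (of_nat a) (- int m)" .
  have "of_nat CARD('p) powi k * x \<in> pball (of_nat a) (- int m)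
      \<longleftrightarrow> x \<in> pball (of_nat a * of_nat CARD('p) powi (- k)) (k - int m)" for a
    using mult_card_powi_mem_pball[of k x "of_nat a * of_nat CARD('p) powi (- k)" "k - int m"]
    by (simp add: power_int_minus field_simps)
  with * show ?thesis by simp
qed

lemma sets_pball [measurable]: "pball c k \<in> sets borel"
  by (intro borel_closed closed_pball)

text \<open>The ball is a disjoint union of p^m translates of the smaller one, one for each residue.
  With \<open>m = 0\<close> it says that the measure of a ball depends only on its radius.\<close>

lemma invariant_pball:
  fixes \<mu> :: "'p::prime_card padic measure"
  assumes sets: "sets \<mu> = sets borel"
    and inv: "\<And>a B. B \<in> sets borel \<Longrightarrow> emeasure \<mu> ((\<lambda>x. x + a) ` B) = emeasure \<mu> B"
  shows "emeasure \<mu> (pball c k) = of_nat (CARD('p) ^ m) * emeasure \<mu> (pball 0 (k - int m))"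
proof -
  have trans: "emeasure \<mu> (pball c j) = emeasure \<mu> (pball 0 j)" for c j
  proof -
    have "pball c j = (\<lambda>x. x + c) ` pball 0 j"
    proof (intro equalityI subsetI)
      fix x assume "x \<in> pball c j"
      then show "x \<in> (\<lambda>x. x + c) ` pball 0 j"
        by (intro image_eqI[of _ _ "x - c"]) (auto simp: mem_pball)
    qed (auto simp: mem_pball)
    then show ?thesis using inv[OF sets_pball, of c 0 j] by simp
  qed
  let ?B = "\<lambda>a. pball (of_nat a * of_nat CARD('p) powi (- k)) (k - int m) :: 'p padic set"
  have "emeasure \<mu> (pball 0 k) = emeasure \<mu> (\<Union>a<CARD('p) ^ m. ?B a)"
  proof (rule arg_cong[of _ _ "emeasure \<mu>"], intro equalityI subsetI)
    fix x :: "'p padic" assume "x \<in> pball 0 k"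
    from padic_nat_approx_scaled[OF this, of m] show "x \<in> (\<Union>a<CARD('p) ^ m. ?B a)" by auto
  next
    fix x :: "'p padic" assume "x \<in> (\<Union>a<CARD('p) ^ m. ?B a)"
    then obtain a where x: "x \<in> ?B a" by auto
    have "of_nat a * of_nat CARD('p) powi (- k) \<in> pball (0 :: 'p padic) k"
      using padic_norm_of_int_le_1[of "int a", where 'p='p] real_card_gt_0[where 'p='p]
      by (simp add: mem_pball padic_norm_mult padic_norm_card_powi)
    moreover have "x \<in> pball (of_nat a * of_nat CARD('p) powi (- k)) k"
      using x pball_mono[of "k - int m" k] by auto
    ultimately show "x \<in> pball 0 k" by (rule pball_trans[rotated])
  qed
  also have "\<dots> = (\<Sum>a<CARD('p) ^ m. emeasure \<mu> (?B a))"
  proof (rule sum_emeasure[symmetric])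
    show "?B ` {..<CARD('p) ^ m} \<subseteq> sets \<mu>"
      by (simp only: sets image_subset_iff sets_pball ball_triv simp_thms)
    show "disjoint_family_on ?B {..<CARD('p) ^ m}"
    proof (unfold disjoint_family_on_def, intro ballI impI)
      fix a b assume ab: "a \<in> {..<CARD('p) ^ m}" "b \<in> {..<CARD('p) ^ m}" "a \<noteq> b"
      show "?B a \<inter> ?B b = {}"
      proof (rule ccontr)
        assume "?B a \<inter> ?B b \<noteq> {}"
        then obtain x where x: "x \<in> ?B a" "x \<in> ?B b" by auto
        have "of_nat a * of_nat CARD('p) powi (- k) \<in> pball (0 :: 'p padic) k"
          using padic_norm_of_int_le_1[of "int a", where 'p='p] real_card_gt_0[where 'p='p]
          by (simp add: mem_pball padic_norm_mult padic_norm_card_powi)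
        moreover have "x \<in> pball (of_nat a * of_nat CARD('p) powi (- k)) k"
          using x(1) pball_mono[of "k - int m" k] by auto
        ultimately have "x \<in> pball 0 k" by (rule pball_trans[rotated])
        from padic_nat_approx_scaled[OF this, of m] x ab show False by auto
      qed
    qed
  qed auto
  also have "\<dots> = of_nat (CARD('p) ^ m) * emeasure \<mu> (pball 0 (k - int m))"
    by (simp add: trans[of "of_nat a * of_nat CARD('p) powi (- k)" for a])
  finally show ?thesis using trans[of c k] by simp
qed

section \<open>Base p digits and the construction of Haar measure\<close>

definition digit_sum :: "nat \<Rightarrow> nat \<Rightarrow> (nat \<Rightarrow> nat) \<Rightarrow> nat" where
  "digit_sum p m \<omega> = (\<Sum>k<m. \<omega> k * p ^ k)"

lemma digit_sum_less:
  assumes "\<And>k. \<omega> k < p"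
  shows "digit_sum p m \<omega> < p ^ m"
proof (induct m)
  case (Suc m)
  have "digit_sum p (Suc m) \<omega> = digit_sum p m \<omega> + \<omega> m * p ^ m" by (simp add: digit_sum_def)
  also have "\<dots> < p ^ m + \<omega> m * p ^ m" using Suc by simp
  also have "\<dots> = Suc (\<omega> m) * p ^ m" by simp
  also have "\<dots> \<le> p * p ^ m" using assms[of m] by (intro mult_right_mono) auto
  finally show ?case by simp
qed (simp add: digit_sum_def)

text \<open>Turns a prescribed residue into one condition for each digit, which is a cylinder event
  for the product measure on digit sequences.\<close>

lemma digit_sum_eq_iff:
  assumes "\<And>k. \<omega> k < p" "a < p ^ m"
  shows "digit_sum p m \<omega> = a \<longleftrightarrow> (\<forall>k<m. \<omega> k = a div p ^ k mod p)"
  using assms(2)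
proof (induct m arbitrary: a)
  case (Suc m)
  have p: "p > 0" using assms(1)[of 0] by simp
  have S: "digit_sum p (Suc m) \<omega> = digit_sum p m \<omega> + \<omega> m * p ^ m" by (simp add: digit_sum_def)
  have lt: "digit_sum p m \<omega> < p ^ m" using assms(1) by (rule digit_sum_less)
  have "digit_sum p (Suc m) \<omega> = a \<longleftrightarrow> digit_sum p m \<omega> = a mod p ^ m \<and> \<omega> m = a div p ^ m"
  proof
    assume "digit_sum p (Suc m) \<omega> = a"
    then show "digit_sum p m \<omega> = a mod p ^ m \<and> \<omega> m = a div p ^ m" using S lt p by auto
  next
    assume "digit_sum p m \<omega> = a mod p ^ m \<and> \<omega> m = a div p ^ m"
    then show "digit_sum p (Suc m) \<omega> = a" using S by (simp add: mod_div_mult_eq)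
  qed
  also have "digit_sum p m \<omega> = a mod p ^ m \<longleftrightarrow> (\<forall>k<m. \<omega> k = (a mod p ^ m) div p ^ k mod p)"
    using p by (intro Suc(1)) simp
  also have "\<dots> \<longleftrightarrow> (\<forall>k<m. \<omega> k = a div p ^ k mod p)"
  proof -
    have "(a mod p ^ m) div p ^ k mod p = a div p ^ k mod p" if k: "k < m" for k
    proof -
      \<comment> \<open>Since k < m, removing the multiple of p^m changes the quotient by p^k only
        by a multiple of p.\<close>
      have "a = a mod p ^ m + p ^ k * (p * (p ^ (m - Suc k) * (a div p ^ m)))"
        using k by (simp add: mult.assoc[symmetric] power_add[symmetric] flip: power_Suc2)
          (simp add: mult.commute mod_mult_div_eq power_add[symmetric] flip: power_Suc)
      then have "a div p ^ k = (a mod p ^ m + p ^ k * (p * (p ^ (m - Suc k) * (a div p ^ m)))) div p ^ k"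
        by (rule arg_cong)
      also have "\<dots> = p * (p ^ (m - Suc k) * (a div p ^ m)) + (a mod p ^ m) div p ^ k"
        using p by (intro div_mult_self2) simp
      finally have "a div p ^ k = p * (p ^ (m - Suc k) * (a div p ^ m)) + (a mod p ^ m) div p ^ k" .
      then show ?thesis by simp
    qed
    then show ?thesis by simp
  qed
  finally have "digit_sum p (Suc m) \<omega> = a
      \<longleftrightarrow> (\<forall>k<m. \<omega> k = a div p ^ k mod p) \<and> \<omega> m = a div p ^ m" .
  moreover have "a div p ^ m mod p = a div p ^ m"
    using Suc(2) p by (simp add: less_mult_imp_div_less mult.commute)
  ultimately show ?case by (auto simp: less_Suc_eq)
qed (simp add: digit_sum_def)

text \<open>This is the law of the series of \<open>\<omega> k * p ^ k\<close> with independent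
  uniform digits. Membership in a ball of radius p^-m around a p-adic integer prescribes exactly the
  first m digits, an event of probability p^-m.\<close>

lemma zp_measure_exists:
  "\<exists>\<nu> :: 'p::prime_card padic measure. prob_space \<nu> \<and> sets \<nu> = sets borel \<and>
     (\<forall>c m. emeasure \<nu> (pball c (- int m))
        = (if c \<in> pball 0 0 then ennreal (real CARD('p) powi (- int m)) else 0))"
proof -
  let ?p = "CARD('p)"
  let ?U = "uniform_count_measure {..<?p}"
  let ?D = "PiM UNIV (\<lambda>_::nat. ?U)"
  have p0: "?p > 0" using card_prime_gt_1[where 'p='p] by simp
  have "{..<?p} \<noteq> {}" using p0 by (auto simp: lessThan_empty_iff)
  then interpret U: prob_space ?U by (intro prob_space_uniform_count_measure) auto
  interpret D: product_prob_space "\<lambda>_::nat. ?U" UNIV by unfold_locales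
  have dig: "\<omega> k < ?p" if "\<omega> \<in> space ?D" for \<omega> k
    using that by (auto simp: space_PiM space_uniform_count_measure)
  define S where "S m \<omega> = (of_nat (digit_sum ?p m \<omega>) :: 'p padic)" for m \<omega>
  \<comment> \<open>Later digits only add multiples of p^m, so the partial sums stay in the ball
    around the m-th one.\<close>
  have Sball: "S (m + j) \<omega> \<in> pball (S m \<omega>) (- int m)" for m j \<omega>
  proof -
    have "?p ^ m dvd (\<Sum>k<j. \<omega> (m + k) * ?p ^ (m + k))"
      by (intro dvd_sum) (auto simp: power_add)
    moreover have "digit_sum ?p (m + j) \<omega> = digit_sum ?p m \<omega> + (\<Sum>k<j. \<omega> (m + k) * ?p ^ (m + k))"
      by (induct j) (auto simp: digit_sum_def)
    ultimately obtain q where "digit_sum ?p (m + j) \<omega> = digit_sum ?p m \<omega> + ?p ^ m * q" by auto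
    then have "S (m + j) \<omega> - S m \<omega> = of_int (int (?p ^ m * q))" by (simp add: S_def)
    moreover have "int ?p ^ m dvd int (?p ^ m * q)" by simp
    ultimately show ?thesis
      using padic_norm_of_int_le_iff[of "int (?p ^ m * q)" m, where 'p='p] by (simp add: mem_pball)
  qed
  have conv: "convergent (\<lambda>m. S m \<omega>)" for \<omega>
  proof (rule Cauchy_convergent, rule metric_CauchyI)
    fix e :: real assume "e > 0"
    then obtain k where k: "real ?p powi k < e" "k \<le> 0" by (rule powi_small[where 'p='p])
    define N where "N = nat (- k)"
    have N: "- int N = k" using k by (simp add: N_def)
    have "dist (S m \<omega>) (S n \<omega>) < e" if "m \<ge> N" "n \<ge> N" for m n
    proof -
      have "S m \<omega> \<in> pball (S N \<omega>) k" "S n \<omega> \<in> pball (S N \<omega>) k"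
        using Sball[of N "m - N" \<omega>] Sball[of N "n - N" \<omega>] that N by auto
      then have "S m \<omega> \<in> pball (S n \<omega>) k" using pball_trans pball_commute by blast
      then show ?thesis using k by (simp add: mem_pball dist_padic_def)
    qed
    then show "\<exists>M. \<forall>m\<ge>M. \<forall>n\<ge>M. dist (S m \<omega>) (S n \<omega>) < e" by blast
  qed
  define X where "X \<omega> = lim (\<lambda>m. S m \<omega>)" for \<omega>
  have X: "(\<lambda>m. S m \<omega>) \<longlonglongrightarrow> X \<omega>" for \<omega>
    using conv unfolding X_def by (simp add: convergent_LIMSEQ_iff)
  have Xball: "X \<omega> \<in> pball (S m \<omega>) (- int m)" for m \<omega>
  proof (rule Lim_in_closed_set[OF closed_pball _ _ X])
    have "S n \<omega> \<in> pball (S m \<omega>) (- int m)" if "n \<ge> m" for n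
      using Sball[of m "n - m" \<omega>] that by simp
    then show "\<forall>\<^sub>F n in sequentially. S n \<omega> \<in> pball (S m \<omega>) (- int m)"
      by (auto simp: eventually_sequentially)
  qed simp
  have Sm: "S m \<in> borel_measurable ?D" for m
  proof -
    have "(\<lambda>d. of_nat (d * ?p ^ k) :: 'p padic) \<in> borel_measurable ?U" for k
      by (simp add: measurable_def space_uniform_count_measure sets_uniform_count_measure)
    then have "(\<lambda>\<omega>. of_nat (\<omega> k * ?p ^ k) :: 'p padic) \<in> borel_measurable ?D" for k
      by (rule measurable_compose[rotated]) (rule measurable_component_singleton, simp)
    then have "(\<lambda>\<omega>. \<Sum>k<m. of_nat (\<omega> k * ?p ^ k) :: 'p padic) \<in> borel_measurable ?D"
      by (intro borel_measurable_sum)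
    then show ?thesis by (simp add: S_def[abs_def] digit_sum_def)
  qed
  have Xm [measurable]: "X \<in> borel_measurable ?D"
    by (rule borel_measurable_LIMSEQ_metric[OF Sm X])
  define \<nu> where "\<nu> = distr ?D borel X"
  have "prob_space \<nu>" unfolding \<nu>_def by (rule D.prob_space_distr) simp
  moreover have "sets \<nu> = sets borel" by (simp add: \<nu>_def)
  moreover have "emeasure \<nu> (pball c (- int m))
        = (if c \<in> pball 0 0 then ennreal (real CARD('p) powi (- int m)) else 0)" for c m
  proof -
    have "emeasure \<nu> (pball c (- int m)) = emeasure ?D {\<omega> \<in> space ?D. X \<omega> \<in> pball c (- int m)}"
      unfolding \<nu>_def by (subst emeasure_distr) (auto simp: vimage_def Int_def conj_commute)
    also have "\<dots> = (if c \<in> pball 0 0 then ennreal (real CARD('p) powi (- int m)) else 0)"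
    proof (cases "c \<in> pball 0 0")
      case True
      then obtain a where a: "a < ?p ^ m" "c \<in> pball (of_nat a) (- int m)"
        using padic_nat_approx[OF True, of m] by blast
      have "X \<omega> \<in> pball c (- int m) \<longleftrightarrow> (\<forall>k\<in>{..<m}. \<omega> k \<in> {a div ?p ^ k mod ?p})"
        if \<omega>: "\<omega> \<in> space ?D" for \<omega>
      proof -
        have "X \<omega> \<in> pball c (- int m) \<longleftrightarrow> S m \<omega> \<in> pball (of_nat a) (- int m)"
          using Xball[of \<omega> m] a(2) pball_eq[OF a(2)] pball_trans pball_commute by blast
        also have "\<dots> \<longleftrightarrow> digit_sum ?p m \<omega> = a"
        proof
          assume "S m \<omega> \<in> pball (of_nat a) (- int m)"
          moreover have "S m \<omega> \<in> pball (of_nat (digit_sum ?p m \<omega>)) (- int m)" by (simp add: S_def)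
          moreover have "S m \<omega> \<in> pball 0 0"
            using padic_norm_of_int_le_1[of "int (digit_sum ?p m \<omega>)", where 'p='p]
            by (simp add: S_def mem_pball)
          moreover have "digit_sum ?p m \<omega> < ?p ^ m" using dig[OF \<omega>] by (rule digit_sum_less)
          ultimately show "digit_sum ?p m \<omega> = a" using a padic_nat_approx[of "S m \<omega>" m] by blast
        qed (simp add: S_def)
        also have "\<dots> \<longleftrightarrow> (\<forall>k<m. \<omega> k = a div ?p ^ k mod ?p)"
          by (rule digit_sum_eq_iff[OF dig[OF \<omega>] a(1)])
        finally show ?thesis by auto
      qed
      then have "{\<omega> \<in> space ?D. X \<omega> \<in> pball c (- int m)}
          = {\<omega> \<in> space ?D. \<forall>k\<in>{..<m}. \<omega> k \<in> {a div ?p ^ k mod ?p}}" by blast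
      also have "emeasure ?D \<dots> = (\<Prod>k<m. emeasure ?U {a div ?p ^ k mod ?p})"
        using p0 by (intro D.emeasure_PiM_Collect) (auto simp: sets_uniform_count_measure)
      also have "\<dots> = (\<Prod>k<m. ennreal (1 / real ?p))"
        using p0 by (intro prod.cong) (auto simp: emeasure_uniform_count_measure)
      also have "\<dots> = ennreal (real ?p powi (- int m))"
        by (simp add: ennreal_power power_int_minus power_one_over inverse_eq_divide)
      finally show ?thesis using True by simp
    next
      case False
      have "X \<omega> \<notin> pball c (- int m)" for \<omega>
      proof
        assume "X \<omega> \<in> pball c (- int m)"
        then have "X \<omega> \<in> pball c 0" using pball_mono[of "- int m" 0 c] by auto
        moreover have "X \<omega> \<in> pball 0 0" using Xball[of \<omega> 0] by (simp add: S_def digit_sum_def)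
        ultimately show False using False pball_trans pball_commute by blast
      qed
      then show ?thesis using False by simp
    qed
    finally show ?thesis .
  qed
  ultimately show ?thesis by blast
qed

text \<open>The field is the disjoint union of the cosets of the unit ball. Adding a p-adic integer
  to a representative of a coset carries the product of counting measure and \<open>\<nu>\<close> to
  a measure with the required values.\<close>

lemma haar_exists:
  "\<exists>\<mu> :: 'p::prime_card padic measure. sets \<mu> = sets borel \<and>
     (\<forall>c m. emeasure \<mu> (pball c (- int m)) = ennreal (real CARD('p) powi (- int m)))"
proof -
  obtain \<nu> :: "'p padic measure" where "prob_space \<nu>" and s: "sets \<nu> = sets borel"
    and \<nu>: "\<And>c m. emeasure \<nu> (pball c (- int m))
        = (if c \<in> pball 0 0 then ennreal (real CARD('p) powi (- int m)) else 0)"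
    using zp_measure_exists[where 'p='p] by blast
  interpret \<nu>: prob_space \<nu> by fact
  have sp: "space \<nu> = UNIV" using sets_eq_imp_space_eq[OF s] by simp
  \<comment> \<open>The representative depends on the ball as a set, so different centres of one
    coset yield the same point. Rational centres reach all cosets and keep the set of
    representatives countable.\<close>
  define rep where "rep C = (SOME x. x \<in> C)" for C :: "'p padic set"
  let ?R = "range (\<lambda>q. rep (pball (of_rat q) 0))"
  have rep: "rep (pball x 0) \<in> pball x 0" for x
    unfolding rep_def by (rule someI[of _ x]) simp
  have cover: "\<exists>!r. r \<in> ?R \<and> x \<in> pball r 0" for x
  proof (rule ex_ex1I)
    obtain q where q: "x \<in> pball (of_rat q) 0" by (rule pball_rat_center)
    then show "\<exists>r. r \<in> ?R \<and> x \<in> pball r 0"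
      using rep[of "of_rat q"] pball_eq by (intro exI[of _ "rep (pball (of_rat q) 0)"]) blast
  next
    fix r r' assume r: "r \<in> ?R \<and> x \<in> pball r 0" and r': "r' \<in> ?R \<and> x \<in> pball r' 0"
    have "rr = rep (pball x 0)" if "rr \<in> ?R \<and> x \<in> pball rr 0" for rr
    proof -
      obtain q where q: "rr = rep (pball (of_rat q) 0)" using \<open>rr \<in> ?R \<and> _\<close> by auto
      have "pball (of_rat q) 0 = pball rr 0" using rep[of "of_rat q"] pball_eq q by blast
      also have "\<dots> = pball x 0" using that pball_eq by blast
      finally show ?thesis using q by simp
    qed
    with r r' show "r = r'" by metis
  qed
  let ?C = "count_space ?R"
  have cR: "countable ?R" by simp
  have meas: "(\<lambda>(r, z). r + z) \<in> measurable (?C \<Otimes>\<^sub>M \<nu>) borel"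
  proof (rule measurable_pair_measure_countable1[OF cR])
    fix r :: "'p padic"
    have "(\<lambda>z. r + z) \<in> borel_measurable borel"
      by (intro borel_measurable_continuous_onI continuous_intros)
    then show "(\<lambda>z. case (r, z) of (r, z) \<Rightarrow> r + z) \<in> borel_measurable \<nu>"
      by (simp add: measurable_cong_sets[OF s refl])
  qed
  define \<mu> where "\<mu> = distr (?C \<Otimes>\<^sub>M \<nu>) borel (\<lambda>(r, z). r + z)"
  have "emeasure \<mu> (pball c (- int m)) = ennreal (real CARD('p) powi (- int m))" for c m
  proof -
    let ?b = "pball c (- int m)"
    obtain r0 where r0: "r0 \<in> ?R" "c \<in> pball r0 0" and uniq: "\<And>r. r \<in> ?R \<Longrightarrow> c \<in> pball r 0 \<Longrightarrow> r = r0"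
      using cover[of c] by blast
    have "emeasure \<mu> ?b = emeasure (?C \<Otimes>\<^sub>M \<nu>) ((\<lambda>(r, z). r + z) -` ?b \<inter> space (?C \<Otimes>\<^sub>M \<nu>))"
      unfolding \<mu>_def by (rule emeasure_distr[OF meas sets_pball])
    also have "\<dots> = (\<integral>\<^sup>+r. emeasure \<nu> (Pair r -` ((\<lambda>(r, z). r + z) -` ?b \<inter> space (?C \<Otimes>\<^sub>M \<nu>))) \<partial>?C)"
      by (rule \<nu>.emeasure_pair_measure_alt) (rule measurable_sets[OF meas sets_pball])
    also have "\<dots> = (\<integral>\<^sup>+r. ennreal (real CARD('p) powi (- int m)) * indicator {r0} r \<partial>?C)"
    proof (rule nn_integral_cong)
      fix r assume r: "r \<in> space ?C"
      have "Pair r -` ((\<lambda>(r, z). r + z) -` ?b \<inter> space (?C \<Otimes>\<^sub>M \<nu>)) = pball (c - r) (- int m)"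
        using r sp by (auto simp: space_pair_measure mem_pball algebra_simps)
      moreover have "c - r \<in> pball 0 0 \<longleftrightarrow> r = r0"
        using uniq[of r] r r0 by (auto simp: mem_pball)
      ultimately show "emeasure \<nu> (Pair r -` ((\<lambda>(r, z). r + z) -` ?b \<inter> space (?C \<Otimes>\<^sub>M \<nu>)))
          = ennreal (real CARD('p) powi (- int m)) * indicator {r0} r"
        by (simp add: \<nu>)
    qed
    also have "\<dots> = ennreal (real CARD('p) powi (- int m)) * emeasure ?C {r0}"
      using r0 by (subst nn_integral_cmult_indicator) auto
    also have "emeasure ?C {r0} = 1" using r0(1) by (subst emeasure_count_space_finite) auto
    finally show ?thesis by simp
  qed
  moreover have "sets \<mu> = sets borel" by (simp add: \<mu>_def)
  ultimately show ?thesis by blast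
qed

text \<open>Existence: translating the constructed measure preserves its values on balls, hence the
  measure. Uniqueness: the unit ball has measure 1 and splits into p^m translates of the ball of
  radius p^-m, which fixes the values on all small balls.\<close>

lemma padic_haar_properties:
  "sets (padic_haar :: 'p::prime_card padic measure) = sets borel
   \<and> (\<forall>a. \<forall>B\<in>sets borel. emeasure padic_haar ((\<lambda>x. x + a) ` B) = emeasure padic_haar (B :: 'p padic set))
   \<and> emeasure padic_haar {x :: 'p padic. padic_norm x \<le> 1} = 1"
  unfolding padic_haar_def
proof (rule theI')
  obtain \<mu> :: "'p padic measure" where s: "sets \<mu> = sets borel"
    and \<mu>: "\<And>c m. emeasure \<mu> (pball c (- int m)) = ennreal (real CARD('p) powi (- int m))"
    using haar_exists[where 'p='p] by blast
  have \<mu>': "emeasure \<mu> (pball c k) = ennreal (real CARD('p) powi k)" if "k \<le> 0" for c k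
    using \<mu>[of c "nat (- k)"] that by simp
  have unit: "{x :: 'p padic. padic_norm x \<le> 1} = pball 0 0" by (auto simp: mem_pball)
  let ?P = "\<lambda>\<mu> :: 'p padic measure. sets \<mu> = sets borel
   \<and> (\<forall>a. \<forall>B\<in>sets borel. emeasure \<mu> ((\<lambda>x. x + a) ` B) = emeasure \<mu> B)
   \<and> emeasure \<mu> {x :: 'p padic. padic_norm x \<le> 1} = 1"
  have "?P \<mu>"
  proof (intro conjI allI ballI)
    show "emeasure \<mu> {x. padic_norm x \<le> 1} = 1" using \<mu>[of 0 0] by (simp add: unit)
    fix a and B :: "'p padic set" assume B: "B \<in> sets borel"
    have m: "(\<lambda>x :: 'p padic. x + - a) \<in> borel_measurable borel"
      by (intro borel_measurable_continuous_onI continuous_intros)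
    then have m': "(\<lambda>x :: 'p padic. x + - a) \<in> measurable \<mu> borel"
      by (simp only: measurable_cong_sets[OF s refl])
    have sp: "space \<mu> = UNIV" using sets_eq_imp_space_eq[OF s] by simp
    have "distr \<mu> borel (\<lambda>x. x + - a) = \<mu>"
    proof (rule measure_eqI_pball)
      fix c and k :: int assume k: "k \<le> 0"
      have "emeasure (distr \<mu> borel (\<lambda>x. x + - a)) (pball c k) = emeasure \<mu> ((\<lambda>x. x + - a) -` pball c k)"
        using m' sp by (subst emeasure_distr) auto
      also have "(\<lambda>x. x + - a) -` pball c k = pball (c + a) k" by (auto simp: mem_pball algebra_simps)
      finally show "emeasure (distr \<mu> borel (\<lambda>x. x + - a)) (pball c k) = emeasure \<mu> (pball c k)"
        using \<mu>' k by simp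
    next
      fix c
      have "emeasure (distr \<mu> borel (\<lambda>x. x + - a)) (pball c 0) = emeasure \<mu> ((\<lambda>x. x + - a) -` pball c 0)"
        using m' sp by (subst emeasure_distr) auto
      also have "(\<lambda>x. x + - a) -` pball c 0 = pball (c + a) 0" by (auto simp: mem_pball algebra_simps)
      finally show "emeasure (distr \<mu> borel (\<lambda>x. x + - a)) (pball c 0) \<noteq> \<infinity>" using \<mu>' by simp
    qed (auto simp: s)
    then have "emeasure \<mu> B = emeasure (distr \<mu> borel (\<lambda>x. x + - a)) B" by simp
    also have "\<dots> = emeasure \<mu> ((\<lambda>x. x + - a) -` B)" using m' B sp by (subst emeasure_distr) auto
    also have "(\<lambda>x. x + - a) -` B = (\<lambda>x. x + a) ` B" by (auto intro!: image_eqI[of _ _ "_ - a"])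
    finally show "emeasure \<mu> ((\<lambda>x. x + a) ` B) = emeasure \<mu> B" by simp
  qed (rule s)
  moreover have "\<mu>' = \<mu>" if P: "?P \<mu>'" for \<mu>'
  proof (rule measure_eqI_pball)
    show eq: "emeasure \<mu>' (pball c k) = emeasure \<mu> (pball c k)" if "k \<le> 0" for c k
    proof -
      define m where "m = nat (- k)"
      have k: "k = - int m" using that by (simp add: m_def)
      have e: "emeasure \<mu>' (pball c k) = emeasure \<mu>' (pball 0 k)"
        using invariant_pball[of \<mu>' c k 0] P by simp
      have "1 = of_nat (CARD('p) ^ m) * emeasure \<mu>' (pball 0 k)"
        using invariant_pball[of \<mu>' 0 0 m] P by (simp add: unit k)
      moreover have "1 = of_nat (CARD('p) ^ m) * emeasure \<mu> (pball 0 k)"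
        using invariant_pball[of \<mu> 0 0 m] \<open>?P \<mu>\<close> by (simp add: unit k)
      ultimately have "of_nat (CARD('p) ^ m) * emeasure \<mu>' (pball 0 k)
          = of_nat (CARD('p) ^ m) * emeasure \<mu> (pball 0 k)" by simp
      then have "emeasure \<mu>' (pball 0 k) = emeasure \<mu> (pball 0 k)"
        using card_prime_gt_1[where 'p='p]
        by (subst (asm) ennreal_mult_cancel_left) (auto simp: of_nat_eq_0_iff power_eq_top_ennreal)
      then show ?thesis using e \<mu>'[OF that] by simp
    qed
    show "emeasure \<mu>' (pball c 0) \<noteq> \<infinity>" for c using eq[of 0 c] \<mu>' by simp
  qed (use P s in auto)
  ultimately show "\<exists>!\<mu>. ?P \<mu>" by blast
qed

lemma sets_padic_haar [measurable_cong, simp]: "sets padic_haar = sets borel"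
  using padic_haar_properties by blast

lemma space_padic_haar [simp]: "space padic_haar = UNIV"
  using sets_eq_imp_space_eq[OF sets_padic_haar] by simp

lemma emeasure_padic_haar_pball:
  "emeasure padic_haar (pball (c :: 'p::prime_card padic) k) = ennreal (real CARD('p) powi k)"
proof -
  have inv: "\<And>a B. B \<in> sets borel \<Longrightarrow> emeasure padic_haar ((\<lambda>x. x + a) ` B) = emeasure padic_haar (B :: 'p padic set)"
    using padic_haar_properties by blast
  have one: "emeasure padic_haar (pball (0 :: 'p padic) 0) = 1"
    using padic_haar_properties[where 'p='p] by (simp add: pball_def)
  note ip = invariant_pball[OF sets_padic_haar inv]
  have p0: "real CARD('p) > 0" by (rule real_card_gt_0)
  show ?thesis
  proof (cases "k \<ge> 0")
    case True
    then show ?thesis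
      using ip[of c k "nat k"] one by (simp add: ennreal_of_nat_eq_real_of_nat power_int_def)
  next
    case False
    define m where "m = nat (- k)"
    have k: "k = - int m" using False by (simp add: m_def)
    have "emeasure padic_haar (pball c k) = emeasure padic_haar (pball (0 :: 'p padic) k)"
      using ip[of c k 0] by simp
    moreover have "1 = of_nat (CARD('p) ^ m) * emeasure padic_haar (pball (0 :: 'p padic) k)"
      using ip[of 0 0 m] one by (simp add: k)
    then have "ennreal (real CARD('p) powi k) * 1
        = (ennreal (real CARD('p) powi k) * ennreal (real CARD('p) ^ m)) * emeasure padic_haar (pball (0 :: 'p padic) k)"
      by (metis ennreal_of_nat_eq_real_of_nat mult.assoc of_nat_power)
    moreover have "ennreal (real CARD('p) powi k) * ennreal (real CARD('p) ^ m) = 1"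
      using p0 by (simp add: k power_int_minus flip: ennreal_mult)
    ultimately show ?thesis by simp
  qed
qed

lemma measure_padic_haar_pball:
  "measure padic_haar (pball (c :: 'p::prime_card padic) k) = real CARD('p) powi k"
  using real_card_gt_0[where 'p='p] by (simp add: measure_def emeasure_padic_haar_pball)

lemma distr_padic_haar_translate: "distr padic_haar borel (\<lambda>x. x + a) = (padic_haar :: 'p::prime_card padic measure)"
proof (rule measure_eqI_pball)
  have m: "(\<lambda>x :: 'p padic. x + a) \<in> borel_measurable borel"
    by (intro borel_measurable_continuous_onI continuous_intros)
  have *: "emeasure (distr padic_haar borel (\<lambda>x. x + a)) (pball c k) = ennreal (real CARD('p) powi k)" for c :: "'p padic" and k
  proof -
    have "emeasure (distr padic_haar borel (\<lambda>x. x + a)) (pball c k) = emeasure padic_haar ((\<lambda>x. x + a) -` pball c k)"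
      using m by (subst emeasure_distr) auto
    also have "(\<lambda>x. x + a) -` pball c k = pball (c - a) k" by (auto simp: mem_pball algebra_simps)
    finally show ?thesis by (simp add: emeasure_padic_haar_pball)
  qed
  show "emeasure (distr padic_haar borel (\<lambda>x. x + a)) (pball c k) = emeasure padic_haar (pball c k)" for c :: "'p padic" and k
    by (simp add: * emeasure_padic_haar_pball)
  show "emeasure (distr padic_haar borel (\<lambda>x. x + a)) (pball c 0) \<noteq> \<infinity>" for c :: "'p padic"
    by (simp add: *)
qed auto

lemma pball_exhaust: "(\<Union>k::nat. pball 0 (int k)) = (UNIV :: 'p::prime_card padic set)"
proof -
  have "\<exists>k::nat. x \<in> pball 0 (int k)" for x :: "'p padic"
  proof -
    obtain k where "padic_norm x \<le> real CARD('p) powi k" "k \<ge> 0"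
      by (rule powi_large[of "padic_norm x" 0, where 'p='p])
    then show ?thesis by (intro exI[of _ "nat k"]) (simp add: mem_pball)
  qed
  then show ?thesis by auto
qed

interpretation padic_haar: sigma_finite_measure "padic_haar :: 'p::prime_card padic measure"
proof
  show "\<exists>A. countable A \<and> A \<subseteq> sets (padic_haar :: 'p padic measure) \<and> \<Union> A = space padic_haar
      \<and> (\<forall>a\<in>A. emeasure padic_haar a \<noteq> \<infinity>)"
    using pball_exhaust[where 'p='p]
    by (intro exI[of _ "range (\<lambda>k::nat. pball 0 (int k))"]) (auto simp: emeasure_padic_haar_pball)
qed

subsection \<open>Square integrable functions and kernel operators\<close>

lemma L2_functionsD:
  assumes "f \<in> L2_functions M"
  shows "f \<in> borel_measurable M" "integrable M (\<lambda>x. (cmod (f x))\<^sup>2)"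
  using assms by (auto simp: L2_functions_def)

lemma cmod_add_square_le: "(cmod (a + b))\<^sup>2 \<le> 2 * (cmod a)\<^sup>2 + 2 * (cmod b)\<^sup>2"
proof -
  have "(cmod (a + b))\<^sup>2 \<le> (cmod a + cmod b)\<^sup>2"
    by (intro power_mono norm_triangle_ineq) simp
  also have "\<dots> \<le> 2 * (cmod a)\<^sup>2 + 2 * (cmod b)\<^sup>2"
    using zero_le_power2[of "cmod a - cmod b"] by (simp add: power2_eq_square algebra_simps)
  finally show ?thesis .
qed

lemma L2_add:
  assumes "f \<in> L2_functions M" "g \<in> L2_functions M"
  shows "(\<lambda>x. f x + g x) \<in> L2_functions M"
proof -
  note [measurable] = L2_functionsD(1)[OF assms(1)] L2_functionsD(1)[OF assms(2)]
  have "integrable M (\<lambda>x. (cmod (f x + g x))\<^sup>2)"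
    by (rule Bochner_Integration.integrable_bound[of _ "\<lambda>x. 2 * (cmod (f x))\<^sup>2 + 2 * (cmod (g x))\<^sup>2"])
      (use L2_functionsD(2)[OF assms(1)] L2_functionsD(2)[OF assms(2)] cmod_add_square_le in auto)
  then show ?thesis by (simp add: L2_functions_def)
qed

lemma L2_mult: "f \<in> L2_functions M \<Longrightarrow> (\<lambda>x. c * f x) \<in> L2_functions M"
  by (auto simp: L2_functions_def norm_mult power_mult_distrib)

lemma L2_diff: "f \<in> L2_functions M \<Longrightarrow> g \<in> L2_functions M \<Longrightarrow> (\<lambda>x. f x - g x) \<in> L2_functions M"
  using L2_add[of f M "\<lambda>x. - 1 * g x"] L2_mult[of g M "- 1"] by simp

lemma L2_uminus: "f \<in> L2_functions M \<Longrightarrow> (\<lambda>x. - f x) \<in> L2_functions M"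
  using L2_mult[of f M "- 1"] by simp

lemma L2_divide: "f \<in> L2_functions M \<Longrightarrow> (\<lambda>x. f x / c) \<in> L2_functions M"
  using L2_mult[of f M "1 / c"] by simp

lemma L2_zero: "(\<lambda>x. 0) \<in> L2_functions M"
  by (simp add: L2_functions_def)

lemmas L2_intros = L2_add L2_mult L2_diff L2_uminus L2_divide L2_zero

lemma L2_norm_nonneg [simp]: "0 \<le> L2_norm M f"
  by (simp add: L2_norm_def)

lemma L2_norm_square: "(L2_norm M f)\<^sup>2 = (LINT x|M. (cmod (f x))\<^sup>2)"
  by (simp add: L2_norm_def)

lemma L2_norm_mult: "L2_norm M (\<lambda>x. c * f x) = cmod c * L2_norm M f"
  by (simp add: L2_norm_def norm_mult power_mult_distrib real_sqrt_mult)

lemma L2_norm_uminus: "L2_norm M (\<lambda>x. - f x) = L2_norm M f"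
  by (simp add: L2_norm_def)

lemma L2_norm_minus_commute: "L2_norm M (\<lambda>x. f x - g x) = L2_norm M (\<lambda>x. g x - f x)"
  by (simp add: L2_norm_def norm_minus_commute)

lemma L2_norm_cong_AE:
  assumes "f \<in> L2_functions M" "g \<in> L2_functions M" "AE x in M. f x = g x"
  shows "L2_norm M f = L2_norm M g"
proof -
  note [measurable] = L2_functionsD(1)[OF assms(1)] L2_functionsD(1)[OF assms(2)]
  show ?thesis unfolding L2_norm_def
    by (rule arg_cong[of _ _ sqrt], rule integral_cong_AE) (use assms(3) in auto)
qed

lemma L2_norm_eq_0_iff:
  assumes "f \<in> L2_functions M"
  shows "L2_norm M f = 0 \<longleftrightarrow> (AE x in M. f x = 0)"
  using L2_functionsD[OF assms] by (simp add: L2_norm_def integral_nonneg_eq_0_iff_AE)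

text \<open>The square is expanded with weights \<open>b / a\<close> and \<open>a / b\<close>. For
  \<open>a\<close> and \<open>b\<close> just above the two norms the weighted sum is at most (a +
  b)^2.\<close>

lemma L2_norm_triangle:
  assumes f: "f \<in> L2_functions M" and g: "g \<in> L2_functions M"
  shows "L2_norm M (\<lambda>x. f x + g x) \<le> L2_norm M f + L2_norm M g"
proof (rule field_le_epsilon)
  fix e :: real assume e: "e > 0"
  \<comment> \<open>The summand \<open>e / 2\<close> keeps \<open>a\<close> and \<open>b\<close>
    positive when a norm vanishes.\<close>
  define a where "a = L2_norm M f + e / 2"
  define b where "b = L2_norm M g + e / 2"
  have ab: "a > 0" "b > 0" using e by (simp_all add: a_def b_def add_nonneg_pos)
  have pt: "(cmod (f x + g x))\<^sup>2 \<le> (1 + b / a) * (cmod (f x))\<^sup>2 + (1 + a / b) * (cmod (g x))\<^sup>2" for x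
  proof -
    have "(cmod (f x + g x))\<^sup>2 \<le> (cmod (f x) + cmod (g x))\<^sup>2"
      by (intro power_mono norm_triangle_ineq) simp
    also have "\<dots> \<le> (1 + b / a) * (cmod (f x))\<^sup>2 + (1 + a / b) * (cmod (g x))\<^sup>2"
    proof -
      have "0 \<le> (b * cmod (f x) - a * cmod (g x))\<^sup>2 / (a * b)" using ab by simp
      also have "\<dots> = b / a * (cmod (f x))\<^sup>2 + a / b * (cmod (g x))\<^sup>2 - 2 * cmod (f x) * cmod (g x)"
        using ab by (simp add: field_simps power2_eq_square)
      finally show ?thesis by (simp add: power2_eq_square algebra_simps)
    qed
    finally show ?thesis .
  qed
  have "(L2_norm M (\<lambda>x. f x + g x))\<^sup>2 \<le> (LINT x|M. (1 + b / a) * (cmod (f x))\<^sup>2 + (1 + a / b) * (cmod (g x))\<^sup>2)"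
    unfolding L2_norm_square
    by (rule integral_mono) (use L2_functionsD[OF L2_add[OF f g]] L2_functionsD[OF f] L2_functionsD[OF g] pt in auto)
  also have "\<dots> = (1 + b / a) * (L2_norm M f)\<^sup>2 + (1 + a / b) * (L2_norm M g)\<^sup>2"
    using L2_functionsD[OF f] L2_functionsD[OF g] by (simp add: L2_norm_square)
  also have "\<dots> \<le> (1 + b / a) * a\<^sup>2 + (1 + a / b) * b\<^sup>2"
    using ab e by (intro add_mono mult_left_mono power_mono) (auto simp: a_def b_def)
  also have "\<dots> = (a + b)\<^sup>2" using ab by (simp add: field_simps power2_eq_square)
  finally have "L2_norm M (\<lambda>x. f x + g x) \<le> a + b"
    by (rule power2_le_imp_le) (use ab in simp)
  then show "L2_norm M (\<lambda>x. f x + g x) \<le> L2_norm M f + L2_norm M g + e"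
    by (simp add: a_def b_def)
qed

lemma L2_norm_triangle_AE:
  assumes "F \<in> L2_functions M" "G \<in> L2_functions M" "H \<in> L2_functions M"
    and "AE x in M. F x = G x + H x"
  shows "L2_norm M F \<le> L2_norm M G + L2_norm M H"
  using L2_norm_cong_AE[OF assms(1) L2_add[OF assms(2,3)] assms(4)] L2_norm_triangle[OF assms(2,3)] by simp

lemma L2_norm_triangle3_AE:
  assumes "F \<in> L2_functions M" "G \<in> L2_functions M" "H \<in> L2_functions M" "K \<in> L2_functions M"
    and "AE x in M. F x = G x + H x + K x"
  shows "L2_norm M F \<le> L2_norm M G + L2_norm M H + L2_norm M K"
  using L2_norm_triangle_AE[OF assms(1) L2_add[OF assms(2,3)] assms(4,5)]
    L2_norm_triangle[OF assms(2,3)] by simp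

lemma L2_norm_triangle_diff:
  assumes "f \<in> L2_functions M" "g \<in> L2_functions M" "h \<in> L2_functions M"
  shows "L2_norm M (\<lambda>x. f x - h x) \<le> L2_norm M (\<lambda>x. f x - g x) + L2_norm M (\<lambda>x. g x - h x)"
  by (rule L2_norm_triangle_AE) (auto intro!: L2_intros assms)

text \<open>The hypotheses of Schur's test. The uniform bound on \<open>k\<close> makes
  \<open>kernel_op\<close> an absolutely convergent integral at every point and not only almost
  everywhere, so that later identities between operators hold pointwise.\<close>

definition schur_kernel :: "'a measure \<Rightarrow> real \<Rightarrow> ('a \<Rightarrow> 'a \<Rightarrow> real) \<Rightarrow> bool" where
  "schur_kernel M c k \<longleftrightarrow> 0 < c \<and> case_prod k \<in> borel_measurable (M \<Otimes>\<^sub>M M) \<and> (\<exists>B. \<forall>x y. \<bar>k x y\<bar> \<le> B)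
     \<and> (\<forall>x\<in>space M. (\<integral>\<^sup>+y. ennreal \<bar>k x y\<bar> \<partial>M) \<le> ennreal c)
     \<and> (\<forall>y\<in>space M. (\<integral>\<^sup>+x. ennreal \<bar>k x y\<bar> \<partial>M) \<le> ennreal c)"

definition kernel_op :: "'a measure \<Rightarrow> ('a \<Rightarrow> 'a \<Rightarrow> real) \<Rightarrow> ('a \<Rightarrow> complex) \<Rightarrow> 'a \<Rightarrow> complex" where
  "kernel_op M k f x = (LINT y|M. complex_of_real (k x y) * f y)"

context sigma_finite_measure
begin

lemma schur_kernelD:
  assumes "schur_kernel M c k"
  shows "case_prod k \<in> borel_measurable (M \<Otimes>\<^sub>M M)"
    and "x \<in> space M \<Longrightarrow> k x \<in> borel_measurable M"
    and "x \<in> space M \<Longrightarrow> integrable M (k x)"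
    and "x \<in> space M \<Longrightarrow> (LINT y|M. \<bar>k x y\<bar>) \<le> c"
proof -
  show m: "case_prod k \<in> borel_measurable (M \<Otimes>\<^sub>M M)"
    using assms by (simp add: schur_kernel_def)
  show mx: "k x \<in> borel_measurable M" if "x \<in> space M"
    using measurable_compose[OF measurable_Pair1'[OF that] m] by simp
  have le: "(\<integral>\<^sup>+y. ennreal \<bar>k x y\<bar> \<partial>M) \<le> ennreal c" if "x \<in> space M"
    using assms that by (simp add: schur_kernel_def)
  show i: "integrable M (k x)" if "x \<in> space M"
    using le[OF that] mx[OF that] by (intro integrableI_bounded) (auto simp: le_less_trans)
  show "(LINT y|M. \<bar>k x y\<bar>) \<le> c" if "x \<in> space M"
  proof -
    have "ennreal (LINT y|M. \<bar>k x y\<bar>) = (\<integral>\<^sup>+y. ennreal \<bar>k x y\<bar> \<partial>M)"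
      using i[OF that] by (intro nn_integral_eq_integral[symmetric]) auto
    also have "\<dots> \<le> ennreal c" by (rule le[OF that])
    finally show ?thesis using assms by (simp add: schur_kernel_def)
  qed
qed

text \<open>The third part is Cauchy-Schwarz for the measure with density
  \<open>\<bar>k x y\<bar>\<close>, read off from the nonnegative integral of the squared deviation
  of \<open>cmod (f y)\<close> from \<open>v / c\<close>.\<close>

lemma schur_kernel_integrable:
  assumes k: "schur_kernel M c k" and f: "f \<in> L2_functions M" and x: "x \<in> space M"
  shows "integrable M (\<lambda>y. complex_of_real (k x y) * f y)"
    and "integrable M (\<lambda>y. \<bar>k x y\<bar> * (cmod (f y))\<^sup>2)"
    and "(LINT y|M. \<bar>k x y\<bar> * cmod (f y))\<^sup>2 \<le> c * (LINT y|M. \<bar>k x y\<bar> * (cmod (f y))\<^sup>2)"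
proof -
  note [measurable] = schur_kernelD(2)[OF k x] L2_functionsD(1)[OF f]
  obtain B where B: "\<And>x y. \<bar>k x y\<bar> \<le> B" using k by (auto simp: schur_kernel_def)
  have c: "c > 0" using k by (simp add: schur_kernel_def)
  have B0: "B \<ge> 0" using B[of x x] by linarith
  show i2: "integrable M (\<lambda>y. \<bar>k x y\<bar> * (cmod (f y))\<^sup>2)"
    by (rule Bochner_Integration.integrable_bound[of _ "\<lambda>y. B * (cmod (f y))\<^sup>2"])
      (use L2_functionsD(2)[OF f] B B0 in \<open>auto intro!: mult_right_mono\<close>)
  \<comment> \<open>Reduces absolute convergence to the integrability of the kernel and of the
    kernel times the square of \<open>f\<close>.\<close>
  have le: "a \<le> 1 + a\<^sup>2" for a :: real
    using zero_le_power2[of "a - 1/2"] by (simp add: power2_eq_square algebra_simps)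
  have le': "\<bar>k x y\<bar> * cmod (f y) \<le> \<bar>k x y\<bar> + \<bar>k x y\<bar> * (cmod (f y))\<^sup>2" for y
    using mult_left_mono[OF le[of "cmod (f y)"], of "\<bar>k x y\<bar>"] by (simp add: distrib_left)
  show i1: "integrable M (\<lambda>y. complex_of_real (k x y) * f y)"
    by (rule Bochner_Integration.integrable_bound[of _ "\<lambda>y. \<bar>k x y\<bar> + \<bar>k x y\<bar> * (cmod (f y))\<^sup>2"])
      (use i2 schur_kernelD(3)[OF k x] le' in \<open>auto simp: norm_mult\<close>)
  define v where "v = (LINT y|M. \<bar>k x y\<bar> * cmod (f y))"
  have i1': "integrable M (\<lambda>y. \<bar>k x y\<bar> * cmod (f y))"
    using integrable_norm[OF i1] by (simp add: norm_mult)
  have "0 \<le> (LINT y|M. \<bar>k x y\<bar> * (cmod (f y) - v / c)\<^sup>2)" by (rule integral_nonneg_AE) auto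
  also have "\<dots> = (LINT y|M. \<bar>k x y\<bar> * (cmod (f y))\<^sup>2 - 2 * (v / c) * (\<bar>k x y\<bar> * cmod (f y))
      + (v / c)\<^sup>2 * \<bar>k x y\<bar>)"
    by (rule Bochner_Integration.integral_cong) (auto simp: power2_eq_square algebra_simps)
  also have "\<dots> = (LINT y|M. \<bar>k x y\<bar> * (cmod (f y))\<^sup>2) - 2 * (v / c) * v + (v / c)\<^sup>2 * (LINT y|M. \<bar>k x y\<bar>)"
    using i1' i2 schur_kernelD(3)[OF k x] by (simp add: v_def)
  also have "\<dots> \<le> (LINT y|M. \<bar>k x y\<bar> * (cmod (f y))\<^sup>2) - 2 * (v / c) * v + (v / c)\<^sup>2 * c"
    using schur_kernelD(4)[OF k x] by (intro add_left_mono mult_left_mono) auto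
  also have "\<dots> = (LINT y|M. \<bar>k x y\<bar> * (cmod (f y))\<^sup>2) - v\<^sup>2 / c"
    using c by (simp add: power2_eq_square field_simps)
  finally have "v\<^sup>2 / c \<le> (LINT y|M. \<bar>k x y\<bar> * (cmod (f y))\<^sup>2)" by simp
  then show "(LINT y|M. \<bar>k x y\<bar> * cmod (f y))\<^sup>2 \<le> c * (LINT y|M. \<bar>k x y\<bar> * (cmod (f y))\<^sup>2)"
    unfolding v_def pos_divide_le_eq[OF c] by (simp only: mult.commute)
qed

text \<open>Schur's test: the row bound enters through the pointwise Cauchy-Schwarz estimate, the
  column bound after the integrals are exchanged, and each contributes one factor \<open>c\<close>
  to the squared norm.\<close>

lemma kernel_op_L2:
  assumes k: "schur_kernel M c k" and f: "f \<in> L2_functions M"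
  shows "kernel_op M k f \<in> L2_functions M" and "L2_norm M (kernel_op M k f) \<le> c * L2_norm M f"
proof -
  interpret P: pair_sigma_finite M M by unfold_locales
  note [measurable] = schur_kernelD(1)[OF k] L2_functionsD(1)[OF f]
  have c: "c > 0" using k by (simp add: schur_kernel_def)
  have m: "kernel_op M k f \<in> borel_measurable M"
    unfolding kernel_op_def by measurable
  have pt: "ennreal ((cmod (kernel_op M k f x))\<^sup>2) \<le> c * (\<integral>\<^sup>+y. \<bar>k x y\<bar> * (cmod (f y))\<^sup>2 \<partial>M)"
    if x: "x \<in> space M" for x
  proof -
    have "cmod (kernel_op M k f x) \<le> (LINT y|M. \<bar>k x y\<bar> * cmod (f y))"
      unfolding kernel_op_def
      using integral_norm_bound[of M "\<lambda>y. complex_of_real (k x y) * f y"] by (simp add: norm_mult)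
    then have "(cmod (kernel_op M k f x))\<^sup>2 \<le> (LINT y|M. \<bar>k x y\<bar> * cmod (f y))\<^sup>2"
      by (intro power_mono) auto
    also have "\<dots> \<le> c * (LINT y|M. \<bar>k x y\<bar> * (cmod (f y))\<^sup>2)"
      by (rule schur_kernel_integrable(3)[OF k f x])
    finally have "ennreal ((cmod (kernel_op M k f x))\<^sup>2) \<le> ennreal (c * (LINT y|M. \<bar>k x y\<bar> * (cmod (f y))\<^sup>2))"
      by (rule ennreal_leI)
    also have "\<dots> = c * ennreal (LINT y|M. \<bar>k x y\<bar> * (cmod (f y))\<^sup>2)"
      using c by (simp add: ennreal_mult')
    also have "ennreal (LINT y|M. \<bar>k x y\<bar> * (cmod (f y))\<^sup>2) = (\<integral>\<^sup>+y. \<bar>k x y\<bar> * (cmod (f y))\<^sup>2 \<partial>M)"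
      using schur_kernel_integrable(2)[OF k f x] by (intro nn_integral_eq_integral[symmetric]) auto
    finally show ?thesis .
  qed
  have "(\<integral>\<^sup>+x. (cmod (kernel_op M k f x))\<^sup>2 \<partial>M) \<le> (\<integral>\<^sup>+x. c * (\<integral>\<^sup>+y. \<bar>k x y\<bar> * (cmod (f y))\<^sup>2 \<partial>M) \<partial>M)"
    by (rule nn_integral_mono) (rule pt)
  also have "\<dots> = c * (\<integral>\<^sup>+x. (\<integral>\<^sup>+y. \<bar>k x y\<bar> * (cmod (f y))\<^sup>2 \<partial>M) \<partial>M)"
    by (rule nn_integral_cmult) measurable
  also have "(\<integral>\<^sup>+x. (\<integral>\<^sup>+y. \<bar>k x y\<bar> * (cmod (f y))\<^sup>2 \<partial>M) \<partial>M)
      = (\<integral>\<^sup>+y. (\<integral>\<^sup>+x. \<bar>k x y\<bar> * (cmod (f y))\<^sup>2 \<partial>M) \<partial>M)"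
    by (rule P.Fubini') measurable
  also have "\<dots> = (\<integral>\<^sup>+y. (\<integral>\<^sup>+x. \<bar>k x y\<bar> \<partial>M) * ennreal ((cmod (f y))\<^sup>2) \<partial>M)"
    by (intro nn_integral_cong) (auto simp: ennreal_mult' nn_integral_multc)
  also have "\<dots> \<le> (\<integral>\<^sup>+y. c * ennreal ((cmod (f y))\<^sup>2) \<partial>M)"
    using k by (intro nn_integral_mono mult_right_mono) (auto simp: schur_kernel_def)
  also have "\<dots> = c * (\<integral>\<^sup>+y. ennreal ((cmod (f y))\<^sup>2) \<partial>M)"
    by (rule nn_integral_cmult) measurable
  also have "(\<integral>\<^sup>+y. ennreal ((cmod (f y))\<^sup>2) \<partial>M) = ennreal ((L2_norm M f)\<^sup>2)"
    unfolding L2_norm_square using L2_functionsD(2)[OF f] by (intro nn_integral_eq_integral) auto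
  also have "ennreal c * (ennreal c * ennreal ((L2_norm M f)\<^sup>2)) = ennreal ((c * L2_norm M f)\<^sup>2)"
    using c by (simp add: power2_eq_square ennreal_mult' mult_ac)
  finally have *: "(\<integral>\<^sup>+x. (cmod (kernel_op M k f x))\<^sup>2 \<partial>M) \<le> ennreal ((c * L2_norm M f)\<^sup>2)"
    by (simp add: mult_left_mono)
  then have i: "integrable M (\<lambda>x. (cmod (kernel_op M k f x))\<^sup>2)"
    using m by (intro integrableI_bounded) (auto simp: le_less_trans)
  then show L2: "kernel_op M k f \<in> L2_functions M" using m by (simp add: L2_functions_def)
  have "ennreal ((L2_norm M (kernel_op M k f))\<^sup>2) \<le> ennreal ((c * L2_norm M f)\<^sup>2)"
    unfolding L2_norm_square[of M "kernel_op M k f"] using * i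
    by (subst (asm) nn_integral_eq_integral) auto
  then have "(L2_norm M (kernel_op M k f))\<^sup>2 \<le> (c * L2_norm M f)\<^sup>2" by simp
  then show "L2_norm M (kernel_op M k f) \<le> c * L2_norm M f"
    by (rule power2_le_imp_le) (use c in simp)
qed

lemma schur_kernel_abs: "schur_kernel M c k \<Longrightarrow> schur_kernel M c (\<lambda>x y. \<bar>k x y\<bar>)"
  unfolding schur_kernel_def by (auto simp: case_prod_unfold)

lemma L2_cmod: "f \<in> L2_functions M \<Longrightarrow> (\<lambda>x. complex_of_real (cmod (f x))) \<in> L2_functions M"
  by (auto simp: L2_functions_def)

text \<open>Fubini applies at every point \<open>x\<close>: the operator with kernel
  \<open>\<bar>l y z\<bar>\<close> sends the modulus of \<open>f\<close> into L2, and such a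
  function is integrable against \<open>\<bar>k x y\<bar>\<close>.\<close>

lemma kernel_op_compose:
  assumes k: "schur_kernel M c k" and l: "schur_kernel M d l" and f: "f \<in> L2_functions M"
    and x: "x \<in> space M"
    and comp: "\<And>z. z \<in> space M \<Longrightarrow> (LINT y|M. k x y * l y z) = m x z"
  shows "kernel_op M k (kernel_op M l f) x = kernel_op M m f x"
proof -
  interpret P: pair_sigma_finite M M by unfold_locales
  note [measurable] = schur_kernelD(2)[OF k x] schur_kernelD(1)[OF l] L2_functionsD(1)[OF f]
  let ?F = "\<lambda>y z. complex_of_real (k x y) * (complex_of_real (l y z) * f z)"
  have int: "integrable (M \<Otimes>\<^sub>M M) (case_prod ?F)"
  proof (rule P.Fubini_integrable)
    show "case_prod ?F \<in> borel_measurable (M \<Otimes>\<^sub>M M)" by measurable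
    show "AE y in M. integrable M (\<lambda>z. case_prod ?F (y, z))"
      using schur_kernel_integrable(1)[OF l f] by (intro AE_I2) simp
    let ?g = "\<lambda>z. complex_of_real (cmod (f z))"
    have eq: "complex_of_real (LINT z|M. norm (case_prod ?F (y, z)))
        = complex_of_real \<bar>k x y\<bar> * kernel_op M (\<lambda>y z. \<bar>l y z\<bar>) ?g y" for y
    proof -
      have "(LINT z|M. norm (case_prod ?F (y, z))) = \<bar>k x y\<bar> * (LINT z|M. \<bar>l y z\<bar> * cmod (f z))"
        by (simp add: norm_mult)
      moreover have "kernel_op M (\<lambda>y z. \<bar>l y z\<bar>) ?g y = complex_of_real (LINT z|M. \<bar>l y z\<bar> * cmod (f z))"
        unfolding kernel_op_def by (simp only: of_real_mult[symmetric] integral_complex_of_real)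
      ultimately show ?thesis by simp
    qed
    have "integrable M (\<lambda>y. complex_of_real (LINT z|M. norm (case_prod ?F (y, z))))"
      unfolding eq
      by (rule schur_kernel_integrable(1)[OF schur_kernel_abs[OF k]
            kernel_op_L2(1)[OF schur_kernel_abs[OF l] L2_cmod[OF f]] x])
    then show "integrable M (\<lambda>y. LINT z|M. norm (case_prod ?F (y, z)))"
      by (simp only: complex_of_real_integrable_eq)
  qed
  have "kernel_op M k (kernel_op M l f) x = (LINT y|M. LINT z|M. ?F y z)"
    unfolding kernel_op_def by simp
  also have "\<dots> = (LINT z|M. LINT y|M. ?F y z)"
    by (rule P.Fubini_integral[OF int, symmetric])
  also have "\<dots> = kernel_op M m f x"
    unfolding kernel_op_def
  proof (rule Bochner_Integration.integral_cong[OF refl])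
    fix z assume z: "z \<in> space M"
    have "(LINT y|M. ?F y z) = (LINT y|M. complex_of_real (k x y * l y z) * f z)"
      by (simp add: mult.assoc)
    also have "\<dots> = (LINT y|M. complex_of_real (k x y * l y z)) * f z" by (rule integral_mult_left_zero)
    also have "(LINT y|M. complex_of_real (k x y * l y z)) = complex_of_real (m x z)"
      by (simp only: integral_complex_of_real comp[OF z])
    finally show "(LINT y|M. ?F y z) = complex_of_real (m x z) * f z" .
  qed
  finally show ?thesis .
qed

lemma kernel_op_linear:
  assumes k: "schur_kernel M c k" and f: "f \<in> L2_functions M" and g: "g \<in> L2_functions M" and x: "x \<in> space M"
  shows "kernel_op M k (\<lambda>x. a * f x + b * g x) x = a * kernel_op M k f x + b * kernel_op M k g x"
proof -
  have "kernel_op M k (\<lambda>x. a * f x + b * g x) x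
      = (LINT y|M. a * (complex_of_real (k x y) * f y) + b * (complex_of_real (k x y) * g y))"
    unfolding kernel_op_def by (rule Bochner_Integration.integral_cong) (auto simp: algebra_simps)
  also have "\<dots> = a * kernel_op M k f x + b * kernel_op M k g x"
    unfolding kernel_op_def
    using schur_kernel_integrable(1)[OF k f x] schur_kernel_integrable(1)[OF k g x] by simp
  finally show ?thesis .
qed

end

subsection \<open>Contraction semigroups\<close>

text \<open>A mean value inequality from right-hand increments: the last point at which
  \<open>e\<close> lies on or below the line of slope \<open>C + \<eta>\<close> through its initial
  value could be moved further right unless it is \<open>b\<close>.\<close>

lemma dini_bound:
  fixes e :: "real \<Rightarrow> real"
  assumes b: "0 \<le> b" and cont: "continuous_on {0..b} e"
    and dini: "\<And>s \<eta>. 0 \<le> s \<Longrightarrow> s < b \<Longrightarrow> \<eta> > 0 \<Longrightarrow>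
      eventually (\<lambda>h. e (s + h) \<le> e s + (C + \<eta>) * h) (at_right 0)"
  shows "e b \<le> e 0 + C * b"
proof -
  have *: "e b \<le> e 0 + (C + \<eta>) * b" if \<eta>: "\<eta> > 0" for \<eta>
  proof (rule ccontr)
    assume neg: "\<not> e b \<le> e 0 + (C + \<eta>) * b"
    define \<phi> where "\<phi> r = e r - e 0 - (C + \<eta>) * r" for r
    have c\<phi>: "continuous_on {0..b} \<phi>" unfolding \<phi>_def by (intro continuous_intros cont)
    let ?S = "{r \<in> {0..b}. \<phi> r \<le> 0}"
    have "closed ({0..b} \<inter> \<phi> -` {..0})"
      by (intro continuous_closed_preimage c\<phi>) auto
    also have "{0..b} \<inter> \<phi> -` {..0} = ?S" by auto
    finally have "closed ?S" .
    moreover have bdd: "bdd_above ?S" by (auto intro: bdd_aboveI[of _ b])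
    moreover have ne: "?S \<noteq> {}" using b by (auto simp: \<phi>_def intro!: exI[of _ 0])
    ultimately have S: "Sup ?S \<in> ?S" by (intro closed_contains_Sup) auto
    define s where "s = Sup ?S"
    have s: "0 \<le> s" "s \<le> b" "\<phi> s \<le> 0" using S by (auto simp: s_def)
    have "s \<noteq> b" using s(3) neg by (auto simp: \<phi>_def)
    with s have sb: "s < b" by simp
    have "eventually (\<lambda>h. e (s + h) \<le> e s + (C + \<eta>) * h) (at_right 0)"
      by (rule dini[OF s(1) sb \<eta>])
    moreover have "eventually (\<lambda>h. h \<in> {0<..<b - s}) (at_right 0)"
      using sb by (intro eventually_at_right_real) simp
    ultimately have "eventually (\<lambda>h. e (s + h) \<le> e s + (C + \<eta>) * h \<and> h \<in> {0<..<b - s}) (at_right 0)"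
      by (rule eventually_conj)
    then obtain h where h: "e (s + h) \<le> e s + (C + \<eta>) * h" "0 < h" "h < b - s"
      using eventually_happens'[OF trivial_limit_at_right_real] by fastforce
    have "\<phi> (s + h) \<le> 0" using h s(3) by (simp add: \<phi>_def algebra_simps)
    then have "s + h \<in> ?S" using h s by auto
    then have "s + h \<le> s" unfolding s_def using bdd by (rule cSup_upper)
    then show False using h by simp
  qed
  show ?thesis
  proof (cases "b = 0")
    case False
    then have b: "b > 0" using b by simp
    show ?thesis
    proof (rule field_le_epsilon)
      fix d :: real assume "d > 0"
      then show "e b \<le> e 0 + C * b + d" using *[of "d / b"] b by (simp add: distrib_right)
    qed
  qed simp
qed

locale contraction_sg =
  fixes M :: "'a measure" and T :: "real \<Rightarrow> ('a \<Rightarrow> complex) \<Rightarrow> 'a \<Rightarrow> complex"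
  assumes sg: "contraction_semigroup M T"
begin

lemma T_L2: "0 \<le> t \<Longrightarrow> f \<in> L2_functions M \<Longrightarrow> T t f \<in> L2_functions M"
  and T_norm: "0 \<le> t \<Longrightarrow> f \<in> L2_functions M \<Longrightarrow> L2_norm M (T t f) \<le> L2_norm M f"
  and T_lin: "0 \<le> t \<Longrightarrow> f \<in> L2_functions M \<Longrightarrow> g \<in> L2_functions M \<Longrightarrow>
      AE x in M. T t (\<lambda>x. a * f x + b * g x) x = a * T t f x + b * T t g x"
  and T_0: "f \<in> L2_functions M \<Longrightarrow> AE x in M. T 0 f x = f x"
  and T_add: "0 \<le> s \<Longrightarrow> 0 \<le> t \<Longrightarrow> f \<in> L2_functions M \<Longrightarrow> AE x in M. T (s + t) f x = T s (T t f) x"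
  and T_lim: "f \<in> L2_functions M \<Longrightarrow> ((\<lambda>t. L2_norm M (\<lambda>x. T t f x - f x)) \<longlongrightarrow> 0) (at_right 0)"
  using sg unfolding contraction_semigroup_def by blast+

lemma T_diff: "0 \<le> t \<Longrightarrow> f \<in> L2_functions M \<Longrightarrow> g \<in> L2_functions M \<Longrightarrow>
    AE x in M. T t (\<lambda>x. f x - g x) x = T t f x - T t g x"
  using T_lin[of t f g 1 "- 1"] by simp

lemma T_dist:
  assumes "0 \<le> t" "f \<in> L2_functions M" "g \<in> L2_functions M"
  shows "L2_norm M (\<lambda>x. T t f x - T t g x) \<le> L2_norm M (\<lambda>x. f x - g x)"
proof -
  have "L2_norm M (\<lambda>x. T t f x - T t g x) = L2_norm M (T t (\<lambda>x. f x - g x))"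
    by (rule L2_norm_cong_AE) (use T_diff[OF assms] in \<open>auto intro!: L2_intros T_L2 assms\<close>)
  also have "\<dots> \<le> L2_norm M (\<lambda>x. f x - g x)" by (intro T_norm L2_intros assms)
  finally show ?thesis .
qed

lemma T_orbit:
  assumes "0 \<le> s" "0 \<le> h" "f \<in> L2_functions M"
  shows "L2_norm M (\<lambda>x. T (s + h) f x - T s f x) \<le> L2_norm M (\<lambda>x. T h f x - f x)"
proof -
  have "L2_norm M (\<lambda>x. T (s + h) f x - T s f x) = L2_norm M (\<lambda>x. T s (T h f) x - T s f x)"
    by (rule L2_norm_cong_AE) (use T_add[OF assms] assms in \<open>auto intro!: L2_intros T_L2\<close>)
  also have "\<dots> \<le> L2_norm M (\<lambda>x. T h f x - f x)" by (intro T_dist T_L2 assms)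
  finally show ?thesis .
qed

text \<open>Strong continuity at 0 is enough, because a contraction does not enlarge the increment
  that starts at time 0.\<close>

lemma orbit_uniform:
  assumes f: "f \<in> L2_functions M" and "\<epsilon> > 0"
  obtains \<delta> where "\<delta> > 0" "\<And>s t. 0 \<le> s \<Longrightarrow> 0 \<le> t \<Longrightarrow> \<bar>s - t\<bar> < \<delta> \<Longrightarrow> L2_norm M (\<lambda>x. T s f x - T t f x) < \<epsilon>"
proof -
  have "eventually (\<lambda>t. L2_norm M (\<lambda>x. T t f x - f x) < \<epsilon>) (at_right 0)"
    by (rule order_tendstoD(2)[OF T_lim[OF f] \<open>\<epsilon> > 0\<close>])
  then obtain \<delta> where \<delta>: "\<delta> > 0" "\<And>h. 0 < h \<Longrightarrow> h < \<delta> \<Longrightarrow> L2_norm M (\<lambda>x. T h f x - f x) < \<epsilon>"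
    unfolding eventually_at_right_field by auto
  have *: "L2_norm M (\<lambda>x. T s f x - T t f x) < \<epsilon>" if "0 \<le> t" "t \<le> s" "s - t < \<delta>" for s t
  proof (cases "s = t")
    case True
    then show ?thesis using \<open>\<epsilon> > 0\<close> by (simp add: L2_norm_def)
  next
    case False
    then show ?thesis using T_orbit[of t "s - t" f] \<delta>(2)[of "s - t"] that f by simp
  qed
  show thesis
  proof (rule that[OF \<delta>(1)])
    fix s t :: real assume st: "0 \<le> s" "0 \<le> t" "\<bar>s - t\<bar> < \<delta>"
    show "L2_norm M (\<lambda>x. T s f x - T t f x) < \<epsilon>"
    proof (cases "t \<le> s")
      case True
      then show ?thesis using * st by auto
    next
      case False
      then show ?thesis using *[of s t] st by (subst L2_norm_minus_commute) auto
    qed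
  qed
qed

lemma generator_increment:
  assumes f: "f \<in> L2_functions M" and g: "g \<in> L2_functions M" and gen: "has_generator_value M T f g"
    and "\<eta> > 0"
  shows "eventually (\<lambda>h. L2_norm M (\<lambda>x. T h f x - f x - of_real h * g x) \<le> \<eta> * h) (at_right 0)"
proof -
  have "eventually (\<lambda>h. L2_norm M (\<lambda>x. (T h f x - f x) / of_real h - g x) < \<eta>) (at_right 0)"
    using gen \<open>\<eta> > 0\<close> unfolding has_generator_value_def by (rule order_tendstoD(2))
  moreover have "eventually (\<lambda>h. h > (0::real)) (at_right 0)" by (simp add: eventually_at_right_less)
  ultimately show ?thesis
  proof eventually_elim
    case (elim h)
    have "(\<lambda>x. T h f x - f x - of_real h * g x) = (\<lambda>x. of_real h * ((T h f x - f x) / of_real h - g x))"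
      using elim by (auto simp: fun_eq_iff right_diff_distrib[of _ "_ / _"])
    then have "L2_norm M (\<lambda>x. T h f x - f x - of_real h * g x) = h * L2_norm M (\<lambda>x. (T h f x - f x) / of_real h - g x)"
      using elim by (simp only: L2_norm_mult) simp
    also have "\<dots> \<le> h * \<eta>" using elim by (intro mult_left_mono) auto
    finally show ?case by (simp add: mult.commute)
  qed
qed

text \<open>The operators commute with the difference quotients of the semigroup, so the domain of
  the generator is invariant and the generator commutes with the semigroup on it.\<close>

lemma generator_orbit:
  assumes f: "f \<in> L2_functions M" and g: "g \<in> L2_functions M" and gen: "has_generator_value M T f g"
    and s: "0 \<le> s"
  shows "has_generator_value M T (T s f) (T s g)"
  unfolding has_generator_value_def
proof (rule tendsto_sandwich[OF _ _ tendsto_const gen[unfolded has_generator_value_def]])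
  have "eventually (\<lambda>h. h > (0::real)) (at_right 0)" by (simp add: eventually_at_right_less)
  then show "eventually (\<lambda>h. L2_norm M (\<lambda>x. (T h (T s f) x - T s f x) / of_real h - T s g x)
      \<le> L2_norm M (\<lambda>x. (T h f x - f x) / of_real h - g x)) (at_right 0)"
  proof eventually_elim
    case (elim h)
    then have h: "0 \<le> h" by simp
    let ?q = "\<lambda>x. (T h f x - f x) / of_real h"
    have q: "?q \<in> L2_functions M" by (intro L2_intros T_L2 f h)
    have "AE x in M. T s ?q x = (T s (T h f) x - T s f x) / of_real h"
    proof -
      have "AE x in M. T s (\<lambda>x. (1 / of_real h) * T h f x + (- 1 / of_real h) * f x) x
          = (1 / of_real h) * T s (T h f) x + (- 1 / of_real h) * T s f x"
        by (rule T_lin[OF s T_L2[OF h f] f])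
      moreover have "(\<lambda>x. (1 / of_real h) * T h f x + (- 1 / of_real h) * f x) = ?q"
        by (auto simp: fun_eq_iff diff_divide_distrib)
      ultimately show ?thesis by (simp add: diff_divide_distrib)
    qed
    moreover have "AE x in M. T h (T s f) x = T s (T h f) x"
      using T_add[OF h s f] T_add[OF s h f, unfolded add.commute[of s h]] by eventually_elim simp
    ultimately have "AE x in M. (T h (T s f) x - T s f x) / of_real h - T s g x = T s ?q x - T s g x"
      by eventually_elim simp
    then have "L2_norm M (\<lambda>x. (T h (T s f) x - T s f x) / of_real h - T s g x) = L2_norm M (\<lambda>x. T s ?q x - T s g x)"
      by (rule L2_norm_cong_AE[rotated 2]) (intro L2_intros T_L2 f g h s)+
    also have "\<dots> \<le> L2_norm M (\<lambda>x. ?q x - g x)" by (rule T_dist[OF s q g])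
    finally show ?case .
  qed
qed auto

text \<open>Stands in for the formula that T_t u - u is the integral of T_s v over s from 0 to t:
  the deviation from the tangent line has right derivative at most \<open>C\<close>, and
  \<open>dini_bound\<close> integrates this.\<close>

lemma generator_growth:
  assumes u: "u \<in> L2_functions M" and v: "v \<in> L2_functions M" and gen: "has_generator_value M T u v"
    and t: "0 \<le> t" and C: "\<And>s. 0 \<le> s \<Longrightarrow> s \<le> t \<Longrightarrow> L2_norm M (\<lambda>x. T s v x - v x) \<le> C"
  shows "L2_norm M (\<lambda>x. T t u x - u x - of_real t * v x) \<le> C * t"
proof -
  define e where "e s = L2_norm M (\<lambda>x. T s u x - u x - of_real s * v x)" for s
  have e0: "e 0 = 0"
  proof -
    have "e 0 = L2_norm M (\<lambda>x. 0)"
      unfolding e_def by (rule L2_norm_cong_AE)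
        (use T_0[OF u] in \<open>auto intro!: L2_intros T_L2 u v\<close>)
    then show ?thesis by (simp add: L2_norm_def)
  qed
  have L: "(\<lambda>x. T s u x - u x - of_real s * v x) \<in> L2_functions M" if "0 \<le> s" for s
    using that by (intro L2_intros T_L2 u v)
  have diff: "e s \<le> e r + (L2_norm M (\<lambda>x. T s u x - T r u x) + \<bar>s - r\<bar> * L2_norm M v)" if "0 \<le> s" "0 \<le> r" for s r
  proof -
    have "e s \<le> e r + L2_norm M (\<lambda>x. T s u x - T r u x) + L2_norm M (\<lambda>x. of_real (r - s) * v x)"
      unfolding e_def
      by (rule L2_norm_triangle3_AE) (use that in \<open>auto intro!: L2_intros T_L2 u v simp: algebra_simps\<close>)
    also have "L2_norm M (\<lambda>x. of_real (r - s) * v x) = \<bar>s - r\<bar> * L2_norm M v"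
      unfolding L2_norm_mult by (simp add: abs_minus_commute flip: of_real_diff)
    finally show ?thesis by simp
  qed
  have cont: "continuous_on {0..t} e"
    unfolding continuous_on_iff
  proof (intro ballI allI impI)
    fix r \<epsilon> :: real assume r: "r \<in> {0..t}" and \<epsilon>: "\<epsilon> > 0"
    obtain \<delta> where \<delta>: "\<delta> > 0" "\<And>s t. 0 \<le> s \<Longrightarrow> 0 \<le> t \<Longrightarrow> \<bar>s - t\<bar> < \<delta> \<Longrightarrow> L2_norm M (\<lambda>x. T s u x - T t u x) < \<epsilon> / 2"
      using orbit_uniform[OF u, of "\<epsilon> / 2"] \<epsilon> by auto
    define \<delta>' where "\<delta>' = min \<delta> (\<epsilon> / 2 / (L2_norm M v + 1))"
    have pos: "L2_norm M v + 1 > 0" by (simp add: add_nonneg_pos)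
    have "dist (e s) (e r) < \<epsilon>" if s: "s \<in> {0..t}" "dist s r < \<delta>'" for s
    proof -
      have "\<bar>s - r\<bar> * L2_norm M v \<le> \<bar>s - r\<bar> * (L2_norm M v + 1)" by (intro mult_left_mono) auto
      also have "\<dots> < \<epsilon> / 2"
        using s(2) by (simp only: \<delta>'_def dist_real_def min_less_iff_conj pos_less_divide_eq[OF pos])
      finally have 1: "\<bar>s - r\<bar> * L2_norm M v < \<epsilon> / 2" .
      have 2: "L2_norm M (\<lambda>x. T s u x - T r u x) < \<epsilon> / 2" "L2_norm M (\<lambda>x. T r u x - T s u x) < \<epsilon> / 2"
        using \<delta>(2)[of s r] \<delta>(2)[of r s] s r by (auto simp: \<delta>'_def dist_real_def abs_minus_commute)
      show ?thesis
        using diff[of s r] diff[of r s] 1 2 s r by (auto simp: dist_real_def abs_minus_commute abs_less_iff)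
    qed
    moreover have "\<delta>' > 0" using \<delta>(1) \<epsilon> pos by (simp add: \<delta>'_def)
    ultimately show "\<exists>d>0. \<forall>x'\<in>{0..t}. dist x' r < d \<longrightarrow> dist (e x') (e r) < \<epsilon>" by blast
  qed
  have "e t \<le> e 0 + C * t"
  proof (rule dini_bound[OF t cont])
    fix s \<eta> :: real assume s: "0 \<le> s" "s < t" and \<eta>: "\<eta> > 0"
    have "eventually (\<lambda>h. h > (0::real)) (at_right 0)" by (simp add: eventually_at_right_less)
    with generator_increment[OF u v gen \<eta>]
    show "eventually (\<lambda>h. e (s + h) \<le> e s + (C + \<eta>) * h) (at_right 0)"
    proof eventually_elim
      case (elim h)
      then have h: "0 \<le> h" by simp
      let ?w = "\<lambda>x. T h u x - u x - of_real h * v x"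
      have w: "?w \<in> L2_functions M" by (rule L[OF h])
      have "AE x in M. T s ?w x = T s (T h u) x - T s u x - of_real h * T s v x"
      proof -
        have "AE x in M. T s (\<lambda>x. (T h u x - u x) - of_real h * v x) x
            = T s (\<lambda>x. T h u x - u x) x - T s (\<lambda>x. of_real h * v x) x"
          by (intro T_diff L2_intros T_L2 u v h s)
        moreover have "AE x in M. T s (\<lambda>x. T h u x - u x) x = T s (T h u) x - T s u x"
          by (intro T_diff L2_intros T_L2 u v h s)
        moreover have "AE x in M. T s (\<lambda>x. of_real h * v x + 0 * v x) x = of_real h * T s v x + 0 * T s v x"
          by (intro T_lin v s)
        ultimately show ?thesis by eventually_elim simp
      qed
      moreover have "AE x in M. T (s + h) u x = T s (T h u) x" by (rule T_add[OF s(1) h u])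
      \<comment> \<open>The deviation at \<open>s + h\<close> splits into the one at
        \<open>s\<close>, the image under T_s of the deviation at \<open>h\<close>, which is o(h),
        and h times T_s v - v.\<close>
      ultimately have ae: "AE x in M. T (s + h) u x - u x - of_real (s + h) * v x
          = (T s u x - u x - of_real s * v x) + T s ?w x + of_real h * (T s v x - v x)"
        by eventually_elim (simp add: algebra_simps)
      have "e (s + h) \<le> e s + L2_norm M (T s ?w) + L2_norm M (\<lambda>x. of_real h * (T s v x - v x))"
        unfolding e_def
        by (rule L2_norm_triangle3_AE[OF _ _ _ _ ae]) (use s h in \<open>intro L2_intros T_L2 u v; simp\<close>)+
      also have "L2_norm M (T s ?w) \<le> \<eta> * h"
        using T_norm[OF s(1) w] elim by simp
      also have "L2_norm M (\<lambda>x. of_real h * (T s v x - v x)) = h * L2_norm M (\<lambda>x. T s v x - v x)"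
        unfolding L2_norm_mult using h by simp
      also have "\<dots> \<le> h * C" using C[of s] s h by (intro mult_left_mono) auto
      finally show ?case by (simp add: algebra_simps)
    qed
  qed
  then show ?thesis by (simp add: e0) (simp add: e_def)
qed

text \<open>The orbits of the \<open>v k\<close> stay near that of \<open>g\<close>, so
  \<open>generator_growth\<close> controls the difference quotients of the \<open>u k\<close>
  uniformly in \<open>k\<close>. This allows the limit in \<open>k\<close> before the one in
  \<open>t\<close>.\<close>

lemma generator_closed:
  assumes f: "f \<in> L2_functions M" and g: "g \<in> L2_functions M"
    and u: "\<And>k::nat. u k \<in> L2_functions M" and v: "\<And>k. v k \<in> L2_functions M"
    and gen: "\<And>k. has_generator_value M T (u k) (v k)"
    and uf: "(\<lambda>k. L2_norm M (\<lambda>x. u k x - f x)) \<longlonglongrightarrow> 0"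
    and vg: "(\<lambda>k. L2_norm M (\<lambda>x. v k x - g x)) \<longlonglongrightarrow> 0"
  shows "has_generator_value M T f g"
  unfolding has_generator_value_def
proof (rule tendstoI)
  fix \<epsilon> :: real assume \<epsilon>: "\<epsilon> > 0"
  obtain \<delta> where \<delta>: "\<delta> > 0" "\<And>s t. 0 \<le> s \<Longrightarrow> 0 \<le> t \<Longrightarrow> \<bar>s - t\<bar> < \<delta> \<Longrightarrow> L2_norm M (\<lambda>x. T s g x - T t g x) < \<epsilon> / 2"
    using orbit_uniform[OF g, of "\<epsilon> / 2"] \<epsilon> by auto
  have small: "L2_norm M (\<lambda>x. T s g x - g x) \<le> \<epsilon> / 2" if "0 \<le> s" "s < \<delta>" for s
  proof -
    have "L2_norm M (\<lambda>x. T s g x - g x) = L2_norm M (\<lambda>x. T s g x - T 0 g x)"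
      by (rule L2_norm_cong_AE) (use T_0[OF g] that in \<open>auto intro!: L2_intros T_L2 g\<close>)
    then show ?thesis using \<delta>(2)[of s 0] that by simp
  qed
  have main: "L2_norm M (\<lambda>x. T t f x - f x - of_real t * g x) \<le> t * (\<epsilon> / 2)" if t: "0 \<le> t" "t < \<delta>" for t
  proof (rule LIMSEQ_le_const)
    let ?a = "\<lambda>k. L2_norm M (\<lambda>x. u k x - f x)" and ?b = "\<lambda>k. L2_norm M (\<lambda>x. v k x - g x)"
    \<comment> \<open>The constant \<open>\<epsilon> / 2\<close> bounds the movement of the orbit of
      \<open>g\<close>; \<open>?a k\<close> and \<open>?b k\<close> are the costs of exchanging
      \<open>u k\<close> for \<open>f\<close> and \<open>v k\<close> for \<open>g\<close>.\<close>
    have "(\<lambda>k. (\<epsilon> / 2 + 2 * ?b k) * t + (2 * ?a k + t * ?b k)) \<longlonglongrightarrow> (\<epsilon> / 2 + 2 * 0) * t + (2 * 0 + t * 0)"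
      by (intro tendsto_intros uf vg)
    then show "(\<lambda>k. (\<epsilon> / 2 + 2 * ?b k) * t + (2 * ?a k + t * ?b k)) \<longlonglongrightarrow> t * (\<epsilon> / 2)"
      by (simp add: mult.commute)
    have "L2_norm M (\<lambda>x. T t f x - f x - of_real t * g x) \<le> (\<epsilon> / 2 + 2 * ?b k) * t + (2 * ?a k + t * ?b k)" for k
    proof -
      have C: "L2_norm M (\<lambda>x. T s (v k) x - v k x) \<le> \<epsilon> / 2 + 2 * ?b k" if s: "0 \<le> s" "s \<le> t" for s
      proof -
        have "L2_norm M (\<lambda>x. T s (v k) x - v k x)
            \<le> L2_norm M (\<lambda>x. T s (v k) x - T s g x) + L2_norm M (\<lambda>x. T s g x - g x) + L2_norm M (\<lambda>x. g x - v k x)"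
          by (rule L2_norm_triangle3_AE) (use s in \<open>auto intro!: L2_intros T_L2 g v\<close>)
        moreover have "L2_norm M (\<lambda>x. T s (v k) x - T s g x) \<le> ?b k" by (rule T_dist[OF s(1) v g])
        moreover have "L2_norm M (\<lambda>x. g x - v k x) = ?b k" by (rule L2_norm_minus_commute)
        moreover have "L2_norm M (\<lambda>x. T s g x - g x) \<le> \<epsilon> / 2" using s t by (intro small) auto
        ultimately show ?thesis by simp
      qed
      have 1: "L2_norm M (\<lambda>x. T t (u k) x - u k x - of_real t * v k x) \<le> (\<epsilon> / 2 + 2 * ?b k) * t"
        by (rule generator_growth[OF u v gen t(1) C])
      have 2: "L2_norm M (\<lambda>x. (T t f x - T t (u k) x) + (u k x - f x) + of_real t * (v k x - g x))
          \<le> 2 * ?a k + t * ?b k"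
      proof -
        have "L2_norm M (\<lambda>x. (T t f x - T t (u k) x) + (u k x - f x) + of_real t * (v k x - g x))
          \<le> L2_norm M (\<lambda>x. T t f x - T t (u k) x) + ?a k + L2_norm M (\<lambda>x. of_real t * (v k x - g x))"
          by (rule L2_norm_triangle3_AE) (use t in \<open>auto intro!: L2_intros T_L2 f g u v\<close>)
        moreover have "L2_norm M (\<lambda>x. T t f x - T t (u k) x) \<le> ?a k"
          using T_dist[OF t(1) f u, of k] by (simp add: L2_norm_minus_commute)
        moreover have "L2_norm M (\<lambda>x. of_real t * (v k x - g x)) = t * ?b k"
          unfolding L2_norm_mult using t by simp
        ultimately show ?thesis by simp
      qed
      have "L2_norm M (\<lambda>x. T t f x - f x - of_real t * g x)
          \<le> L2_norm M (\<lambda>x. T t (u k) x - u k x - of_real t * v k x)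
            + L2_norm M (\<lambda>x. (T t f x - T t (u k) x) + (u k x - f x) + of_real t * (v k x - g x))"
        by (rule L2_norm_triangle_AE) (use t in \<open>auto intro!: L2_intros T_L2 f g u v simp: algebra_simps\<close>)
      with 1 2 show ?thesis by simp
    qed
    then show "\<exists>N. \<forall>k\<ge>N. L2_norm M (\<lambda>x. T t f x - f x - of_real t * g x) \<le> (\<epsilon> / 2 + 2 * ?b k) * t + (2 * ?a k + t * ?b k)"
      by blast
  qed
  have "eventually (\<lambda>t. t \<in> {0<..<\<delta>}) (at_right 0)" using \<delta>(1) by (rule eventually_at_right_real)
  then show "eventually (\<lambda>t. dist (L2_norm M (\<lambda>x. (T t f x - f x) / of_real t - g x)) 0 < \<epsilon>) (at_right 0)"
  proof eventually_elim
    case (elim t)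
    have "(\<lambda>x. (T t f x - f x) / of_real t - g x) = (\<lambda>x. (1 / of_real t) * (T t f x - f x - of_real t * g x))"
      using elim by (auto simp: fun_eq_iff field_simps)
    then have "L2_norm M (\<lambda>x. (T t f x - f x) / of_real t - g x)
        = (1 / t) * L2_norm M (\<lambda>x. T t f x - f x - of_real t * g x)"
      using elim by (simp only: L2_norm_mult) (simp add: norm_divide)
    also have "\<dots> \<le> (1 / t) * (t * (\<epsilon> / 2))" using elim main[of t] by (intro mult_left_mono) auto
    also have "\<dots> < \<epsilon>" using elim \<epsilon> by simp
    finally show ?case by simp
  qed
qed

end

text \<open>At the point S_s f both semigroups have the derivative S_s g. Comparing one small step
  of each from there shows that the distance of the two orbits of \<open>f\<close> has right
  derivative at most 0.\<close>

lemma contraction_semigroups_agree: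
  assumes T: "contraction_semigroup M T" and S: "contraction_semigroup M S"
    and f: "f \<in> L2_functions M" and g: "g \<in> L2_functions M" and gen: "has_generator_value M S f g"
    and dom: "\<And>u v. u \<in> L2_functions M \<Longrightarrow> v \<in> L2_functions M \<Longrightarrow> has_generator_value M S u v \<Longrightarrow> has_generator_value M T u v"
    and t: "0 \<le> t"
  shows "AE x in M. T t f x = S t f x"
proof -
  interpret T: contraction_sg M T by unfold_locales (rule T)
  interpret S: contraction_sg M S by unfold_locales (rule S)
  define e where "e s = L2_norm M (\<lambda>x. T s f x - S s f x)" for s
  have diff: "e s \<le> e r + (L2_norm M (\<lambda>x. T s f x - T r f x) + L2_norm M (\<lambda>x. S r f x - S s f x))"
    if "0 \<le> s" "0 \<le> r" for s r
  proof -
    have "e s \<le> e r + L2_norm M (\<lambda>x. T s f x - T r f x) + L2_norm M (\<lambda>x. S r f x - S s f x)"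
      unfolding e_def
      by (rule L2_norm_triangle3_AE) (use that in \<open>auto intro!: L2_intros T.T_L2 S.T_L2 f\<close>)
    then show ?thesis by simp
  qed
  have cont: "continuous_on {0..t} e"
    unfolding continuous_on_iff
  proof (intro ballI allI impI)
    fix r \<epsilon> :: real assume r: "r \<in> {0..t}" and \<epsilon>: "\<epsilon> > 0"
    obtain \<delta>1 where \<delta>1: "\<delta>1 > 0" "\<And>s t. 0 \<le> s \<Longrightarrow> 0 \<le> t \<Longrightarrow> \<bar>s - t\<bar> < \<delta>1 \<Longrightarrow> L2_norm M (\<lambda>x. T s f x - T t f x) < \<epsilon> / 2"
      using T.orbit_uniform[OF f, of "\<epsilon> / 2"] \<epsilon> by auto
    obtain \<delta>2 where \<delta>2: "\<delta>2 > 0" "\<And>s t. 0 \<le> s \<Longrightarrow> 0 \<le> t \<Longrightarrow> \<bar>s - t\<bar> < \<delta>2 \<Longrightarrow> L2_norm M (\<lambda>x. S s f x - S t f x) < \<epsilon> / 2"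
      using S.orbit_uniform[OF f, of "\<epsilon> / 2"] \<epsilon> by auto
    have "dist (e s) (e r) < \<epsilon>" if s: "s \<in> {0..t}" "dist s r < min \<delta>1 \<delta>2" for s
      using diff[of s r] diff[of r s] \<delta>1(2)[of s r] \<delta>1(2)[of r s] \<delta>2(2)[of s r] \<delta>2(2)[of r s] s r
      by (auto simp: dist_real_def abs_minus_commute abs_less_iff)
    moreover have "min \<delta>1 \<delta>2 > 0" using \<delta>1 \<delta>2 by simp
    ultimately show "\<exists>d>0. \<forall>x'\<in>{0..t}. dist x' r < d \<longrightarrow> dist (e x') (e r) < \<epsilon>" by blast
  qed
  have e0: "e 0 = 0"
  proof -
    have "e 0 = L2_norm M (\<lambda>x. 0)"
      unfolding e_def by (rule L2_norm_cong_AE)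
        (use T.T_0[OF f] S.T_0[OF f] in \<open>auto intro!: L2_intros T.T_L2 S.T_L2 f\<close>)
    then show ?thesis by (simp add: L2_norm_def)
  qed
  have "e t \<le> e 0 + 0 * t"
  proof (rule dini_bound[OF t cont])
    fix s \<eta> :: real assume s: "0 \<le> s" "s < t" and \<eta>: "\<eta> > 0"
    let ?v = "S s f" and ?w = "S s g"
    have v: "?v \<in> L2_functions M" and w: "?w \<in> L2_functions M" using s f g S.T_L2 by auto
    have gS: "has_generator_value M S ?v ?w" by (rule S.generator_orbit[OF f g gen s(1)])
    have gT: "has_generator_value M T ?v ?w" by (rule dom[OF v w gS])
    have \<eta>2: "\<eta> / 2 > 0" using \<eta> by simp
    have "eventually (\<lambda>h. h > (0::real)) (at_right 0)" by (simp add: eventually_at_right_less)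
    with S.generator_increment[OF v w gS \<eta>2] T.generator_increment[OF v w gT \<eta>2]
    show "eventually (\<lambda>h. e (s + h) \<le> e s + (0 + \<eta>) * h) (at_right 0)"
    proof eventually_elim
      case (elim h)
      then have h: "0 \<le> h" by simp
      have L: "T s f \<in> L2_functions M" using T.T_L2 s f by simp
      have sh: "0 \<le> s + h" using s h by simp
      have "AE x in M. T (s + h) f x = T h (T s f) x"
        using T.T_add[OF h s(1) f] by (simp add: add.commute)
      moreover have "AE x in M. S (s + h) f x = S h (S s f) x"
        using S.T_add[OF h s(1) f] by (simp add: add.commute)
      ultimately have ae: "AE x in M. T (s + h) f x - S (s + h) f x
          = (T h (T s f) x - T h ?v x) + (T h ?v x - ?v x - of_real h * ?w x)
            + - (S h ?v x - ?v x - of_real h * ?w x)"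
        by eventually_elim simp
      have "e (s + h) \<le> L2_norm M (\<lambda>x. T h (T s f) x - T h ?v x)
          + L2_norm M (\<lambda>x. T h ?v x - ?v x - of_real h * ?w x)
          + L2_norm M (\<lambda>x. - (S h ?v x - ?v x - of_real h * ?w x))"
        unfolding e_def
        by (rule L2_norm_triangle3_AE[OF _ _ _ _ ae]) (intro L2_intros T.T_L2 S.T_L2 f g v w L h s sh)+
      also have "\<dots> \<le> e s + \<eta> / 2 * h + \<eta> / 2 * h"
        using T.T_dist[OF h L v] elim unfolding e_def L2_norm_uminus by linarith
      finally show ?case by simp
    qed
  qed
  then have "e t = 0" using e0 by (simp add: e_def order_antisym)
  then show ?thesis
    unfolding e_def by (subst (asm) L2_norm_eq_0_iff) (use t f in \<open>auto intro: L2_intros T.T_L2 S.T_L2\<close>)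
qed

text \<open>Contractivity extends the agreement from the domain of the generator to its L2
  limits.\<close>

lemma contraction_semigroups_eq:
  assumes T: "contraction_semigroup M T" and S: "contraction_semigroup M S"
    and dom: "\<And>u v. u \<in> L2_functions M \<Longrightarrow> v \<in> L2_functions M \<Longrightarrow> has_generator_value M S u v \<Longrightarrow> has_generator_value M T u v"
    and f: "f \<in> L2_functions M"
    and dense: "\<And>\<epsilon>. \<epsilon> > 0 \<Longrightarrow> \<exists>u\<in>L2_functions M. \<exists>v\<in>L2_functions M. has_generator_value M S u v
        \<and> L2_norm M (\<lambda>x. u x - f x) < \<epsilon>"
    and t: "0 \<le> t"
  shows "AE x in M. T t f x = S t f x"
proof -
  interpret T: contraction_sg M T by unfold_locales (rule T)
  interpret S: contraction_sg M S by unfold_locales (rule S)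
  have "L2_norm M (\<lambda>x. T t f x - S t f x) \<le> 0"
  proof (rule field_le_epsilon)
    fix \<epsilon> :: real assume "\<epsilon> > 0"
    then obtain u v where u: "u \<in> L2_functions M" and v: "v \<in> L2_functions M"
      and gen: "has_generator_value M S u v" and uf: "L2_norm M (\<lambda>x. u x - f x) < \<epsilon> / 2"
      using dense[of "\<epsilon> / 2"] by auto
    have ae: "AE x in M. T t f x - S t f x = (T t f x - T t u x) + (S t u x - S t f x)"
    proof -
      have "AE x in M. T t u x = S t u x" by (rule contraction_semigroups_agree[OF T S u v gen dom t])
      then show ?thesis by eventually_elim simp
    qed
    have "L2_norm M (\<lambda>x. T t f x - S t f x)
        \<le> L2_norm M (\<lambda>x. T t f x - T t u x) + L2_norm M (\<lambda>x. S t u x - S t f x)"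
      by (rule L2_norm_triangle_AE[OF _ _ _ ae]) (intro L2_intros T.T_L2 S.T_L2 f u t)+
    also have "\<dots> \<le> L2_norm M (\<lambda>x. f x - u x) + L2_norm M (\<lambda>x. u x - f x)"
      by (intro add_mono T.T_dist S.T_dist f u t)
    also have "\<dots> \<le> \<epsilon>" using uf by (simp add: L2_norm_minus_commute[of M f u])
    finally show "L2_norm M (\<lambda>x. T t f x - S t f x) \<le> 0 + \<epsilon>" by simp
  qed
  then have "L2_norm M (\<lambda>x. T t f x - S t f x) = 0" by (simp add: order_antisym)
  then show ?thesis
    by (subst (asm) L2_norm_eq_0_iff) (use t f in \<open>auto intro: L2_intros T.T_L2 S.T_L2\<close>)
qed

subsection \<open>Telescoping sums over the integers\<close>

text \<open>Sums over the integers are written as integrals over counting measure, so that the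
  theorems of Tonelli and Fubini and dominated convergence apply to them directly.\<close>

abbreviation int_counting :: "int measure" where
  "int_counting \<equiv> count_space UNIV"

lemma sigma_finite_int_counting: "sigma_finite_measure int_counting"
  by (rule sigma_finite_measure_count_space)

text \<open>Finite telescoping, then monotone convergence; monotonicity of \<open>F\<close> keeps
  \<open>ennreal\<close> from truncating the increments.\<close>

lemma telescope_le:
  fixes F :: "int \<Rightarrow> real"
  assumes F: "mono F" and l: "(\<lambda>n. F (- int n)) \<longlonglongrightarrow> l"
  shows "(\<integral>\<^sup>+j. ennreal (F j - F (j - 1)) * indicator {..J} j \<partial>int_counting) = ennreal (F J - l)"
proof -
  let ?f = "\<lambda>n j. ennreal (F j - F (j - 1)) * indicator {J - int n<..J} j"
  have nn: "0 \<le> F j - F (j - 1)" for j using F by (simp add: monoD)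
  have fin: "(\<integral>\<^sup>+j. ?f n j \<partial>int_counting) = ennreal (F J - F (J - int n))" for n
  proof -
    have "(\<integral>\<^sup>+j. ?f n j \<partial>int_counting) = (\<Sum>j\<in>{J - int n<..J}. ?f n j)"
      by (rule nn_integral_count_space') auto
    also have "\<dots> = (\<Sum>j\<in>{J - int n<..J}. ennreal (F j - F (j - 1)))" by (rule sum.cong) auto
    also have "\<dots> = ennreal (\<Sum>j\<in>{J - int n<..J}. F j - F (j - 1))" using nn by (rule sum_ennreal)
    also have "(\<Sum>j\<in>{J - int n<..J}. F j - F (j - 1)) = F J - F (J - int n)"
    proof (induct n)
      case (Suc n)
      have "{J - int (Suc n)<..J} = insert (J - int n) {J - int n<..J}" by auto
      then show ?case using Suc by (simp add: algebra_simps)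
    qed simp
    finally show ?thesis .
  qed
  have "(\<lambda>n. \<integral>\<^sup>+j. ?f n j \<partial>int_counting)
      \<longlonglongrightarrow> (\<integral>\<^sup>+j. ennreal (F j - F (j - 1)) * indicator {..J} j \<partial>int_counting)"
  proof (rule nn_integral_LIMSEQ)
    show "incseq ?f" by (auto simp: incseq_def le_fun_def intro!: mult_left_mono split: split_indicator)
    fix j
    have "eventually (\<lambda>n. ?f n j = ennreal (F j - F (j - 1)) * indicator {..J} j) sequentially"
      using eventually_ge_at_top[of "nat (J - j + 1)"]
      by eventually_elim (auto split: split_indicator)
    then show "(\<lambda>n. ?f n j) \<longlonglongrightarrow> ennreal (F j - F (j - 1)) * indicator {..J} j"
      by (rule tendsto_eventually)
  qed simp
  moreover have "(\<lambda>n. F (J - int n)) \<longlonglongrightarrow> l"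
  proof -
    have "(\<lambda>n. F (- int (n + nat (- J)))) \<longlonglongrightarrow> l" by (rule LIMSEQ_ignore_initial_segment[OF l])
    then have "(\<lambda>n. F (J - int (n + nat J))) \<longlonglongrightarrow> l"
      by (cases "J \<ge> 0") (simp_all add: l algebra_simps)
    then show ?thesis by (rule LIMSEQ_offset)
  qed
  then have "(\<lambda>n. ennreal (F J - F (J - int n))) \<longlonglongrightarrow> ennreal (F J - l)"
    by (intro tendsto_ennrealI tendsto_intros)
  ultimately show ?thesis unfolding fin by (rule LIMSEQ_unique)
qed

lemma telescope_ge:
  fixes F :: "int \<Rightarrow> real"
  assumes F: "mono F" and u: "(\<lambda>n. F (int n)) \<longlonglongrightarrow> u"
  shows "(\<integral>\<^sup>+j. ennreal (F j - F (j - 1)) * indicator {J..} j \<partial>int_counting) = ennreal (u - F (J - 1))"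
proof -
  \<comment> \<open>The reflection of the index; the shift by one makes the increment of
    \<open>?G\<close> at \<open>j\<close> that of \<open>F\<close> at \<open>- j\<close>.\<close>
  let ?G = "\<lambda>j. - F (- j - 1)"
  have "(\<integral>\<^sup>+j. ennreal (F j - F (j - 1)) * indicator {J..} j \<partial>int_counting)
      = (\<integral>\<^sup>+j. ennreal (F (- j) - F (- j - 1)) * indicator {J..} (- j) \<partial>int_counting)"
    by (rule nn_integral_bij_count_space[symmetric]) (auto simp: bij_betw_def inj_on_def image_iff intro: exI[of _ "- _"])
  also have "\<dots> = (\<integral>\<^sup>+j. ennreal (?G j - ?G (j - 1)) * indicator {..- J} j \<partial>int_counting)"
    by (intro nn_integral_cong) (auto split: split_indicator)
  also have "\<dots> = ennreal (?G (- J) - (- u))"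
  proof (rule telescope_le)
    show "mono ?G" using F by (auto simp: mono_def)
    have "(\<lambda>n. F (int (Suc n) - 2)) \<longlonglongrightarrow> u"
    proof -
      have "(\<lambda>n. F (int (n + 2) - 2)) \<longlonglongrightarrow> u" using u by simp
      then have "(\<lambda>n. F (int n - 2)) \<longlonglongrightarrow> u" by (rule LIMSEQ_offset[of "\<lambda>n. F (int n - 2)" 2])
      then show ?thesis by (rule LIMSEQ_Suc)
    qed
    then have "(\<lambda>n. - F (int n - 1)) \<longlonglongrightarrow> - u" by (intro tendsto_intros) simp
    then show "(\<lambda>n. ?G (- int n)) \<longlonglongrightarrow> - u" by simp
  qed
  finally show ?thesis by simp
qed

lemma telescope:
  fixes F :: "int \<Rightarrow> real"
  assumes F: "mono F" and l: "(\<lambda>n. F (- int n)) \<longlonglongrightarrow> l" and u: "(\<lambda>n. F (int n)) \<longlonglongrightarrow> u"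
  shows "(\<integral>\<^sup>+j. ennreal (F j - F (j - 1)) \<partial>int_counting) = ennreal (u - l)"
proof -
  have "(\<integral>\<^sup>+j. ennreal (F j - F (j - 1)) \<partial>int_counting)
      = (\<integral>\<^sup>+j. ennreal (F j - F (j - 1)) * indicator {..0} j + ennreal (F j - F (j - 1)) * indicator {1..} j \<partial>int_counting)"
    by (intro nn_integral_cong) (auto split: split_indicator)
  also have "\<dots> = ennreal (F 0 - l) + ennreal (u - F 0)"
    using telescope_le[OF F l, of 0] telescope_ge[OF F u, of 1] by (subst nn_integral_add) auto
  also have "\<dots> = ennreal ((F 0 - l) + (u - F 0))"
  proof (rule ennreal_plus[symmetric])
    show "0 \<le> F 0 - l"
      using LIMSEQ_le_const2[OF l, of "F 0"] F by (auto simp: mono_def)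
    show "0 \<le> u - F 0"
      using LIMSEQ_le_const[OF u, of "F 0"] F by (auto simp: mono_def)
  qed
  finally show ?thesis by simp
qed

definition increment :: "(int \<Rightarrow> real) \<Rightarrow> int \<Rightarrow> real" where
  "increment F j = F j - F (j - 1)"

text \<open>For a multiplier with value \<open>F j\<close> at frequencies of norm p^-j, this
  discards the norms above p^-J. On kernels it corresponds to averaging over balls of radius
  p^J.\<close>

definition cutoff :: "int \<Rightarrow> (int \<Rightarrow> real) \<Rightarrow> int \<Rightarrow> real" where
  "cutoff J F j = (if J \<le> j then F j else 0)"

lemma cutoff_at_bot: "(\<lambda>n. cutoff J F (- int n)) \<longlonglongrightarrow> 0"
proof (rule tendsto_eventually)
  show "eventually (\<lambda>n. cutoff J F (- int n) = 0) sequentially"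
    using eventually_gt_at_top[of "nat (- J)"] by eventually_elim (auto simp: cutoff_def)
qed

lemma cutoff_at_top:
  assumes "(\<lambda>n. F (int n)) \<longlonglongrightarrow> u"
  shows "(\<lambda>n. cutoff J F (int n)) \<longlonglongrightarrow> u"
proof (rule Lim_transform_eventually[OF assms])
  show "eventually (\<lambda>n. F (int n) = cutoff J F (int n)) sequentially"
    using eventually_ge_at_top[of "nat J"] by eventually_elim (auto simp: cutoff_def)
qed

lemma mono_cutoff: "mono F \<Longrightarrow> (\<And>j. 0 \<le> F j) \<Longrightarrow> mono (cutoff J F)"
  by (auto simp: mono_def cutoff_def)

text \<open>The function jumps from 0 to \<open>\<psi> J\<close> and then decreases to 0; each of
  the two parts contributes \<open>\<psi> J\<close> to the total variation.\<close>

lemma variation_cutoff_antimono: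
  assumes \<psi>: "antimono \<psi>" and pos: "\<And>j. 0 \<le> \<psi> j" and lim: "(\<lambda>n. \<psi> (int n)) \<longlonglongrightarrow> 0"
  shows "(\<integral>\<^sup>+j. ennreal \<bar>increment (cutoff J \<psi>) j\<bar> \<partial>int_counting) = ennreal (2 * \<psi> J)"
proof -
  \<comment> \<open>The decreasing part reflected upwards: the absolute increments are the same, but
    the function is monotone, so \<open>telescope\<close> applies.\<close>
  let ?G = "cutoff J (\<lambda>j. 2 * \<psi> J - \<psi> j)"
  have "\<psi> j \<le> 2 * \<psi> J" if "J \<le> j" for j
    using antimonoD[OF \<psi> that] pos[of J] by linarith
  then have "mono ?G" using \<psi> by (auto simp: mono_def cutoff_def antimono_def)
  then have "(\<integral>\<^sup>+j. ennreal (?G j - ?G (j - 1)) \<partial>int_counting) = ennreal (2 * \<psi> J - 0)"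
    by (rule telescope) (use tendsto_diff[OF tendsto_const lim, of "2 * \<psi> J"] in \<open>auto intro!: cutoff_at_bot cutoff_at_top\<close>)
  moreover have "\<bar>increment (cutoff J \<psi>) j\<bar> = ?G j - ?G (j - 1)" for j
  proof (cases "J \<le> j - 1")
    case True
    then show ?thesis using antimonoD[OF \<psi>, of "j - 1" j] by (simp add: increment_def cutoff_def)
  next
    case False
    then have "j = J" if "J \<le> j" using that by simp
    then show ?thesis using pos False by (auto simp: increment_def cutoff_def)
  qed
  ultimately show ?thesis by simp
qed

text \<open>Composing two averaging operators over balls gives the one over the larger ball. Hence the
  weights compose like the distribution of the maximum of two independent variables: the
  distribution functions multiply.\<close>

lemma max_convolution:
  fixes F G :: "int \<Rightarrow> real" and \<phi> :: "int \<Rightarrow> ennreal"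
  assumes F: "mono F" "(\<lambda>n. F (- int n)) \<longlonglongrightarrow> 0" and G: "mono G" "(\<lambda>n. G (- int n)) \<longlonglongrightarrow> 0"
  shows "(\<integral>\<^sup>+i. (\<integral>\<^sup>+l. ennreal (increment F i) * ennreal (increment G l) * \<phi> (max i l) \<partial>int_counting) \<partial>int_counting)
    = (\<integral>\<^sup>+j. ennreal (increment (\<lambda>j. F j * G j) j) * \<phi> j \<partial>int_counting)"
proof -
  interpret sigma_finite_measure int_counting by (rule sigma_finite_int_counting)
  interpret P: pair_sigma_finite int_counting int_counting by unfold_locales
  have prod_count: "int_counting \<Otimes>\<^sub>M int_counting = count_space UNIV"
    using pair_measure_countable[of "UNIV :: int set" "UNIV :: int set"] by simp
  have meas: "f \<in> borel_measurable (int_counting \<Otimes>\<^sub>M int_counting)" for f :: "int \<times> int \<Rightarrow> ennreal"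
    by (simp add: prod_count)
  let ?f = "\<lambda>i. ennreal (increment F i)" and ?g = "\<lambda>i. ennreal (increment G i)"
  have F0: "0 \<le> F j" and G0: "0 \<le> G j" for j
    by (rule LIMSEQ_le_const2[OF F(2)] LIMSEQ_le_const2[OF G(2)],
        use F(1) G(1) in \<open>auto simp: mono_def intro!: exI[of _ "nat (- j)"]\<close>)+
  have incF: "0 \<le> increment F j" and incG: "0 \<le> increment G j" for j
    using F(1) G(1) by (auto simp: increment_def mono_def)
  have tF: "(\<integral>\<^sup>+i. ?f i * indicator {..j} i \<partial>int_counting) = ennreal (F j)" for j
    using telescope_le[OF F] by (simp add: increment_def)
  have tG: "(\<integral>\<^sup>+i. ?g i * indicator {..j} i \<partial>int_counting) = ennreal (G j)" for j
    using telescope_le[OF G] by (simp add: increment_def)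
  \<comment> \<open>Lets \<open>\<phi> (max i l)\<close> be written as a sum over \<open>j\<close>
    with an indicator, after which \<open>j\<close> can become the outermost variable.\<close>
  have pick: "(\<integral>\<^sup>+j. h j * indicator {m} j \<partial>int_counting) = h m" for h :: "int \<Rightarrow> ennreal" and m
    by (subst nn_integral_count_space'[of "{m}"]) (auto split: split_indicator_asm)
  have "(\<integral>\<^sup>+i. (\<integral>\<^sup>+l. ?f i * ?g l * \<phi> (max i l) \<partial>int_counting) \<partial>int_counting)
      = (\<integral>\<^sup>+i. (\<integral>\<^sup>+l. (\<integral>\<^sup>+j. ?f i * ?g l * \<phi> j * indicator {max i l} j \<partial>int_counting) \<partial>int_counting) \<partial>int_counting)"
    by (simp add: pick)
  also have "\<dots> = (\<integral>\<^sup>+i. (\<integral>\<^sup>+j. (\<integral>\<^sup>+l. ?f i * ?g l * \<phi> j * indicator {max i l} j \<partial>int_counting) \<partial>int_counting) \<partial>int_counting)"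
    by (intro nn_integral_cong P.Fubini' meas)
  also have "\<dots> = (\<integral>\<^sup>+j. (\<integral>\<^sup>+i. (\<integral>\<^sup>+l. ?f i * ?g l * \<phi> j * indicator {max i l} j \<partial>int_counting) \<partial>int_counting) \<partial>int_counting)"
    by (intro P.Fubini' meas)
  also have "\<dots> = (\<integral>\<^sup>+j. ennreal (increment (\<lambda>j. F j * G j) j) * \<phi> j \<partial>int_counting)"
  proof (intro nn_integral_cong)
    \<comment> \<open>The pairs with maximum \<open>j\<close> are those with i = j and l \<le> j and
      those with i < j and l = j. The two contributions add up by the product rule for
      increments.\<close>
    fix j :: int
    have "(\<integral>\<^sup>+i. (\<integral>\<^sup>+l. ?f i * ?g l * \<phi> j * indicator {max i l} j \<partial>int_counting) \<partial>int_counting)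
      = (\<integral>\<^sup>+i. (\<integral>\<^sup>+l. (?f i * indicator {j} i * \<phi> j) * (?g l * indicator {..j} l)
          + (?f i * indicator {..j - 1} i * \<phi> j) * (?g l * indicator {j} l) \<partial>int_counting) \<partial>int_counting)"
      by (intro nn_integral_cong) (auto split: split_indicator simp: mult_ac max_def)
    also have "\<dots> = (\<integral>\<^sup>+i. (?f i * indicator {j} i * \<phi> j) * ennreal (G j) + (?f i * indicator {..j - 1} i * \<phi> j) * ?g j \<partial>int_counting)"
      by (subst nn_integral_add, simp, simp, subst (1 2) nn_integral_cmult) (simp_all add: tG pick)
    also have "\<dots> = (\<integral>\<^sup>+i. (\<phi> j * ennreal (G j)) * (?f i * indicator {j} i) + (\<phi> j * ?g j) * (?f i * indicator {..j - 1} i) \<partial>int_counting)"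
      by (simp add: mult_ac)
    also have "\<dots> = (\<phi> j * ennreal (G j)) * ?f j + (\<phi> j * ?g j) * ennreal (F (j - 1))"
      by (subst nn_integral_add, simp, simp, subst (1 2) nn_integral_cmult) (simp_all add: tF pick)
    also have "\<dots> = \<phi> j * (ennreal (G j) * ?f j + ?g j * ennreal (F (j - 1)))"
      by (simp add: distrib_left mult.assoc)
    also have "ennreal (G j) * ?f j + ?g j * ennreal (F (j - 1))
        = ennreal (G j * increment F j + increment G j * F (j - 1))"
      using F0 G0 incF incG by (simp add: ennreal_mult')
    also have "G j * increment F j + increment G j * F (j - 1) = increment (\<lambda>j. F j * G j) j"
      by (simp add: increment_def algebra_simps)
    finally show "(\<integral>\<^sup>+i. (\<integral>\<^sup>+l. ?f i * ?g l * \<phi> j * indicator {max i l} j \<partial>int_counting) \<partial>int_counting)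
        = ennreal (increment (\<lambda>j. F j * G j) j) * \<phi> j" by (simp add: mult.commute)
  qed
  finally show ?thesis .
qed

subsection \<open>Radial kernels\<close>

text \<open>The density of the uniform distribution on the ball of radius p^j; convolution with it
  is the average over such balls.\<close>

definition ball_kernel :: "int \<Rightarrow> 'p::prime_card padic \<Rightarrow> real" where
  "ball_kernel j x = real CARD('p) powi (- j) * indicator (pball 0 j) x"

definition radial_kernel :: "(int \<Rightarrow> real) \<Rightarrow> 'p::prime_card padic \<Rightarrow> real" where
  "radial_kernel c x = (LINT j|int_counting. c j * ball_kernel j x)"

text \<open>Summability of \<open>c\<close> bounds the L1 norm of the radial kernel; the second
  condition bounds its supremum, since small balls carry high density.\<close>

definition admissible :: "real \<Rightarrow> (int \<Rightarrow> real) \<Rightarrow> bool" where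
  "admissible q c \<longleftrightarrow> integrable int_counting c \<and> integrable int_counting (\<lambda>j. c j * q powi (- j))"

lemma ball_kernel_nonneg [simp]: "0 \<le> ball_kernel j x"
  by (simp add: ball_kernel_def)

lemma ball_kernel_le: "ball_kernel j (x :: 'p::prime_card padic) \<le> real CARD('p) powi (- j)"
  by (auto simp: ball_kernel_def split: split_indicator)

lemma ball_kernel_minus [simp]: "ball_kernel j (- x) = ball_kernel j x"
  using pball_minus[of x 0 j] by (simp add: ball_kernel_def indicator_def)

lemma ball_kernel_measurable [measurable]: "ball_kernel j \<in> borel_measurable borel"
  unfolding ball_kernel_def by measurable

lemma radial_kernel_integrable:
  assumes "admissible (real CARD('p)) c"
  shows "integrable int_counting (\<lambda>j. c j * ball_kernel j (x :: 'p::prime_card padic))"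
  by (rule Bochner_Integration.integrable_bound[of _ "\<lambda>j. c j * real CARD('p) powi (- j)"])
    (use assms ball_kernel_le[of _ x] in \<open>auto simp: admissible_def abs_mult intro!: mult_left_mono\<close>)

lemma radial_kernel_minus [simp]: "radial_kernel c (- x) = radial_kernel c x"
  by (simp add: radial_kernel_def)

lemma radial_kernel_bounded:
  assumes "admissible (real CARD('p)) c"
  shows "\<bar>radial_kernel c (x :: 'p::prime_card padic)\<bar> \<le> (LINT j|int_counting. \<bar>c j\<bar> * real CARD('p) powi (- j))"
proof -
  have "\<bar>radial_kernel c x\<bar> \<le> (LINT j|int_counting. \<bar>c j * ball_kernel j x\<bar>)"
    unfolding radial_kernel_def using integral_norm_bound[of int_counting "\<lambda>j. c j * ball_kernel j x"] by simp
  also have "\<dots> \<le> (LINT j|int_counting. \<bar>c j\<bar> * real CARD('p) powi (- j))"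
  proof (rule integral_mono)
    show "integrable int_counting (\<lambda>j. \<bar>c j * ball_kernel j x\<bar>)"
      using radial_kernel_integrable[OF assms] by (rule integrable_abs)
    show "integrable int_counting (\<lambda>j. \<bar>c j\<bar> * real CARD('p) powi (- j))"
      using assms integrable_abs[of int_counting "\<lambda>j. c j * real CARD('p) powi (- j)"]
      by (simp add: admissible_def abs_mult)
  qed (auto simp: abs_mult ball_kernel_le intro!: mult_left_mono)
  finally show ?thesis .
qed

text \<open>Balls are open and closed, so each ball kernel is locally constant; the second half of
  \<open>admissible\<close> dominates the series.\<close>

lemma continuous_radial_kernel:
  assumes c: "admissible (real CARD('p)) c"
  shows "continuous_on UNIV (radial_kernel c :: 'p::prime_card padic \<Rightarrow> real)"
  unfolding continuous_on_sequentially
proof (intro ballI allI impI)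
  fix x :: "nat \<Rightarrow> 'p padic" and a
  assume "(\<forall>n. x n \<in> UNIV) \<and> x \<longlonglongrightarrow> a"
  then have x: "x \<longlonglongrightarrow> a" by simp
  have "(\<lambda>n. radial_kernel c (x n)) \<longlonglongrightarrow> radial_kernel c a"
    unfolding radial_kernel_def
  proof (rule integral_dominated_convergence)
    show "integrable int_counting (\<lambda>j. \<bar>c j * real CARD('p) powi (- j)\<bar>)"
      using c by (auto simp: admissible_def)
    show "AE j in int_counting. norm (c j * ball_kernel j (x n)) \<le> \<bar>c j * real CARD('p) powi (- j)\<bar>" for n
      by (auto simp: abs_mult ball_kernel_le intro!: mult_left_mono AE_I2)
    show "AE j in int_counting. (\<lambda>n. c j * ball_kernel j (x n)) \<longlonglongrightarrow> c j * ball_kernel j a"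
    proof (rule AE_I2)
      fix j
      have "eventually (\<lambda>n. x n \<in> pball 0 j \<longleftrightarrow> a \<in> pball 0 j) sequentially"
      proof (cases "a \<in> pball 0 j")
        case True
        then show ?thesis using topological_tendstoD[OF x open_pball True] by simp
      next
        case False
        have "open (- pball 0 j :: 'p padic set)" using closed_pball by (rule open_Compl)
        then show ?thesis using topological_tendstoD[OF x, of "- pball 0 j"] False by simp
      qed
      then have "eventually (\<lambda>n. c j * ball_kernel j (x n) = c j * ball_kernel j a) sequentially"
        by eventually_elim (simp add: ball_kernel_def indicator_def)
      then show "(\<lambda>n. c j * ball_kernel j (x n)) \<longlonglongrightarrow> c j * ball_kernel j a"
        by (rule tendsto_eventually)
    qed
  qed auto
  then show "(radial_kernel c \<circ> x) \<longlonglongrightarrow> radial_kernel c a" by (simp add: o_def)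
qed

lemma radial_kernel_measurable:
  "admissible (real CARD('p)) c \<Longrightarrow> (radial_kernel c :: 'p::prime_card padic \<Rightarrow> real) \<in> borel_measurable borel"
  by (intro borel_measurable_continuous_onI continuous_radial_kernel)

lemma nn_integral_ball_kernel: "(\<integral>\<^sup>+x. ennreal (ball_kernel j (x :: 'p::prime_card padic)) \<partial>padic_haar) = 1"
proof -
  have "(\<integral>\<^sup>+x. ennreal (ball_kernel j (x :: 'p padic)) \<partial>padic_haar)
      = (\<integral>\<^sup>+x. ennreal (real CARD('p) powi (- j)) * indicator (pball 0 j) (x :: 'p padic) \<partial>padic_haar)"
    by (intro nn_integral_cong) (auto simp: ball_kernel_def split: split_indicator)
  also have "\<dots> = ennreal (real CARD('p) powi (- j)) * ennreal (real CARD('p) powi j)"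
    by (subst nn_integral_cmult_indicator) (auto simp: emeasure_padic_haar_pball)
  also have "\<dots> = 1"
    using real_card_gt_0[where 'p='p] by (simp add: power_int_minus flip: ennreal_mult)
  finally show ?thesis .
qed

lemma meas_count_pair:
  fixes f :: "int \<Rightarrow> 'a \<Rightarrow> 'b::topological_space"
  assumes "\<And>j. f j \<in> borel_measurable M"
  shows "(\<lambda>(j, x). f j x) \<in> borel_measurable (int_counting \<Otimes>\<^sub>M M)"
  by (rule measurable_pair_measure_countable1) (use assms in auto)

lemma nn_integral_radial_swap:
  fixes f :: "int \<Rightarrow> 'p::prime_card padic \<Rightarrow> ennreal"
  assumes "\<And>j. f j \<in> borel_measurable borel"
  shows "(\<integral>\<^sup>+x. (\<integral>\<^sup>+j. f j x \<partial>int_counting) \<partial>padic_haar) = (\<integral>\<^sup>+j. (\<integral>\<^sup>+x. f j x \<partial>padic_haar) \<partial>int_counting)"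
proof -
  interpret I: sigma_finite_measure int_counting by (rule sigma_finite_int_counting)
  interpret P: pair_sigma_finite int_counting "padic_haar :: 'p padic measure" by unfold_locales
  have "(\<lambda>(j, x). f j x) \<in> borel_measurable (int_counting \<Otimes>\<^sub>M (padic_haar :: 'p padic measure))"
    by (rule meas_count_pair) (use assms in \<open>simp cong: measurable_cong_sets\<close>)
  from P.Fubini'[OF this] show ?thesis .
qed

lemma ennreal_radial_kernel:
  assumes c: "admissible (real CARD('p)) c" and nn: "\<And>j. 0 \<le> c j"
  shows "ennreal (radial_kernel c (x :: 'p::prime_card padic)) = (\<integral>\<^sup>+j. ennreal (c j) * ennreal (ball_kernel j x) \<partial>int_counting)"
  unfolding radial_kernel_def
  using radial_kernel_integrable[OF c, of x] nn
  by (subst nn_integral_eq_integral[symmetric]) (auto simp: ennreal_mult')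

lemma radial_kernel_nonneg: "(\<And>j. 0 \<le> c j) \<Longrightarrow> 0 \<le> radial_kernel c x"
  unfolding radial_kernel_def by (intro integral_nonneg_AE) auto

text \<open>Evenness makes the row and column integrals of Schur's test coincide for the kernel
  \<open>g (x - y)\<close>, so that one L1 bound serves both.\<close>

definition even_L1 :: "real \<Rightarrow> ('p::prime_card padic \<Rightarrow> real) \<Rightarrow> bool" where
  "even_L1 C g \<longleftrightarrow> 0 < C \<and> g \<in> borel_measurable borel \<and> (\<exists>B. \<forall>x. \<bar>g x\<bar> \<le> B) \<and> (\<forall>x. g (- x) = g x)
     \<and> (\<integral>\<^sup>+x. ennreal \<bar>g x\<bar> \<partial>padic_haar) \<le> ennreal C"

text \<open>Each ball kernel has mass 1, so the L1 norm of the superposition is at most the sum of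
  the moduli of its weights.\<close>

lemma even_L1_radial_kernel:
  assumes c: "admissible (real CARD('p)) c" and C: "(\<integral>\<^sup>+j. ennreal \<bar>c j\<bar> \<partial>int_counting) \<le> ennreal C" "C > 0"
  shows "even_L1 C (radial_kernel c :: 'p::prime_card padic \<Rightarrow> real)"
proof -
  have abs: "ennreal \<bar>radial_kernel c x\<bar> \<le> (\<integral>\<^sup>+j. ennreal \<bar>c j\<bar> * ennreal (ball_kernel j x) \<partial>int_counting)"
    for x :: "'p padic"
  proof -
    have "ennreal \<bar>radial_kernel c x\<bar> \<le> (\<integral>\<^sup>+j. ennreal (norm (c j * ball_kernel j x)) \<partial>int_counting)"
      unfolding radial_kernel_def
      using integral_norm_bound_ennreal[OF radial_kernel_integrable[OF c, of x]] by simp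
    then show ?thesis by (simp add: abs_mult ennreal_mult')
  qed
  have "(\<integral>\<^sup>+x. ennreal \<bar>radial_kernel c (x :: 'p padic)\<bar> \<partial>padic_haar)
      \<le> (\<integral>\<^sup>+x. (\<integral>\<^sup>+j. ennreal \<bar>c j\<bar> * ennreal (ball_kernel j (x :: 'p padic)) \<partial>int_counting) \<partial>padic_haar)"
    by (rule nn_integral_mono) (rule abs)
  also have "\<dots> = (\<integral>\<^sup>+j. (\<integral>\<^sup>+x. ennreal \<bar>c j\<bar> * ennreal (ball_kernel j (x :: 'p padic)) \<partial>padic_haar) \<partial>int_counting)"
    by (rule nn_integral_radial_swap) measurable
  also have "\<dots> = (\<integral>\<^sup>+j. ennreal \<bar>c j\<bar> \<partial>int_counting)"
    by (subst nn_integral_cmult) (simp_all add: nn_integral_ball_kernel)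
  also have "\<dots> \<le> ennreal C" by (rule C)
  finally have "(\<integral>\<^sup>+x. ennreal \<bar>radial_kernel c (x :: 'p padic)\<bar> \<partial>padic_haar) \<le> ennreal C" .
  then show ?thesis
    using radial_kernel_bounded[OF c] radial_kernel_measurable[OF c] C(2) by (auto simp: even_L1_def)
qed

lemma nn_integral_padic_translate:
  assumes [measurable]: "g \<in> borel_measurable borel"
  shows "(\<integral>\<^sup>+x. g (x - y) \<partial>padic_haar) = (\<integral>\<^sup>+x. g (x :: 'p::prime_card padic) \<partial>padic_haar)"
proof -
  have m: "(\<lambda>x :: 'p padic. x + - y) \<in> borel_measurable borel"
    by (intro borel_measurable_continuous_onI continuous_intros)
  have "(\<integral>\<^sup>+x. g x \<partial>padic_haar) = (\<integral>\<^sup>+x. g x \<partial>distr padic_haar borel (\<lambda>x. x + - y))"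
    by (simp only: distr_padic_haar_translate)
  also have "\<dots> = (\<integral>\<^sup>+x. g (x + - y) \<partial>padic_haar)"
    using m by (intro nn_integral_distr) auto
  finally show ?thesis by simp
qed

lemma even_L1_translate:
  assumes g: "even_L1 C (g :: 'p::prime_card padic \<Rightarrow> real)"
  shows "(\<integral>\<^sup>+x. ennreal \<bar>g (x - y)\<bar> \<partial>padic_haar) \<le> ennreal C" "(\<integral>\<^sup>+x. ennreal \<bar>g (y - x)\<bar> \<partial>padic_haar) \<le> ennreal C"
proof -
  have [measurable]: "g \<in> borel_measurable borel" using g by (simp add: even_L1_def)
  show 1: "(\<integral>\<^sup>+x. ennreal \<bar>g (x - y)\<bar> \<partial>padic_haar) \<le> ennreal C"
    using nn_integral_padic_translate[of "\<lambda>x. ennreal \<bar>g x\<bar>" y] g by (simp add: even_L1_def)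
  have "g (y - x) = g (x - y)" for x
    using g unfolding even_L1_def by (metis minus_diff_eq)
  with 1 show "(\<integral>\<^sup>+x. ennreal \<bar>g (y - x)\<bar> \<partial>padic_haar) \<le> ennreal C" by simp
qed

lemma even_L1_abs: "even_L1 C g \<Longrightarrow> even_L1 C (\<lambda>x. \<bar>g x\<bar>)"
  by (auto simp: even_L1_def)

lemma even_L1_add:
  assumes "even_L1 C g" "even_L1 D h"
  shows "even_L1 (C + D) (\<lambda>x. g x + h x)"
proof -
  have [measurable]: "g \<in> borel_measurable borel" "h \<in> borel_measurable borel"
    using assms by (auto simp: even_L1_def)
  obtain B1 B2 where "\<And>x. \<bar>g x\<bar> \<le> B1" "\<And>x. \<bar>h x\<bar> \<le> B2" using assms by (auto simp: even_L1_def)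
  then have bd: "\<exists>B. \<forall>x. \<bar>g x + h x\<bar> \<le> B" by (intro exI[of _ "B1 + B2"]) (meson abs_triangle_ineq add_mono order_trans)
  have "(\<integral>\<^sup>+x. ennreal \<bar>g x + h x\<bar> \<partial>padic_haar) \<le> (\<integral>\<^sup>+x. ennreal \<bar>g x\<bar> + ennreal \<bar>h x\<bar> \<partial>padic_haar)"
    by (intro nn_integral_mono) (simp add: abs_triangle_ineq flip: ennreal_plus)
  also have "\<dots> = (\<integral>\<^sup>+x. ennreal \<bar>g x\<bar> \<partial>padic_haar) + (\<integral>\<^sup>+x. ennreal \<bar>h x\<bar> \<partial>padic_haar)"
    by (rule nn_integral_add) measurable
  also have "\<dots> \<le> ennreal C + ennreal D" using assms by (intro add_mono) (auto simp: even_L1_def)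
  also have "\<dots> = ennreal (C + D)" using assms by (simp add: even_L1_def)
  finally show ?thesis using assms bd by (auto simp: even_L1_def)
qed

text \<open>The kernel of the larger ball is constant along balls of the smaller radius, and the
  kernel of the smaller ball has mass 1.\<close>

lemma ball_kernel_convolution:
  "(\<integral>\<^sup>+y. ennreal (ball_kernel i (x - y)) * ennreal (ball_kernel l (y - z)) \<partial>padic_haar)
    = ennreal (ball_kernel (max i l) (x - z :: 'p::prime_card padic))"
proof -
  have main: "(\<integral>\<^sup>+y. ennreal (ball_kernel i (x - y)) * ennreal (ball_kernel l (y - z)) \<partial>padic_haar)
    = ennreal (ball_kernel l (x - z :: 'p padic))" if il: "i \<le> l" for i l and x z :: "'p padic"
  proof -
    have "ennreal (ball_kernel i (x - y)) * ennreal (ball_kernel l (y - z))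
        = ennreal (ball_kernel l (x - z)) * ennreal (ball_kernel i (y - x))" for y
    proof (cases "y \<in> pball x i")
      case True
      then have "y \<in> pball x l" using pball_mono[OF il] by auto
      then have "y \<in> pball z l \<longleftrightarrow> x \<in> pball z l" using pball_trans pball_commute by blast
      then show ?thesis using ball_kernel_minus[of i "x - y"]
        by (simp add: ball_kernel_def indicator_def mem_pball mult.commute)
    next
      case False
      then have "ball_kernel i (y - x) = 0" by (simp add: ball_kernel_def mem_pball)
      then show ?thesis using ball_kernel_minus[of i "x - y"] by simp
    qed
    then have "(\<integral>\<^sup>+y. ennreal (ball_kernel i (x - y)) * ennreal (ball_kernel l (y - z)) \<partial>padic_haar)
        = (\<integral>\<^sup>+y. ennreal (ball_kernel l (x - z)) * ennreal (ball_kernel i (y - x)) \<partial>padic_haar)"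
      by simp
    also have "\<dots> = ennreal (ball_kernel l (x - z)) * (\<integral>\<^sup>+y. ennreal (ball_kernel i (y - x)) \<partial>padic_haar)"
    proof (rule nn_integral_cmult)
      have "(\<lambda>y :: 'p padic. y - x) \<in> borel_measurable borel"
        by (intro borel_measurable_continuous_onI continuous_intros)
      then show "(\<lambda>y. ennreal (ball_kernel i (y - x))) \<in> borel_measurable padic_haar" by simp
    qed
    also have "(\<integral>\<^sup>+y. ennreal (ball_kernel i (y - x)) \<partial>padic_haar) = 1"
      using nn_integral_padic_translate[of "\<lambda>y. ennreal (ball_kernel i y)" x] by (simp add: nn_integral_ball_kernel)
    finally show ?thesis by simp
  qed
  show ?thesis
  proof (cases "i \<le> l")
    case True
    then show ?thesis using main by (simp add: max_def)
  next
    case False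
    then have li: "l \<le> i" by simp
    have sym: "ball_kernel j (a - b) = ball_kernel j (b - a)" for j and a b :: "'p padic"
      using ball_kernel_minus[of j "b - a"] by simp
    have "(\<integral>\<^sup>+y. ennreal (ball_kernel i (x - y)) * ennreal (ball_kernel l (y - z)) \<partial>padic_haar)
        = (\<integral>\<^sup>+y. ennreal (ball_kernel l (z - y)) * ennreal (ball_kernel i (y - x)) \<partial>padic_haar)"
      by (intro nn_integral_cong) (simp add: sym[of _ x] sym[of _ _ z] mult.commute)
    also have "\<dots> = ennreal (ball_kernel i (z - x))" by (rule main[OF li])
    finally show ?thesis using False by (simp add: sym[of i z x] max_def)
  qed
qed

text \<open>All terms are nonnegative, so sums and integral may be exchanged; what remains is
  \<open>max_convolution\<close> for the ball kernels at \<open>x - z\<close>.\<close>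

lemma radial_kernel_convolution:
  assumes F: "mono F" "(\<lambda>n. F (- int n)) \<longlonglongrightarrow> 0" "admissible (real CARD('p)) (increment F)"
    and G: "mono G" "(\<lambda>n. G (- int n)) \<longlonglongrightarrow> 0" "admissible (real CARD('p)) (increment G)"
    and FG: "admissible (real CARD('p)) (increment (\<lambda>j. F j * G j))"
  shows "(\<integral>\<^sup>+y. ennreal (radial_kernel (increment F) (x - y)) * ennreal (radial_kernel (increment G) (y - z)) \<partial>padic_haar)
    = ennreal (radial_kernel (increment (\<lambda>j. F j * G j)) (x - z :: 'p::prime_card padic))"
proof -
  have iF: "0 \<le> increment F j" and iG: "0 \<le> increment G j" for j
    using F(1) G(1) by (auto simp: increment_def mono_def)
  have F0: "0 \<le> F j" and G0: "0 \<le> G j" for j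
    by (rule LIMSEQ_le_const2[OF F(2)] LIMSEQ_le_const2[OF G(2)],
        use F(1) G(1) in \<open>auto simp: mono_def intro!: exI[of _ "nat (- j)"]\<close>)+
  have iFG: "0 \<le> increment (\<lambda>j. F j * G j) j" for j
    using F(1) G(1) F0 G0 by (auto simp: increment_def mono_def intro!: mult_mono)
  have m1: "(\<lambda>y :: 'p padic. x - y) \<in> borel_measurable borel" and m2: "(\<lambda>y :: 'p padic. y - z) \<in> borel_measurable borel"
    by (intro borel_measurable_continuous_onI continuous_intros)+
  have m: "(\<lambda>y. ennreal (ball_kernel i (x - y))) \<in> borel_measurable borel"
    "(\<lambda>y. ennreal (ball_kernel i (y - z))) \<in> borel_measurable borel" for i
    using m1 m2 by measurable
  note [measurable] = m
  let ?f = "\<lambda>i. ennreal (increment F i)" and ?g = "\<lambda>i. ennreal (increment G i)"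
  have "(\<integral>\<^sup>+y. ennreal (radial_kernel (increment F) (x - y)) * ennreal (radial_kernel (increment G) (y - z)) \<partial>padic_haar)
    = (\<integral>\<^sup>+y. (\<integral>\<^sup>+i. ?f i * ennreal (ball_kernel i (x - y)) * (\<integral>\<^sup>+l. ?g l * ennreal (ball_kernel l (y - z)) \<partial>int_counting) \<partial>int_counting) \<partial>padic_haar)"
    by (simp add: ennreal_radial_kernel F(3) G(3) iF iG nn_integral_multc)
  also have "\<dots> = (\<integral>\<^sup>+i. (\<integral>\<^sup>+y. ?f i * ennreal (ball_kernel i (x - y)) * (\<integral>\<^sup>+l. ?g l * ennreal (ball_kernel l (y - z)) \<partial>int_counting) \<partial>padic_haar) \<partial>int_counting)"
  proof (rule nn_integral_radial_swap)
    have e: "(\<integral>\<^sup>+l. ?g l * ennreal (ball_kernel l (y - z)) \<partial>int_counting) = ennreal (radial_kernel (increment G) (y - z))" for y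
      by (simp add: ennreal_radial_kernel G(3) iG)
    have "(\<lambda>y. radial_kernel (increment G) (y - z)) \<in> borel_measurable borel"
      by (rule measurable_compose[OF m2 radial_kernel_measurable[OF G(3)]])
    then show "(\<lambda>y. ?f i * ennreal (ball_kernel i (x - y)) * (\<integral>\<^sup>+l. ?g l * ennreal (ball_kernel l (y - z)) \<partial>int_counting)) \<in> borel_measurable borel" for i
      unfolding e by measurable
  qed
  also have "\<dots> = (\<integral>\<^sup>+i. (\<integral>\<^sup>+y. (\<integral>\<^sup>+l. ?f i * ennreal (ball_kernel i (x - y)) * (?g l * ennreal (ball_kernel l (y - z))) \<partial>int_counting) \<partial>padic_haar) \<partial>int_counting)"
    by (simp add: nn_integral_cmult)
  also have "\<dots> = (\<integral>\<^sup>+i. (\<integral>\<^sup>+l. (\<integral>\<^sup>+y. ?f i * ennreal (ball_kernel i (x - y)) * (?g l * ennreal (ball_kernel l (y - z))) \<partial>padic_haar) \<partial>int_counting) \<partial>int_counting)"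
    by (intro nn_integral_cong nn_integral_radial_swap) measurable
  also have "\<dots> = (\<integral>\<^sup>+i. (\<integral>\<^sup>+l. ?f i * ?g l * ennreal (ball_kernel (max i l) (x - z)) \<partial>int_counting) \<partial>int_counting)"
  proof (intro nn_integral_cong)
    fix i l
    have "(\<integral>\<^sup>+y. ?f i * ennreal (ball_kernel i (x - y)) * (?g l * ennreal (ball_kernel l (y - z))) \<partial>padic_haar)
        = (\<integral>\<^sup>+y. ?f i * ?g l * (ennreal (ball_kernel i (x - y)) * ennreal (ball_kernel l (y - z))) \<partial>padic_haar)"
      by (simp add: mult_ac)
    also have "\<dots> = ?f i * ?g l * ennreal (ball_kernel (max i l) (x - z))"
      by (subst nn_integral_cmult) (simp_all add: ball_kernel_convolution)
    finally show "(\<integral>\<^sup>+y. ?f i * ennreal (ball_kernel i (x - y)) * (?g l * ennreal (ball_kernel l (y - z))) \<partial>padic_haar)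
        = ?f i * ?g l * ennreal (ball_kernel (max i l) (x - z))" .
  qed
  also have "\<dots> = (\<integral>\<^sup>+j. ennreal (increment (\<lambda>j. F j * G j) j) * ennreal (ball_kernel j (x - z)) \<partial>int_counting)"
    by (rule max_convolution[OF F(1,2) G(1,2), where \<phi> = "\<lambda>j. ennreal (ball_kernel j (x - z))"])
  also have "\<dots> = ennreal (radial_kernel (increment (\<lambda>j. F j * G j)) (x - z))"
    by (simp add: ennreal_radial_kernel FG iFG)
  finally show ?thesis .
qed

lemma radial_kernel_single:
  assumes "\<And>j. c j = (if j = J then a else 0)"
  shows "radial_kernel c x = a * ball_kernel J x"
proof -
  have "radial_kernel c x = (\<Sum>j | j \<in> UNIV \<and> c j * ball_kernel j x \<noteq> 0. c j * ball_kernel j x)"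
    unfolding radial_kernel_def
    by (rule lebesgue_integral_count_space_finite_support)
      (use assms in \<open>auto intro: finite_subset[of _ "{J}"]\<close>)
  also have "\<dots> = (\<Sum>j\<in>{J}. c j * ball_kernel j x)"
    by (rule sum.mono_neutral_left) (use assms in auto)
  finally show ?thesis using assms by simp
qed

lemma radial_kernel_linear:
  assumes "admissible (real CARD('p)) c" "admissible (real CARD('p)) d"
  shows "radial_kernel (\<lambda>j. a * c j + b * d j) (x :: 'p::prime_card padic) = a * radial_kernel c x + b * radial_kernel d x"
proof -
  have "radial_kernel (\<lambda>j. a * c j + b * d j) x
      = (LINT j|int_counting. a * (c j * ball_kernel j x) + b * (d j * ball_kernel j x))"
    unfolding radial_kernel_def by (simp add: algebra_simps)
  also have "\<dots> = a * radial_kernel c x + b * radial_kernel d x"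
    unfolding radial_kernel_def
    using radial_kernel_integrable[OF assms(1), of x] radial_kernel_integrable[OF assms(2), of x] by simp
  finally show ?thesis .
qed

text \<open>Below \<open>J\<close> all increments vanish, and from \<open>J\<close> on the weight
  q^-j is at most q^-J.\<close>

lemma admissible_cutoff:
  assumes q: "1 < q" and fin: "(\<integral>\<^sup>+j. ennreal \<bar>increment (cutoff J F) j\<bar> \<partial>int_counting) < \<infinity>"
  shows "admissible q (increment (cutoff J F))"
proof -
  have i: "integrable int_counting (increment (cutoff J F))"
    by (rule integrableI_bounded) (use fin in auto)
  have "integrable int_counting (\<lambda>j. increment (cutoff J F) j * q powi (- j))"
  proof (rule Bochner_Integration.integrable_bound[of _ "\<lambda>j. q powi (- J) * increment (cutoff J F) j"])
    show "AE j in int_counting. norm (increment (cutoff J F) j * q powi (- j)) \<le> norm (q powi (- J) * increment (cutoff J F) j)"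
    proof (rule AE_I2)
      fix j
      show "norm (increment (cutoff J F) j * q powi (- j)) \<le> norm (q powi (- J) * increment (cutoff J F) j)"
      proof (cases "J \<le> j")
        case True
        then have "q powi (- j) \<le> q powi (- J)" using q by (intro power_int_increasing) auto
        then show ?thesis using q by (simp add: abs_mult mult.commute[of _ "q powi _"] mult_right_mono)
      qed (simp add: increment_def cutoff_def)
    qed
  qed (use i in auto)
  with i show ?thesis by (simp add: admissible_def)
qed

lemma admissible_linear:
  assumes "admissible q c" "admissible q d"
  shows "admissible q (\<lambda>j. a * c j + b * d j)"
proof -
  have "(\<lambda>j. (a * c j + b * d j) * q powi (- j)) = (\<lambda>j. a * (c j * q powi (- j)) + b * (d j * q powi (- j)))"
    by (auto simp: algebra_simps)
  then show ?thesis using assms by (simp add: admissible_def)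
qed

subsection \<open>The heat kernel on the line\<close>

text \<open>The value of the multiplier of order \<beta> at frequencies of norm q^-j; growing
  \<open>j\<close> means lower frequencies and larger balls in space.\<close>

definition symb :: "real \<Rightarrow> real \<Rightarrow> int \<Rightarrow> real" where
  "symb q \<beta> j = q powr (- \<beta> * of_int j)"

definition heat_cdf :: "real \<Rightarrow> real \<Rightarrow> real \<Rightarrow> int \<Rightarrow> real" where
  "heat_cdf q \<beta> t j = exp (- t * symb q \<beta> j)"

lemma powi_eq_powr: "1 < q \<Longrightarrow> q powi k = q powr (of_int k)" for q :: real
  by (simp add: powr_real_of_int')

context
  fixes q \<beta> :: real
  assumes q: "1 < q" and \<beta>: "0 < \<beta>"
begin

lemma powr_neg_tendsto: "0 < \<gamma> \<Longrightarrow> (\<lambda>n. q powr (- \<gamma> * real n)) \<longlonglongrightarrow> 0"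
proof -
  assume \<gamma>: "0 < \<gamma>"
  have "q powr (- \<gamma>) < q powr 0" using q \<gamma> by (intro powr_less_mono) auto
  then have "(\<lambda>n. (q powr (- \<gamma>)) ^ n) \<longlonglongrightarrow> 0" using q by (intro LIMSEQ_realpow_zero) auto
  then show ?thesis using q by (simp add: powr_power mult.commute)
qed

lemma symb_pos: "0 < symb q \<beta> j"
  using q by (simp add: symb_def)

lemma symb_antimono: "antimono (symb q \<beta>)"
  using q \<beta> by (auto simp: antimono_def symb_def intro!: powr_mono mult_left_mono)

lemma symb_at_top: "(\<lambda>n. symb q \<beta> (int n)) \<longlonglongrightarrow> 0"
  using powr_neg_tendsto[OF \<beta>] by (simp add: symb_def)

lemma symb_pred: "symb q \<beta> (j - 1) = q powr \<beta> * symb q \<beta> j"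
  by (simp add: symb_def algebra_simps flip: powr_add)

lemma heat_cdf_mono: "0 \<le> t \<Longrightarrow> mono (heat_cdf q \<beta> t)"
  using symb_antimono by (auto simp: mono_def antimono_def heat_cdf_def intro!: mult_left_mono)

lemma heat_cdf_pos: "0 \<le> heat_cdf q \<beta> t j"
  by (simp add: heat_cdf_def)

lemma heat_cdf_at_top: "(\<lambda>n. heat_cdf q \<beta> t (int n)) \<longlonglongrightarrow> 1"
proof -
  have "(\<lambda>n. exp (- t * symb q \<beta> (int n))) \<longlonglongrightarrow> exp (- t * 0)"
    by (intro tendsto_intros symb_at_top)
  then show ?thesis by (simp add: heat_cdf_def)
qed

lemma heat_cdf_at_bot:
  assumes t: "0 < t"
  shows "(\<lambda>n. heat_cdf q \<beta> t (- int n)) \<longlonglongrightarrow> 0"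
proof (rule tendsto_sandwich[OF _ _ tendsto_const])
  have bound: "heat_cdf q \<beta> t (- int n) \<le> (1 / t) * q powr (- \<beta> * real n)" for n
  proof -
    have x: "t * symb q \<beta> (- int n) > 0" using t symb_pos by simp
    have "t * symb q \<beta> (- int n) \<le> exp (t * symb q \<beta> (- int n))"
      using exp_ge_add_one_self[of "t * symb q \<beta> (- int n)"] by linarith
    then have "heat_cdf q \<beta> t (- int n) \<le> 1 / (t * symb q \<beta> (- int n))"
      unfolding heat_cdf_def mult_minus_left exp_minus inverse_eq_divide
      using x by (intro divide_left_mono) auto
    also have "\<dots> = (1 / t) * q powr (- \<beta> * real n)"
      using q by (simp add: symb_def powr_minus field_simps)
    finally show ?thesis .
  qed
  then show "eventually (\<lambda>n. heat_cdf q \<beta> t (- int n) \<le> (1 / t) * q powr (- \<beta> * real n)) sequentially"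
    by (intro always_eventually allI)
  show "(\<lambda>n. (1 / t) * q powr (- \<beta> * real n)) \<longlonglongrightarrow> 0"
    using tendsto_mult[OF tendsto_const powr_neg_tendsto[OF \<beta>], of "1 / t"] by simp
qed (auto simp: heat_cdf_def)

lemma heat_cdf_mult: "heat_cdf q \<beta> s j * heat_cdf q \<beta> t j = heat_cdf q \<beta> (s + t) j"
  by (simp add: heat_cdf_def algebra_simps flip: exp_add)

lemma heat_increment_nonneg: "0 \<le> t \<Longrightarrow> 0 \<le> increment (heat_cdf q \<beta> t) j"
  using heat_cdf_mono[of t] by (auto simp: increment_def mono_def)

lemma heat_increment_sum:
  "0 < t \<Longrightarrow> (\<integral>\<^sup>+j. ennreal (increment (heat_cdf q \<beta> t) j) \<partial>int_counting) = 1"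
  using telescope[OF heat_cdf_mono heat_cdf_at_bot heat_cdf_at_top, of t] by (simp add: increment_def)

text \<open>The summand is the increment of an explicit geometric antiderivative, so
  \<open>telescope_le\<close> evaluates the series.\<close>

lemma geometric_le:
  assumes \<gamma>: "0 < \<gamma>"
  shows "(\<integral>\<^sup>+j. ennreal (q powr (\<gamma> * of_int j)) * indicator {..J} j \<partial>int_counting)
    = ennreal (q powr (\<gamma> * of_int J) / (1 - q powr (- \<gamma>)))"
proof -
  let ?F = "\<lambda>j :: int. q powr (\<gamma> * of_int j) / (1 - q powr (- \<gamma>))"
  have l: "q powr (- \<gamma>) < 1" using q \<gamma> powr_less_mono[of "- \<gamma>" 0 q] by auto
  have diff: "?F j - ?F (j - 1) = q powr (\<gamma> * of_int j)" for j
  proof -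
    have "q powr (\<gamma> * of_int (j - 1)) = q powr (\<gamma> * of_int j) * q powr (- \<gamma>)"
      by (simp add: algebra_simps flip: powr_add)
    then have "?F j - ?F (j - 1) = q powr (\<gamma> * of_int j) * (1 - q powr (- \<gamma>)) / (1 - q powr (- \<gamma>))"
      by (simp only: right_diff_distrib mult_1_right diff_divide_distrib)
    then show ?thesis using l by simp
  qed
  have "(\<integral>\<^sup>+j. ennreal (?F j - ?F (j - 1)) * indicator {..J} j \<partial>int_counting) = ennreal (?F J - 0)"
  proof (rule telescope_le)
    show "mono ?F" using q \<gamma> l by (auto simp: mono_def intro!: divide_right_mono powr_mono mult_left_mono)
    have "(\<lambda>n. q powr (- \<gamma> * real n) / (1 - q powr (- \<gamma>))) \<longlonglongrightarrow> 0 / (1 - q powr (- \<gamma>))"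
      using l by (intro tendsto_intros powr_neg_tendsto[OF \<gamma>]) auto
    then show "(\<lambda>n. ?F (- int n)) \<longlonglongrightarrow> 0" by simp
  qed
  then show ?thesis by (simp only: diff diff_zero)
qed

lemma geometric_ge:
  assumes \<gamma>: "0 < \<gamma>"
  shows "(\<integral>\<^sup>+j. ennreal (q powr (- \<gamma> * of_int j)) * indicator {J..} j \<partial>int_counting)
    = ennreal (q powr (- \<gamma> * (of_int J - 1)) / (q powr \<gamma> - 1))"
proof -
  let ?F = "\<lambda>j :: int. - (q powr (- \<gamma> * of_int j) / (q powr \<gamma> - 1))"
  have l: "q powr \<gamma> > 1" using q \<gamma> powr_less_mono[of 0 \<gamma> q] by auto
  have diff: "?F j - ?F (j - 1) = q powr (- \<gamma> * of_int j)" for j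
  proof -
    have "q powr (- \<gamma> * of_int (j - 1)) = q powr (- \<gamma> * of_int j) * q powr \<gamma>"
      by (simp add: algebra_simps flip: powr_add)
    then have "?F j - ?F (j - 1) = q powr (- \<gamma> * of_int j) * (q powr \<gamma> - 1) / (q powr \<gamma> - 1)"
      by (simp only: right_diff_distrib mult_1_right diff_divide_distrib)
    then show ?thesis using l by simp
  qed
  have "(\<integral>\<^sup>+j. ennreal (?F j - ?F (j - 1)) * indicator {J..} j \<partial>int_counting) = ennreal (- 0 - ?F (J - 1))"
  proof (rule telescope_ge)
    show "mono ?F" using q \<gamma> less_imp_le[OF l] by (auto simp: mono_def intro!: divide_right_mono powr_mono mult_left_mono)
    have "(\<lambda>n. - (q powr (- \<gamma> * real n) / (q powr \<gamma> - 1))) \<longlonglongrightarrow> - (0 / (q powr \<gamma> - 1))"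
      using l by (intro tendsto_intros powr_neg_tendsto[OF \<gamma>]) auto
    then show "(\<lambda>n. ?F (int n)) \<longlonglongrightarrow> - 0" by simp
  qed
  then show ?thesis by (simp only: diff) simp
qed

lemma scale_exponent:
  assumes "0 < s"
  obtains J :: int where "q powr of_int J \<le> s" "s < q powr (of_int J + 1)"
proof (rule that)
  have s: "s = q powr (log q s)" using q assms by simp
  show "q powr of_int \<lfloor>log q s\<rfloor> \<le> s" by (subst (2) s) (use q in \<open>intro powr_mono; simp\<close>)
  show "s < q powr (of_int \<lfloor>log q s\<rfloor> + 1)" by (subst s) (use q in \<open>intro powr_less_mono; linarith\<close>)
qed

text \<open>From 1 + u/N \<le> exp(u/N), raised to the power \<open>N\<close>.\<close>

lemma exp_minus_le_power:
  assumes "0 < u" "0 < N"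
  shows "exp (- u) \<le> real N ^ N * u powr (- real N)"
proof -
  have "(u / real N) ^ N \<le> (1 + u / real N) ^ N" using assms by (intro power_mono) auto
  also have "\<dots> \<le> exp u"
  proof -
    have "(1 + u / real N) ^ N \<le> exp (u / real N) ^ N"
      using assms by (intro power_mono exp_ge_add_one_self) auto
    also have "\<dots> = exp u" using assms by (simp flip: exp_of_nat_mult)
    finally show ?thesis .
  qed
  finally have "inverse (exp u) \<le> inverse ((u / real N) ^ N)"
    using assms by (intro le_imp_inverse_le) auto
  then show ?thesis
    using assms by (simp add: exp_minus powr_minus powr_realpow power_divide field_simps)
qed

text \<open>This sum is the heat kernel at the origin. It is split at the exponent \<open>J\<close>
  of the scale t^(1/\<beta>): larger balls have density at most t^(-1/\<beta>) and total weight at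
  most 1, while the weights of smaller balls decay faster than any power of the radius.\<close>

lemma heat_sum_bound:
  "\<exists>C>0. \<forall>t>0. (\<integral>\<^sup>+j. ennreal (increment (heat_cdf q \<beta> t) j * q powi (- j)) \<partial>int_counting) \<le> ennreal (C * t powr (- 1 / \<beta>))"
proof -
  \<comment> \<open>\<open>N\<close> exceeds 1/\<beta>, so that decay of order \<beta> N beats the
    density q^-j and the exponent \<open>\<gamma>\<close> of the remaining geometric series is
    positive.\<close>
  define N where "N = Suc (nat \<lceil>1 / \<beta>\<rceil>)"
  have N: "real N > 1 / \<beta>" unfolding N_def by linarith
  define \<gamma> where "\<gamma> = \<beta> * real N - 1"
  have \<gamma>: "\<gamma> > 0" using N \<beta> by (simp add: \<gamma>_def field_simps)
  have l: "q powr (- \<gamma>) < 1" using q \<gamma> powr_less_mono[of "- \<gamma>" 0 q] by auto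
  define D where "D = real N ^ N / (1 - q powr (- \<gamma>))"
  have D: "D > 0" using l by (simp add: D_def N_def)
  have "(\<integral>\<^sup>+j. ennreal (increment (heat_cdf q \<beta> t) j * q powi (- j)) \<partial>int_counting) \<le> ennreal ((1 + D) * t powr (- 1 / \<beta>))"
    if t: "t > 0" for t
  proof -
    let ?w = "increment (heat_cdf q \<beta> t)"
    define s where "s = t powr (1 / \<beta>)"
    have s: "s > 0" using t by (simp add: s_def)
    have ts: "t = s powr \<beta>" using t \<beta> by (simp add: s_def powr_powr)
    obtain J where J: "q powr of_int J \<le> s" "s < q powr (of_int J + 1)" by (rule scale_exponent[OF s])
    have w0: "0 \<le> ?w j" for j using t by (intro heat_increment_nonneg) simp
    have small: "?w j * q powi (- j) \<le> real N ^ N * s powr (- (\<gamma> + 1)) * q powr (\<gamma> * of_int j)" for j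
    proof -
      have "?w j \<le> exp (- (t * symb q \<beta> j))" by (simp add: increment_def heat_cdf_def)
      also have "\<dots> \<le> real N ^ N * (t * symb q \<beta> j) powr (- real N)"
        using t symb_pos by (intro exp_minus_le_power) (auto simp: N_def)
      also have "(t * symb q \<beta> j) powr (- real N) = s powr (- (\<gamma> + 1)) * q powr ((\<gamma> + 1) * of_int j)"
        using s q by (simp add: ts symb_def powr_mult powr_powr \<gamma>_def mult_ac)
      finally have "?w j * q powi (- j) \<le> (real N ^ N * (s powr (- (\<gamma> + 1)) * q powr ((\<gamma> + 1) * of_int j))) * q powi (- j)"
        using q by (intro mult_right_mono) auto
      also have "\<dots> = real N ^ N * s powr (- (\<gamma> + 1)) * (q powr ((\<gamma> + 1) * of_int j) * q powr (- of_int j))"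
        using q by (simp add: powi_eq_powr)
      also have "q powr ((\<gamma> + 1) * of_int j) * q powr (- of_int j) = q powr (\<gamma> * of_int j)"
        by (simp add: algebra_simps flip: powr_add)
      finally show ?thesis .
    qed
    have large: "?w j * q powi (- j) \<le> (1 / s) * ?w j" if "J + 1 \<le> j" for j
    proof -
      have "q powi (- j) \<le> q powr (- (of_int J + 1))"
        unfolding powi_eq_powr[OF q] using q that by (intro powr_mono) auto
      also have "\<dots> = 1 / q powr (of_int J + 1)" by (rule powr_minus_divide)
      also have "\<dots> \<le> 1 / s" using J(2) s q by (intro divide_left_mono) auto
      finally show ?thesis using w0[of j] mult_right_mono[of "q powi (- j)" "1 / s" "?w j"] by (simp add: mult.commute)
    qed
    have "(\<integral>\<^sup>+j. ennreal (?w j * q powi (- j)) \<partial>int_counting)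
        \<le> (\<integral>\<^sup>+j. ennreal (real N ^ N * s powr (- (\<gamma> + 1))) * (ennreal (q powr (\<gamma> * of_int j)) * indicator {..J} j)
          + ennreal (1 / s) * ennreal (?w j) \<partial>int_counting)"
    proof (rule nn_integral_mono)
      fix j :: int
      show "ennreal (?w j * q powi (- j)) \<le> ennreal (real N ^ N * s powr (- (\<gamma> + 1))) * (ennreal (q powr (\<gamma> * of_int j)) * indicator {..J} j)
          + ennreal (1 / s) * ennreal (?w j)"
      proof (cases "j \<le> J")
        case True
        have "ennreal (?w j * q powi (- j)) \<le> ennreal (real N ^ N * s powr (- (\<gamma> + 1)) * q powr (\<gamma> * of_int j))"
          by (rule ennreal_leI[OF small])
        also have "\<dots> = ennreal (real N ^ N * s powr (- (\<gamma> + 1))) * (ennreal (q powr (\<gamma> * of_int j)) * indicator {..J} j)"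
          using True by (simp add: ennreal_mult')
        finally show ?thesis by (simp add: add_increasing2)
      next
        case False
        then have "ennreal (?w j * q powi (- j)) \<le> ennreal ((1 / s) * ?w j)"
          by (intro ennreal_leI large) simp
        also have "\<dots> = ennreal (1 / s) * ennreal (?w j)" using s by (intro ennreal_mult') simp
        finally show ?thesis by (simp add: add_increasing)
      qed
    qed
    also have "\<dots> = ennreal (real N ^ N * s powr (- (\<gamma> + 1))) * ennreal (q powr (\<gamma> * of_int J) / (1 - q powr (- \<gamma>)))
        + ennreal (1 / s) * 1"
      by (subst nn_integral_add, simp, simp, subst (1 2) nn_integral_cmult)
        (simp_all add: geometric_le[OF \<gamma>] heat_increment_sum[OF t])
    also have "\<dots> = ennreal (real N ^ N * s powr (- (\<gamma> + 1)) * (q powr (\<gamma> * of_int J) / (1 - q powr (- \<gamma>))) + 1 / s)"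
    proof -
      have A: "0 \<le> real N ^ N * s powr (- (\<gamma> + 1))" by simp
      have B: "0 \<le> q powr (\<gamma> * of_int J) / (1 - q powr (- \<gamma>))" using l by simp
      show ?thesis
        unfolding mult_1_right ennreal_mult[OF A B, symmetric]
        using mult_nonneg_nonneg[OF A B] s by (intro ennreal_plus[symmetric]) auto
    qed
    also have "\<dots> \<le> ennreal ((1 + D) * t powr (- 1 / \<beta>))"
    proof (rule ennreal_leI)
      have "q powr (\<gamma> * of_int J) = (q powr of_int J) powr \<gamma>" by (simp add: powr_powr mult.commute)
      also have "\<dots> \<le> s powr \<gamma>" using J(1) \<gamma> by (intro powr_mono2) auto
      finally have "real N ^ N * s powr (- (\<gamma> + 1)) * (q powr (\<gamma> * of_int J) / (1 - q powr (- \<gamma>)))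
          \<le> real N ^ N * s powr (- (\<gamma> + 1)) * (s powr \<gamma> / (1 - q powr (- \<gamma>)))"
        using l by (intro mult_left_mono divide_right_mono) auto
      also have "\<dots> = D * (s powr (- (\<gamma> + 1)) * s powr \<gamma>)" by (simp add: D_def)
      also have "s powr (- (\<gamma> + 1)) * s powr \<gamma> = 1 / s"
        using s by (simp add: powr_minus_divide flip: powr_add)
      finally have le: "real N ^ N * s powr (- (\<gamma> + 1)) * (q powr (\<gamma> * of_int J) / (1 - q powr (- \<gamma>))) \<le> D * (1 / s)" .
      have "1 / s = t powr (- 1 / \<beta>)" by (simp add: s_def powr_minus_divide)
      with le show "real N ^ N * s powr (- (\<gamma> + 1)) * (q powr (\<gamma> * of_int J) / (1 - q powr (- \<gamma>))) + 1 / s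
          \<le> (1 + D) * t powr (- 1 / \<beta>)"
        by (simp only: distrib_right mult_1_left)
    qed
    finally show ?thesis .
  qed
  then show ?thesis using D by (intro exI[of _ "1 + D"]) auto
qed

lemma admissible_heat:
  assumes t: "0 < t"
  shows "admissible q (increment (heat_cdf q \<beta> t))"
proof -
  obtain C where C: "(\<integral>\<^sup>+j. ennreal (increment (heat_cdf q \<beta> t) j * q powi (- j)) \<partial>int_counting) \<le> ennreal (C * t powr (- 1 / \<beta>))"
    using heat_sum_bound t by blast
  have "integrable int_counting (\<lambda>j. increment (heat_cdf q \<beta> t) j * q powi (- j))"
    using C t q heat_increment_nonneg[of t]
    by (intro integrableI_bounded) (auto simp: abs_mult le_less_trans)
  moreover have "integrable int_counting (increment (heat_cdf q \<beta> t))"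
    using heat_increment_sum[OF t] heat_increment_nonneg[of t] t by (intro integrableI_bounded) auto
  ultimately show ?thesis by (simp add: admissible_def)
qed

lemma cutoff_heat_sum:
  assumes t: "0 \<le> t"
  shows "(\<integral>\<^sup>+j. ennreal \<bar>increment (cutoff J (heat_cdf q \<beta> t)) j\<bar> \<partial>int_counting) = 1"
proof -
  have m: "mono (cutoff J (heat_cdf q \<beta> t))" by (intro mono_cutoff heat_cdf_mono t heat_cdf_pos)
  have nn: "0 \<le> increment (cutoff J (heat_cdf q \<beta> t)) j" for j
    using m by (auto simp: increment_def mono_def)
  have "(\<integral>\<^sup>+j. ennreal (increment (cutoff J (heat_cdf q \<beta> t)) j) \<partial>int_counting) = ennreal (1 - 0)"
    unfolding increment_def by (intro telescope m cutoff_at_bot cutoff_at_top heat_cdf_at_top)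
  then show ?thesis using nn by simp
qed

lemma admissible_cutoff_heat: "0 \<le> t \<Longrightarrow> admissible q (increment (cutoff J (heat_cdf q \<beta> t)))"
  by (intro admissible_cutoff q) (simp add: cutoff_heat_sum)

lemma cutoff_symb_sum:
  "(\<integral>\<^sup>+j. ennreal \<bar>increment (cutoff J (symb q \<beta>)) j\<bar> \<partial>int_counting) = ennreal (2 * symb q \<beta> J)"
  by (intro variation_cutoff_antimono symb_antimono symb_at_top) (simp add: symb_pos less_imp_le)

lemma admissible_cutoff_symb: "admissible q (increment (cutoff J (symb q \<beta>)))"
  by (intro admissible_cutoff q) (simp add: cutoff_symb_sum)

text \<open>Up to sign the difference is the cut-off of a decreasing function with limit 0, whose
  variation is twice its value at \<open>J\<close>.\<close>

lemma cutoff_heat_diff_sum: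
  assumes t: "0 < t"
  shows "(\<integral>\<^sup>+j. ennreal \<bar>increment (cutoff J (heat_cdf q \<beta> t)) j - increment (cutoff J (heat_cdf q \<beta> 0)) j\<bar> \<partial>int_counting)
    \<le> ennreal (2 * t * symb q \<beta> J)"
proof -
  let ?\<psi> = "\<lambda>j. 1 - heat_cdf q \<beta> t j"
  have "(\<integral>\<^sup>+j. ennreal \<bar>increment (cutoff J ?\<psi>) j\<bar> \<partial>int_counting) = ennreal (2 * ?\<psi> J)"
  proof (rule variation_cutoff_antimono)
    show "antimono ?\<psi>" using heat_cdf_mono[of t] t by (auto simp: mono_def antimono_def)
    show "0 \<le> ?\<psi> j" for j using t symb_pos[of j] by (simp add: heat_cdf_def)
    show "(\<lambda>n. ?\<psi> (int n)) \<longlonglongrightarrow> 0"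
      using tendsto_diff[OF tendsto_const heat_cdf_at_top, of 1 t] by simp
  qed
  moreover have "\<bar>increment (cutoff J (heat_cdf q \<beta> t)) j - increment (cutoff J (heat_cdf q \<beta> 0)) j\<bar> = \<bar>increment (cutoff J ?\<psi>) j\<bar>" for j
    by (auto simp: increment_def cutoff_def heat_cdf_def)
  moreover have "2 * ?\<psi> J \<le> 2 * t * symb q \<beta> J"
    using exp_ge_add_one_self[of "- t * symb q \<beta> J"] by (simp add: heat_cdf_def)
  ultimately show ?thesis by (simp add: ennreal_leI)
qed

text \<open>The product of the right-hand side with the lower Taylor bound 1 + x + x^2/2 of exp x is
  1 + x^4/4.\<close>

lemma exp_minus_le_quadratic:
  fixes x :: real
  assumes "0 \<le> x"
  shows "exp (- x) \<le> 1 - x + x\<^sup>2 / 2"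
proof -
  have "1 \<le> (1 - x + x\<^sup>2 / 2) * (1 + x + x\<^sup>2 / 2)"
  proof -
    have "(1 - x + x\<^sup>2 / 2) * (1 + x + x\<^sup>2 / 2) = 1 + (x\<^sup>2)\<^sup>2 / 4"
      by (simp add: power2_eq_square algebra_simps)
    then show ?thesis by simp
  qed
  also have "\<dots> \<le> (1 - x + x\<^sup>2 / 2) * exp x"
  proof (rule mult_left_mono[OF exp_lower_Taylor_quadratic[OF assms]])
    have "1 - x + x\<^sup>2 / 2 = (1 - x)\<^sup>2 / 2 + 1 / 2" by (simp add: power2_eq_square field_simps)
    then show "0 \<le> 1 - x + x\<^sup>2 / 2" by simp
  qed
  finally show ?thesis by (simp add: exp_minus field_simps)
qed

text \<open>The error of the difference quotient is an increasing function \<open>h\<close> of the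
  symbol with value 0 at 0. Its total variation over \<open>j\<close> is therefore twice its value
  at \<open>J\<close>, and the quadratic bound for exp makes that linear in
  \<open>t\<close>.\<close>

lemma cutoff_heat_derivative_sum:
  assumes t: "0 < t"
  shows "(\<integral>\<^sup>+j. ennreal \<bar>(increment (cutoff J (heat_cdf q \<beta> t)) j - increment (cutoff J (heat_cdf q \<beta> 0)) j) / t
      + increment (cutoff J (symb q \<beta>)) j\<bar> \<partial>int_counting) \<le> ennreal (t * (symb q \<beta> J)\<^sup>2)"
proof -
  define h where "h a = a - (1 - exp (- t * a)) / t" for a
  have h_mono: "h a \<le> h b" if "a \<le> b" "0 \<le> a" for a b
  proof -
    have "exp (- t * a) - exp (- t * b) = exp (- t * a) * (1 - exp (- t * (b - a)))"
      by (simp add: algebra_simps flip: exp_add)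
    also have "\<dots> \<le> 1 * (t * (b - a))"
    proof (rule mult_mono)
      show "exp (- t * a) \<le> 1" using t that by simp
      show "1 - exp (- t * (b - a)) \<le> t * (b - a)"
        using exp_ge_add_one_self[of "- t * (b - a)"] by simp
      show "0 \<le> 1 - exp (- t * (b - a))" using t that by simp
    qed simp
    finally have "(exp (- t * a) - exp (- t * b)) / t \<le> b - a" using t by (simp add: divide_le_eq mult.commute)
    then show ?thesis by (simp add: h_def diff_divide_distrib)
  qed
  have h0: "h 0 = 0" by (simp add: h_def)
  let ?\<psi> = "\<lambda>j. h (symb q \<beta> j)"
  have "(\<integral>\<^sup>+j. ennreal \<bar>increment (cutoff J ?\<psi>) j\<bar> \<partial>int_counting) = ennreal (2 * ?\<psi> J)"
  proof (rule variation_cutoff_antimono)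
    show "antimono ?\<psi>" using symb_antimono symb_pos by (auto simp: antimono_def less_imp_le intro!: h_mono)
    show "0 \<le> ?\<psi> j" for j using h_mono[of 0 "symb q \<beta> j"] symb_pos[of j] h0 by simp
    have "(\<lambda>n. ?\<psi> (int n)) \<longlonglongrightarrow> 0 - (1 - exp (- t * 0)) / t"
      unfolding h_def using t by (intro tendsto_intros symb_at_top) auto
    then show "(\<lambda>n. ?\<psi> (int n)) \<longlonglongrightarrow> 0" by simp
  qed
  moreover have "\<bar>(increment (cutoff J (heat_cdf q \<beta> t)) j - increment (cutoff J (heat_cdf q \<beta> 0)) j) / t
      + increment (cutoff J (symb q \<beta>)) j\<bar> = \<bar>increment (cutoff J ?\<psi>) j\<bar>" for j
    using t by (auto simp: increment_def cutoff_def heat_cdf_def h_def diff_divide_distrib add_divide_distrib algebra_simps)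
  moreover have "2 * ?\<psi> J \<le> t * (symb q \<beta> J)\<^sup>2"
  proof -
    have "exp (- (t * symb q \<beta> J)) \<le> 1 - t * symb q \<beta> J + (t * symb q \<beta> J)\<^sup>2 / 2"
      using t symb_pos[of J] by (intro exp_minus_le_quadratic) simp
    then have "t * h (symb q \<beta> J) \<le> (t * symb q \<beta> J)\<^sup>2 / 2"
    proof -
      have "t * h (symb q \<beta> J) = t * symb q \<beta> J - (1 - exp (- (t * symb q \<beta> J)))"
        using t by (simp add: h_def right_diff_distrib[of _ _ "_ / _"])
      then show ?thesis using \<open>exp (- (t * symb q \<beta> J)) \<le> _\<close> by simp
    qed
    then have "t * (2 * h (symb q \<beta> J)) \<le> t * (t * (symb q \<beta> J)\<^sup>2)" by (simp add: power2_eq_square mult_ac)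
    then show ?thesis using t by (simp only: mult_le_cancel_left_pos)
  qed
  ultimately show ?thesis by (simp add: ennreal_leI)
qed

text \<open>One weight is at most the whole tail from \<open>j\<close> on, and that tail is of first
  order in \<open>t\<close>; this is the source of the factor \<open>t\<close> away from the
  origin.\<close>

lemma heat_increment_le:
  assumes t: "0 < t"
  shows "increment (heat_cdf q \<beta> t) j \<le> t * q powr \<beta> * symb q \<beta> j"
proof -
  have "increment (heat_cdf q \<beta> t) j \<le> 1 - heat_cdf q \<beta> t (j - 1)"
    using t symb_pos[of j] by (simp add: increment_def heat_cdf_def)
  also have "\<dots> \<le> t * symb q \<beta> (j - 1)"
    using exp_ge_add_one_self[of "- t * symb q \<beta> (j - 1)"] by (simp add: heat_cdf_def)
  finally show ?thesis by (simp add: symb_pred mult.assoc)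
qed

end

section \<open>One-variable kernels: L1 bounds, convolutions and pointwise estimates\<close>

definition heat1 :: "real \<Rightarrow> real \<Rightarrow> 'p::prime_card padic \<Rightarrow> real" where
  "heat1 \<beta> t = radial_kernel (increment (heat_cdf (real CARD('p)) \<beta> t))"

text \<open>The heat kernel smoothed by an average over balls of radius p^J. At time 0 it is that
  average itself, which acts as the identity on functions constant on such balls.\<close>

definition heat1_cut :: "real \<Rightarrow> int \<Rightarrow> real \<Rightarrow> 'p::prime_card padic \<Rightarrow> real" where
  "heat1_cut \<beta> J t = radial_kernel (increment (cutoff J (heat_cdf (real CARD('p)) \<beta> t)))"

text \<open>The kernel of the fractional derivative restricted to frequencies of norm at most p^-J,
  where its multiplier is bounded.\<close>

definition frac1_cut :: "real \<Rightarrow> int \<Rightarrow> 'p::prime_card padic \<Rightarrow> real" where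
  "frac1_cut \<beta> J = radial_kernel (increment (cutoff J (symb (real CARD('p)) \<beta>)))"

context
  fixes \<beta> :: real
  assumes \<beta>: "0 < \<beta>"
begin

lemma even_L1_heat1: "0 < t \<Longrightarrow> even_L1 1 (heat1 \<beta> t :: 'p::prime_card padic \<Rightarrow> real)"
  unfolding heat1_def using real_card_gt_1[where 'p='p] \<beta>
  by (intro even_L1_radial_kernel admissible_heat) (simp_all add: heat_increment_sum heat_increment_nonneg)

lemma even_L1_heat1_cut: "0 \<le> t \<Longrightarrow> even_L1 1 (heat1_cut \<beta> J t :: 'p::prime_card padic \<Rightarrow> real)"
  unfolding heat1_cut_def using real_card_gt_1[where 'p='p] \<beta>
  by (intro even_L1_radial_kernel admissible_cutoff_heat) (simp_all add: cutoff_heat_sum)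

lemma even_L1_frac1_cut:
  "even_L1 (2 * symb (real CARD('p)) \<beta> J) (frac1_cut \<beta> J :: 'p::prime_card padic \<Rightarrow> real)"
  unfolding frac1_cut_def using real_card_gt_1[where 'p='p] \<beta> symb_pos[OF real_card_gt_1[where 'p='p] \<beta>]
  by (intro even_L1_radial_kernel admissible_cutoff_symb) (simp_all add: cutoff_symb_sum)

text \<open>Differentiability in L1 at time 0, with an error linear in \<open>t\<close>. The
  constants grow without bound as \<open>J\<close> decreases, which is why the generator is treated
  one level at a time.\<close>

lemma heat1_cut_derivative:
  assumes t: "0 < t"
  shows "even_L1 (2 * t * symb (real CARD('p)) \<beta> J) (\<lambda>x :: 'p::prime_card padic. heat1_cut \<beta> J t x - heat1_cut \<beta> J 0 x)"
    and "even_L1 (t * (symb (real CARD('p)) \<beta> J)\<^sup>2)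
      (\<lambda>x :: 'p padic. (heat1_cut \<beta> J t x - heat1_cut \<beta> J 0 x) / t + frac1_cut \<beta> J x)"
proof -
  let ?q = "real CARD('p)"
  note q = real_card_gt_1[where 'p='p]
  note pos = symb_pos[OF q \<beta>, of J]
  let ?c = "increment (cutoff J (heat_cdf ?q \<beta> t))" and ?d = "increment (cutoff J (heat_cdf ?q \<beta> 0))"
    and ?e = "increment (cutoff J (symb ?q \<beta>))"
  have c: "admissible ?q ?c" and d: "admissible ?q ?d" and e: "admissible ?q ?e"
    using t by (auto intro!: admissible_cutoff_heat admissible_cutoff_symb q \<beta>)
  have cd: "admissible ?q (\<lambda>j. 1 * ?c j + - 1 * ?d j)"
    by (rule admissible_linear[OF c d])
  have "radial_kernel (\<lambda>j. 1 * ?c j + - 1 * ?d j) x = heat1_cut \<beta> J t x - heat1_cut \<beta> J 0 x" for x :: "'p padic"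
    by (subst radial_kernel_linear[OF c d]) (simp add: heat1_cut_def)
  moreover have "even_L1 (2 * t * symb ?q \<beta> J) (radial_kernel (\<lambda>j. 1 * ?c j + - 1 * ?d j) :: 'p padic \<Rightarrow> real)"
    by (intro even_L1_radial_kernel cd) (use cutoff_heat_diff_sum[OF q \<beta> t] t pos in simp_all)
  ultimately show "even_L1 (2 * t * symb ?q \<beta> J) (\<lambda>x :: 'p padic. heat1_cut \<beta> J t x - heat1_cut \<beta> J 0 x)"
    by presburger
  have cde: "admissible ?q (\<lambda>j. (1 / t) * (1 * ?c j + - 1 * ?d j) + 1 * ?e j)"
    by (rule admissible_linear[OF cd e])
  have "radial_kernel (\<lambda>j. (1 / t) * (1 * ?c j + - 1 * ?d j) + 1 * ?e j) x
      = (heat1_cut \<beta> J t x - heat1_cut \<beta> J 0 x) / t + frac1_cut \<beta> J x" for x :: "'p padic"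
    by (subst radial_kernel_linear[OF cd e], subst radial_kernel_linear[OF c d])
      (simp add: heat1_cut_def frac1_cut_def)
  moreover have "even_L1 (t * (symb ?q \<beta> J)\<^sup>2) (radial_kernel (\<lambda>j. (1 / t) * (1 * ?c j + - 1 * ?d j) + 1 * ?e j) :: 'p padic \<Rightarrow> real)"
    by (intro even_L1_radial_kernel cde) (use cutoff_heat_derivative_sum[OF q \<beta> t, of J] t pos in simp_all)
  ultimately show "even_L1 (t * (symb ?q \<beta> J)\<^sup>2)
      (\<lambda>x :: 'p padic. (heat1_cut \<beta> J t x - heat1_cut \<beta> J 0 x) / t + frac1_cut \<beta> J x)"
    by presburger
qed

lemma heat1_nonneg: "0 < t \<Longrightarrow> 0 \<le> heat1 \<beta> t (x :: 'p::prime_card padic)"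
  unfolding heat1_def
  by (intro radial_kernel_nonneg heat_increment_nonneg real_card_gt_1 \<beta>) simp

lemma heat1_cut_nonneg: "0 \<le> t \<Longrightarrow> 0 \<le> heat1_cut \<beta> J t (x :: 'p::prime_card padic)"
  unfolding heat1_cut_def
  using mono_cutoff[OF heat_cdf_mono[OF real_card_gt_1[where 'p='p] \<beta>] heat_cdf_pos[OF real_card_gt_1[where 'p='p] \<beta>], of t J]
  by (intro radial_kernel_nonneg) (auto simp: increment_def mono_def)

lemma continuous_heat1: "0 < t \<Longrightarrow> continuous_on UNIV (heat1 \<beta> t :: 'p::prime_card padic \<Rightarrow> real)"
  unfolding heat1_def by (intro continuous_radial_kernel admissible_heat real_card_gt_1 \<beta>)

lemma heat1_cut_0: "heat1_cut \<beta> J 0 x = ball_kernel J (x :: 'p::prime_card padic)"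
  unfolding heat1_cut_def
  by (subst radial_kernel_single[where J = J and a = 1]) (auto simp: increment_def cutoff_def heat_cdf_def)

lemma heat1_convolution:
  assumes s: "0 < s" and t: "0 < t"
  shows "(\<integral>\<^sup>+y. ennreal (heat1 \<beta> s (x - y)) * ennreal (heat1 \<beta> t (y - z)) \<partial>padic_haar)
    = ennreal (heat1 \<beta> (s + t) (x - z :: 'p::prime_card padic))"
proof -
  note q = real_card_gt_1[where 'p='p]
  have e: "(\<lambda>j. heat_cdf (real CARD('p)) \<beta> s j * heat_cdf (real CARD('p)) \<beta> t j) = heat_cdf (real CARD('p)) \<beta> (s + t)"
    by (auto simp: heat_cdf_mult[OF q \<beta>])
  have a: "admissible (real CARD('p)) (increment (\<lambda>j. heat_cdf (real CARD('p)) \<beta> s j * heat_cdf (real CARD('p)) \<beta> t j))"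
    unfolding e using s t by (intro admissible_heat q \<beta>) simp
  show ?thesis
    using radial_kernel_convolution[OF heat_cdf_mono[OF q \<beta> less_imp_le[OF s]] heat_cdf_at_bot[OF q \<beta> s]
        admissible_heat[OF q \<beta> s] heat_cdf_mono[OF q \<beta> less_imp_le[OF t]] heat_cdf_at_bot[OF q \<beta> t]
        admissible_heat[OF q \<beta> t] a, of x z]
    unfolding e heat1_def .
qed

text \<open>At time 0 the cut-off distribution function is a step at \<open>J\<close>.
  Multiplication by this step is the cut-off, so \<open>radial_kernel_convolution\<close> yields the
  smoothed kernel from either side.\<close>

lemma heat1_convolution_cut:
  assumes s: "0 < s"
  shows "(\<integral>\<^sup>+y. ennreal (heat1 \<beta> s (x - y)) * ennreal (heat1_cut \<beta> J 0 (y - z)) \<partial>padic_haar)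
      = ennreal (heat1_cut \<beta> J s (x - z :: 'p::prime_card padic))"
    and "(\<integral>\<^sup>+y. ennreal (heat1_cut \<beta> J 0 (x - y)) * ennreal (heat1 \<beta> s (y - z)) \<partial>padic_haar)
      = ennreal (heat1_cut \<beta> J s (x - z :: 'p::prime_card padic))"
proof -
  note q = real_card_gt_1[where 'p='p]
  let ?q = "real CARD('p)"
  have e1: "(\<lambda>j. heat_cdf ?q \<beta> s j * cutoff J (heat_cdf ?q \<beta> 0) j) = cutoff J (heat_cdf ?q \<beta> s)"
    and e2: "(\<lambda>j. cutoff J (heat_cdf ?q \<beta> 0) j * heat_cdf ?q \<beta> s j) = cutoff J (heat_cdf ?q \<beta> s)"
    by (auto simp: cutoff_def heat_cdf_def)
  have m: "mono (cutoff J (heat_cdf ?q \<beta> 0))"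
    by (intro mono_cutoff heat_cdf_mono heat_cdf_pos q \<beta>) simp
  have a: "admissible ?q (increment (cutoff J (heat_cdf ?q \<beta> s)))"
    using s by (intro admissible_cutoff_heat q \<beta>) simp
  note H = heat_cdf_mono[OF q \<beta> less_imp_le[OF s]] heat_cdf_at_bot[OF q \<beta> s] admissible_heat[OF q \<beta> s]
  note E = m cutoff_at_bot admissible_cutoff_heat[OF q \<beta> order_refl]
  show "(\<integral>\<^sup>+y. ennreal (heat1 \<beta> s (x - y)) * ennreal (heat1_cut \<beta> J 0 (y - z)) \<partial>padic_haar)
      = ennreal (heat1_cut \<beta> J s (x - z :: 'p padic))"
    using radial_kernel_convolution[OF H E, unfolded e1, OF a, of x z] unfolding heat1_def heat1_cut_def .
  show "(\<integral>\<^sup>+y. ennreal (heat1_cut \<beta> J 0 (x - y)) * ennreal (heat1 \<beta> s (y - z)) \<partial>padic_haar)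
      = ennreal (heat1_cut \<beta> J s (x - z :: 'p padic))"
    using radial_kernel_convolution[OF E H, unfolded e2, OF a, of x z] unfolding heat1_def heat1_cut_def .
qed

text \<open>The kernel is largest at the origin, where it equals the sum in
  \<open>heat_sum_bound\<close>.\<close>

lemma heat1_le:
  "\<exists>C>0. \<forall>t>0. \<forall>x :: 'p::prime_card padic. heat1 \<beta> t x \<le> C * t powr (- 1 / \<beta>)"
proof -
  note q = real_card_gt_1[where 'p='p]
  obtain C where C: "C > 0" "\<And>t. t > 0 \<Longrightarrow> (\<integral>\<^sup>+j. ennreal (increment (heat_cdf (real CARD('p)) \<beta> t) j * real CARD('p) powi (- j)) \<partial>int_counting) \<le> ennreal (C * t powr (- 1 / \<beta>))"
    using heat_sum_bound[OF q \<beta>] by blast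
  have "heat1 \<beta> t x \<le> C * t powr (- 1 / \<beta>)" if t: "t > 0" for t and x :: "'p padic"
  proof -
    have nn: "0 \<le> increment (heat_cdf (real CARD('p)) \<beta> t) j" for j
      using t by (intro heat_increment_nonneg q \<beta>) simp
    have "ennreal (heat1 \<beta> t x) \<le> (\<integral>\<^sup>+j. ennreal (increment (heat_cdf (real CARD('p)) \<beta> t) j * real CARD('p) powi (- j)) \<partial>int_counting)"
      unfolding heat1_def ennreal_radial_kernel[OF admissible_heat[OF q \<beta> t] nn]
      using nn ball_kernel_le[of _ x] by (intro nn_integral_mono) (simp add: mult_left_mono flip: ennreal_mult')
    also have "\<dots> \<le> ennreal (C * t powr (- 1 / \<beta>))" by (rule C(2)[OF t])
    finally show ?thesis using C(1) by simp
  qed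
  with C(1) show ?thesis by blast
qed

text \<open>Only balls that contain \<open>x\<close> contribute. Their weights are at most t
  p^\<beta> p^(-\<beta> j) and their densities p^-j, which leaves a geometric series of exponent 1 +
  \<beta> starting at the norm of \<open>x\<close>.\<close>

lemma heat1_off_diagonal_le:
  "\<exists>C>0. \<forall>t>0. \<forall>x :: 'p::prime_card padic. x \<noteq> 0 \<longrightarrow> heat1 \<beta> t x \<le> C * t * padic_norm x powr (- (1 + \<beta>))"
proof -
  let ?q = "real CARD('p)"
  note q = real_card_gt_1[where 'p='p]
  let ?\<gamma> = "1 + \<beta>"
  have \<gamma>: "?\<gamma> > 0" using \<beta> by simp
  have l: "?q powr ?\<gamma> > 1" using q \<gamma> powr_less_mono[of 0 ?\<gamma> ?q] by auto
  define C where "C = ?q powr \<beta> * ?q powr ?\<gamma> / (?q powr ?\<gamma> - 1)"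
  have C: "C > 0" using l q by (simp add: C_def)
  have "heat1 \<beta> t x \<le> C * t * padic_norm x powr (- (1 + \<beta>))" if t: "t > 0" and x: "x \<noteq> 0" for t and x :: "'p padic"
  proof -
    obtain i where i: "padic_norm x = ?q powi i" by (rule padic_norm_values[OF x])
    have nn: "0 \<le> increment (heat_cdf ?q \<beta> t) j" for j
      using t by (intro heat_increment_nonneg q \<beta>) simp
    have "ennreal (heat1 \<beta> t x) = (\<integral>\<^sup>+j. ennreal (increment (heat_cdf ?q \<beta> t) j) * ennreal (ball_kernel j x) \<partial>int_counting)"
      unfolding heat1_def by (rule ennreal_radial_kernel[OF admissible_heat[OF q \<beta> t] nn])
    also have "\<dots> \<le> (\<integral>\<^sup>+j. ennreal (t * ?q powr \<beta>) * (ennreal (?q powr (- ?\<gamma> * of_int j)) * indicator {i..} j) \<partial>int_counting)"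
    proof (rule nn_integral_mono)
      fix j :: int
      show "ennreal (increment (heat_cdf ?q \<beta> t) j) * ennreal (ball_kernel j x)
          \<le> ennreal (t * ?q powr \<beta>) * (ennreal (?q powr (- ?\<gamma> * of_int j)) * indicator {i..} j)"
      proof (cases "i \<le> j")
        case True
        have "increment (heat_cdf ?q \<beta> t) j * ball_kernel j x \<le> (t * ?q powr \<beta> * symb ?q \<beta> j) * ?q powi (- j)"
          using heat_increment_le[OF q \<beta> t] ball_kernel_le[of _ x] nn t
          by (intro mult_mono) (auto simp: symb_def)
        also have "\<dots> = t * ?q powr \<beta> * ?q powr (- ?\<gamma> * of_int j)"
          using q by (simp add: symb_def powi_eq_powr algebra_simps flip: powr_add)
        finally show ?thesis using True nn t
          by (simp add: ennreal_leI flip: ennreal_mult')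
      next
        case False
        then have "ball_kernel j x = 0"
          using powi_le_iff[OF q, of i j] by (simp add: ball_kernel_def mem_pball i)
        then show ?thesis by simp
      qed
    qed
    also have "\<dots> = ennreal (t * ?q powr \<beta>) * ennreal (?q powr (- ?\<gamma> * (of_int i - 1)) / (?q powr ?\<gamma> - 1))"
      by (subst nn_integral_cmult) (simp_all only: geometric_ge[OF q \<beta> \<gamma>], simp)
    also have "\<dots> = ennreal (t * ?q powr \<beta> * (?q powr (- ?\<gamma> * (of_int i - 1)) / (?q powr ?\<gamma> - 1)))"
      using t by (intro ennreal_mult'[symmetric]) simp
    also have "?q powr (- ?\<gamma> * (of_int i - 1)) = padic_norm x powr (- ?\<gamma>) * ?q powr ?\<gamma>"
      unfolding i powi_eq_powr[OF q] powr_powr by (simp add: algebra_simps flip: powr_add)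
    finally have "heat1 \<beta> t x \<le> t * ?q powr \<beta> * (padic_norm x powr (- ?\<gamma>) * ?q powr ?\<gamma> / (?q powr ?\<gamma> - 1))"
      using t l by (subst (asm) ennreal_le_iff) auto
    then show ?thesis by (simp add: C_def mult_ac)
  qed
  with C show ?thesis by blast
qed

text \<open>A single ball suffices: its radius p^J is the largest power of p not exceeding
  t^(1/\<beta>), it contains \<open>x\<close>, and its weight is bounded below uniformly in
  \<open>t\<close>.\<close>

lemma heat1_ge:
  "\<exists>c>0. \<forall>t>0. \<forall>x :: 'p::prime_card padic. padic_norm x powr \<beta> \<le> t \<longrightarrow> c * t powr (- 1 / \<beta>) \<le> heat1 \<beta> t x"
proof -
  let ?q = "real CARD('p)"
  note q = real_card_gt_1[where 'p='p]
  have l: "?q powr \<beta> > 1" using q \<beta> powr_less_mono[of 0 \<beta> ?q] by auto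
  \<comment> \<open>With u = t p^(-\<beta> J), which lies between 1 and p^\<beta>, the weight is
    exp(-u) (1 - exp(-u (p^\<beta> - 1))). The first factor is estimated at u = p^\<beta>, the
    second at u = 1.\<close>
  define c where "c = exp (- (?q powr \<beta>)) * (1 - exp (- (?q powr \<beta> - 1)))"
  have c: "c > 0" using l by (simp add: c_def)
  have "c * t powr (- 1 / \<beta>) \<le> heat1 \<beta> t x" if t: "t > 0" and x: "padic_norm x powr \<beta> \<le> t" for t and x :: "'p padic"
  proof -
    define s where "s = t powr (1 / \<beta>)"
    have s: "s > 0" using t by (simp add: s_def)
    have ts: "t = s powr \<beta>" using t \<beta> by (simp add: s_def powr_powr)
    obtain J where J: "?q powr of_int J \<le> s" "s < ?q powr (of_int J + 1)" by (rule scale_exponent[OF q \<beta> s])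
    have xs: "padic_norm x \<le> s"
      using powr_mono2[OF _ _ x, of "1 / \<beta>"] \<beta> by (simp add: s_def powr_powr)
    \<comment> \<open>The norm of a nonzero \<open>x\<close> is a power of p below p^(J+1), hence at
      most p^J.\<close>
    have xJ: "x \<in> pball 0 J"
    proof (cases "x = 0")
      case False
      then obtain i where i: "padic_norm x = ?q powi i" by (rule padic_norm_values)
      then have "?q powr of_int i < ?q powr (of_int J + 1)"
        using xs J by (simp only: powi_eq_powr[OF q] le_less_trans)
      then have "i \<le> J" using q by simp
      then show ?thesis using i powi_le_iff[OF q] by (simp add: mem_pball)
    qed simp
    let ?w = "increment (heat_cdf ?q \<beta> t)"
    have nn: "0 \<le> ?w j" for j using t by (intro heat_increment_nonneg q \<beta>) simp
    define u where "u = t * symb ?q \<beta> J"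
    have u: "u = (s / ?q powr of_int J) powr \<beta>"
      using s q by (simp add: u_def ts symb_def powr_divide powr_powr powr_minus field_simps)
    have u1: "1 \<le> u" unfolding u using J(1) q \<beta> by (intro ge_one_powr_ge_zero) auto
    have "s / ?q powr of_int J \<le> ?q"
      using J(2) q by (simp add: powr_add field_simps)
    then have u2: "u \<le> ?q powr \<beta>" unfolding u using s q \<beta> by (intro powr_mono2) auto
    have "?w J = exp (- u) - exp (- (u * ?q powr \<beta>))"
      by (simp add: increment_def heat_cdf_def symb_pred[OF q \<beta>] u_def mult_ac)
    also have "\<dots> = exp (- u) * (1 - exp (- (u * (?q powr \<beta> - 1))))"
      by (simp add: algebra_simps flip: exp_add)
    also have "\<dots> \<ge> c"
      unfolding c_def
    proof (rule mult_mono)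
      show "exp (- (?q powr \<beta>)) \<le> exp (- u)" using u2 by simp
      have "?q powr \<beta> - 1 \<le> u * (?q powr \<beta> - 1)" using u1 l mult_right_mono[of 1 u "?q powr \<beta> - 1"] by simp
      then show "1 - exp (- (?q powr \<beta> - 1)) \<le> 1 - exp (- (u * (?q powr \<beta> - 1)))" by simp
    qed (use l in auto)
    finally have wJ: "c \<le> ?w J" .
    have "c * t powr (- 1 / \<beta>) = c * (1 / s)" by (simp add: s_def powr_minus_divide)
    also have "\<dots> \<le> ?w J * ?q powi (- J)"
    proof (rule mult_mono[OF wJ])
      have "1 / s \<le> 1 / ?q powr of_int J" using J(1) q s by (intro divide_left_mono) auto
      then show "1 / s \<le> ?q powi (- J)" using q by (simp add: powi_eq_powr powr_minus_divide)
    qed (use nn s in auto)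
    also have "\<dots> = ?w J * ball_kernel J x" using xJ by (simp add: ball_kernel_def)
    finally have "ennreal (c * t powr (- 1 / \<beta>)) \<le> ennreal (?w J) * ennreal (ball_kernel J x)"
      using nn by (simp add: ennreal_leI flip: ennreal_mult')
    also have "\<dots> = (\<integral>\<^sup>+j. ennreal (?w j) * ennreal (ball_kernel j x) * indicator {J} j \<partial>int_counting)"
      by (subst nn_integral_count_space'[of "{J}"]) (auto split: split_indicator_asm)
    also have "\<dots> \<le> (\<integral>\<^sup>+j. ennreal (?w j) * ennreal (ball_kernel j x) \<partial>int_counting)"
      by (intro nn_integral_mono) (auto split: split_indicator)
    also have "\<dots> = ennreal (heat1 \<beta> t x)"
      unfolding heat1_def by (rule ennreal_radial_kernel[OF admissible_heat[OF q \<beta> t] nn, symmetric])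
    finally show ?thesis using heat1_nonneg[OF t, of x] by (subst (asm) ennreal_le_iff) auto
  qed
  with c show ?thesis by blast
qed

end

subsection \<open>Product kernels\<close>

lemma prod_diff_bound:
  fixes x y :: "'i \<Rightarrow> real"
  assumes "finite S" and xy: "\<And>k. 0 \<le> x k" "\<And>k. 0 \<le> y k"
  shows "\<bar>(\<Prod>k\<in>S. x k) - (\<Prod>k\<in>S. y k)\<bar>
    \<le> (\<Sum>i\<in>S. \<Prod>k\<in>S. if k = i then \<bar>x k - y k\<bar> else x k + y k)"
  using assms(1)
proof induct
  case (insert m S)
  let ?P = "\<Prod>k\<in>S. x k" and ?Q = "\<Prod>k\<in>S. y k"
  let ?t = "\<lambda>i S. \<Prod>k\<in>S. if k = i then \<bar>x k - y k\<bar> else x k + y k"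
  have eq: "x m * ?P - y m * ?Q = (x m - y m) * ?P + y m * (?P - ?Q)" by (simp add: algebra_simps)
  have "\<bar>x m * ?P - y m * ?Q\<bar> \<le> \<bar>x m - y m\<bar> * \<bar>?P\<bar> + \<bar>y m\<bar> * \<bar>?P - ?Q\<bar>"
    unfolding eq by (rule order_trans[OF abs_triangle_ineq]) (simp only: abs_mult order_refl)
  also have "\<dots> \<le> \<bar>x m - y m\<bar> * (\<Prod>k\<in>S. x k + y k) + (x m + y m) * (\<Sum>i\<in>S. ?t i S)"
    using xy insert(3) by (intro add_mono mult_mono) (auto intro!: prod_mono simp: prod_nonneg abs_prod)
  also have "\<bar>x m - y m\<bar> * (\<Prod>k\<in>S. x k + y k) = ?t m (insert m S)"
    using insert(1,2) by (auto intro!: prod.cong)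
  also have "(x m + y m) * (\<Sum>i\<in>S. ?t i S) = (\<Sum>i\<in>S. ?t i (insert m S))"
    unfolding sum_distrib_left using insert(1,2) by (intro sum.cong) auto
  finally show ?case using insert(1,2) by simp
qed simp

text \<open>What is left after the first-order terms contains at least two difference factors. The
  majorant has one factor for each index, so every summand is again a product, and its Schur
  constant is a product of one-variable constants.\<close>

lemma prod_second_order_bound:
  fixes x y :: "'i \<Rightarrow> real"
  assumes "finite S" and xy: "\<And>k. 0 \<le> x k" "\<And>k. 0 \<le> y k"
  shows "\<bar>(\<Prod>k\<in>S. x k) - (\<Prod>k\<in>S. y k) - (\<Sum>i\<in>S. \<Prod>k\<in>S. if k = i then x k - y k else y k)\<bar>
    \<le> (\<Sum>i\<in>S. \<Sum>l\<in>S - {i}. \<Prod>k\<in>S. if k = i \<or> k = l then \<bar>x k - y k\<bar> else x k + y k)"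
  using assms(1)
proof induct
  case (insert m S)
  let ?P = "\<Prod>k\<in>S. x k" and ?Q = "\<Prod>k\<in>S. y k"
  let ?d = "\<lambda>i S. \<Prod>k\<in>S. if k = i then x k - y k else y k"
  let ?t = "\<lambda>i l S. \<Prod>k\<in>S. if k = i \<or> k = l then \<bar>x k - y k\<bar> else x k + y k"
  let ?E = "?P - ?Q - (\<Sum>i\<in>S. ?d i S)"
  have t0: "0 \<le> ?t i l S" for i l S using xy by (intro prod_nonneg) auto
  have d1: "?d m (insert m S) = (x m - y m) * ?Q"
    using insert(1,2) by (auto intro!: prod.cong)
  have d2: "(\<Sum>i\<in>S. ?d i (insert m S)) = y m * (\<Sum>i\<in>S. ?d i S)"
    unfolding sum_distrib_left using insert(1,2) by (intro sum.cong) auto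
  \<comment> \<open>Separating the new factor leaves its difference times a first-order difference
    of the old products, plus a multiple of the old remainder.\<close>
  have eq: "x m * ?P - y m * ?Q - (?d m (insert m S) + (\<Sum>i\<in>S. ?d i (insert m S)))
      = (x m - y m) * (?P - ?Q) + y m * ?E"
    unfolding d1 d2 by (simp add: algebra_simps)
  have "\<bar>x m * ?P - y m * ?Q - (?d m (insert m S) + (\<Sum>i\<in>S. ?d i (insert m S)))\<bar>
      \<le> \<bar>x m - y m\<bar> * \<bar>?P - ?Q\<bar> + \<bar>y m\<bar> * \<bar>?E\<bar>"
    unfolding eq by (rule order_trans[OF abs_triangle_ineq]) (simp only: abs_mult order_refl)
  also have "\<dots> \<le> \<bar>x m - y m\<bar> * (\<Sum>i\<in>S. \<Prod>k\<in>S. if k = i then \<bar>x k - y k\<bar> else x k + y k)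
      + (x m + y m) * (\<Sum>i\<in>S. \<Sum>l\<in>S - {i}. ?t i l S)"
    using xy insert(3) prod_diff_bound[OF insert(1) xy]
    by (intro add_mono mult_mono) (auto intro!: sum_nonneg t0)
  also have "\<bar>x m - y m\<bar> * (\<Sum>i\<in>S. \<Prod>k\<in>S. if k = i then \<bar>x k - y k\<bar> else x k + y k)
      = (\<Sum>l\<in>S. ?t m l (insert m S))"
    unfolding sum_distrib_left using insert(1,2)
    by (intro sum.cong refl) (auto intro!: prod.cong)
  also have "(x m + y m) * (\<Sum>i\<in>S. \<Sum>l\<in>S - {i}. ?t i l S) = (\<Sum>i\<in>S. \<Sum>l\<in>S - {i}. ?t i l (insert m S))"
    unfolding sum_distrib_left using insert(1,2) by (intro sum.cong refl) auto
  also have "\<dots> \<le> (\<Sum>i\<in>S. \<Sum>l\<in>insert m S - {i}. ?t i l (insert m S))"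
    by (intro sum_mono sum_mono2 t0) (use insert(1) in auto)
  finally show ?case using insert(1,2) by simp
qed simp

interpretation padic_prod: product_sigma_finite "\<lambda>_ :: 'n::finite. padic_haar :: 'p::prime_card padic measure"
  by unfold_locales

interpretation padic_n: sigma_finite_measure "padic_haar_n :: ('n::finite \<Rightarrow> 'p::prime_card padic) measure"
  unfolding padic_haar_n_def by (rule padic_prod.sigma_finite) simp

lemma sets_padic_haar_n [measurable_cong, simp]:
  "sets (padic_haar_n :: ('n::finite \<Rightarrow> 'p::prime_card padic) measure) = sets borel"
proof -
  have "sets (padic_haar_n :: ('n \<Rightarrow> 'p padic) measure) = sets (PiM UNIV (\<lambda>_ :: 'n. borel :: 'p padic measure))"
    unfolding padic_haar_n_def by (rule sets_PiM_cong) auto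
  then show ?thesis by (simp add: sets_PiM_equal_borel)
qed

lemma space_padic_haar_n [simp]: "space padic_haar_n = UNIV"
  using sets_eq_imp_space_eq[OF sets_padic_haar_n] by simp

lemma measurable_padic_haar_iff [simp]: "f \<in> measurable padic_haar N \<longleftrightarrow> f \<in> measurable borel N"
  by (simp only: measurable_cong_sets[OF sets_padic_haar refl])

lemma measurable_padic_haar_n_iff [simp]: "f \<in> measurable padic_haar_n N \<longleftrightarrow> f \<in> measurable borel N"
  by (simp only: measurable_cong_sets[OF sets_padic_haar_n refl])

lemma prod_mono_ennreal:
  fixes f g :: "'i \<Rightarrow> ennreal"
  assumes "\<And>i. i \<in> A \<Longrightarrow> f i \<le> g i"
  shows "prod f A \<le> prod g A"
  using assms by (induction A rule: infinite_finite_induct) (auto intro!: mult_mono)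

lemma measurable_coordinate [measurable]:
  "(\<lambda>x. x i) \<in> borel_measurable (borel :: ('n::finite \<Rightarrow> 'p::prime_card padic) measure)"
  by (intro borel_measurable_continuous_onI continuous_on_product_coordinates)

definition prod_kernel :: "('n::finite \<Rightarrow> 'p::prime_card padic \<Rightarrow> real) \<Rightarrow> ('n \<Rightarrow> 'p padic) \<Rightarrow> ('n \<Rightarrow> 'p padic) \<Rightarrow> real" where
  "prod_kernel g x y = (\<Prod>i\<in>UNIV. g i (x i - y i))"

lemma measurable_padic_diff:
  assumes "f \<in> borel_measurable M" "g \<in> borel_measurable M"
  shows "(\<lambda>x. f x - g x :: 'p::prime_card padic) \<in> borel_measurable M"
  by (rule borel_measurable_continuous_Pair[OF assms]) (intro continuous_intros)

lemma measurable_prod_kernel: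
  assumes g: "\<And>i. g i \<in> borel_measurable borel"
  shows "case_prod (prod_kernel g)
    \<in> borel_measurable (padic_haar_n \<Otimes>\<^sub>M (padic_haar_n :: ('n::finite \<Rightarrow> 'p::prime_card padic) measure))"
proof -
  have "(\<lambda>p. g i (fst p i - snd p i))
      \<in> borel_measurable (padic_haar_n \<Otimes>\<^sub>M (padic_haar_n :: ('n \<Rightarrow> 'p padic) measure))" for i
    by (rule measurable_compose[OF measurable_padic_diff g]) measurable
  then show ?thesis unfolding prod_kernel_def case_prod_unfold by (intro borel_measurable_prod)
qed

lemma nn_integral_padic_haar_n_prod:
  assumes "\<And>i. f i \<in> borel_measurable borel"
  shows "(\<integral>\<^sup>+x. (\<Prod>i\<in>UNIV. f i (x i)) \<partial>(padic_haar_n :: ('n::finite \<Rightarrow> 'p::prime_card padic) measure))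
    = (\<Prod>i\<in>UNIV. \<integral>\<^sup>+x. f i x \<partial>padic_haar)"
  unfolding padic_haar_n_def
  by (rule padic_prod.product_nn_integral_prod) (use assms in auto)

text \<open>Both integrals of Schur's test factor over the coordinates, so the constants
  multiply.\<close>

lemma schur_kernel_prod:
  fixes g :: "'n::finite \<Rightarrow> 'p::prime_card padic \<Rightarrow> real"
  assumes g: "\<And>i. even_L1 (C i) (g i)"
  shows "schur_kernel padic_haar_n (\<Prod>i\<in>UNIV. C i) (prod_kernel g)"
proof -
  have gm: "g i \<in> borel_measurable borel" for i using g[of i] by (simp add: even_L1_def)
  have C: "C i > 0" for i using g[of i] by (simp add: even_L1_def)
  have m1: "(\<lambda>y. g i (a - y)) \<in> borel_measurable borel" and m2: "(\<lambda>y. g i (y - a)) \<in> borel_measurable borel" for i a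
    by (rule measurable_compose[OF _ gm], intro borel_measurable_continuous_onI continuous_intros)+
  have "\<forall>i. \<exists>B. \<forall>x. \<bar>g i x\<bar> \<le> B" using g by (auto simp: even_L1_def)
  then obtain B where B: "\<And>i x. \<bar>g i x\<bar> \<le> B i" by metis
  have bd: "\<bar>prod_kernel g x y\<bar> \<le> (\<Prod>i\<in>UNIV. B i)" for x y
    unfolding prod_kernel_def abs_prod using B by (intro prod_mono) auto
  have eq: "ennreal \<bar>prod_kernel g x y\<bar> = (\<Prod>i\<in>UNIV. ennreal \<bar>g i (x i - y i)\<bar>)" for x y
    unfolding prod_kernel_def abs_prod by (rule prod_ennreal[symmetric]) simp
  have "(\<integral>\<^sup>+y. ennreal \<bar>prod_kernel g x y\<bar> \<partial>padic_haar_n) \<le> ennreal (\<Prod>i\<in>UNIV. C i)" for x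
  proof -
    have "(\<integral>\<^sup>+y. ennreal \<bar>prod_kernel g x y\<bar> \<partial>padic_haar_n) = (\<Prod>i\<in>UNIV. \<integral>\<^sup>+y. ennreal \<bar>g i (x i - y)\<bar> \<partial>padic_haar)"
      unfolding eq using m1 by (intro nn_integral_padic_haar_n_prod) measurable
    also have "\<dots> \<le> (\<Prod>i\<in>UNIV. ennreal (C i))" by (intro prod_mono_ennreal even_L1_translate(2)[OF g])
    also have "\<dots> = ennreal (\<Prod>i\<in>UNIV. C i)" using C by (intro prod_ennreal) (simp add: less_imp_le)
    finally show ?thesis .
  qed
  moreover have "(\<integral>\<^sup>+x. ennreal \<bar>prod_kernel g x y\<bar> \<partial>padic_haar_n) \<le> ennreal (\<Prod>i\<in>UNIV. C i)" for y
  proof -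
    have "(\<integral>\<^sup>+x. ennreal \<bar>prod_kernel g x y\<bar> \<partial>padic_haar_n) = (\<Prod>i\<in>UNIV. \<integral>\<^sup>+x. ennreal \<bar>g i (x - y i)\<bar> \<partial>padic_haar)"
      unfolding eq using m2 by (intro nn_integral_padic_haar_n_prod) measurable
    also have "\<dots> \<le> (\<Prod>i\<in>UNIV. ennreal (C i))" by (intro prod_mono_ennreal even_L1_translate(1)[OF g])
    also have "\<dots> = ennreal (\<Prod>i\<in>UNIV. C i)" using C by (intro prod_ennreal) (simp add: less_imp_le)
    finally show ?thesis .
  qed
  moreover have "0 < (\<Prod>i\<in>UNIV. C i)" using C by (intro prod_pos) auto
  ultimately show ?thesis
    unfolding schur_kernel_def using measurable_prod_kernel[of g, OF gm] bd by blast
qed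

text \<open>The integral factors into one-variable convolutions; nonnegativity of all factors allows
  the passage through \<open>ennreal\<close>.\<close>

lemma prod_kernel_composition:
  fixes g h m :: "'n::finite \<Rightarrow> 'p::prime_card padic \<Rightarrow> real"
  assumes g: "\<And>i. even_L1 (C i) (g i)" "\<And>i x. 0 \<le> g i x" and h: "\<And>i. even_L1 (D i) (h i)" "\<And>i x. 0 \<le> h i x"
    and m: "\<And>i x. 0 \<le> m i x"
    and conv: "\<And>i a b. (\<integral>\<^sup>+y. ennreal (g i (a - y)) * ennreal (h i (y - b)) \<partial>padic_haar) = ennreal (m i (a - b))"
  shows "(LINT y|padic_haar_n. prod_kernel g x y * prod_kernel h y z) = prod_kernel m x z"
proof -
  have gm: "g i \<in> borel_measurable borel" and hm: "h i \<in> borel_measurable borel" for i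
    using g(1)[of i] h(1)[of i] by (auto simp: even_L1_def)
  have m1 [measurable]: "(\<lambda>y. g i (a - y)) \<in> borel_measurable borel" and m2 [measurable]: "(\<lambda>y. h i (y - a)) \<in> borel_measurable borel" for i a
    by (rule measurable_compose[OF _ gm] measurable_compose[OF _ hm], intro borel_measurable_continuous_onI continuous_intros)+
  have eq: "prod_kernel g x y * prod_kernel h y z = (\<Prod>i\<in>UNIV. g i (x i - y i) * h i (y i - z i))" for y
    by (simp add: prod_kernel_def prod.distrib)
  have "(LINT y|padic_haar_n. prod_kernel g x y * prod_kernel h y z)
      = enn2real (\<integral>\<^sup>+y. ennreal (\<Prod>i\<in>UNIV. g i (x i - y i) * h i (y i - z i)) \<partial>padic_haar_n)"
    unfolding eq using g(2) h(2)
    by (intro integral_eq_nn_integral) (auto intro!: prod_nonneg borel_measurable_prod borel_measurable_times measurable_compose[OF measurable_coordinate])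
  also have "(\<integral>\<^sup>+y. ennreal (\<Prod>i\<in>UNIV. g i (x i - y i) * h i (y i - z i)) \<partial>padic_haar_n)
      = (\<integral>\<^sup>+y. (\<Prod>i\<in>UNIV. ennreal (g i (x i - y i)) * ennreal (h i (y i - z i))) \<partial>padic_haar_n)"
    using g(2) h(2) by (simp add: ennreal_mult' flip: prod_ennreal)
  also have "\<dots> = (\<Prod>i\<in>UNIV. \<integral>\<^sup>+y. ennreal (g i (x i - y)) * ennreal (h i (y - z i)) \<partial>padic_haar)"
    by (rule nn_integral_padic_haar_n_prod[where f = "\<lambda>i y. ennreal (g i (x i - y)) * ennreal (h i (y - z i))"]) measurable
  also have "\<dots> = ennreal (prod_kernel m x z)"
    unfolding conv prod_kernel_def using m by (intro prod_ennreal) auto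
  finally show ?thesis using m by (simp add: prod_kernel_def prod_nonneg)
qed

section \<open>Sums, multiples and domination of Schur kernels\<close>

context sigma_finite_measure
begin

lemma schur_kernel_mono:
  assumes k: "schur_kernel M c k" and l: "case_prod l \<in> borel_measurable (M \<Otimes>\<^sub>M M)"
    and le: "\<And>x y. \<bar>l x y\<bar> \<le> \<bar>k x y\<bar>" and cd: "c \<le> d"
  shows "schur_kernel M d l"
proof -
  obtain B where "\<And>x y. \<bar>k x y\<bar> \<le> B" using k by (auto simp: schur_kernel_def)
  then have "\<exists>B. \<forall>x y. \<bar>l x y\<bar> \<le> B" using le order_trans by blast
  moreover have "(\<integral>\<^sup>+y. ennreal \<bar>l x y\<bar> \<partial>M) \<le> ennreal d" if "x \<in> space M" for x
  proof -
    have "(\<integral>\<^sup>+y. ennreal \<bar>l x y\<bar> \<partial>M) \<le> (\<integral>\<^sup>+y. ennreal \<bar>k x y\<bar> \<partial>M)"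
      using le by (intro nn_integral_mono ennreal_leI) auto
    also have "\<dots> \<le> ennreal c" using k that by (simp add: schur_kernel_def)
    finally show ?thesis using cd by (meson ennreal_leI order_trans)
  qed
  moreover have "(\<integral>\<^sup>+x. ennreal \<bar>l x y\<bar> \<partial>M) \<le> ennreal d" if "y \<in> space M" for y
  proof -
    have "(\<integral>\<^sup>+x. ennreal \<bar>l x y\<bar> \<partial>M) \<le> (\<integral>\<^sup>+x. ennreal \<bar>k x y\<bar> \<partial>M)"
      using le by (intro nn_integral_mono ennreal_leI) auto
    also have "\<dots> \<le> ennreal c" using k that by (simp add: schur_kernel_def)
    finally show ?thesis using cd by (meson ennreal_leI order_trans)
  qed
  moreover have "0 < d" using k cd by (simp add: schur_kernel_def)
  ultimately show ?thesis using l by (simp add: schur_kernel_def)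
qed

lemma schur_kernel_zero: "0 < c \<Longrightarrow> schur_kernel M c (\<lambda>x y. 0)"
  unfolding schur_kernel_def by (auto simp: case_prod_unfold)

lemma schur_kernel_weaken: "schur_kernel M c k \<Longrightarrow> c \<le> d \<Longrightarrow> schur_kernel M d k"
  by (rule schur_kernel_mono) (auto simp: schur_kernel_def)

lemma schur_kernel_add:
  assumes k: "schur_kernel M c k" and l: "schur_kernel M d l"
  shows "schur_kernel M (c + d) (\<lambda>x y. k x y + l x y)"
proof -
  note mk = schur_kernelD(1)[OF k] and ml = schur_kernelD(1)[OF l]
  obtain B1 B2 where "\<And>x y. \<bar>k x y\<bar> \<le> B1" "\<And>x y. \<bar>l x y\<bar> \<le> B2" using k l by (auto simp: schur_kernel_def)
  then have bd: "\<exists>B. \<forall>x y. \<bar>k x y + l x y\<bar> \<le> B"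
    by (intro exI[of _ "B1 + B2"]) (meson abs_triangle_ineq add_mono order_trans)
  have cd: "0 < c" "0 < d" using k l by (auto simp: schur_kernel_def)
  have "(\<integral>\<^sup>+y. ennreal \<bar>k x y + l x y\<bar> \<partial>M) \<le> ennreal (c + d)" if x: "x \<in> space M" for x
  proof -
    note [measurable] = schur_kernelD(2)[OF k x] schur_kernelD(2)[OF l x]
    have "(\<integral>\<^sup>+y. ennreal \<bar>k x y + l x y\<bar> \<partial>M) \<le> (\<integral>\<^sup>+y. ennreal \<bar>k x y\<bar> + ennreal \<bar>l x y\<bar> \<partial>M)"
      by (intro nn_integral_mono) (simp add: abs_triangle_ineq flip: ennreal_plus)
    also have "\<dots> = (\<integral>\<^sup>+y. ennreal \<bar>k x y\<bar> \<partial>M) + (\<integral>\<^sup>+y. ennreal \<bar>l x y\<bar> \<partial>M)"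
      by (rule nn_integral_add) measurable
    also have "\<dots> \<le> ennreal c + ennreal d" using k l x by (intro add_mono) (auto simp: schur_kernel_def)
    finally show ?thesis using cd by simp
  qed
  moreover have "(\<integral>\<^sup>+x. ennreal \<bar>k x y + l x y\<bar> \<partial>M) \<le> ennreal (c + d)" if y: "y \<in> space M" for y
  proof -
    have [measurable]: "(\<lambda>x. k x y) \<in> borel_measurable M" "(\<lambda>x. l x y) \<in> borel_measurable M"
      using measurable_compose[OF measurable_Pair2'[OF y] mk] measurable_compose[OF measurable_Pair2'[OF y] ml] by simp_all
    have "(\<integral>\<^sup>+x. ennreal \<bar>k x y + l x y\<bar> \<partial>M) \<le> (\<integral>\<^sup>+x. ennreal \<bar>k x y\<bar> + ennreal \<bar>l x y\<bar> \<partial>M)"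
      by (intro nn_integral_mono) (simp add: abs_triangle_ineq flip: ennreal_plus)
    also have "\<dots> = (\<integral>\<^sup>+x. ennreal \<bar>k x y\<bar> \<partial>M) + (\<integral>\<^sup>+x. ennreal \<bar>l x y\<bar> \<partial>M)"
      by (rule nn_integral_add) measurable
    also have "\<dots> \<le> ennreal c + ennreal d" using k l y by (intro add_mono) (auto simp: schur_kernel_def)
    finally show ?thesis using cd by simp
  qed
  moreover have "case_prod (\<lambda>x y. k x y + l x y) \<in> borel_measurable (M \<Otimes>\<^sub>M M)"
    using borel_measurable_add[OF mk ml] by (simp add: case_prod_unfold)
  ultimately show ?thesis using cd bd by (simp add: schur_kernel_def)
qed

lemma schur_kernel_scale:
  assumes k: "schur_kernel M c k" and a: "a > 0"
  shows "schur_kernel M (a * c) (\<lambda>x y. a * k x y)"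
proof -
  note mk = schur_kernelD(1)[OF k]
  obtain B where "\<And>x y. \<bar>k x y\<bar> \<le> B" using k by (auto simp: schur_kernel_def)
  then have bd: "\<exists>B. \<forall>x y. \<bar>a * k x y\<bar> \<le> B"
    using a by (intro exI[of _ "a * B"]) (auto simp: abs_mult)
  have c: "0 < c" using k by (auto simp: schur_kernel_def)
  have "(\<integral>\<^sup>+y. ennreal \<bar>a * k x y\<bar> \<partial>M) \<le> ennreal (a * c)" if x: "x \<in> space M" for x
  proof -
    note [measurable] = schur_kernelD(2)[OF k x]
    have "(\<integral>\<^sup>+y. ennreal \<bar>a * k x y\<bar> \<partial>M) = ennreal a * (\<integral>\<^sup>+y. ennreal \<bar>k x y\<bar> \<partial>M)"
      using a by (subst nn_integral_cmult[symmetric]) (auto simp: abs_mult ennreal_mult')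
    also have "\<dots> \<le> ennreal a * ennreal c" using k x by (intro mult_left_mono) (auto simp: schur_kernel_def)
    finally show ?thesis using a by (simp add: ennreal_mult')
  qed
  moreover have "(\<integral>\<^sup>+x. ennreal \<bar>a * k x y\<bar> \<partial>M) \<le> ennreal (a * c)" if y: "y \<in> space M" for y
  proof -
    have [measurable]: "(\<lambda>x. k x y) \<in> borel_measurable M"
      using measurable_compose[OF measurable_Pair2'[OF y] mk] by simp
    have "(\<integral>\<^sup>+x. ennreal \<bar>a * k x y\<bar> \<partial>M) = ennreal a * (\<integral>\<^sup>+x. ennreal \<bar>k x y\<bar> \<partial>M)"
      using a by (subst nn_integral_cmult[symmetric]) (auto simp: abs_mult ennreal_mult')
    also have "\<dots> \<le> ennreal a * ennreal c" using k y by (intro mult_left_mono) (auto simp: schur_kernel_def)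
    finally show ?thesis using a by (simp add: ennreal_mult')
  qed
  moreover have "case_prod (\<lambda>x y. a * k x y) \<in> borel_measurable (M \<Otimes>\<^sub>M M)"
    using borel_measurable_times[OF borel_measurable_const mk, of a] by (simp add: case_prod_unfold)
  ultimately show ?thesis using c a bd by (simp add: schur_kernel_def)
qed

text \<open>The summand \<open>\<epsilon>\<close> is there because a Schur constant must be
  positive, even for the empty sum.\<close>

lemma schur_kernel_sum:
  assumes "finite A" "\<And>a. a \<in> A \<Longrightarrow> schur_kernel M c (k a)" "0 < c" and \<epsilon>: "0 < \<epsilon>"
  shows "schur_kernel M (real (card A) * c + \<epsilon>) (\<lambda>x y. \<Sum>a\<in>A. k a x y)"
  using assms(1,2)
proof induct
  case empty
  then show ?case using schur_kernel_zero[OF \<epsilon>] by simp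
next
  case (insert a A)
  then have "schur_kernel M (c + (real (card A) * c + \<epsilon>)) (\<lambda>x y. k a x y + (\<Sum>a\<in>A. k a x y))"
    by (intro schur_kernel_add) auto
  then show ?case using insert by (simp add: algebra_simps)
qed

lemma kernel_op_linear_kernel:
  assumes k: "schur_kernel M c k" and l: "schur_kernel M d l" and f: "f \<in> L2_functions M" and x: "x \<in> space M"
  shows "kernel_op M (\<lambda>x y. a * k x y + b * l x y) f x = of_real a * kernel_op M k f x + of_real b * kernel_op M l f x"
proof -
  have "kernel_op M (\<lambda>x y. a * k x y + b * l x y) f x
      = (LINT y|M. of_real a * (complex_of_real (k x y) * f y) + of_real b * (complex_of_real (l x y) * f y))"
    unfolding kernel_op_def by (rule Bochner_Integration.integral_cong) (auto simp: algebra_simps)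
  also have "\<dots> = of_real a * kernel_op M k f x + of_real b * kernel_op M l f x"
    unfolding kernel_op_def
    using schur_kernel_integrable(1)[OF k f x] schur_kernel_integrable(1)[OF l f x] by simp
  finally show ?thesis .
qed

end

subsection \<open>The product heat semigroup\<close>

definition heat_n :: "real \<Rightarrow> real \<Rightarrow> ('n::finite \<Rightarrow> 'p::prime_card padic) \<Rightarrow> ('n \<Rightarrow> 'p padic) \<Rightarrow> real" where
  "heat_n \<beta> t = prod_kernel (\<lambda>_. heat1 \<beta> t)"

definition heat_n_cut :: "real \<Rightarrow> int \<Rightarrow> real \<Rightarrow> ('n::finite \<Rightarrow> 'p::prime_card padic) \<Rightarrow> ('n \<Rightarrow> 'p padic) \<Rightarrow> real" where
  "heat_n_cut \<beta> J t = prod_kernel (\<lambda>_. heat1_cut \<beta> J t)"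

text \<open>In the coordinates other than \<open>i\<close> the identity would be required, which has
  no kernel. The average over balls of radius p^J replaces it and acts as the identity on functions
  of level \<open>J\<close>.\<close>

definition vlad_cut :: "real \<Rightarrow> int \<Rightarrow> ('n::finite \<Rightarrow> 'p::prime_card padic) \<Rightarrow> ('n \<Rightarrow> 'p padic) \<Rightarrow> real" where
  "vlad_cut \<beta> J x y = (\<Sum>i\<in>UNIV. prod_kernel (\<lambda>k. if k = i then frac1_cut \<beta> J else heat1_cut \<beta> J 0) x y)"

text \<open>The identity has no kernel, so time 0 is treated separately; negative times get the same
  value, which lets the norm bounds and linearity be stated for all \<open>t\<close>.\<close>

definition heat_sg :: "real \<Rightarrow> real \<Rightarrow> (('n::finite \<Rightarrow> 'p::prime_card padic) \<Rightarrow> complex) \<Rightarrow> ('n \<Rightarrow> 'p padic) \<Rightarrow> complex" where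
  "heat_sg \<beta> t f = (if t \<le> 0 then f else kernel_op padic_haar_n (heat_n \<beta> t) f)"

definition ball_average :: "int \<Rightarrow> (('n::finite \<Rightarrow> 'p::prime_card padic) \<Rightarrow> complex) \<Rightarrow> ('n \<Rightarrow> 'p padic) \<Rightarrow> complex" where
  "ball_average J = kernel_op padic_haar_n (prod_kernel (\<lambda>_. ball_kernel J))"

definition cube :: "('n::finite \<Rightarrow> 'p::prime_card padic) \<Rightarrow> int \<Rightarrow> ('n \<Rightarrow> 'p padic) set" where
  "cube c J = {x. \<forall>i. x i \<in> pball (c i) J}"

text \<open>The spatial form of a frequency cut-off: constancy on cubes of size p^J confines the
  frequencies to norm at most p^-J in each coordinate.\<close>

definition level :: "int \<Rightarrow> (('n::finite \<Rightarrow> 'p::prime_card padic) \<Rightarrow> complex) \<Rightarrow> bool" where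
  "level J f \<longleftrightarrow> (\<forall>x y. y \<in> cube x J \<longrightarrow> f y = f x)"

lemma cube_eq: "x \<in> cube c J \<Longrightarrow> cube x J = cube c J"
  unfolding cube_def using pball_eq by blast

lemma cube_commute: "x \<in> cube c J \<longleftrightarrow> c \<in> cube x J"
  unfolding cube_def using pball_commute by blast

lemma cube_center [simp]: "c \<in> cube c J"
  by (simp add: cube_def)

lemma cube_mono: "J \<le> K \<Longrightarrow> cube c J \<subseteq> cube c K"
  unfolding cube_def using pball_mono by blast

lemma cube_nested: "J \<le> K \<Longrightarrow> cube c J \<inter> cube d K \<noteq> {} \<Longrightarrow> cube c J \<subseteq> cube d K"
  using cube_mono cube_eq cube_commute by blast

lemma cube_eq_PiE: "cube c J = Pi\<^sub>E UNIV (\<lambda>i. pball (c i) J)"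
  by (auto simp: cube_def PiE_def)

lemma emeasure_cube:
  "emeasure padic_haar_n (cube (c :: 'n::finite \<Rightarrow> 'p::prime_card padic) J) = ennreal ((real CARD('p) powi J) ^ CARD('n))"
proof -
  have "emeasure (Pi\<^sub>M UNIV (\<lambda>_ :: 'n. padic_haar)) (Pi\<^sub>E UNIV (\<lambda>i. pball (c i) J)) = (\<Prod>i\<in>UNIV. emeasure padic_haar (pball (c i) J))"
    by (rule padic_prod.emeasure_PiM) auto
  then show ?thesis
    using real_card_gt_0[where 'p='p] by (simp add: cube_eq_PiE padic_haar_n_def emeasure_padic_haar_pball ennreal_power)
qed

lemma sets_cube [measurable]: "cube c J \<in> sets borel"
proof -
  have "cube c J = (\<Inter>i\<in>UNIV. (\<lambda>x. x i) -` pball (c i) J \<inter> space borel)" by (auto simp: cube_def)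
  also have "\<dots> \<in> sets borel" by (intro sets.finite_INT measurable_sets[OF measurable_coordinate]) auto
  finally show ?thesis .
qed

context
  fixes \<beta> :: real
  assumes \<beta>: "0 < \<beta>"
begin

lemma schur_heat_n: "0 < t \<Longrightarrow> schur_kernel padic_haar_n 1 (heat_n \<beta> t :: ('n::finite \<Rightarrow> 'p::prime_card padic) \<Rightarrow> _)"
  using schur_kernel_prod[of "\<lambda>_. 1" "\<lambda>_ :: 'n. heat1 \<beta> t :: 'p padic \<Rightarrow> real", OF even_L1_heat1[OF \<beta>]]
  by (simp add: heat_n_def)

lemma schur_heat_n_cut: "0 \<le> t \<Longrightarrow> schur_kernel padic_haar_n 1 (heat_n_cut \<beta> J t :: ('n::finite \<Rightarrow> 'p::prime_card padic) \<Rightarrow> _)"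
  using schur_kernel_prod[of "\<lambda>_. 1" "\<lambda>_ :: 'n. heat1_cut \<beta> J t :: 'p padic \<Rightarrow> real", OF even_L1_heat1_cut[OF \<beta>]]
  by (simp add: heat_n_cut_def)

lemma ball_average_eq: "ball_average J = kernel_op padic_haar_n (heat_n_cut \<beta> J 0)"
  unfolding ball_average_def heat_n_cut_def by (simp add: heat1_cut_0[OF \<beta>, abs_def])

lemma schur_vlad_cut: "\<exists>C. schur_kernel padic_haar_n C (vlad_cut \<beta> J :: ('n::finite \<Rightarrow> 'p::prime_card padic) \<Rightarrow> _)"
proof -
  let ?a = "2 * symb (real CARD('p)) \<beta> J"
  have a: "?a > 0" using symb_pos[OF real_card_gt_1[where 'p='p] \<beta>] by simp
  have k: "schur_kernel padic_haar_n ?a (prod_kernel (\<lambda>k. if k = i then frac1_cut \<beta> J else heat1_cut \<beta> J 0) :: ('n \<Rightarrow> 'p padic) \<Rightarrow> _)" for i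
  proof -
    have "schur_kernel padic_haar_n (\<Prod>k\<in>UNIV. if k = i then ?a else 1) (prod_kernel (\<lambda>k. if k = i then frac1_cut \<beta> J else heat1_cut \<beta> J 0) :: ('n \<Rightarrow> 'p padic) \<Rightarrow> _)"
      by (rule schur_kernel_prod) (auto intro: even_L1_frac1_cut even_L1_heat1_cut \<beta>)
    then show ?thesis by simp
  qed
  show ?thesis
    unfolding vlad_cut_def
    by (intro exI, rule padic_n.schur_kernel_sum[OF finite_class.finite_UNIV _ a zero_less_one]) (rule k)
qed

text \<open>Differentiability at time 0 in operator norm. The difference quotient plus
  \<open>vlad_cut\<close> consists of the second-order remainder of the product, divided by
  \<open>t\<close>, and for each coordinate the one-variable error times ball averages; both parts
  are linear in \<open>t\<close>.\<close>

lemma schur_heat_n_derivative: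
  "\<exists>C. \<forall>t>0. schur_kernel padic_haar_n (t * C)
     (\<lambda>x y :: 'n::finite \<Rightarrow> 'p::prime_card padic. (heat_n_cut \<beta> J t x y - heat_n_cut \<beta> J 0 x y) / t + vlad_cut \<beta> J x y)"
proof -
  define a where "a = symb (real CARD('p)) \<beta> J"
  have a: "a > 0" using symb_pos[OF real_card_gt_1[where 'p='p] \<beta>] by (simp add: a_def)
  let ?n = "CARD('n)"
  \<comment> \<open>Two difference factors of constant 2 t a, at most \<open>?n\<close> factors of
    constant 2 and the division by \<open>t\<close> together give t K.\<close>
  define K where "K = 4 * a\<^sup>2 * 2 ^ ?n"
  have K: "K > 0" using a by (simp add: K_def)
  \<comment> \<open>The summands 1 absorb the slack that \<open>schur_kernel_sum\<close> adds in
    each of its three uses.\<close>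
  define C where "C = real ?n * (real ?n * K + 1) + 1 + (real ?n * a\<^sup>2 + 1)"
  have "schur_kernel padic_haar_n (t * C)
     (\<lambda>x y :: 'n \<Rightarrow> 'p padic. (heat_n_cut \<beta> J t x y - heat_n_cut \<beta> J 0 x y) / t + vlad_cut \<beta> J x y)" if t: "t > 0" for t
  proof -
    let ?X = "heat1_cut \<beta> J t :: 'p padic \<Rightarrow> real" and ?Y = "heat1_cut \<beta> J 0 :: 'p padic \<Rightarrow> real"
    let ?d = "\<lambda>z. \<bar>?X z - ?Y z\<bar>" and ?s = "\<lambda>z. ?X z + ?Y z"
    let ?e = "\<lambda>z. (?X z - ?Y z) / t + frac1_cut \<beta> J z"
    let ?P = "\<lambda>i l. prod_kernel (\<lambda>k. if k = i \<or> k = l then ?d else ?s) :: ('n \<Rightarrow> 'p padic) \<Rightarrow> _"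
    let ?R = "\<lambda>i. prod_kernel (\<lambda>k. if k = i then ?e else ?Y) :: ('n \<Rightarrow> 'p padic) \<Rightarrow> _"
    have d: "even_L1 (2 * t * a) ?d"
      unfolding a_def by (rule even_L1_abs) (rule heat1_cut_derivative(1)[OF \<beta> t])
    have s: "even_L1 2 ?s"
      using even_L1_add[OF even_L1_heat1_cut[OF \<beta>, of t J] even_L1_heat1_cut[OF \<beta>, of 0 J]] t by simp
    have e: "even_L1 (t * a\<^sup>2) ?e" unfolding a_def by (rule heat1_cut_derivative(2)[OF \<beta> t])
    have Y: "even_L1 1 ?Y" by (rule even_L1_heat1_cut[OF \<beta>]) simp
    have P: "schur_kernel padic_haar_n (t * K) (\<lambda>x y. (1 / t) * ?P i l x y)" if il: "i \<noteq> l" for i l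
    proof -
      have "schur_kernel padic_haar_n (\<Prod>k\<in>UNIV. if k = i \<or> k = l then 2 * t * a else 2) (?P i l)"
        by (rule schur_kernel_prod) (auto intro: d s)
      moreover have "(\<Prod>k\<in>UNIV. if k = i \<or> k = l then 2 * t * a else 2) \<le> (2 * t * a)\<^sup>2 * 2 ^ ?n"
      proof -
        have "{k. k = i \<or> k = l} = {i, l}" by auto
        then have "(\<Prod>k\<in>UNIV. if k = i \<or> k = l then 2 * t * a else 2) = (2 * t * a)\<^sup>2 * 2 ^ card (- {i, l})"
          using il by (simp add: prod.If_cases power2_eq_square)
        also have "\<dots> \<le> (2 * t * a)\<^sup>2 * 2 ^ ?n"
          by (intro mult_left_mono power_increasing card_mono) auto
        finally show ?thesis .
      qed
      ultimately have "schur_kernel padic_haar_n ((1 / t) * ((2 * t * a)\<^sup>2 * 2 ^ ?n)) (\<lambda>x y. (1 / t) * ?P i l x y)"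
        using t by (intro padic_n.schur_kernel_scale) (auto intro: padic_n.schur_kernel_weaken)
      moreover have "(1 / t) * ((2 * t * a)\<^sup>2 * 2 ^ ?n) = t * K"
        using t by (simp add: K_def power2_eq_square)
      ultimately show ?thesis by simp
    qed
    have P2: "schur_kernel padic_haar_n (t * (real ?n * K + 1)) (\<lambda>x y. \<Sum>l\<in>UNIV - {i}. (1 / t) * ?P i l x y)" for i
    proof -
      have "schur_kernel padic_haar_n (real (card (UNIV - {i})) * (t * K) + t) (\<lambda>x y. \<Sum>l\<in>UNIV - {i}. (1 / t) * ?P i l x y)"
        by (rule padic_n.schur_kernel_sum, simp, rule P) (use t K in auto)
      moreover have "real (card (UNIV - {i})) * (t * K) \<le> real ?n * (t * K)"
        using t K by (intro mult_right_mono of_nat_mono card_mono) auto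
      then have "real (card (UNIV - {i})) * (t * K) + t \<le> t * (real ?n * K + 1)" by (simp add: algebra_simps)
      ultimately show ?thesis by (rule padic_n.schur_kernel_weaken)
    qed
    have "t * (real ?n * K + 1) > 0" using t K by (simp add: add_nonneg_pos)
    from padic_n.schur_kernel_sum[OF finite_class.finite_UNIV P2 this t]
    have P3: "schur_kernel padic_haar_n (real ?n * (t * (real ?n * K + 1)) + t) (\<lambda>x y. \<Sum>i\<in>UNIV. \<Sum>l\<in>UNIV - {i}. (1 / t) * ?P i l x y)" .
    have R: "schur_kernel padic_haar_n (t * a\<^sup>2) (\<lambda>x y. \<bar>?R i x y\<bar>)" for i
    proof -
      have "schur_kernel padic_haar_n (\<Prod>k\<in>UNIV. if k = i then t * a\<^sup>2 else 1) (?R i)"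
        by (rule schur_kernel_prod) (auto intro: e Y)
      then show ?thesis by (intro padic_n.schur_kernel_abs) simp
    qed
    have "t * a\<^sup>2 > 0" using t a by simp
    from padic_n.schur_kernel_sum[OF finite_class.finite_UNIV R this t]
    have R2: "schur_kernel padic_haar_n (real ?n * (t * a\<^sup>2) + t) (\<lambda>x y. \<Sum>i\<in>UNIV. \<bar>?R i x y\<bar>)" .
    have eqC: "(real ?n * (t * (real ?n * K + 1)) + t) + (real ?n * (t * a\<^sup>2) + t) = t * C"
      by (simp add: C_def algebra_simps)
    show ?thesis
    proof (rule padic_n.schur_kernel_mono[OF padic_n.schur_kernel_add[OF P3 R2]])
      obtain C' where C': "schur_kernel padic_haar_n C' (vlad_cut \<beta> J :: ('n \<Rightarrow> 'p padic) \<Rightarrow> _)" using schur_vlad_cut by blast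
      note [measurable] = padic_n.schur_kernelD(1)[OF schur_heat_n_cut[OF less_imp_le[OF t], of J, where 'n='n and 'p='p], unfolded case_prod_unfold]
        padic_n.schur_kernelD(1)[OF schur_heat_n_cut[OF order_refl, of J, where 'n='n and 'p='p], unfolded case_prod_unfold]
        padic_n.schur_kernelD(1)[OF C', unfolded case_prod_unfold]
      show "(\<lambda>(x, y). (heat_n_cut \<beta> J t x y - heat_n_cut \<beta> J 0 x y) / t + vlad_cut \<beta> J x y)
          \<in> borel_measurable (padic_haar_n \<Otimes>\<^sub>M (padic_haar_n :: ('n \<Rightarrow> 'p padic) measure))"
        unfolding case_prod_unfold by measurable
      show "real ?n * (t * (real ?n * K + 1)) + t + (real ?n * (t * a\<^sup>2) + t) \<le> t * C" using eqC by simp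
      fix x y :: "'n \<Rightarrow> 'p padic"
      define X where "X k = ?X (x k - y k)" for k
      define Y where "Y k = ?Y (x k - y k)" for k
      define b where "b k = (frac1_cut \<beta> J (x k - y k) :: real)" for k
      have nn: "0 \<le> X k" "0 \<le> Y k" for k
        using t by (auto simp: X_def Y_def intro!: heat1_cut_nonneg \<beta>)
      have eR: "?R i x y = (\<Prod>k\<in>UNIV. if k = i then X k - Y k else Y k) / t + (\<Prod>k\<in>UNIV. if k = i then b k else Y k)" for i
      proof -
        have split: "(\<Prod>k\<in>UNIV. if k = i then u k else Y k) = u i * (\<Prod>k\<in>UNIV - {i}. Y k)" for u :: "'n \<Rightarrow> real"
          by (subst prod.remove[of _ i]) (auto intro!: prod.cong)
        have "?R i x y = (\<Prod>k\<in>UNIV. if k = i then (X k - Y k) / t + b k else Y k)"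
          unfolding prod_kernel_def by (intro prod.cong) (auto simp: X_def Y_def b_def)
        then show ?thesis unfolding split by (simp add: distrib_right)
      qed
      have eV: "vlad_cut \<beta> J x y = (\<Sum>i\<in>UNIV. \<Prod>k\<in>UNIV. if k = i then b k else Y k)"
        unfolding vlad_cut_def prod_kernel_def by (intro sum.cong prod.cong) (auto simp: b_def Y_def)
      have eP: "?P i l x y = (\<Prod>k\<in>UNIV. if k = i \<or> k = l then \<bar>X k - Y k\<bar> else X k + Y k)" for i l
        unfolding prod_kernel_def by (intro prod.cong) (auto simp: X_def Y_def)
      have eH: "heat_n_cut \<beta> J t x y = (\<Prod>k\<in>UNIV. X k)" "heat_n_cut \<beta> J 0 x y = (\<Prod>k\<in>UNIV. Y k)"
        by (simp_all add: heat_n_cut_def prod_kernel_def X_def Y_def)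
      \<comment> \<open>The first-order terms: they are subtracted from the difference of the
        products and restored inside \<open>?R\<close>, where they meet the summands of
        \<open>vlad_cut\<close>.\<close>
      let ?S = "\<Sum>i\<in>UNIV. \<Prod>k\<in>UNIV. if k = i then X k - Y k else Y k"
      have "(\<Sum>i\<in>UNIV. \<Sum>l\<in>UNIV - {i}. ?P i l x y)
          = (\<Sum>i\<in>UNIV. \<Sum>l\<in>UNIV - {i}. \<Prod>k\<in>UNIV. if k = i \<or> k = l then \<bar>X k - Y k\<bar> else X k + Y k)"
        by (rule sum.cong[OF refl], rule sum.cong[OF refl], rule eP)
      then have bound: "\<bar>(\<Prod>k\<in>UNIV. X k) - (\<Prod>k\<in>UNIV. Y k) - ?S\<bar> \<le> (\<Sum>i\<in>UNIV. \<Sum>l\<in>UNIV - {i}. ?P i l x y)"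
        using prod_second_order_bound[of UNIV X Y, OF finite_class.finite_UNIV nn] by (simp only:)
      let ?A = "(\<Prod>k\<in>UNIV. X k) - (\<Prod>k\<in>UNIV. Y k) - ?S" and ?B = "\<Sum>i\<in>UNIV. ?R i x y"
      have eq: "(heat_n_cut \<beta> J t x y - heat_n_cut \<beta> J 0 x y) / t + vlad_cut \<beta> J x y
          = ((\<Prod>k\<in>UNIV. X k) - (\<Prod>k\<in>UNIV. Y k) - ?S) / t + (\<Sum>i\<in>UNIV. ?R i x y)"
        unfolding eH eV eR sum.distrib by (simp add: diff_divide_distrib sum_divide_distrib)
      have "\<bar>?A / t + ?B\<bar> \<le> \<bar>?A / t\<bar> + \<bar>?B\<bar>" by (rule abs_triangle_ineq)
      moreover have "\<bar>?B\<bar> \<le> (\<Sum>i\<in>UNIV. \<bar>?R i x y\<bar>)" by (rule sum_abs)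
      moreover have "\<bar>?A / t\<bar> \<le> (\<Sum>i\<in>UNIV. \<Sum>l\<in>UNIV - {i}. (1 / t) * ?P i l x y)"
      proof -
        have "\<bar>?A / t\<bar> = \<bar>?A\<bar> / t" using t by (simp only: abs_divide abs_of_pos)
        also have "\<dots> \<le> (\<Sum>i\<in>UNIV. \<Sum>l\<in>UNIV - {i}. ?P i l x y) / t"
          by (rule divide_right_mono[OF bound]) (use t in simp)
        also have "\<dots> = (\<Sum>i\<in>UNIV. \<Sum>l\<in>UNIV - {i}. (1 / t) * ?P i l x y)"
          by (simp add: sum_divide_distrib)
        finally show ?thesis .
      qed
      ultimately have "\<bar>?A / t + ?B\<bar> \<le> (\<Sum>i\<in>UNIV. \<Sum>l\<in>UNIV - {i}. (1 / t) * ?P i l x y) + (\<Sum>i\<in>UNIV. \<bar>?R i x y\<bar>)"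
        by linarith
      then show "\<bar>(heat_n_cut \<beta> J t x y - heat_n_cut \<beta> J 0 x y) / t + vlad_cut \<beta> J x y\<bar>
          \<le> \<bar>(\<Sum>i\<in>UNIV. \<Sum>l\<in>UNIV - {i}. (1 / t) * ?P i l x y) + (\<Sum>i\<in>UNIV. \<bar>?R i x y\<bar>)\<bar>"
        unfolding eq by (rule order_trans[OF _ abs_ge_self])
    qed
  qed
  then show ?thesis by blast
qed

lemma ball_average_L2:
  "f \<in> L2_functions padic_haar_n \<Longrightarrow> ball_average J f \<in> L2_functions padic_haar_n"
  "f \<in> L2_functions padic_haar_n \<Longrightarrow> L2_norm padic_haar_n (ball_average J f) \<le> L2_norm padic_haar_n f"
  using padic_n.kernel_op_L2[OF schur_heat_n_cut[OF order_refl, of J]] by (simp_all add: ball_average_eq)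

lemma ball_average_level: "level J (ball_average J (f :: ('n::finite \<Rightarrow> 'p::prime_card padic) \<Rightarrow> complex))"
  unfolding level_def
proof (intro allI impI)
  fix x y :: "'n \<Rightarrow> 'p padic" assume y: "y \<in> cube x J"
  have "ball_kernel J (y i - z i) = ball_kernel J (x i - z i)" for z i
  proof -
    have "y i \<in> pball (x i) J" using y by (simp add: cube_def)
    then have "y i \<in> pball (z i) J \<longleftrightarrow> x i \<in> pball (z i) J" using pball_trans pball_commute by blast
    then show ?thesis by (simp add: ball_kernel_def indicator_def mem_pball)
  qed
  then show "ball_average J f y = ball_average J f x"
    by (simp add: ball_average_def kernel_op_def prod_kernel_def)
qed

lemma ball_average_of_level:
  assumes f: "level K f" and J: "J \<le> K"
  shows "ball_average J f = (f :: ('n::finite \<Rightarrow> 'p::prime_card padic) \<Rightarrow> complex)"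
proof
  fix x :: "'n \<Rightarrow> 'p padic"
  let ?k = "prod_kernel (\<lambda>_. ball_kernel J) :: ('n \<Rightarrow> 'p padic) \<Rightarrow> _"
  have "ball_average J f x = (LINT y|padic_haar_n. complex_of_real (?k x y) * f x)"
    unfolding ball_average_def kernel_op_def
  proof (rule Bochner_Integration.integral_cong[OF refl])
    fix y
    show "complex_of_real (?k x y) * f y = complex_of_real (?k x y) * f x"
    proof (cases "y \<in> cube x J")
      case True
      then have "f y = f x" using f cube_mono[OF J] by (auto simp: level_def)
      then show ?thesis by simp
    next
      case False
      then obtain i where "y i \<notin> pball (x i) J" by (auto simp: cube_def)
      then have "ball_kernel J (x i - y i) = 0"
        using pball_commute[of "y i" "x i" J] by (simp add: ball_kernel_def mem_pball)
      then have "?k x y = 0" unfolding prod_kernel_def by (intro prod_zero) auto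
      then show ?thesis by simp
    qed
  qed
  also have "\<dots> = complex_of_real (LINT y|padic_haar_n. ?k x y) * f x" by simp
  also have "(LINT y|padic_haar_n. ?k x y) = 1"
  proof -
    have m: "(\<lambda>y. ball_kernel J (a - y)) \<in> borel_measurable borel" for a :: "'p padic"
      by (rule measurable_compose[OF _ ball_kernel_measurable], intro borel_measurable_continuous_onI continuous_intros)
    have mi: "(\<lambda>y. ball_kernel J (x i - y i)) \<in> borel_measurable borel" for i
      by (rule measurable_compose[OF measurable_coordinate m])
    have "(LINT y|padic_haar_n. ?k x y) = enn2real (\<integral>\<^sup>+y. ennreal (?k x y) \<partial>padic_haar_n)"
      unfolding prod_kernel_def
      by (intro integral_eq_nn_integral)
        (auto intro!: prod_nonneg borel_measurable_prod mi)
    also have "(\<integral>\<^sup>+y. ennreal (?k x y) \<partial>padic_haar_n) = (\<integral>\<^sup>+y. (\<Prod>i\<in>UNIV. ennreal (ball_kernel J (x i - y i))) \<partial>padic_haar_n)"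
      by (simp add: prod_kernel_def prod_ennreal)
    also have "\<dots> = (\<Prod>i\<in>UNIV. \<integral>\<^sup>+y. ennreal (ball_kernel J (x i - y)) \<partial>padic_haar)"
      by (rule nn_integral_padic_haar_n_prod[where f = "\<lambda>i y. ennreal (ball_kernel J (x i - y))"])
        (rule measurable_compose[OF m measurable_ennreal])
    also have "\<dots> = 1"
    proof (rule prod.neutral, rule ballI)
      fix i
      have "(\<integral>\<^sup>+y. ennreal (ball_kernel J (x i - y)) \<partial>padic_haar) = (\<integral>\<^sup>+y. ennreal (ball_kernel J (y - x i)) \<partial>padic_haar)"
        using ball_kernel_minus[of J "x i - y" for y] by (intro nn_integral_cong) simp
      also have "\<dots> = 1"
        using nn_integral_padic_translate[of "\<lambda>y. ennreal (ball_kernel J y)" "x i"] by (simp add: nn_integral_ball_kernel)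
      finally show "(\<integral>\<^sup>+y. ennreal (ball_kernel J (x i - y)) \<partial>padic_haar) = 1" .
    qed
    finally show ?thesis by simp
  qed
  finally show "ball_average J f x = f x" by simp
qed

text \<open>Both compositions have the smoothed kernel. Hence averaging commutes with the heat
  semigroup, and on functions of level \<open>J\<close> the heat kernel may be replaced by its
  smoothed version.\<close>

lemma heat_n_ball_average:
  assumes t: "0 < t" and f: "f \<in> L2_functions padic_haar_n"
  shows "kernel_op padic_haar_n (heat_n \<beta> t) (ball_average J f) = kernel_op padic_haar_n (heat_n_cut \<beta> J t) (f :: ('n::finite \<Rightarrow> 'p::prime_card padic) \<Rightarrow> complex)"
    and "ball_average J (kernel_op padic_haar_n (heat_n \<beta> t) f) = kernel_op padic_haar_n (heat_n_cut \<beta> J t) f"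
proof -
  show "kernel_op padic_haar_n (heat_n \<beta> t) (ball_average J f) = kernel_op padic_haar_n (heat_n_cut \<beta> J t) f"
  proof
    fix x
    show "kernel_op padic_haar_n (heat_n \<beta> t) (ball_average J f) x = kernel_op padic_haar_n (heat_n_cut \<beta> J t) f x"
      unfolding ball_average_eq
    proof (rule padic_n.kernel_op_compose[OF schur_heat_n[OF t] schur_heat_n_cut[OF order_refl] f])
      fix z
      show "(LINT y|padic_haar_n. heat_n \<beta> t x y * heat_n_cut \<beta> J 0 y z) = heat_n_cut \<beta> J t x z"
        unfolding heat_n_def heat_n_cut_def
        by (rule prod_kernel_composition[OF even_L1_heat1[OF \<beta> t] heat1_nonneg[OF \<beta> t]
              even_L1_heat1_cut[OF \<beta> order_refl] heat1_cut_nonneg[OF \<beta> order_refl]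
              heat1_cut_nonneg[OF \<beta> less_imp_le[OF t]] heat1_convolution_cut(1)[OF \<beta> t]])
    qed simp
  qed
  show "ball_average J (kernel_op padic_haar_n (heat_n \<beta> t) f) = kernel_op padic_haar_n (heat_n_cut \<beta> J t) f"
  proof
    fix x
    show "ball_average J (kernel_op padic_haar_n (heat_n \<beta> t) f) x = kernel_op padic_haar_n (heat_n_cut \<beta> J t) f x"
      unfolding ball_average_eq
    proof (rule padic_n.kernel_op_compose[OF schur_heat_n_cut[OF order_refl] schur_heat_n[OF t] f])
      fix z
      show "(LINT y|padic_haar_n. heat_n_cut \<beta> J 0 x y * heat_n \<beta> t y z) = heat_n_cut \<beta> J t x z"
        unfolding heat_n_def heat_n_cut_def
        by (rule prod_kernel_composition[OF even_L1_heat1_cut[OF \<beta> order_refl] heat1_cut_nonneg[OF \<beta> order_refl]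
              even_L1_heat1[OF \<beta> t] heat1_nonneg[OF \<beta> t]
              heat1_cut_nonneg[OF \<beta> less_imp_le[OF t]] heat1_convolution_cut(2)[OF \<beta> t]])
    qed simp
  qed
qed

lemma heat_n_compose:
  assumes s: "0 < s" and t: "0 < t" and f: "f \<in> L2_functions padic_haar_n"
  shows "kernel_op padic_haar_n (heat_n \<beta> s) (kernel_op padic_haar_n (heat_n \<beta> t) f)
    = kernel_op padic_haar_n (heat_n \<beta> (s + t)) (f :: ('n::finite \<Rightarrow> 'p::prime_card padic) \<Rightarrow> complex)"
proof
  fix x
  have st: "0 < s + t" using s t by simp
  show "kernel_op padic_haar_n (heat_n \<beta> s) (kernel_op padic_haar_n (heat_n \<beta> t) f) x
    = kernel_op padic_haar_n (heat_n \<beta> (s + t)) f x"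
  proof (rule padic_n.kernel_op_compose[OF schur_heat_n[OF s] schur_heat_n[OF t] f])
    fix z
    show "(LINT y|padic_haar_n. heat_n \<beta> s x y * heat_n \<beta> t y z) = heat_n \<beta> (s + t) x z"
      unfolding heat_n_def
      by (rule prod_kernel_composition[OF even_L1_heat1[OF \<beta> s] heat1_nonneg[OF \<beta> s]
            even_L1_heat1[OF \<beta> t] heat1_nonneg[OF \<beta> t] heat1_nonneg[OF \<beta> st] heat1_convolution[OF \<beta> s t]])
  qed simp
qed

text \<open>Such an \<open>f\<close> equals its own average, so the error of the difference quotient
  is the operator of \<open>schur_heat_n_derivative\<close> applied to \<open>f\<close>, of norm at
  most a multiple of \<open>t\<close>.\<close>

lemma heat_sg_generator_level:
  fixes f :: "('n::finite \<Rightarrow> 'p::prime_card padic) \<Rightarrow> complex"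
  assumes f: "f \<in> L2_functions padic_haar_n" and lev: "level J f"
  shows "has_generator_value padic_haar_n (heat_sg \<beta>) f (\<lambda>x. - kernel_op padic_haar_n (vlad_cut \<beta> J) f x)"
  unfolding has_generator_value_def
proof -
  obtain C where C: "\<And>t. t > 0 \<Longrightarrow> schur_kernel padic_haar_n (t * C)
     (\<lambda>x y :: 'n \<Rightarrow> 'p padic. (heat_n_cut \<beta> J t x y - heat_n_cut \<beta> J 0 x y) / t + vlad_cut \<beta> J x y)"
    using schur_heat_n_derivative by blast
  obtain D where D: "schur_kernel padic_haar_n D (vlad_cut \<beta> J :: ('n \<Rightarrow> 'p padic) \<Rightarrow> _)" using schur_vlad_cut by blast
  have fE: "ball_average J f = f" by (rule ball_average_of_level[OF lev order_refl])
  have le: "L2_norm padic_haar_n (\<lambda>x. (heat_sg \<beta> t f x - f x) / of_real t - - kernel_op padic_haar_n (vlad_cut \<beta> J) f x)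
      \<le> t * C * L2_norm padic_haar_n f" if t: "t > 0" for t
  proof -
    note s1 = schur_heat_n_cut[OF less_imp_le[OF t], of J, where 'n='n and 'p='p]
    note s0 = schur_heat_n_cut[OF order_refl, of J, where 'n='n and 'p='p]
    have Tf: "heat_sg \<beta> t f = kernel_op padic_haar_n (heat_n_cut \<beta> J t) f"
      using heat_n_ball_average(1)[OF t f, of J] t by (simp add: heat_sg_def fE)
    have f0: "f = kernel_op padic_haar_n (heat_n_cut \<beta> J 0) f"
      using fE unfolding ball_average_eq by simp
    \<comment> \<open>The difference of the two kernels is handled by domination: its modulus is at
      most the sum of the two nonnegative kernels.\<close>
    have dd: "schur_kernel padic_haar_n (1 / t * (1 + 1)) (\<lambda>x y :: 'n \<Rightarrow> 'p padic. (1 / t) * (heat_n_cut \<beta> J t x y + \<bar>- heat_n_cut \<beta> J 0 x y\<bar>))"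
      using t padic_n.schur_kernel_abs[OF s0] by (intro padic_n.schur_kernel_scale padic_n.schur_kernel_add s1) simp_all
    have nn: "0 \<le> heat_n_cut \<beta> J s x y" if "0 \<le> s" for s and x y :: "'n \<Rightarrow> 'p padic"
      unfolding heat_n_cut_def prod_kernel_def using that by (intro prod_nonneg heat1_cut_nonneg \<beta> ballI)
    have d: "schur_kernel padic_haar_n (1 / t * (1 + 1)) (\<lambda>x y :: 'n \<Rightarrow> 'p padic. (1 / t) * heat_n_cut \<beta> J t x y + (- 1 / t) * heat_n_cut \<beta> J 0 x y)"
    proof (rule padic_n.schur_kernel_mono[OF dd])
      note [measurable] = padic_n.schur_kernelD(1)[OF s1, unfolded case_prod_unfold] padic_n.schur_kernelD(1)[OF s0, unfolded case_prod_unfold]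
      show "(\<lambda>(x, y). (1 / t) * heat_n_cut \<beta> J t x y + (- 1 / t) * heat_n_cut \<beta> J 0 x y) \<in> borel_measurable (padic_haar_n \<Otimes>\<^sub>M (padic_haar_n :: ('n \<Rightarrow> 'p padic) measure))"
        unfolding case_prod_unfold by measurable
      fix x y :: "'n \<Rightarrow> 'p padic"
      have "\<bar>heat_n_cut \<beta> J t x y - heat_n_cut \<beta> J 0 x y\<bar> \<le> heat_n_cut \<beta> J t x y + heat_n_cut \<beta> J 0 x y"
        using nn[of t x y] nn[of 0 x y] t by linarith
      then have "\<bar>heat_n_cut \<beta> J t x y - heat_n_cut \<beta> J 0 x y\<bar> / t \<le> (heat_n_cut \<beta> J t x y + heat_n_cut \<beta> J 0 x y) / t"
        using t by (intro divide_right_mono) auto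
      then show "\<bar>(1 / t) * heat_n_cut \<beta> J t x y + (- 1 / t) * heat_n_cut \<beta> J 0 x y\<bar> \<le> \<bar>(1 / t) * (heat_n_cut \<beta> J t x y + \<bar>- heat_n_cut \<beta> J 0 x y\<bar>)\<bar>"
        using nn[of t x y] nn[of 0 x y] t by (simp add: abs_mult flip: diff_divide_distrib)
    qed simp
    have "kernel_op padic_haar_n (\<lambda>x y. (heat_n_cut \<beta> J t x y - heat_n_cut \<beta> J 0 x y) / t + vlad_cut \<beta> J x y) f x
        = (heat_sg \<beta> t f x - f x) / of_real t - - kernel_op padic_haar_n (vlad_cut \<beta> J) f x" for x
    proof -
      have "kernel_op padic_haar_n (\<lambda>x y. 1 * ((1 / t) * heat_n_cut \<beta> J t x y + (- 1 / t) * heat_n_cut \<beta> J 0 x y) + 1 * vlad_cut \<beta> J x y) f x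
          = of_real 1 * kernel_op padic_haar_n (\<lambda>x y. (1 / t) * heat_n_cut \<beta> J t x y + (- 1 / t) * heat_n_cut \<beta> J 0 x y) f x
            + of_real 1 * kernel_op padic_haar_n (vlad_cut \<beta> J) f x"
        by (rule padic_n.kernel_op_linear_kernel[OF d D f]) simp
      also have "kernel_op padic_haar_n (\<lambda>x y. (1 / t) * heat_n_cut \<beta> J t x y + (- 1 / t) * heat_n_cut \<beta> J 0 x y) f x
          = of_real (1 / t) * kernel_op padic_haar_n (heat_n_cut \<beta> J t) f x + of_real (- 1 / t) * kernel_op padic_haar_n (heat_n_cut \<beta> J 0) f x"
        by (rule padic_n.kernel_op_linear_kernel[OF s1 s0 f]) simp
      also have "\<dots> = (heat_sg \<beta> t f x - f x) / of_real t"
        unfolding Tf f0[symmetric] by (simp add: diff_divide_distrib)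
      finally show ?thesis by (simp add: diff_divide_distrib)
    qed
    then have "L2_norm padic_haar_n (\<lambda>x. (heat_sg \<beta> t f x - f x) / of_real t - - kernel_op padic_haar_n (vlad_cut \<beta> J) f x)
        = L2_norm padic_haar_n (kernel_op padic_haar_n (\<lambda>x y. (heat_n_cut \<beta> J t x y - heat_n_cut \<beta> J 0 x y) / t + vlad_cut \<beta> J x y) f)"
      by presburger
    also have "\<dots> \<le> t * C * L2_norm padic_haar_n f" by (rule padic_n.kernel_op_L2(2)[OF C[OF t] f])
    finally show ?thesis .
  qed
  show "((\<lambda>t. L2_norm padic_haar_n (\<lambda>x. (heat_sg \<beta> t f x - f x) / of_real t - - kernel_op padic_haar_n (vlad_cut \<beta> J) f x)) \<longlongrightarrow> 0) (at_right 0)"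
  proof (rule tendsto_sandwich[OF _ _ tendsto_const])
    show "eventually (\<lambda>t. L2_norm padic_haar_n (\<lambda>x. (heat_sg \<beta> t f x - f x) / of_real t - - kernel_op padic_haar_n (vlad_cut \<beta> J) f x)
        \<le> t * C * L2_norm padic_haar_n f) (at_right 0)"
      using eventually_at_right_less[of 0] by eventually_elim (rule le)
    have "((\<lambda>t. t * C * L2_norm padic_haar_n f) \<longlongrightarrow> 0 * C * L2_norm padic_haar_n f) (at_right 0)"
      by (intro tendsto_intros)
    then show "((\<lambda>t. t * C * L2_norm padic_haar_n f) \<longlongrightarrow> 0) (at_right 0)" by simp
  qed simp
qed

end

subsection \<open>Cubes and test functions\<close>

lemma open_cube: "open (cube (c :: 'n::finite \<Rightarrow> 'p::prime_card padic) J)"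
proof -
  have "cube c J = (\<Inter>i\<in>UNIV. (\<lambda>x. x i) -` pball (c i) J)" by (auto simp: cube_def)
  also have "open \<dots>"
    by (intro open_INT ballI open_vimage open_pball continuous_on_product_coordinates) auto
  finally show ?thesis .
qed

lemma compact_cube: "compact (cube (c :: 'n::finite \<Rightarrow> 'p::prime_card padic) J)"
proof -
  have "compactin (product_topology (\<lambda>_. euclidean) UNIV) (Pi\<^sub>E UNIV (\<lambda>i. pball (c i) J))"
    by (subst compactin_PiE) (auto simp: compact_pball)
  then show ?thesis by (simp add: euclidean_product_topology cube_eq_PiE)
qed

lemma open_contains_cube:
  assumes "open U" "c \<in> U"
  obtains J where "J \<le> m" "cube (c :: 'n::finite \<Rightarrow> 'p::prime_card padic) J \<subseteq> U"
proof -
  have "openin (product_topology (\<lambda>_ :: 'n. euclidean) UNIV) U"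
    using assms(1) by (simp add: euclidean_product_topology)
  then obtain X where X: "c \<in> Pi\<^sub>E UNIV X" "\<And>i. open (X i)" "Pi\<^sub>E UNIV X \<subseteq> U"
    using product_topology_open_contains_basis[OF _ assms(2), of "\<lambda>_. euclidean" UNIV] by auto
  have "\<exists>k. pball (c i) k \<subseteq> X i" for i
  proof -
    have "c i \<in> X i" using X(1) by auto
    then obtain k where "k \<le> 0" "pball (c i) k \<subseteq> X i" by (rule open_contains_pball[OF X(2)])
    then show ?thesis by blast
  qed
  then obtain k where k: "\<And>i. pball (c i) (k i) \<subseteq> X i" by metis
  define J where "J = min m (Min (range k))"
  have "cube c J \<subseteq> Pi\<^sub>E UNIV X"
  proof
    fix x assume x: "x \<in> cube c J"
    have "J \<le> k i" for i unfolding J_def by (intro min.coboundedI2 Min_le) auto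
    then have "x i \<in> pball (c i) (k i)" for i
      using x pball_mono[of J "k i" "c i"] by (auto simp: cube_def)
    then show "x \<in> Pi\<^sub>E UNIV X" using k by auto
  qed
  with X(3) that[of J] show thesis by (auto simp: J_def)
qed

lemma cube_exhaust: "\<exists>N::nat. x \<in> cube (\<lambda>_. 0) (int N)" for x :: "'n::finite \<Rightarrow> 'p::prime_card padic"
proof -
  have "\<exists>k::nat. x i \<in> pball 0 (int k)" for i
    using pball_exhaust by blast
  then obtain k :: "'n \<Rightarrow> nat" where k: "\<And>i. x i \<in> pball 0 (int (k i))" by metis
  have "x i \<in> pball 0 (int (Max (range k)))" for i
    using k[of i] pball_mono[of "int (k i)" "int (Max (range k))" 0] by auto
  then show ?thesis by (auto simp: cube_def)
qed

lemma compact_subset_cube: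
  assumes K: "compact (K :: ('n::finite \<Rightarrow> 'p::prime_card padic) set)"
  obtains N :: nat where "K \<subseteq> cube (\<lambda>_. 0) (int N)"
proof -
  have cov: "K \<subseteq> (\<Union>N\<in>UNIV. cube (\<lambda>_. 0) (int N))" using cube_exhaust by blast
  obtain G where G: "finite G" "K \<subseteq> (\<Union>N\<in>G. cube (\<lambda>_. 0) (int N))"
    by (rule compactE_image[OF K, of UNIV "\<lambda>N. cube (\<lambda>_. 0) (int N)", OF open_cube cov]) blast
  have "K \<subseteq> cube (\<lambda>_. 0) (int (Max (insert 0 G)))"
  proof
    fix x assume "x \<in> K"
    then obtain N where N: "N \<in> G" "x \<in> cube (\<lambda>_. 0) (int N)" using G(2) by auto
    have "N \<le> Max (insert 0 G)" using N(1) G(1) by (intro Max_ge) auto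
    then show "x \<in> cube (\<lambda>_. 0) (int (Max (insert 0 G)))"
      using N(2) cube_mono[of "int N" "int (Max (insert 0 G))" "\<lambda>_. 0"] by auto
  qed
  then show thesis by (rule that)
qed

lemma cube_rat_center:
  obtains q where "(x :: 'n::finite \<Rightarrow> 'p::prime_card padic) \<in> cube (\<lambda>i. of_rat (q i)) J"
proof -
  have "\<exists>q. x i \<in> pball (of_rat q) J" for i by (rule pball_rat_center[of "x i" J]) blast
  then obtain q where "\<And>i. x i \<in> pball (of_rat (q i)) J" by metis
  then show thesis using that[of q] by (simp add: cube_def)
qed

text \<open>Provides the generators for the induction over Borel sets that proves convergence of
  averages.\<close>

lemma sets_borel_cube:
  "sets (borel :: ('n::finite \<Rightarrow> 'p::prime_card padic) measure) = sigma_sets UNIV ({{}} \<union> {cube c J | c J. True})"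
    (is "_ = sigma_sets UNIV ?E")
proof
  show "sigma_sets UNIV ?E \<subseteq> sets (borel :: ('n \<Rightarrow> 'p padic) measure)"
    by (rule sets.sigma_sets_subset') (auto intro: borel_open open_cube)
  have "U \<in> sigma_sets UNIV ?E" if U: "open U" for U :: "('n \<Rightarrow> 'p padic) set"
  proof -
    let ?I = "{(q :: 'n \<Rightarrow> rat, J). cube (\<lambda>i. of_rat (q i)) J \<subseteq> U}"
    have "x \<in> (\<Union>(q, J)\<in>?I. cube (\<lambda>i. of_rat (q i)) J)" if x: "x \<in> U" for x
    proof -
      obtain J where J: "J \<le> 0" "cube x J \<subseteq> U" by (rule open_contains_cube[OF U x])
      obtain r where r: "x \<in> cube (\<lambda>i. of_rat (r i)) J" by (rule cube_rat_center)
      with J cube_eq[OF r] show ?thesis by (intro UN_I[of "(r, J)"]) auto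
    qed
    then have "U = (\<Union>(q, J)\<in>?I. cube (\<lambda>i. of_rat (q i)) J)" by auto
    also have "\<dots> \<in> sigma_sets UNIV ?E"
      by (rule sigma_sets_UNION) (auto intro!: sigma_sets.Basic countable_image)
    finally show ?thesis .
  qed
  then show "sets (borel :: ('n \<Rightarrow> 'p padic) measure) \<subseteq> sigma_sets UNIV ?E"
    unfolding borel_def by (subst sets_measure_of) (auto intro!: sigma_sets_mono)
qed

lemma level_measurable:
  assumes "level J f"
  shows "(f :: ('n::finite \<Rightarrow> 'p::prime_card padic) \<Rightarrow> complex) \<in> borel_measurable borel"
proof (rule borel_measurable_continuous_onI)
  have "open (f -` U)" for U
  proof (subst open_subopen, intro ballI)
    fix x assume "x \<in> f -` U"
    then show "\<exists>T. open T \<and> x \<in> T \<and> T \<subseteq> f -` U"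
      using assms by (intro exI[of _ "cube x J"]) (auto simp: open_cube level_def)
  qed
  then show "continuous_on UNIV f" by (simp add: continuous_on_open_vimage)
qed

lemma level_indicator_cube: "J \<le> K \<Longrightarrow> level J (indicator (cube c K) :: ('n::finite \<Rightarrow> 'p::prime_card padic) \<Rightarrow> complex)"
  unfolding level_def
proof (intro allI impI)
  fix x y :: "'n \<Rightarrow> 'p padic" assume "J \<le> K" "y \<in> cube x J"
  then have "y \<in> cube x K" using cube_mono by blast
  then have "y \<in> cube c K \<longleftrightarrow> x \<in> cube c K" using cube_eq cube_commute by blast
  then show "(indicator (cube c K) y :: complex) = indicator (cube c K) x" by (simp add: indicator_def)
qed

lemma level_mult: "level J f \<Longrightarrow> level J g \<Longrightarrow> level J (\<lambda>x. f x * g x)"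
  by (auto simp: level_def)

text \<open>Compactness of the support makes local constancy uniform: finitely many of the local
  cubes cover it, and the smallest of their exponents works everywhere.\<close>

lemma test_function_level:
  fixes f :: "('n::finite \<Rightarrow> 'p::prime_card padic) \<Rightarrow> complex"
  assumes f: "f \<in> test_functions"
  obtains J N where "level J f" "\<And>x. f x \<noteq> 0 \<Longrightarrow> x \<in> cube (\<lambda>_. 0) (int N)"
proof -
  let ?K = "closure {x. f x \<noteq> 0}"
  have K: "compact ?K" using f by (simp add: test_functions_def)
  have "\<exists>J. \<forall>y\<in>cube x J. f y = f x" for x
  proof -
    obtain U where U: "open U" "x \<in> U" "\<forall>y\<in>U. f y = f x" using f by (auto simp: test_functions_def)
    obtain J where "J \<le> 0" "cube x J \<subseteq> U" by (rule open_contains_cube[OF U(1,2)])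
    then show ?thesis using U(3) by (intro exI[of _ J]) auto
  qed
  then obtain k where k: "\<And>x y. y \<in> cube x (k x) \<Longrightarrow> f y = f x" by metis
  have cov: "?K \<subseteq> (\<Union>x\<in>UNIV. cube x (k x))" using cube_center by blast
  obtain F where F: "finite F" "?K \<subseteq> (\<Union>x\<in>F. cube x (k x))"
    by (rule compactE_image[OF K, of UNIV "\<lambda>x. cube x (k x)", OF open_cube cov]) blast
  define J where "J = Min (insert 0 (k ` F))"
  have Jk: "J \<le> k a" if "a \<in> F" for a unfolding J_def using F(1) that by (intro Min_le) auto
  have loc: "f y = f x" if x: "x \<in> ?K" and y: "y \<in> cube x J" for x y
  proof -
    obtain a where a: "a \<in> F" "x \<in> cube a (k a)" using F(2) x by auto
    have "y \<in> cube a (k a)" using cube_eq[OF a(2)] cube_mono[OF Jk[OF a(1)], of x] y by auto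
    then show ?thesis using k a(2) by metis
  qed
  have "level J f"
    unfolding level_def
  proof (intro allI impI)
    fix x y :: "'n \<Rightarrow> 'p padic" assume y: "y \<in> cube x J"
    \<comment> \<open>The roles of the two points are symmetric, so it is enough that one of them
      lies in the closed support; otherwise both values are 0.\<close>
    then have x: "x \<in> cube y J" by (simp add: cube_commute)
    have out: "f z = 0" if "z \<notin> ?K" for z
      using that subsetD[OF closure_subset[of "{x. f x \<noteq> 0}"], of z] by auto
    show "f y = f x"
    proof (cases "x \<in> ?K \<or> y \<in> ?K")
      case True
      then show ?thesis using loc[OF _ y] loc[OF _ x] by metis
    next
      case False
      then have "f x = 0" "f y = 0" using out[of x] out[of y] by blast+
      then show ?thesis by (simp only:)
    qed
  qed
  moreover
  obtain N :: nat where N: "?K \<subseteq> cube (\<lambda>_. 0) (int N)"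
    by (rule compact_subset_cube[OF K])
  have "x \<in> cube (\<lambda>_. 0) (int N)" if "f x \<noteq> 0" for x
  proof -
    have "x \<in> ?K" by (rule subsetD[OF closure_subset]) (use that in simp)
    then show ?thesis by (rule subsetD[OF N])
  qed
  ultimately show thesis by (rule that)
qed

lemma level_test_function:
  fixes f :: "('n::finite \<Rightarrow> 'p::prime_card padic) \<Rightarrow> complex"
  assumes f: "level J f" and N: "\<And>x. f x \<noteq> 0 \<Longrightarrow> x \<in> cube (\<lambda>_. 0) N"
  shows "f \<in> test_functions"
  unfolding test_functions_def
proof (intro CollectI conjI allI)
  show "\<exists>U. open U \<and> x \<in> U \<and> (\<forall>y\<in>U. f y = f x)" for x
    using f by (intro exI[of _ "cube x J"]) (auto simp: open_cube level_def)
  have "compact (cube (\<lambda>_ :: 'n. 0 :: 'p padic) N)" by (rule compact_cube)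
  moreover have "closed (cube (\<lambda>_ :: 'n. 0 :: 'p padic) N)"
  proof -
    have "cube (\<lambda>_ :: 'n. 0 :: 'p padic) N = (\<Inter>i\<in>UNIV. (\<lambda>x. x i) -` pball 0 N)" by (auto simp: cube_def)
    then show ?thesis
      by (simp only:) (intro closed_INT ballI closed_vimage closed_pball continuous_on_product_coordinates)
  qed
  moreover have "closure {x. f x \<noteq> 0} \<subseteq> cube (\<lambda>_. 0) N"
    using N \<open>closed (cube (\<lambda>_. 0) N)\<close> by (intro closure_minimal) auto
  ultimately show "compact (closure {x. f x \<noteq> 0})"
    by (metis Int_absorb2 closed_closure compact_Int_closed inf_commute)
qed

lemma indicator_L2:
  assumes "A \<in> sets M" "emeasure M A < \<infinity>"
  shows "(\<lambda>x. indicator A x :: complex) \<in> L2_functions M"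
proof -
  have "(\<lambda>x. (cmod (indicator A x))\<^sup>2) = (indicator A :: _ \<Rightarrow> real)" by (auto simp: indicator_def)
  then show ?thesis using assms by (simp add: L2_functions_def)
qed

lemma indicator_cube_L2:
  "A \<in> sets borel \<Longrightarrow> (\<lambda>x. indicator (A \<inter> cube c J) x :: complex) \<in> L2_functions (padic_haar_n :: ('n::finite \<Rightarrow> 'p::prime_card padic) measure)"
proof (rule indicator_L2)
  assume A: "A \<in> sets (borel :: ('n \<Rightarrow> 'p padic) measure)"
  have "emeasure padic_haar_n (A \<inter> cube c J) \<le> emeasure padic_haar_n (cube c J)"
    using A by (intro emeasure_mono) auto
  also have "\<dots> < \<infinity>" by (simp add: emeasure_cube)
  finally show "emeasure padic_haar_n (A \<inter> cube c J) < \<infinity>" .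
qed auto

lemma test_function_L2:
  fixes f :: "('n::finite \<Rightarrow> 'p::prime_card padic) \<Rightarrow> complex"
  assumes f: "f \<in> test_functions"
  shows "f \<in> L2_functions padic_haar_n"
proof -
  obtain J N where J: "level J f" and N: "\<And>x. f x \<noteq> 0 \<Longrightarrow> x \<in> cube (\<lambda>_. 0) (int N)"
    using test_function_level[OF f] by metis
  have m: "f \<in> borel_measurable borel" by (rule level_measurable[OF J])
  have "continuous_on (cube (\<lambda>_. 0) (int N)) f"
  proof -
    have "open (f -` U)" for U
    proof (subst open_subopen, intro ballI)
      fix x assume "x \<in> f -` U"
      then show "\<exists>T. open T \<and> x \<in> T \<and> T \<subseteq> f -` U"
        using J by (intro exI[of _ "cube x J"]) (auto simp: open_cube level_def)
    qed
    then have "continuous_on UNIV f" by (simp add: continuous_on_open_vimage)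
    then show ?thesis by (rule continuous_on_subset) simp
  qed
  then have "bounded (f ` cube (\<lambda>_. 0) (int N))"
    by (intro compact_imp_bounded compact_continuous_image compact_cube)
  then obtain B where B: "\<And>x. x \<in> cube (\<lambda>_. 0) (int N) \<Longrightarrow> cmod (f x) \<le> B"
    by (auto simp: bounded_iff)
  have "integrable padic_haar_n (\<lambda>x. (cmod (f x))\<^sup>2)"
  proof (rule Bochner_Integration.integrable_bound)
    show "integrable padic_haar_n (\<lambda>x :: 'n \<Rightarrow> 'p padic. B\<^sup>2 * indicator (cube (\<lambda>_. 0) (int N)) x)"
      by (simp add: emeasure_cube)
    show "AE x in padic_haar_n. norm ((cmod (f x))\<^sup>2) \<le> norm (B\<^sup>2 * indicator (cube (\<lambda>_. 0) (int N)) x)"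
    proof (rule AE_I2)
      fix x
      show "norm ((cmod (f x))\<^sup>2) \<le> norm (B\<^sup>2 * indicator (cube (\<lambda>_. 0) (int N)) x)"
      proof (cases "f x = 0")
        case False
        then have x: "x \<in> cube (\<lambda>_. 0) (int N)" by (rule N)
        then show ?thesis using power_mono[OF B[OF x], of 2] by simp
      qed simp
    qed
  qed (use m in simp)
  then show ?thesis using m by (simp add: L2_functions_def)
qed

subsection \<open>Density of functions of finite level\<close>

lemma L2_dominated_convergence:
  assumes f: "f \<in> borel_measurable M" and g: "\<And>k::nat. g k \<in> borel_measurable M" and w: "w \<in> L2_functions M"
    and lim: "\<And>x. x \<in> space M \<Longrightarrow> (\<lambda>k. g k x) \<longlonglongrightarrow> f x"
    and dom: "\<And>k x. x \<in> space M \<Longrightarrow> cmod (g k x) \<le> cmod (w x)"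
  shows "f \<in> L2_functions M" "\<And>k. g k \<in> L2_functions M" "(\<lambda>k. L2_norm M (\<lambda>x. g k x - f x)) \<longlonglongrightarrow> 0"
proof -
  note [measurable] = f g L2_functionsD(1)[OF w]
  have fw: "cmod (f x) \<le> cmod (w x)" if "x \<in> space M" for x
    by (rule LIMSEQ_le_const2[OF tendsto_norm[OF lim[OF that]]]) (use dom[OF that] in auto)
  have L2: "h \<in> L2_functions M" if "h \<in> borel_measurable M" "\<And>x. x \<in> space M \<Longrightarrow> cmod (h x) \<le> cmod (w x)" for h
    using that L2_functionsD(2)[OF w] unfolding L2_functions_def
    by (auto intro!: Bochner_Integration.integrable_bound[of M "\<lambda>x. (cmod (w x))\<^sup>2"] AE_I2 power_mono)
  show "f \<in> L2_functions M" and gL: "g k \<in> L2_functions M" for k using f g fw dom by (auto intro: L2)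
  have "(\<lambda>k. LINT x|M. (cmod (g k x - f x))\<^sup>2) \<longlonglongrightarrow> (LINT x|M. 0)"
  proof (rule integral_dominated_convergence)
    show "integrable M (\<lambda>x. 4 * (cmod (w x))\<^sup>2)" using L2_functionsD(2)[OF w] by simp
    show "AE x in M. (\<lambda>k. (cmod (g k x - f x))\<^sup>2) \<longlonglongrightarrow> 0"
    proof (rule AE_I2)
      fix x assume "x \<in> space M"
      from tendsto_power[OF tendsto_norm[OF tendsto_diff[OF lim[OF this] tendsto_const]], of "f x" 2]
      show "(\<lambda>k. (cmod (g k x - f x))\<^sup>2) \<longlonglongrightarrow> 0" by simp
    qed
    show "AE x in M. norm ((cmod (g k x - f x))\<^sup>2) \<le> 4 * (cmod (w x))\<^sup>2" for k
    proof (rule AE_I2)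
      fix x assume x: "x \<in> space M"
      have "cmod (g k x - f x) \<le> 2 * cmod (w x)"
        using norm_triangle_ineq4[of "g k x" "f x"] dom[OF x, of k] fw[OF x] by linarith
      then have "(cmod (g k x - f x))\<^sup>2 \<le> (2 * cmod (w x))\<^sup>2" by (intro power_mono) auto
      then show "norm ((cmod (g k x - f x))\<^sup>2) \<le> 4 * (cmod (w x))\<^sup>2" by (simp add: power_mult_distrib)
    qed
  qed auto
  then have "(\<lambda>k. sqrt (LINT x|M. (cmod (g k x - f x))\<^sup>2)) \<longlonglongrightarrow> sqrt 0"
    by (intro tendsto_real_sqrt) simp
  then show "(\<lambda>k. L2_norm M (\<lambda>x. g k x - f x)) \<longlonglongrightarrow> 0" by (simp add: L2_norm_def)
qed

lemma schur_ball_average: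
  "schur_kernel padic_haar_n 1 (prod_kernel (\<lambda>_ :: 'n::finite. ball_kernel J :: 'p::prime_card padic \<Rightarrow> real))"
  using schur_heat_n_cut[OF zero_less_one order_refl, of J, where 'n='n and 'p='p]
  by (simp add: heat_n_cut_def heat1_cut_0[OF zero_less_one, abs_def])

lemma ball_average_linear:
  assumes "f \<in> L2_functions padic_haar_n" "g \<in> L2_functions padic_haar_n"
  shows "ball_average J (\<lambda>x. a * f x + b * g x) x = a * ball_average J f x + b * ball_average J g x"
  unfolding ball_average_def by (rule padic_n.kernel_op_linear[OF schur_ball_average assms]) simp

lemma ball_average_diff:
  assumes "f \<in> L2_functions padic_haar_n" "g \<in> L2_functions padic_haar_n"
  shows "ball_average J (\<lambda>x. f x - g x) x = ball_average J f x - ball_average J g x"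
  using ball_average_linear[OF assms, of J 1 "- 1"] by simp

text \<open>Kept as a predicate because the class is closed under linear combinations and L2 limits,
  which carries it from cubes to Borel sets, then to simple functions and to all of L2.\<close>

definition approximable :: "(('n::finite \<Rightarrow> 'p::prime_card padic) \<Rightarrow> complex) \<Rightarrow> bool" where
  "approximable f \<longleftrightarrow> f \<in> L2_functions padic_haar_n
     \<and> (\<lambda>m. L2_norm padic_haar_n (\<lambda>x. ball_average (- int m) f x - f x)) \<longlonglongrightarrow> 0"

lemma approximable_linear:
  fixes f :: "('n::finite \<Rightarrow> 'p::prime_card padic) \<Rightarrow> complex"
  assumes f: "approximable f" and g: "approximable g"
  shows "approximable (\<lambda>x. a * f x + b * g x)"
proof -
  have fL: "f \<in> L2_functions padic_haar_n" and gL: "g \<in> L2_functions padic_haar_n"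
    using f g by (auto simp: approximable_def)
  let ?e = "\<lambda>h m. L2_norm padic_haar_n (\<lambda>x. ball_average (- int m) h x - h x)"
  have "(\<lambda>m. cmod a * ?e f m + cmod b * ?e g m) \<longlonglongrightarrow> cmod a * 0 + cmod b * 0"
    using f g by (intro tendsto_intros) (auto simp: approximable_def)
  moreover have "?e (\<lambda>x. a * f x + b * g x) m \<le> cmod a * ?e f m + cmod b * ?e g m" for m
  proof -
    have "?e (\<lambda>x. a * f x + b * g x) m
        = L2_norm padic_haar_n (\<lambda>x. a * (ball_average (- int m) f x - f x) + b * (ball_average (- int m) g x - g x))"
      by (simp add: ball_average_linear[OF fL gL] algebra_simps)
    also have "\<dots> \<le> L2_norm padic_haar_n (\<lambda>x. a * (ball_average (- int m) f x - f x))
        + L2_norm padic_haar_n (\<lambda>x. b * (ball_average (- int m) g x - g x))"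
      by (intro L2_norm_triangle L2_intros ball_average_L2(1)[OF zero_less_one] fL gL)
    finally show ?thesis by (simp only: L2_norm_mult)
  qed
  ultimately have "?e (\<lambda>x. a * f x + b * g x) \<longlonglongrightarrow> 0"
    using tendsto_sandwich[of "\<lambda>_. 0" "?e (\<lambda>x. a * f x + b * g x)" sequentially "\<lambda>m. cmod a * ?e f m + cmod b * ?e g m" 0]
    by simp
  then show ?thesis using fL gL by (auto simp: approximable_def intro!: L2_intros)
qed

lemma approximable_zero: "approximable (\<lambda>x :: 'n::finite \<Rightarrow> 'p::prime_card padic. 0)"
proof -
  have "ball_average J (\<lambda>x :: 'n \<Rightarrow> 'p padic. 0) = (\<lambda>x. 0)" for J
    by (simp add: ball_average_def kernel_op_def fun_eq_iff)
  then show ?thesis by (simp add: approximable_def L2_zero L2_norm_def)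
qed

lemma approximable_sum:
  fixes f :: "'i \<Rightarrow> ('n::finite \<Rightarrow> 'p::prime_card padic) \<Rightarrow> complex"
  assumes "finite A" "\<And>a. a \<in> A \<Longrightarrow> approximable (f a)"
  shows "approximable (\<lambda>x. \<Sum>a\<in>A. c a * f a x)"
  using assms
proof induct
  case (insert a A)
  then have "approximable (\<lambda>x. c a * f a x + 1 * (\<Sum>a\<in>A. c a * f a x))"
    by (intro approximable_linear) auto
  then show ?case using insert by simp
qed (simp add: approximable_zero)

text \<open>Averages are contractions, so the error for \<open>f\<close> is at most the error for
  \<open>g k\<close> plus twice the distance between \<open>g k\<close> and
  \<open>f\<close>.\<close>

lemma approximable_limit:
  fixes f :: "('n::finite \<Rightarrow> 'p::prime_card padic) \<Rightarrow> complex"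
  assumes f: "f \<in> L2_functions padic_haar_n" and g: "\<And>k::nat. approximable (g k)"
    and lim: "(\<lambda>k. L2_norm padic_haar_n (\<lambda>x. g k x - f x)) \<longlonglongrightarrow> 0"
  shows "approximable f"
  unfolding approximable_def
proof (intro conjI f tendstoI)
  fix e :: real assume e: "e > 0"
  then have "eventually (\<lambda>k. L2_norm padic_haar_n (\<lambda>x. g k x - f x) < e / 3) sequentially"
    by (intro order_tendstoD(2)[OF lim]) simp
  then obtain k where k: "L2_norm padic_haar_n (\<lambda>x. g k x - f x) < e / 3"
    by (auto simp: eventually_sequentially)
  have gL: "g k \<in> L2_functions padic_haar_n" using g by (simp add: approximable_def)
  have "eventually (\<lambda>m. L2_norm padic_haar_n (\<lambda>x. ball_average (- int m) (g k) x - g k x) < e / 3) sequentially"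
    using g[of k] e by (intro order_tendstoD(2)[where y = 0]) (auto simp: approximable_def)
  then show "eventually (\<lambda>m. dist (L2_norm padic_haar_n (\<lambda>x. ball_average (- int m) f x - f x)) 0 < e) sequentially"
  proof eventually_elim
    case (elim m)
    let ?E = "ball_average (- int m)"
    have E: "?E h \<in> L2_functions padic_haar_n" if "h \<in> L2_functions padic_haar_n" for h :: "('n \<Rightarrow> 'p padic) \<Rightarrow> complex"
      using that by (rule ball_average_L2(1)[OF zero_less_one])
    have "L2_norm padic_haar_n (\<lambda>x. ?E f x - f x)
        \<le> L2_norm padic_haar_n (?E (\<lambda>x. f x - g k x)) + L2_norm padic_haar_n (\<lambda>x. ?E (g k) x - g k x)
          + L2_norm padic_haar_n (\<lambda>x. g k x - f x)"
      by (rule L2_norm_triangle3_AE)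
        (auto intro!: L2_intros E f gL simp: ball_average_diff[OF f gL])
    also have "L2_norm padic_haar_n (?E (\<lambda>x. f x - g k x)) \<le> L2_norm padic_haar_n (\<lambda>x. f x - g k x)"
      by (intro ball_average_L2(2)[OF zero_less_one] L2_intros f gL)
    also have "L2_norm padic_haar_n (\<lambda>x. f x - g k x) = L2_norm padic_haar_n (\<lambda>x. g k x - f x)"
      by (rule L2_norm_minus_commute)
    finally show ?case using k elim by simp
  qed
qed

text \<open>Averages over cubes no larger than the level leave \<open>f\<close> unchanged, so the
  error is eventually 0.\<close>

lemma approximable_level:
  assumes "level J f" "f \<in> L2_functions padic_haar_n"
  shows "approximable f"
  unfolding approximable_def
proof (intro conjI assms(2) tendsto_eventually)
  show "eventually (\<lambda>m. L2_norm padic_haar_n (\<lambda>x. ball_average (- int m) f x - f x) = 0) sequentially"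
    using eventually_ge_at_top[of "nat (- J)"]
  proof eventually_elim
    case (elim m)
    then have "ball_average (- int m) f = f" by (intro ball_average_of_level[OF zero_less_one assms(1)]) simp
    then show ?case by (simp add: L2_norm_def)
  qed
qed

text \<open>Induction over complements and disjoint unions, started from cubes. Intersecting with
  one fixed cube keeps all indicators square integrable, including those of complements.\<close>

lemma approximable_indicator:
  fixes A :: "('n::finite \<Rightarrow> 'p::prime_card padic) set"
  assumes A: "A \<in> sets borel"
  shows "approximable (indicator (A \<inter> cube (\<lambda>_. 0) N))"
proof -
  let ?E = "{{}} \<union> {cube c J :: ('n \<Rightarrow> 'p padic) set | c J. True}"
  let ?C = "cube (\<lambda>_. 0) N :: ('n \<Rightarrow> 'p padic) set"
  have stable: "A \<inter> B \<in> ?E" if A: "A \<in> ?E" and B: "B \<in> ?E" for A B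
  proof (cases "A \<inter> B = {}")
    case False
    then obtain c j d k where *: "A = cube c j" "B = cube d k" using A B by auto
    then have "A \<subseteq> B \<or> B \<subseteq> A"
      using False cube_nested[of j k c d] cube_nested[of k j d c] by (cases "j \<le> k") auto
    then show ?thesis using A B by (auto simp: Int_absorb1 Int_absorb2)
  qed simp
  have cubeE: "approximable (indicator B)" if BE: "B \<in> ?E" for B
  proof (cases "B = {}")
    case True
    then have "(indicator B :: ('n \<Rightarrow> 'p padic) \<Rightarrow> complex) = (\<lambda>x. 0)" by (auto simp: indicator_def)
    then show ?thesis by (simp add: approximable_zero)
  next
    case False
    then obtain c J where B: "B = cube c J" using BE by blast
    show ?thesis
      using level_indicator_cube[OF order_refl, of J c] indicator_cube_L2[of UNIV c J]
      unfolding B by (intro approximable_level) auto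
  qed
  have A': "A \<in> sigma_sets UNIV ?E" using A by (simp only: sets_borel_cube)
  have st: "Int_stable ?E" by (rule Int_stableI) (rule stable)
  have pw: "?E \<subseteq> Pow UNIV" by simp
  from st pw A' show ?thesis
  proof (induct A rule: sigma_sets_induct_disjoint)
    case (basic A)
    then show ?case using cubeE[OF stable[of A ?C]] by auto
  next
    case empty
    have "(indicator ({} \<inter> ?C) :: ('n \<Rightarrow> 'p padic) \<Rightarrow> complex) = (\<lambda>x. 0)" by (auto simp: indicator_def)
    then show ?case by (simp add: approximable_zero)
  next
    case (compl A)
    have "approximable (\<lambda>x. 1 * indicator ?C x + - 1 * indicator (A \<inter> ?C) x)"
      by (intro approximable_linear compl cubeE) auto
    moreover have "(\<lambda>x. 1 * indicator ?C x + - 1 * indicator (A \<inter> ?C) x)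
        = (indicator ((UNIV - A) \<inter> ?C) :: ('n \<Rightarrow> 'p padic) \<Rightarrow> complex)"
      by (auto simp: fun_eq_iff indicator_def)
    ultimately show ?case by simp
  next
    case (union A)
    have Am: "A i \<in> sets borel" for i using union(2) by (auto simp only: sets_borel_cube)
    \<comment> \<open>Partial sums over the disjoint pieces are indicators of finite unions and
      converge under the indicator of the fixed cube.\<close>
    let ?g = "\<lambda>k x. \<Sum>i<k. (1::complex) * indicator (A i \<inter> ?C) x"
    have geq: "?g k = indicator ((\<Union>i<k. A i) \<inter> ?C)" for k :: nat
    proof
      fix x
      show "?g k x = indicator ((\<Union>i<k. A i) \<inter> ?C) x"
      proof (cases "x \<in> ?C \<and> (\<exists>i<k. x \<in> A i)")
        case True
        then obtain i where i: "i < k" "x \<in> A i" "x \<in> ?C" by auto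
        have "x \<in> A j \<longleftrightarrow> j = i" for j
          using union(1) i(2) by (auto simp: disjoint_family_on_def)
        then have "?g k x = (\<Sum>j<k. if j = i then 1 else 0)"
          using i(3) by (intro sum.cong) (auto simp: indicator_def)
        then show ?thesis using i by (simp add: indicator_def) blast
      next
        case False
        then show ?thesis by (auto simp: indicator_def intro!: sum.neutral)
      qed
    qed
    have geqx: "?g k x = indicator ((\<Union>i<k. A i) \<inter> ?C) x" for k x by (rule fun_cong[OF geq])
    have gap: "approximable (?g k)" for k by (intro approximable_sum union(3)) auto
    show ?case
    proof (rule approximable_limit[OF _ gap])
      have dom: "(\<lambda>x. indicator ?C x :: complex) \<in> L2_functions padic_haar_n"
        using indicator_cube_L2[of UNIV "\<lambda>_. 0" N] by simp
      have f: "(indicator ((\<Union>i. A i) \<inter> ?C) :: ('n \<Rightarrow> 'p padic) \<Rightarrow> complex) \<in> borel_measurable padic_haar_n"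
        using Am by auto
      have g: "?g k \<in> borel_measurable padic_haar_n" for k
        unfolding geq using Am by auto
      have lim: "(\<lambda>k. ?g k x) \<longlonglongrightarrow> indicator ((\<Union>i. A i) \<inter> ?C) x" for x
      proof (rule tendsto_eventually)
        show "eventually (\<lambda>k. ?g k x = indicator ((\<Union>i. A i) \<inter> ?C) x) sequentially"
        proof (cases "\<exists>i. x \<in> A i")
          case True
          then obtain i where "x \<in> A i" by auto
          then show ?thesis unfolding geqx
            by (intro eventually_sequentiallyI[of "Suc i"]) (auto simp: indicator_def)
        qed (auto simp: geqx indicator_def)
      qed
      have bd: "cmod (?g k x) \<le> cmod (indicator ?C x)" for k x
        unfolding geqx by (auto simp: indicator_def)
      show "indicator ((\<Union>i. A i) \<inter> ?C) \<in> L2_functions padic_haar_n"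
        by (rule L2_dominated_convergence(1)[OF f g dom lim bd])
      show "(\<lambda>k. L2_norm padic_haar_n (\<lambda>x. ?g k x - indicator ((\<Union>i. A i) \<inter> ?C) x)) \<longlonglongrightarrow> 0"
        by (rule L2_dominated_convergence(3)[OF f g dom lim bd])
    qed
  qed
qed

text \<open>Simple functions cut to growing cubes converge to \<open>f\<close>, dominated by 2
  f.\<close>

lemma L2_approximable:
  fixes f :: "('n::finite \<Rightarrow> 'p::prime_card padic) \<Rightarrow> complex"
  assumes f: "f \<in> L2_functions padic_haar_n"
  shows "approximable f"
proof -
  have fm: "f \<in> borel_measurable borel" using L2_functionsD(1)[OF f] by simp
  obtain s where s: "\<And>i. simple_function borel (s i)" "\<And>x. (\<lambda>i. s i x) \<longlonglongrightarrow> f x"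
    "\<And>i x. dist (s i x) 0 \<le> 2 * dist (f x) 0"
    using borel_measurable_implies_sequence_metric[OF fm, of 0] by auto
  let ?C = "\<lambda>i :: nat. cube (\<lambda>_. 0) (int i) :: ('n \<Rightarrow> 'p padic) set"
  let ?g = "\<lambda>i x. s i x * indicator (?C i) x"
  have geq: "?g i = (\<lambda>x. \<Sum>v\<in>range (s i). v * indicator (s i -` {v} \<inter> ?C i) x)" for i
  proof
    fix x
    have "(\<Sum>v\<in>range (s i). v * indicator (s i -` {v} \<inter> ?C i) x) = (\<Sum>v\<in>{s i x}. v * indicator (s i -` {v} \<inter> ?C i) x)"
      using s(1)[of i] by (intro sum.mono_neutral_right) (auto simp: simple_function_def indicator_def)
    then show "?g i x = (\<Sum>v\<in>range (s i). v * indicator (s i -` {v} \<inter> ?C i) x)"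
      by (simp add: indicator_def)
  qed
  have gap: "approximable (?g i)" for i
    unfolding geq
  proof (rule approximable_sum)
    show "finite (range (s i))" using s(1)[of i] by (simp add: simple_function_def)
    show "approximable (indicator (s i -` {v} \<inter> ?C i))" if "v \<in> range (s i)" for v
      using s(1)[of i] that by (intro approximable_indicator) (auto simp: simple_function_def)
  qed
  show ?thesis
  proof (rule approximable_limit[OF f gap])
    have sm: "s i \<in> borel_measurable borel" for i by (rule borel_measurable_simple_function[OF s(1)])
    have gm: "?g i \<in> borel_measurable padic_haar_n" for i
      using sm[of i] by (auto intro!: borel_measurable_times borel_measurable_indicator)
    have lim: "(\<lambda>i. ?g i x) \<longlonglongrightarrow> f x" for x
    proof (rule Lim_transform_eventually[OF s(2)])
      obtain N :: nat where N: "x \<in> ?C N" using cube_exhaust by blast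
      show "eventually (\<lambda>i. s i x = ?g i x) sequentially"
      proof (rule eventually_sequentiallyI[of N])
        fix i assume "N \<le> i"
        then have "x \<in> ?C i" using N cube_mono[of "int N" "int i" "\<lambda>_. 0"] by auto
        then show "s i x = ?g i x" by simp
      qed
    qed
    have bd: "cmod (?g i x) \<le> cmod (2 * f x)" for i x
      using s(3)[of i x] by (auto simp: indicator_def norm_mult)
    show "(\<lambda>k. L2_norm padic_haar_n (\<lambda>x. ?g k x - f x)) \<longlonglongrightarrow> 0"
      by (rule L2_dominated_convergence(3)[OF L2_functionsD(1)[OF f] gm L2_mult[OF f, of 2] lim bd])
  qed
qed

subsection \<open>The heat semigroup and its generator\<close>

lemma generator_value_unique:
  assumes T: "\<And>t. 0 < t \<Longrightarrow> T t f \<in> L2_functions M" and f: "f \<in> L2_functions M"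
    and g: "g \<in> L2_functions M" and h: "h \<in> L2_functions M"
    and gen: "has_generator_value M T f g" "has_generator_value M T f h"
  shows "AE x in M. g x = h x"
proof -
  let ?a = "\<lambda>t. L2_norm M (\<lambda>x. (T t f x - f x) / of_real t - g x)"
    and ?b = "\<lambda>t. L2_norm M (\<lambda>x. (T t f x - f x) / of_real t - h x)"
  have "((\<lambda>t. ?a t + ?b t) \<longlongrightarrow> 0 + 0) (at_right 0)"
    using gen unfolding has_generator_value_def by (intro tendsto_add)
  moreover have "eventually (\<lambda>t. L2_norm M (\<lambda>x. g x - h x) \<le> ?a t + ?b t) (at_right 0)"
    using eventually_at_right_less[of 0]
  proof eventually_elim
    case (elim t)
    let ?q = "\<lambda>x. (T t f x - f x) / of_real t"
    have q: "?q \<in> L2_functions M" by (intro L2_intros T f elim)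
    have "L2_norm M (\<lambda>x. g x - h x) \<le> L2_norm M (\<lambda>x. g x - ?q x) + L2_norm M (\<lambda>x. ?q x - h x)"
      by (rule L2_norm_triangle_diff[OF g q h])
    then show ?case by (simp add: L2_norm_minus_commute[of M g])
  qed
  ultimately have "L2_norm M (\<lambda>x. g x - h x) \<le> 0"
    using tendsto_lowerbound[of "\<lambda>t. ?a t + ?b t" 0 "at_right 0"] by simp
  then have "L2_norm M (\<lambda>x. g x - h x) = 0" by (simp add: order_antisym)
  then show ?thesis using L2_norm_eq_0_iff[OF L2_diff[OF g h]] by simp
qed

context
  fixes \<beta> :: real
  assumes \<beta>: "0 < \<beta>"
begin

lemma heat_sg_L2:
  fixes f :: "('n::finite \<Rightarrow> 'p::prime_card padic) \<Rightarrow> complex"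
  assumes "f \<in> L2_functions padic_haar_n"
  shows "heat_sg \<beta> t f \<in> L2_functions padic_haar_n" "L2_norm padic_haar_n (heat_sg \<beta> t f) \<le> L2_norm padic_haar_n f"
  using assms padic_n.kernel_op_L2[OF schur_heat_n[OF \<beta>] assms] by (auto simp: heat_sg_def)

lemma heat_sg_linear:
  fixes f :: "('n::finite \<Rightarrow> 'p::prime_card padic) \<Rightarrow> complex"
  assumes "f \<in> L2_functions padic_haar_n" "g \<in> L2_functions padic_haar_n"
  shows "heat_sg \<beta> t (\<lambda>x. a * f x + b * g x) x = a * heat_sg \<beta> t f x + b * heat_sg \<beta> t g x"
  using padic_n.kernel_op_linear[OF schur_heat_n[OF \<beta>] assms, of t x a b] by (auto simp: heat_sg_def)

lemma heat_sg_diff: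
  fixes f :: "('n::finite \<Rightarrow> 'p::prime_card padic) \<Rightarrow> complex"
  assumes "f \<in> L2_functions padic_haar_n" "g \<in> L2_functions padic_haar_n"
  shows "heat_sg \<beta> t (\<lambda>x. f x - g x) x = heat_sg \<beta> t f x - heat_sg \<beta> t g x"
  using heat_sg_linear[OF assms, of t 1 "- 1" x] by simp

lemma vlad_cut_L2:
  "f \<in> L2_functions padic_haar_n \<Longrightarrow> kernel_op padic_haar_n (vlad_cut \<beta> J) f
    \<in> L2_functions (padic_haar_n :: ('n::finite \<Rightarrow> 'p::prime_card padic) measure)"
  using schur_vlad_cut[OF \<beta>, of J, where 'n='n and 'p='p] padic_n.kernel_op_L2(1) by blast

text \<open>For an average \<open>u\<close> of \<open>f\<close> the difference quotients converge,
  so T_t u - u is of order \<open>t\<close>; contractivity transfers this to \<open>f\<close> at the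
  cost of two small errors.\<close>

lemma heat_sg_tendsto:
  fixes f :: "('n::finite \<Rightarrow> 'p::prime_card padic) \<Rightarrow> complex"
  assumes f: "f \<in> L2_functions padic_haar_n"
  shows "((\<lambda>t. L2_norm padic_haar_n (\<lambda>x. heat_sg \<beta> t f x - f x)) \<longlongrightarrow> 0) (at_right 0)"
proof (rule tendstoI)
  fix e :: real assume e: "e > 0"
  have "approximable f" by (rule L2_approximable[OF f])
  then have "eventually (\<lambda>m. L2_norm padic_haar_n (\<lambda>x. ball_average (- int m) f x - f x) < e / 3) sequentially"
    unfolding approximable_def using e by (intro order_tendstoD(2)[where y = 0]) auto
  then obtain m where m: "L2_norm padic_haar_n (\<lambda>x. ball_average (- int m) f x - f x) < e / 3"
    by (auto simp: eventually_sequentially)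
  let ?u = "ball_average (- int m) f"
  have u: "?u \<in> L2_functions padic_haar_n" by (rule ball_average_L2(1)[OF \<beta> f])
  define v where "v = (\<lambda>x. - kernel_op padic_haar_n (vlad_cut \<beta> (- int m)) ?u x)"
  have v: "v \<in> L2_functions padic_haar_n" unfolding v_def by (intro L2_intros vlad_cut_L2 u)
  have "has_generator_value padic_haar_n (heat_sg \<beta>) ?u v"
    unfolding v_def by (rule heat_sg_generator_level[OF \<beta> u ball_average_level[OF \<beta>]])
  then have "eventually (\<lambda>t. L2_norm padic_haar_n (\<lambda>x. (heat_sg \<beta> t ?u x - ?u x) / of_real t - v x) < 1) (at_right 0)"
    unfolding has_generator_value_def by (rule order_tendstoD(2)) simp
  \<comment> \<open>The difference quotient is eventually within 1 of \<open>v\<close>, so the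
    increment of \<open>u\<close> is at most t times 1 plus the norm of \<open>v\<close>; this range
    of \<open>t\<close> makes it less than e / 3.\<close>
  moreover have "eventually (\<lambda>t. t \<in> {0<..<e / 3 / (1 + L2_norm padic_haar_n v)}) (at_right 0)"
    using e by (intro eventually_at_right_real) (simp add: add_pos_nonneg)
  ultimately show "eventually (\<lambda>t. dist (L2_norm padic_haar_n (\<lambda>x. heat_sg \<beta> t f x - f x)) 0 < e) (at_right 0)"
  proof eventually_elim
    case (elim t)
    have t: "t > 0" using elim by simp
    have pos: "1 + L2_norm padic_haar_n v > 0" by (simp add: add_pos_nonneg)
    have "L2_norm padic_haar_n (\<lambda>x. heat_sg \<beta> t ?u x - ?u x)
        \<le> L2_norm padic_haar_n (\<lambda>x. of_real t * ((heat_sg \<beta> t ?u x - ?u x) / of_real t - v x)) + L2_norm padic_haar_n (\<lambda>x. of_real t * v x)"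
      by (rule L2_norm_triangle_AE)
        (use t in \<open>auto intro!: L2_intros heat_sg_L2 u v simp: right_diff_distrib[of _ "_ / _"]\<close>)
    also have "\<dots> = t * L2_norm padic_haar_n (\<lambda>x. (heat_sg \<beta> t ?u x - ?u x) / of_real t - v x) + t * L2_norm padic_haar_n v"
      unfolding L2_norm_mult using t by simp
    also have "\<dots> \<le> t * 1 + t * L2_norm padic_haar_n v" using elim t by (intro add_right_mono mult_left_mono) auto
    also have "\<dots> = t * (1 + L2_norm padic_haar_n v)" by (simp add: distrib_left)
    also have "\<dots> < e / 3"
      using elim by (simp only: greaterThanLessThan_iff pos_less_divide_eq[OF pos])
    finally have 1: "L2_norm padic_haar_n (\<lambda>x. heat_sg \<beta> t ?u x - ?u x) < e / 3" .
    have "L2_norm padic_haar_n (\<lambda>x. heat_sg \<beta> t f x - f x)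
        \<le> L2_norm padic_haar_n (heat_sg \<beta> t (\<lambda>x. f x - ?u x)) + L2_norm padic_haar_n (\<lambda>x. heat_sg \<beta> t ?u x - ?u x)
          + L2_norm padic_haar_n (\<lambda>x. ?u x - f x)"
      by (rule L2_norm_triangle3_AE) (auto intro!: L2_intros heat_sg_L2 u f simp: heat_sg_diff[OF f u])
    also have "L2_norm padic_haar_n (heat_sg \<beta> t (\<lambda>x. f x - ?u x)) \<le> L2_norm padic_haar_n (\<lambda>x. f x - ?u x)"
      by (intro heat_sg_L2 L2_intros u f)
    also have "L2_norm padic_haar_n (\<lambda>x. f x - ?u x) = L2_norm padic_haar_n (\<lambda>x. ?u x - f x)"
      by (rule L2_norm_minus_commute)
    finally show ?case using 1 m by simp
  qed
qed

lemma heat_sg_contraction_semigroup: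
  "contraction_semigroup (padic_haar_n :: ('n::finite \<Rightarrow> 'p::prime_card padic) measure) (heat_sg \<beta>)"
proof -
  let ?L = "L2_functions (padic_haar_n :: ('n \<Rightarrow> 'p padic) measure)"
  have A: "AE x in padic_haar_n. heat_sg \<beta> (s + t) f x = heat_sg \<beta> s (heat_sg \<beta> t f) x"
    if "0 \<le> s" "0 \<le> t" "f \<in> ?L" for s t f
    using heat_n_compose[OF \<beta> _ _ that(3), of s t] that(1,2) by (auto simp: heat_sg_def)
  have B: "AE x in padic_haar_n. heat_sg \<beta> t (\<lambda>x. a * f x + b * g x) x = a * heat_sg \<beta> t f x + b * heat_sg \<beta> t g x"
    if "f \<in> ?L" "g \<in> ?L" for t f g a b
    by (simp add: heat_sg_linear that)
  have C: "AE x in padic_haar_n. heat_sg \<beta> 0 f x = f x" for f :: "('n \<Rightarrow> 'p padic) \<Rightarrow> complex"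
    by (simp add: heat_sg_def)
  show ?thesis
    unfolding contraction_semigroup_def
    by (intro conjI allI impI ballI A B C heat_sg_L2 heat_sg_tendsto; assumption)
qed

text \<open>Averaging commutes with the semigroup, so the average of \<open>f\<close> has the
  average of \<open>g\<close> as generator value. Being of level \<open>J\<close>, it also has the
  value given by the bounded operator, and generator values are unique.\<close>

lemma heat_sg_generator_average:
  fixes f g :: "('n::finite \<Rightarrow> 'p::prime_card padic) \<Rightarrow> complex"
  assumes f: "f \<in> L2_functions padic_haar_n" and g: "g \<in> L2_functions padic_haar_n"
    and gen: "has_generator_value padic_haar_n (heat_sg \<beta>) f g"
  shows "AE x in padic_haar_n. ball_average J g x = - kernel_op padic_haar_n (vlad_cut \<beta> J) (ball_average J f) x"
proof (rule generator_value_unique[where T = "heat_sg \<beta>" and f = "ball_average J f"])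
  let ?E = "ball_average J"
  show "heat_sg \<beta> t (?E f) \<in> L2_functions padic_haar_n" for t
    by (intro heat_sg_L2 ball_average_L2(1)[OF \<beta>] f)
  show Ef: "?E f \<in> L2_functions padic_haar_n" and "?E g \<in> L2_functions padic_haar_n"
    by (intro ball_average_L2(1)[OF \<beta>] f g)+
  show "(\<lambda>x. - kernel_op padic_haar_n (vlad_cut \<beta> J) (?E f) x) \<in> L2_functions padic_haar_n"
    by (intro L2_intros vlad_cut_L2 Ef)
  show "has_generator_value padic_haar_n (heat_sg \<beta>) (?E f) (\<lambda>x. - kernel_op padic_haar_n (vlad_cut \<beta> J) (?E f) x)"
    by (rule heat_sg_generator_level[OF \<beta> Ef ball_average_level[OF \<beta>]])
  show "has_generator_value padic_haar_n (heat_sg \<beta>) (?E f) (?E g)"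
    unfolding has_generator_value_def
  proof (rule tendsto_sandwich[OF _ _ tendsto_const gen[unfolded has_generator_value_def]])
    show "eventually (\<lambda>t. L2_norm padic_haar_n (\<lambda>x. (heat_sg \<beta> t (?E f) x - ?E f x) / of_real t - ?E g x)
        \<le> L2_norm padic_haar_n (\<lambda>x. (heat_sg \<beta> t f x - f x) / of_real t - g x)) (at_right 0)"
      using eventually_at_right_less[of 0]
    proof eventually_elim
      case (elim t)
      let ?T = "heat_sg \<beta> t f"
      have T: "?T \<in> L2_functions padic_haar_n" by (rule heat_sg_L2[OF f])
      have comm: "heat_sg \<beta> t (?E f) = ?E ?T"
        using heat_n_ball_average[OF \<beta> elim f, of J] elim by (simp add: heat_sg_def)
      have "(\<lambda>x. (heat_sg \<beta> t (?E f) x - ?E f x) / of_real t - ?E g x)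
          = ?E (\<lambda>x. (?T x - f x) / of_real t - g x)"
      proof
        fix x
        have "?E (\<lambda>x. (1 / of_real t) * (?T x - f x) + (- 1) * g x) x
            = (1 / of_real t) * ?E (\<lambda>x. ?T x - f x) x + (- 1) * ?E g x"
          by (rule ball_average_linear[OF L2_diff[OF T f] g])
        then show "(heat_sg \<beta> t (?E f) x - ?E f x) / of_real t - ?E g x = ?E (\<lambda>x. (?T x - f x) / of_real t - g x) x"
          by (simp add: ball_average_diff[OF T f] comm)
      qed
      then have "L2_norm padic_haar_n (\<lambda>x. (heat_sg \<beta> t (?E f) x - ?E f x) / of_real t - ?E g x)
          = L2_norm padic_haar_n (?E (\<lambda>x. (?T x - f x) / of_real t - g x))" by simp
      also have "\<dots> \<le> L2_norm padic_haar_n (\<lambda>x. (?T x - f x) / of_real t - g x)"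
        by (intro ball_average_L2(2)[OF \<beta>] L2_intros T f g)
      finally show ?case .
    qed
  qed auto
qed

text \<open>Averages need not have compact support. Multiplication by the indicator of a large cube
  supplies it, and since \<open>vlad_cut\<close> acts boundedly on L2 the images converge along with
  the functions.\<close>

lemma level_truncation:
  fixes f :: "('n::finite \<Rightarrow> 'p::prime_card padic) \<Rightarrow> complex"
  assumes f: "f \<in> L2_functions padic_haar_n" and lev: "level J f" and e: "e > 0"
  obtains u where "u \<in> test_functions" "level J u" "L2_norm padic_haar_n (\<lambda>x. u x - f x) < e"
    "L2_norm padic_haar_n (\<lambda>x. kernel_op padic_haar_n (vlad_cut \<beta> J) u x - kernel_op padic_haar_n (vlad_cut \<beta> J) f x) < e"
proof -
  obtain C where C: "schur_kernel padic_haar_n C (vlad_cut \<beta> J :: ('n \<Rightarrow> 'p padic) \<Rightarrow> _)"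
    using schur_vlad_cut[OF \<beta>] by blast
  have C0: "C > 0" using C by (simp add: schur_kernel_def)
  let ?u = "\<lambda>N x. indicator (cube (\<lambda>_. 0) (int N)) x * f x"
  have fm: "f \<in> borel_measurable padic_haar_n" by (rule L2_functionsD(1)[OF f])
  have um: "?u N \<in> borel_measurable padic_haar_n" for N
    using fm by (auto intro!: borel_measurable_times borel_measurable_indicator)
  have lim: "(\<lambda>N. ?u N x) \<longlonglongrightarrow> f x" for x
  proof (rule tendsto_eventually)
    obtain N :: nat where N: "x \<in> cube (\<lambda>_. 0) (int N)" using cube_exhaust by blast
    show "eventually (\<lambda>i. ?u i x = f x) sequentially"
    proof (rule eventually_sequentiallyI[of N])
      fix i assume "N \<le> i"
      then have "x \<in> cube (\<lambda>_. 0) (int i)" using N cube_mono[of "int N" "int i" "\<lambda>_. 0"] by auto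
      then show "?u i x = f x" by simp
    qed
  qed
  have bd: "cmod (?u N x) \<le> cmod (f x)" for N x by (auto simp: indicator_def)
  note D = L2_dominated_convergence[OF fm um f lim bd]
  \<comment> \<open>The bound \<open>e / C\<close> pays for the operator constant of
    \<open>vlad_cut\<close>.\<close>
  have "min e (e / C) > 0" using e C0 by simp
  from order_tendstoD(2)[OF D(3) this]
  have "eventually (\<lambda>N. L2_norm padic_haar_n (\<lambda>x. ?u N x - f x) < min e (e / C)) sequentially" .
  \<comment> \<open>Size at least p^J guarantees that the indicator of the cube has level
    \<open>J\<close>.\<close>
  moreover have "eventually (\<lambda>N. nat J \<le> N) sequentially" by (rule eventually_ge_at_top)
  ultimately have "eventually (\<lambda>N. L2_norm padic_haar_n (\<lambda>x. ?u N x - f x) < min e (e / C) \<and> nat J \<le> N) sequentially"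
    by (rule eventually_conj)
  then obtain N where N: "L2_norm padic_haar_n (\<lambda>x. ?u N x - f x) < min e (e / C)" "nat J \<le> N"
    by (auto simp: eventually_sequentially)
  have lu: "level J (?u N)" using N(2) by (intro level_mult level_indicator_cube lev) simp
  show thesis
  proof (rule that[OF _ lu])
    show "?u N \<in> test_functions"
      by (rule level_test_function[OF lu, of "int N"]) (auto simp: indicator_def split: if_splits)
    show "L2_norm padic_haar_n (\<lambda>x. ?u N x - f x) < e" using N(1) by simp
    have "kernel_op padic_haar_n (vlad_cut \<beta> J) (\<lambda>x. 1 * ?u N x + - 1 * f x) x
        = 1 * kernel_op padic_haar_n (vlad_cut \<beta> J) (?u N) x + - 1 * kernel_op padic_haar_n (vlad_cut \<beta> J) f x" for x
      by (rule padic_n.kernel_op_linear[OF C D(2) f]) simp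
    then have "(\<lambda>x. kernel_op padic_haar_n (vlad_cut \<beta> J) (?u N) x - kernel_op padic_haar_n (vlad_cut \<beta> J) f x)
        = kernel_op padic_haar_n (vlad_cut \<beta> J) (\<lambda>x. ?u N x - f x)" by (simp add: fun_eq_iff)
    then have "L2_norm padic_haar_n (\<lambda>x. kernel_op padic_haar_n (vlad_cut \<beta> J) (?u N) x - kernel_op padic_haar_n (vlad_cut \<beta> J) f x)
        \<le> C * L2_norm padic_haar_n (\<lambda>x. ?u N x - f x)"
      using padic_n.kernel_op_L2(2)[OF C L2_diff[OF D(2) f]] by simp
    also have "\<dots> < e" using N(1) C0 by (simp add: pos_less_divide_eq mult.commute)
    finally show "L2_norm padic_haar_n (\<lambda>x. kernel_op padic_haar_n (vlad_cut \<beta> J) (?u N) x - kernel_op padic_haar_n (vlad_cut \<beta> J) f x) < e" .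
  qed
qed

text \<open>The test functions form a core. From left to right, \<open>f\<close> is averaged over
  cubes of size p^-k and truncated; the average of \<open>g\<close> is the image of the average of
  \<open>f\<close> under the bounded operator. From right to left, the generator is closed.
  \<open>L\<close> is abstract so that Fourier analysis enters only through its agreement with the
  bounded operators.\<close>

lemma heat_sg_generator_iff_closure:
  fixes f g :: "('n::finite \<Rightarrow> 'p::prime_card padic) \<Rightarrow> complex"
  assumes L: "\<And>u J. u \<in> test_functions \<Longrightarrow> level J u \<Longrightarrow> L u = kernel_op padic_haar_n (vlad_cut \<beta> J) u"
    and f: "f \<in> L2_functions padic_haar_n" and g: "g \<in> L2_functions padic_haar_n"
  shows "has_generator_value padic_haar_n (heat_sg \<beta>) f (\<lambda>x. - g x) \<longleftrightarrow> has_closure_value padic_haar_n test_functions L f g"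
proof
  let ?V = "\<lambda>J. kernel_op padic_haar_n (vlad_cut \<beta> J)"
  assume gen: "has_generator_value padic_haar_n (heat_sg \<beta>) f (\<lambda>x. - g x)"
  let ?E = "\<lambda>k :: nat. ball_average (- int k)"
  let ?P = "\<lambda>k u. u \<in> test_functions \<and> L2_norm padic_haar_n (\<lambda>x. u x - ?E k f x) < 1 / real (Suc k)
      \<and> L2_norm padic_haar_n (\<lambda>x. L u x - ?E k g x) < 1 / real (Suc k)"
  have ex: "\<exists>u. u \<in> test_functions \<and> L2_norm padic_haar_n (\<lambda>x. u x - ?E k f x) < 1 / real (Suc k)
      \<and> L2_norm padic_haar_n (\<lambda>x. L u x - ?E k g x) < 1 / real (Suc k)" for k
  proof -
    have Ef: "?E k f \<in> L2_functions padic_haar_n" and Eg: "?E k g \<in> L2_functions padic_haar_n"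
      by (intro ball_average_L2(1)[OF \<beta>] f g)+
    obtain u where u: "u \<in> test_functions" "level (- int k) u" "L2_norm padic_haar_n (\<lambda>x. u x - ?E k f x) < 1 / real (Suc k)"
      "L2_norm padic_haar_n (\<lambda>x. ?V (- int k) u x - ?V (- int k) (?E k f) x) < 1 / real (Suc k)"
      by (rule level_truncation[OF Ef ball_average_level[OF \<beta>], of "1 / real (Suc k)"]) auto
    have "AE x in padic_haar_n. ?E k (\<lambda>x. - g x) x = - ?V (- int k) (?E k f) x"
      by (rule heat_sg_generator_average[OF f L2_uminus[OF g] gen])
    moreover have "?E k (\<lambda>x. - g x) x = - ?E k g x" for x
      using ball_average_linear[OF g L2_zero, of "- int k" "- 1" 0 x] by simp
    ultimately have ae: "AE x in padic_haar_n. ?V (- int k) (?E k f) x = ?E k g x"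
      by (elim eventually_mono) simp
    have Lu: "L u = ?V (- int k) u" by (rule L[OF u(1,2)])
    have "L2_norm padic_haar_n (\<lambda>x. L u x - ?E k g x) = L2_norm padic_haar_n (\<lambda>x. ?V (- int k) u x - ?V (- int k) (?E k f) x)"
      unfolding Lu by (rule L2_norm_cong_AE)
        (use ae in \<open>auto intro!: L2_intros vlad_cut_L2 test_function_L2[OF u(1)] Ef Eg\<close>)
    then show ?thesis using u by (intro exI[of _ u]) auto
  qed
  define u where "u k = (SOME w. ?P k w)" for k
  have uP: "?P k (u k)" for k unfolding u_def by (rule someI_ex[OF ex])
  have u: "u k \<in> test_functions" "L2_norm padic_haar_n (\<lambda>x. u k x - ?E k f x) < 1 / real (Suc k)"
    "L2_norm padic_haar_n (\<lambda>x. L (u k) x - ?E k g x) < 1 / real (Suc k)" for k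
    using uP[of k] by simp_all
  have LL2: "L (u k) \<in> L2_functions padic_haar_n" for k
  proof -
    obtain J N where "level J (u k)" using test_function_level[OF u(1)] by metis
    then show ?thesis using L[OF u(1)] vlad_cut_L2[OF test_function_L2[OF u(1)]] by simp
  qed
  have conv: "(\<lambda>k. L2_norm padic_haar_n (\<lambda>x. w k x - h x)) \<longlonglongrightarrow> 0"
    if h: "h \<in> L2_functions padic_haar_n" and w: "\<And>k. w k \<in> L2_functions padic_haar_n"
      and b: "\<And>k. L2_norm padic_haar_n (\<lambda>x. w k x - ?E k h x) < 1 / real (Suc k)" for h :: "('n \<Rightarrow> 'p padic) \<Rightarrow> complex" and w
  proof (rule tendsto_sandwich[OF _ _ tendsto_const])
    have "approximable h" by (rule L2_approximable[OF h])
    then have "(\<lambda>k. 1 / real (Suc k) + L2_norm padic_haar_n (\<lambda>x. ?E k h x - h x)) \<longlonglongrightarrow> 0 + 0"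
      unfolding approximable_def by (intro tendsto_add lim_1_over_n[THEN LIMSEQ_Suc]) auto
    then show "(\<lambda>k. 1 / real (Suc k) + L2_norm padic_haar_n (\<lambda>x. ?E k h x - h x)) \<longlonglongrightarrow> 0" by simp
    have "L2_norm padic_haar_n (\<lambda>x. w k x - h x) \<le> 1 / real (Suc k) + L2_norm padic_haar_n (\<lambda>x. ?E k h x - h x)" for k
      using L2_norm_triangle_diff[OF w ball_average_L2(1)[OF \<beta> h] h, of k "- int k"] b[of k] by linarith
    then show "eventually (\<lambda>k. L2_norm padic_haar_n (\<lambda>x. w k x - h x) \<le> 1 / real (Suc k) + L2_norm padic_haar_n (\<lambda>x. ?E k h x - h x)) sequentially"
      by (intro always_eventually allI)
  qed simp
  show "has_closure_value padic_haar_n test_functions L f g"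
    unfolding has_closure_value_def
    by (intro exI[of _ u] conjI allI u(1) LL2 test_function_L2[OF u(1)] conv[OF f test_function_L2[OF u(1)] u(2)]
        conv[OF g LL2 u(3)])
next
  assume "has_closure_value padic_haar_n test_functions L f g"
  then obtain u where u: "\<And>k. u k \<in> test_functions" "\<And>k. L (u k) \<in> L2_functions padic_haar_n"
    and uf: "(\<lambda>k. L2_norm padic_haar_n (\<lambda>x. u k x - f x)) \<longlonglongrightarrow> 0"
    and ug: "(\<lambda>k. L2_norm padic_haar_n (\<lambda>x. L (u k) x - g x)) \<longlonglongrightarrow> 0"
    unfolding has_closure_value_def by blast
  interpret contraction_sg padic_haar_n "heat_sg \<beta> :: real \<Rightarrow> (('n \<Rightarrow> 'p padic) \<Rightarrow> complex) \<Rightarrow> _"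
    by unfold_locales (rule heat_sg_contraction_semigroup)
  show "has_generator_value padic_haar_n (heat_sg \<beta>) f (\<lambda>x. - g x)"
  proof (rule generator_closed[OF f L2_uminus[OF g] test_function_L2[OF u(1)] L2_uminus[OF u(2)] _ uf])
    show "has_generator_value padic_haar_n (heat_sg \<beta>) (u k) (\<lambda>x. - L (u k) x)" for k
    proof -
      obtain J N where J: "level J (u k)" using test_function_level[OF u(1)] by metis
      show ?thesis
        using heat_sg_generator_level[OF \<beta> test_function_L2[OF u(1)] J] L[OF u(1) J] by simp
    qed
    have "L2_norm padic_haar_n (\<lambda>x. - L (u k) x - - g x) = L2_norm padic_haar_n (\<lambda>x. L (u k) x - g x)" for k
      using L2_norm_uminus[of padic_haar_n "\<lambda>x. L (u k) x - g x"] by simp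
    then show "(\<lambda>k. L2_norm padic_haar_n (\<lambda>x. - L (u k) x - - g x)) \<longlonglongrightarrow> 0" using ug by simp
  qed
qed

text \<open>Averages over cubes lie in the domain and converge to \<open>f\<close>.\<close>

lemma heat_sg_domain_dense:
  fixes f :: "('n::finite \<Rightarrow> 'p::prime_card padic) \<Rightarrow> complex"
  assumes f: "f \<in> L2_functions padic_haar_n" and e: "e > 0"
  shows "\<exists>u\<in>L2_functions padic_haar_n. \<exists>v\<in>L2_functions padic_haar_n.
    has_generator_value padic_haar_n (heat_sg \<beta>) u v \<and> L2_norm padic_haar_n (\<lambda>x. u x - f x) < e"
proof -
  have "approximable f" by (rule L2_approximable[OF f])
  then have "eventually (\<lambda>m. L2_norm padic_haar_n (\<lambda>x. ball_average (- int m) f x - f x) < e) sequentially"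
    unfolding approximable_def using e by (intro order_tendstoD(2)[where y = 0]) auto
  then obtain m where m: "L2_norm padic_haar_n (\<lambda>x. ball_average (- int m) f x - f x) < e"
    by (auto simp: eventually_sequentially)
  let ?u = "ball_average (- int m) f"
  have u: "?u \<in> L2_functions padic_haar_n" by (rule ball_average_L2(1)[OF \<beta> f])
  show ?thesis
    by (rule bexI[OF _ u], rule bexI[OF _ L2_uminus[OF vlad_cut_L2[OF u]]], rule conjI[OF _ m])
      (rule heat_sg_generator_level[OF \<beta> u ball_average_level[OF \<beta>]])
qed

end

subsection \<open>The additive character\<close>

text \<open>Joint continuity makes \<open>\<xi> * x\<close> a Borel function of both variables, as
  the exchange of Fourier integrals requires.\<close>

instance padic :: (prime_card) topological_semigroup_mult
proof
  fix a b :: "'a padic"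
  have le: "dist (x * y) (a * b) \<le> dist x 0 * dist y b + dist x a * dist b 0" for x y
  proof -
    have e: "x * y - a * b = x * (y - b) + (x - a) * b" by (simp add: algebra_simps)
    show ?thesis
      using padic_norm_triangle[of "x * (y - b)" "(x - a) * b"]
      unfolding dist_padic_def e by (simp add: padic_norm_mult)
  qed
  have "((\<lambda>x. dist (fst x) 0 * dist (snd x) b + dist (fst x) a * dist b 0)
      \<longlongrightarrow> dist a 0 * dist b b + dist a a * dist b 0) (nhds a \<times>\<^sub>F nhds b)"
    by (intro tendsto_intros filterlim_fst filterlim_snd)
  then have "((\<lambda>x. dist (fst x * snd x) (a * b)) \<longlongrightarrow> 0) (nhds a \<times>\<^sub>F nhds b)"
    by (simp only: dist_self add_0_left mult_zero_right mult_zero_left)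
      (rule Lim_null_comparison[rotated], auto intro!: le always_eventually)
  then show "((\<lambda>x. fst x * snd x) \<longlongrightarrow> a * b) (nhds a \<times>\<^sub>F nhds b)"
    by (simp add: tendsto_dist_iff[symmetric])
qed

text \<open>The bound on the norm says exactly that p^k divides the numerator over the denominator
  p^k.\<close>

lemma rat_int_if_padic_int:
  assumes "r * of_nat CARD('p) ^ k \<in> \<int>" and "padic_norm (of_rat r :: 'p::prime_card padic) \<le> 1"
  shows "r \<in> \<int>"
proof -
  obtain b where b: "r * of_nat CARD('p) ^ k = of_int b" using assms(1) by (auto elim: Ints_cases)
  have "(of_rat r :: 'p padic) * of_nat CARD('p) powi int k = of_int b"
    using arg_cong[OF b, of "of_rat :: rat \<Rightarrow> 'p padic"] by (simp add: of_rat_mult of_rat_power)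
  then have "padic_norm (of_int b :: 'p padic) = padic_norm (of_rat r :: 'p padic) * real CARD('p) powi (- int k)"
    using padic_norm_mult[of "of_rat r :: 'p padic" "of_nat CARD('p) powi int k"]
    by (simp only: padic_norm_card_powi)
  also have "\<dots> \<le> 1 * real CARD('p) powi (- int k)"
    using real_card_gt_0[where 'p='p] assms(2) by (intro mult_right_mono) auto
  finally have "int CARD('p) ^ k dvd b" by (simp add: padic_norm_of_int_le_iff)
  then obtain c where c: "b = int CARD('p) ^ k * c" by auto
  have "of_nat CARD('p) ^ k \<noteq> (0 :: rat)" using card_prime_gt_1[where 'p='p] by simp
  moreover have "r * of_nat CARD('p) ^ k = of_int c * of_nat CARD('p) ^ k" using b c by simp
  ultimately show ?thesis by simp
qed

text \<open>For existence, \<open>x\<close> is approximated by some a / p^m up to a p-adic integer.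
  For uniqueness, the difference of two candidates is an integer of absolute value below 1.\<close>

lemma padic_frac_ex1:
  fixes x :: "'p::prime_card padic"
  shows "\<exists>!r. 0 \<le> r \<and> r < 1 \<and> (\<exists>k. r * of_nat CARD('p) ^ k \<in> \<int>) \<and> padic_norm (x - of_rat r) \<le> 1"
proof (rule ex_ex1I)
  obtain m :: nat where "x \<in> pball 0 (int m)" using pball_exhaust by blast
  from padic_nat_approx_scaled[OF this, of m]
  obtain a where a: "a < CARD('p) ^ m" "x \<in> pball (of_nat a * of_nat CARD('p) powi (- int m)) 0" by auto
  have p: "of_nat CARD('p) ^ m \<noteq> (0 :: rat)" using card_prime_gt_1[where 'p='p] by simp
  define r where "r = (of_nat a / of_nat CARD('p) ^ m :: rat)"
  have "of_rat r = (of_nat a * of_nat CARD('p) powi (- int m) :: 'p padic)"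
    by (simp only: r_def of_rat_divide of_rat_power of_rat_of_nat_eq power_int_minus power_int_of_nat divide_inverse
        of_rat_mult of_rat_inverse)
  then have "padic_norm (x - of_rat r) \<le> 1" using a(2) by (simp add: mem_pball)
  moreover have "r * of_nat CARD('p) ^ m \<in> \<int>" using p by (simp add: r_def)
  moreover have "0 \<le> r" by (simp add: r_def)
  moreover have "r < 1"
  proof -
    have "(of_nat a :: rat) < of_nat (CARD('p) ^ m)" using a(1) by (simp only: of_nat_less_iff)
    then show ?thesis using card_prime_gt_1[where 'p='p] by (simp add: r_def divide_less_eq)
  qed
  ultimately show "\<exists>r. 0 \<le> r \<and> r < 1 \<and> (\<exists>k. r * of_nat CARD('p) ^ k \<in> \<int>) \<and> padic_norm (x - of_rat r) \<le> 1"
    by blast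
next
  fix r s
  assume r: "0 \<le> r \<and> r < 1 \<and> (\<exists>k. r * of_nat CARD('p) ^ k \<in> \<int>) \<and> padic_norm (x - of_rat r) \<le> 1"
    and s: "0 \<le> s \<and> s < 1 \<and> (\<exists>k. s * of_nat CARD('p) ^ k \<in> \<int>) \<and> padic_norm (x - of_rat s) \<le> 1"
  obtain k l where k: "r * of_nat CARD('p) ^ k \<in> \<int>" and l: "s * of_nat CARD('p) ^ l \<in> \<int>" using r s by blast
  have "(r - s) * of_nat CARD('p) ^ (k + l)
      = (r * of_nat CARD('p) ^ k) * of_nat CARD('p) ^ l - (s * of_nat CARD('p) ^ l) * of_nat CARD('p) ^ k"
    by (simp add: power_add algebra_simps)
  also have "\<dots> \<in> \<int>" by (intro k l Ints_diff Ints_mult Ints_power Ints_of_nat)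
  finally have "r - s \<in> \<int>"
  proof (rule rat_int_if_padic_int)
    have "padic_norm (of_rat (r - s) :: 'p padic) \<le> max (padic_norm (x - of_rat s)) (padic_norm (x - of_rat r))"
      using padic_norm_diff_ultra[of "x - of_rat s" "x - of_rat r"] by (simp add: of_rat_diff)
    also have "\<dots> \<le> 1" using r s by (simp only: max.bounded_iff)
    finally show "padic_norm (of_rat (r - s) :: 'p padic) \<le> 1" .
  qed
  then obtain z where "r - s = of_int z" by (auto elim: Ints_cases)
  moreover have "\<bar>r - s\<bar> < 1" using r s by linarith
  ultimately have "\<bar>of_int z\<bar> < (1 :: rat)" by simp
  then have "z = 0" by linarith
  with \<open>r - s = of_int z\<close> show "r = s" by simp
qed

lemma padic_frac_properties:
  fixes x :: "'p::prime_card padic"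
  shows "0 \<le> padic_frac x" "padic_frac x < 1" "\<exists>k. padic_frac x * of_nat CARD('p) ^ k \<in> \<int>"
    "padic_norm (x - of_rat (padic_frac x)) \<le> 1"
  using theI'[OF padic_frac_ex1[of x]] unfolding padic_frac_def by blast+

text \<open>The fractional part is additive up to an integer, because the defect has a power of p as
  denominator and is a p-adic integer; \<open>cis\<close> does not see integer multiples of a full
  turn.\<close>

lemma padic_char_add: "padic_char (x + y) = padic_char x * padic_char (y :: 'p::prime_card padic)"
proof -
  let ?r = "padic_frac (x + y) - padic_frac x - padic_frac y"
  obtain k l m where k: "padic_frac (x + y) * of_nat CARD('p) ^ k \<in> \<int>"
    and l: "padic_frac x * of_nat CARD('p) ^ l \<in> \<int>" and m: "padic_frac y * of_nat CARD('p) ^ m \<in> \<int>"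
    using padic_frac_properties(3) by metis
  have "?r * of_nat CARD('p) ^ (k + l + m)
      = (padic_frac (x + y) * of_nat CARD('p) ^ k) * of_nat CARD('p) ^ (l + m)
        - (padic_frac x * of_nat CARD('p) ^ l) * of_nat CARD('p) ^ (k + m)
        - (padic_frac y * of_nat CARD('p) ^ m) * of_nat CARD('p) ^ (k + l)"
    by (simp add: power_add algebra_simps)
  also have "\<dots> \<in> \<int>" by (intro k l m Ints_diff Ints_mult Ints_power Ints_of_nat)
  finally have "?r \<in> \<int>"
  proof (rule rat_int_if_padic_int)
    have "of_rat ?r = ((x - of_rat (padic_frac x)) + (y - of_rat (padic_frac y))) - (x + y - of_rat (padic_frac (x + y)))"
      by (simp add: of_rat_diff)
    then have "padic_norm (of_rat ?r :: 'p padic)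
        \<le> max (padic_norm ((x - of_rat (padic_frac x)) + (y - of_rat (padic_frac y)))) (padic_norm (x + y - of_rat (padic_frac (x + y))))"
      by (simp only: padic_norm_diff_ultra)
    moreover have "padic_norm ((x - of_rat (padic_frac x)) + (y - of_rat (padic_frac y))) \<le> 1"
      using padic_norm_ultra[of "x - of_rat (padic_frac x)" "y - of_rat (padic_frac y)"]
        padic_frac_properties(4)[of x] padic_frac_properties(4)[of y] by linarith
    ultimately show "padic_norm (of_rat ?r :: 'p padic) \<le> 1"
      using padic_frac_properties(4)[of "x + y"] by linarith
  qed
  then obtain z where z: "?r = of_int z" by (auto elim: Ints_cases)
  then have "padic_frac (x + y) = padic_frac x + padic_frac y + of_int z" by (simp add: algebra_simps)
  then have e: "(of_rat (padic_frac (x + y)) :: real) = of_rat (padic_frac x) + of_rat (padic_frac y) + of_int z"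
    by (simp add: of_rat_add)
  have "padic_char (x + y) = cis (2 * pi * of_rat (padic_frac x)) * cis (2 * pi * of_rat (padic_frac y)) * cis (2 * pi * of_int z)"
    unfolding padic_char_def e by (simp only: cis_mult distrib_left)
  also have "cis (2 * pi * of_int z) = 1" by (rule cis_multiple_2pi) simp
  finally show ?thesis by (simp add: padic_char_def)
qed

text \<open>That the character is trivial on the unit ball and nowhere else makes the balls of
  radius p^J and p^-J dual to each other.\<close>

lemma padic_char_eq_1_iff: "padic_char x = 1 \<longleftrightarrow> padic_norm (x :: 'p::prime_card padic) \<le> 1"
proof
  assume x: "padic_norm x \<le> 1"
  have "padic_frac x = 0"
    unfolding padic_frac_def using x by (intro the1_equality padic_frac_ex1) auto
  then show "padic_char x = 1" by (simp add: padic_char_def)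
next
  assume "padic_char x = 1"
  then have "cos (2 * pi * of_rat (padic_frac x)) = 1"
    unfolding padic_char_def by (metis cis.sel(1) one_complex.sel(1))
  then obtain n :: int where n: "2 * pi * of_rat (padic_frac x) = of_int n * 2 * pi"
    by (auto simp: cos_one_2pi_int)
  have "(of_rat (padic_frac x) :: real) = of_rat (of_int n)" using n by simp
  then have e: "padic_frac x = of_int n" by (simp only: of_rat_eq_iff)
  then have "n = 0" using padic_frac_properties(1,2)[of x] by simp
  then show "padic_norm x \<le> 1" using padic_frac_properties(4)[of x] e by simp
qed

lemma norm_padic_char [simp]: "cmod (padic_char x) = 1"
  by (simp add: padic_char_def)

lemma cnj_padic_char: "cnj (padic_char x) = padic_char (- x :: 'p::prime_card padic)"
proof -
  have "padic_char x * padic_char (- x) = 1"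
    using padic_char_add[of x "- x"] padic_char_eq_1_iff[of "0 :: 'p padic"] by simp
  moreover have "padic_char x * cnj (padic_char x) = 1"
    by (simp add: complex_norm_square[symmetric])
  moreover have "padic_char x \<noteq> 0" using norm_padic_char[of x] by (metis norm_zero zero_neq_one)
  ultimately show ?thesis by (metis mult_left_cancel)
qed

section \<open>Fourier transform of locally constant functions\<close>

lemma locally_constant_measurable:
  fixes f :: "'p::prime_card padic \<Rightarrow> 'b::topological_space"
  assumes "\<And>x y. y \<in> pball x J \<Longrightarrow> f y = f x"
  shows "continuous_on UNIV f" "f \<in> borel_measurable borel"
proof -
  have "open (f -` U)" for U
  proof (subst open_subopen, intro ballI)
    fix x assume "x \<in> f -` U"
    then show "\<exists>T. open T \<and> x \<in> T \<and> T \<subseteq> f -` U"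
      using assms by (intro exI[of _ "pball x J"]) (auto simp: open_pball)
  qed
  then show c: "continuous_on UNIV f" by (simp add: continuous_on_open_vimage)
  then show "f \<in> borel_measurable borel" by (rule borel_measurable_continuous_onI)
qed

lemma padic_char_measurable [measurable]: "padic_char \<in> borel_measurable (borel :: 'p::prime_card padic measure)"
proof (rule locally_constant_measurable(2)[of 0])
  fix x y :: "'p padic" assume "y \<in> pball x 0"
  then have "padic_char (y - x) = 1" by (simp add: mem_pball padic_char_eq_1_iff)
  then show "padic_char y = padic_char x" using padic_char_add[of "y - x" x] by simp
qed

lemma measurable_padic_mult [measurable]:
  assumes "f \<in> borel_measurable M" "g \<in> borel_measurable M"
  shows "(\<lambda>x. f x * g x :: 'p::prime_card padic) \<in> borel_measurable M"
  by (rule borel_measurable_continuous_Pair[OF assms]) (intro continuous_on_mult' continuous_on_fst continuous_on_snd continuous_on_id)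

lemma integral_padic_translate:
  fixes g :: "'p::prime_card padic \<Rightarrow> complex"
  assumes [measurable]: "g \<in> borel_measurable borel"
  shows "(LINT x|padic_haar. g (x + h)) = (LINT x|padic_haar. g x)"
proof -
  have m: "(\<lambda>x :: 'p padic. x + h) \<in> borel_measurable borel"
    by (intro borel_measurable_continuous_onI continuous_intros)
  have "(LINT x|padic_haar. g x) = (LINT x|distr padic_haar borel (\<lambda>x. x + h). g x)"
    by (simp only: distr_padic_haar_translate)
  also have "\<dots> = (LINT x|padic_haar. g (x + h))"
    using m by (intro integral_distr) auto
  finally show ?thesis by simp
qed

text \<open>If \<open>f\<close> is constant on balls of radius \<open>p ^ J\<close>, translating the integration variable by \<open>h\<close> in such a
  ball multiplies the Fourier integral at \<open>\<xi>\<close> by \<open>padic_char (\<xi> * h)\<close>, which differs from 1 for a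
  suitable \<open>h\<close> when \<open>\<xi>\<close> is large.\<close>

lemma padic_fourier_level_eq_0:
  fixes f :: "'p::prime_card padic \<Rightarrow> complex"
  assumes f: "\<And>x y. y \<in> pball x J \<Longrightarrow> f y = f x" and \<xi>: "\<xi> \<notin> pball 0 (- J)"
  shows "padic_fourier f \<xi> = 0"
proof -
  define h where "h = (of_nat CARD('p) powi (- J) :: 'p padic)"
  have nh: "padic_norm h = real CARD('p) powi J" by (simp add: h_def padic_norm_card_powi)
  have "f (x + h) = f x" for x by (rule f) (simp add: mem_pball nh)
  moreover have fm [measurable]: "f \<in> borel_measurable borel" by (rule locally_constant_measurable(2)[OF f])
  moreover have "(LINT x|padic_haar. padic_char (\<xi> * (x + h)) * f (x + h)) = (LINT x|padic_haar. padic_char (\<xi> * x) * f x)"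
    by (rule integral_padic_translate[of "\<lambda>x. padic_char (\<xi> * x) * f x"]) measurable
  ultimately have "(LINT x|padic_haar. padic_char (\<xi> * h) * (padic_char (\<xi> * x) * f x)) = padic_fourier f \<xi>"
    by (simp add: padic_fourier_def distrib_left padic_char_add mult_ac)
  then have "padic_char (\<xi> * h) * padic_fourier f \<xi> = padic_fourier f \<xi>"
    by (simp add: padic_fourier_def)
  moreover have "padic_char (\<xi> * h) \<noteq> 1"
  proof -
    have "padic_norm \<xi> * real CARD('p) powi J > real CARD('p) powi (- J) * real CARD('p) powi J"
      using \<xi> real_card_gt_0[where 'p='p] by (intro mult_strict_right_mono) (auto simp: mem_pball)
    then show ?thesis
      using real_card_gt_0[where 'p='p]
      by (simp add: padic_char_eq_1_iff padic_norm_mult nh power_int_minus)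
  qed
  ultimately show ?thesis by (metis mult_cancel_right1)
qed

text \<open>On the dual ball the character equals 1 along the domain of integration and the integral
  is the volume p^J; elsewhere the translation argument gives 0.\<close>

lemma padic_fourier_ball:
  "(LINT x|padic_haar. padic_char (\<xi> * x) * complex_of_real (indicator (pball 0 J) x))
    = complex_of_real (ball_kernel (- J) (\<xi> :: 'p::prime_card padic))"
proof (cases "\<xi> \<in> pball 0 (- J)")
  case True
  have e: "padic_char (\<xi> * x) * complex_of_real (indicator (pball 0 J) x) = complex_of_real (indicator (pball 0 J) x)" for x
  proof (cases "x \<in> pball 0 J")
    case x: True
    have "padic_norm (\<xi> * x) \<le> real CARD('p) powi (- J) * real CARD('p) powi J"
      unfolding padic_norm_mult using True x real_card_gt_0[where 'p='p]
      by (intro mult_mono) (auto simp: mem_pball)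
    then have "padic_char (\<xi> * x) = 1"
      using real_card_gt_0[where 'p='p] by (simp add: padic_char_eq_1_iff power_int_minus)
    then show ?thesis by simp
  qed simp
  have "(LINT x|padic_haar. padic_char (\<xi> * x) * complex_of_real (indicator (pball 0 J) x))
      = complex_of_real (LINT x|padic_haar. indicator (pball 0 J) (x :: 'p padic))"
    by (simp only: e integral_complex_of_real)
  also have "\<dots> = complex_of_real (real CARD('p) powi J)"
    by (simp add: measure_padic_haar_pball)
  finally show ?thesis using True by (simp add: ball_kernel_def)
next
  case False
  have "padic_fourier (\<lambda>x. complex_of_real (indicator (pball 0 J) x)) \<xi> = 0"
  proof (rule padic_fourier_level_eq_0[OF _ False])
    fix x y :: "'p padic" assume "y \<in> pball x J"
    then have "y \<in> pball 0 J \<longleftrightarrow> x \<in> pball 0 J" using pball_trans pball_commute by blast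
    then show "complex_of_real (indicator (pball 0 J) y) = complex_of_real (indicator (pball 0 J) x)"
      by (simp add: indicator_def)
  qed
  then show ?thesis using False by (simp add: padic_fourier_def ball_kernel_def)
qed

lemma emeasure_padic_haar_singleton: "emeasure padic_haar {a :: 'p::prime_card padic} = 0"
proof -
  have le: "emeasure padic_haar {a} \<le> 0 + ennreal e" if e: "0 < e" for e
  proof -
    obtain k where k: "real CARD('p) powi k < e" "k \<le> 0" by (rule powi_small[OF e, where 'p='p])
    have "emeasure padic_haar {a} \<le> emeasure padic_haar (pball a k)" by (intro emeasure_mono) auto
    also have "\<dots> \<le> ennreal e" using k by (simp add: emeasure_padic_haar_pball ennreal_leI)
    finally show ?thesis by simp
  qed
  have "emeasure padic_haar {a} \<le> 0" by (rule ennreal_le_epsilon) (rule le)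
  then show ?thesis by simp
qed

text \<open>The increments vanish below \<open>J\<close>, so the telescoping sum is finite and
  starts from the value 0.\<close>

lemma increment_cutoff_partial_sum:
  "(LINT i|int_counting. increment (cutoff J F) i * indicator {..j} i) = cutoff J F j"
proof -
  have supp: "increment (cutoff J F) i * indicator {..j} i = 0" if "i \<notin> {J..j}" for i
    using that by (auto simp: increment_def cutoff_def indicator_def)
  have "(LINT i|int_counting. increment (cutoff J F) i * indicator {..j} i)
      = (\<Sum>i | i \<in> UNIV \<and> increment (cutoff J F) i * indicator {..j} i \<noteq> 0. increment (cutoff J F) i * indicator {..j} i)"
    by (rule lebesgue_integral_count_space_finite_support) (rule finite_subset[of _ "{J..j}"], use supp in blast, simp)
  also have "\<dots> = (\<Sum>i\<in>{J..j}. increment (cutoff J F) i * indicator {..j} i)"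
    by (rule sum.mono_neutral_left) (simp, use supp in blast, auto)
  also have "\<dots> = (\<Sum>i\<in>{J..j}. cutoff J F i - cutoff J F (i - 1))"
    by (rule sum.cong) (auto simp: increment_def)
  also have "\<dots> = cutoff J F j"
  proof (cases "J \<le> j")
    case True
    then show ?thesis
    proof (induct j rule: int_ge_induct)
      case (step i)
      have "{J..i + 1} = insert (i + 1) {J..i}" using step by auto
      then show ?case using step by simp
    qed (simp add: cutoff_def)
  qed (simp add: cutoff_def)
  finally show ?thesis .
qed

text \<open>Abel summation: inside the ball of radius p^-J the power of the norm is a sum of
  increments times indicators of the balls of radius p^-i with i \<ge> J. Each indicator transforms
  into a ball kernel, and Fubini exchanges sum and transform.\<close>

lemma frac1_cut_fourier:
  assumes \<beta>: "0 < \<beta>"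
  shows "(LINT \<xi>|padic_haar. padic_char (\<xi> * z) * complex_of_real (indicator (pball 0 (- J)) \<xi> * padic_norm \<xi> powr \<beta>))
    = complex_of_real (frac1_cut \<beta> J (z :: 'p::prime_card padic))"
proof -
  let ?q = "real CARD('p)"
  let ?c = "increment (cutoff J (symb ?q \<beta>))"
  note q = real_card_gt_1[where 'p='p]
  have adm: "admissible ?q ?c" by (rule admissible_cutoff_symb[OF q \<beta>])
  interpret I: sigma_finite_measure int_counting by (rule sigma_finite_int_counting)
  interpret P: pair_sigma_finite int_counting "padic_haar :: 'p padic measure" by unfold_locales
  let ?f = "\<lambda>i \<xi>. complex_of_real (?c i) * (padic_char (z * \<xi>) * complex_of_real (indicator (pball 0 (- i)) (\<xi> :: 'p padic)))"
  have fm: "?f i \<in> borel_measurable padic_haar" for i by simp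
  have nf: "norm (?f i \<xi>) = \<bar>?c i\<bar> * indicator (pball 0 (- i)) \<xi>" for i \<xi>
    by (simp add: norm_mult)
  have int: "integrable (int_counting \<Otimes>\<^sub>M padic_haar) (\<lambda>(i, \<xi>). ?f i \<xi>)"
  proof (rule P.Fubini_integrable)
    show "(\<lambda>(i, \<xi>). ?f i \<xi>) \<in> borel_measurable (int_counting \<Otimes>\<^sub>M padic_haar)"
      by (rule meas_count_pair) (rule fm)
    have "(LINT \<xi>|padic_haar. norm (?f i \<xi>)) = \<bar>?c i * ?q powi (- i)\<bar>" for i
      unfolding nf using q by (simp add: measure_padic_haar_pball abs_mult)
    moreover have "integrable int_counting (\<lambda>i. \<bar>?c i * ?q powi (- i)\<bar>)"
      using adm by (auto simp: admissible_def)
    ultimately show "integrable int_counting (\<lambda>i. LINT \<xi>|padic_haar. norm (case (i, \<xi>) of (i, \<xi>) \<Rightarrow> ?f i \<xi>))"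
      by simp
    show "AE i in int_counting. integrable padic_haar (\<lambda>\<xi>. case (i, \<xi>) of (i, \<xi>) \<Rightarrow> ?f i \<xi>)"
    proof (rule AE_I2, simp only: prod.case)
      fix i
      show "integrable padic_haar (?f i)"
        by (rule Bochner_Integration.integrable_bound[of _ "\<lambda>\<xi>. \<bar>?c i\<bar> * indicator (pball 0 (- i)) \<xi>"])
          (use fm nf in \<open>auto simp: emeasure_padic_haar_pball\<close>)
    qed
  qed
  \<comment> \<open>The partial sum is evaluated at the exponent of the norm of
    \<open>\<xi>\<close>; the origin, which has no exponent, is a null set.\<close>
  have pt: "(LINT i|int_counting. ?f i \<xi>) = padic_char (\<xi> * z) * complex_of_real (indicator (pball 0 (- J)) \<xi> * padic_norm \<xi> powr \<beta>)"
    if \<xi>: "\<xi> \<noteq> 0" for \<xi> :: "'p padic"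
  proof -
    obtain k where k: "padic_norm \<xi> = ?q powi k" by (rule padic_norm_values[OF \<xi>])
    have mem: "\<xi> \<in> pball 0 (- i) \<longleftrightarrow> i \<le> - k" for i
      using powi_le_iff[OF q, of k "- i"] by (auto simp: mem_pball k)
    have "?f i \<xi> = padic_char (\<xi> * z) * complex_of_real (?c i * indicator {..- k} i)" for i
      using mem[of i] by (simp add: indicator_def mult.commute)
    then have "(LINT i|int_counting. ?f i \<xi>) = padic_char (\<xi> * z) * complex_of_real (LINT i|int_counting. ?c i * indicator {..- k} i)"
      by (simp only: integral_mult_right_zero integral_complex_of_real)
    also have "(LINT i|int_counting. ?c i * indicator {..- k} i) = cutoff J (symb ?q \<beta>) (- k)"
      by (rule increment_cutoff_partial_sum)
    also have "\<dots> = indicator (pball 0 (- J)) \<xi> * padic_norm \<xi> powr \<beta>"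
      using mem[of J] q by (simp add: cutoff_def symb_def k powi_eq_powr powr_powr mult.commute indicator_def)
    finally show ?thesis .
  qed
  have "(LINT \<xi>|padic_haar. padic_char (\<xi> * z) * complex_of_real (indicator (pball 0 (- J)) \<xi> * padic_norm \<xi> powr \<beta>))
      = (LINT \<xi>|padic_haar. LINT i|int_counting. ?f i \<xi>)"
  proof (rule integral_cong_AE)
    have nm: "padic_norm \<in> borel_measurable (borel :: 'p padic measure)"
      by (intro borel_measurable_continuous_onI continuous_on_padic_norm)
    show "(\<lambda>\<xi>. padic_char (\<xi> * z) * complex_of_real (indicator (pball 0 (- J)) \<xi> * padic_norm \<xi> powr \<beta>)) \<in> borel_measurable padic_haar"
      using nm by (simp, measurable)
    show "(\<lambda>\<xi>. LINT i|int_counting. ?f i \<xi>) \<in> borel_measurable padic_haar"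
      using P.integrable_snd[OF int] by (rule borel_measurable_integrable)
    have "AE \<xi> in padic_haar. \<xi> \<noteq> (0 :: 'p padic)"
      by (rule AE_I[of _ _ "{0}"]) (auto simp: emeasure_padic_haar_singleton)
    then show "AE \<xi> in padic_haar. padic_char (\<xi> * z) * complex_of_real (indicator (pball 0 (- J)) \<xi> * padic_norm \<xi> powr \<beta>)
        = (LINT i|int_counting. ?f i \<xi>)"
      by eventually_elim (rule pt[symmetric])
  qed
  also have "\<dots> = (LINT i|int_counting. LINT \<xi>|padic_haar. ?f i \<xi>)"
    by (rule P.Fubini_integral[OF int])
  also have "\<dots> = (LINT i|int_counting. complex_of_real (?c i * ball_kernel i z))"
    by (rule Bochner_Integration.integral_cong[OF refl])
      (simp only: integral_mult_right_zero padic_fourier_ball minus_minus of_real_mult)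
  also have "\<dots> = complex_of_real (frac1_cut \<beta> J z)"
    unfolding frac1_cut_def radial_kernel_def by (rule integral_complex_of_real)
  finally show ?thesis .
qed

text \<open>The transform of \<open>f\<close> vanishes outside the ball of radius p^-J, so the
  unbounded multiplier may be cut off there. The double integral then converges absolutely, and
  Fubini turns it into a convolution.\<close>

lemma fractional_derivative_level:
  fixes f :: "'p::prime_card padic \<Rightarrow> complex"
  assumes \<beta>: "0 < \<beta>" and f: "\<And>x y. y \<in> pball x J \<Longrightarrow> f y = f x" and supp: "\<And>x. f x \<noteq> 0 \<Longrightarrow> x \<in> pball 0 N"
  shows "padic_fractional_derivative \<beta> f x = (LINT y|padic_haar. complex_of_real (frac1_cut \<beta> J (x - y)) * f y)"
proof -
  interpret P: pair_sigma_finite "padic_haar :: 'p padic measure" "padic_haar :: 'p padic measure" by unfold_locales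
  have fm [measurable]: "f \<in> borel_measurable borel" by (rule locally_constant_measurable(2)[OF f])
  have "continuous_on (pball 0 N) f"
    by (rule continuous_on_subset[OF locally_constant_measurable(1)[OF f]]) auto
  then have "bounded (f ` pball 0 N)"
    by (intro compact_imp_bounded compact_continuous_image compact_pball)
  then obtain B0 where "\<And>x. x \<in> pball 0 N \<Longrightarrow> cmod (f x) \<le> B0" by (auto simp: bounded_iff)
  then have B: "cmod (f x) \<le> max 0 B0 * indicator (pball 0 N) x" for x
    using supp[of x] by (cases "f x = 0") (auto simp: indicator_def le_max_iff_disj)
  have nm [measurable]: "padic_norm \<in> borel_measurable (borel :: 'p padic measure)"
    by (intro borel_measurable_continuous_onI continuous_on_padic_norm)
  let ?b = "pball 0 (- J) :: 'p padic set" and ?c = "pball 0 N :: 'p padic set"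
  let ?w = "\<lambda>\<xi> :: 'p padic. indicator ?b \<xi> * padic_norm \<xi> powr \<beta>"
  let ?F = "\<lambda>\<xi> y. padic_char (\<xi> * (y - x)) * complex_of_real (?w \<xi>) * f y"
  have w: "\<bar>?w \<xi>\<bar> \<le> (real CARD('p) powi (- J)) powr \<beta> * indicator ?b \<xi>" for \<xi>
    using \<beta> by (auto simp: indicator_def mem_pball intro!: powr_mono2)
  have dm: "(\<lambda>p :: 'p padic \<times> 'p padic. snd p - x) \<in> borel_measurable (padic_haar \<Otimes>\<^sub>M padic_haar)"
    by (rule measurable_padic_diff) auto
  have int: "integrable (padic_haar \<Otimes>\<^sub>M padic_haar) (\<lambda>(\<xi>, y). ?F \<xi> y)"
  proof (rule Bochner_Integration.integrable_bound)
    let ?K = "(real CARD('p) powi (- J)) powr \<beta> * max 0 B0"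
    show "integrable (padic_haar \<Otimes>\<^sub>M padic_haar) (\<lambda>p. ?K * indicator (?b \<times> ?c) p)"
    proof -
      have "emeasure (padic_haar \<Otimes>\<^sub>M padic_haar) (?b \<times> ?c) = emeasure padic_haar ?b * emeasure padic_haar (pball (0 :: 'p padic) N)"
        by (rule padic_haar.emeasure_pair_measure_Times) auto
      also have "\<dots> < \<infinity>" by (simp add: emeasure_padic_haar_pball ennreal_mult_less_top)
      finally show ?thesis
        by (intro integrable_mult_right integrable_real_indicator pair_measureI) auto
    qed
    have c1: "(\<lambda>p :: 'p padic \<times> 'p padic. padic_char (fst p * (snd p - x))) \<in> borel_measurable (padic_haar \<Otimes>\<^sub>M padic_haar)"
      by (rule measurable_compose[OF measurable_padic_mult[OF _ dm] padic_char_measurable]) measurable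
    have c2: "(\<lambda>p :: 'p padic \<times> 'p padic. complex_of_real (?w (fst p))) \<in> borel_measurable (padic_haar \<Otimes>\<^sub>M padic_haar)"
      by measurable
    have c3: "(\<lambda>p :: 'p padic \<times> 'p padic. f (snd p)) \<in> borel_measurable (padic_haar \<Otimes>\<^sub>M padic_haar)"
      by measurable
    show "(\<lambda>(\<xi>, y). ?F \<xi> y) \<in> borel_measurable (padic_haar \<Otimes>\<^sub>M padic_haar)"
      unfolding case_prod_unfold by (intro borel_measurable_times c1 c2 c3)
    show "AE p in padic_haar \<Otimes>\<^sub>M padic_haar. norm (case p of (\<xi>, y) \<Rightarrow> ?F \<xi> y) \<le> norm (?K * indicator (?b \<times> ?c) p)"
    proof (rule AE_I2)
      fix p :: "'p padic \<times> 'p padic"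
      obtain \<xi> y where p: "p = (\<xi>, y)" by (cases p)
      have "norm (?F \<xi> y) = \<bar>?w \<xi>\<bar> * cmod (f y)" by (simp add: norm_mult)
      also have "\<dots> \<le> ((real CARD('p) powi (- J)) powr \<beta> * indicator ?b \<xi>) * (max 0 B0 * indicator (pball 0 N) y)"
        by (rule mult_mono[OF w B]) auto
      also have "\<dots> = norm (?K * indicator (?b \<times> ?c) p)"
        by (simp add: p indicator_times abs_mult mult_ac)
      finally show "norm (case p of (\<xi>, y) \<Rightarrow> ?F \<xi> y) \<le> norm (?K * indicator (?b \<times> ?c) p)" by (simp add: p)
    qed
  qed
  have "padic_fractional_derivative \<beta> f x = (LINT \<xi>|padic_haar. LINT y|padic_haar. ?F \<xi> y)"
    unfolding padic_fractional_derivative_def padic_inv_fourier_def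
  proof (rule Bochner_Integration.integral_cong[OF refl])
    fix \<xi> :: "'p padic"
    have "(LINT y|padic_haar. ?F \<xi> y) = (LINT y|padic_haar. cnj (padic_char (\<xi> * x)) * complex_of_real (?w \<xi>) * (padic_char (\<xi> * y) * f y))"
    proof (rule Bochner_Integration.integral_cong[OF refl])
      fix y
      have "padic_char (\<xi> * (y - x)) = padic_char (\<xi> * y) * cnj (padic_char (\<xi> * x))"
        using padic_char_add[of "\<xi> * y" "- (\<xi> * x)"] by (simp add: cnj_padic_char right_diff_distrib)
      then show "?F \<xi> y = cnj (padic_char (\<xi> * x)) * complex_of_real (?w \<xi>) * (padic_char (\<xi> * y) * f y)"
        by (simp only: mult_ac)
    qed
    also have "\<dots> = cnj (padic_char (\<xi> * x)) * complex_of_real (?w \<xi>) * padic_fourier f \<xi>"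
      by (simp add: padic_fourier_def)
    also have "\<dots> = cnj (padic_char (\<xi> * x)) * (complex_of_real (padic_norm \<xi> powr \<beta>) * padic_fourier f \<xi>)"
      using padic_fourier_level_eq_0[of J f \<xi>, OF f] by (cases "\<xi> \<in> ?b") auto
    finally show "cnj (padic_char (\<xi> * x)) * (complex_of_real (padic_norm \<xi> powr \<beta>) * padic_fourier f \<xi>) = (LINT y|padic_haar. ?F \<xi> y)"
      by simp
  qed
  also have "\<dots> = (LINT y|padic_haar. LINT \<xi>|padic_haar. ?F \<xi> y)"
    by (rule P.Fubini_integral[OF int, symmetric])
  also have "\<dots> = (LINT y|padic_haar. complex_of_real (frac1_cut \<beta> J (x - y)) * f y)"
  proof (rule Bochner_Integration.integral_cong[OF refl])
    fix y
    have "frac1_cut \<beta> J (y - x) = frac1_cut \<beta> J (x - y)"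
      using radial_kernel_minus[of _ "x - y"] by (simp add: frac1_cut_def)
    then show "(LINT \<xi>|padic_haar. ?F \<xi> y) = complex_of_real (frac1_cut \<beta> J (x - y)) * f y"
      by (simp only: integral_mult_left_zero frac1_cut_fourier[OF \<beta>])
  qed
  finally show ?thesis .
qed

lemma even_L1_integrable:
  assumes g: "even_L1 C (g :: 'p::prime_card padic \<Rightarrow> real)"
  shows "integrable padic_haar (\<lambda>y. g (x - y))"
proof (rule integrableI_bounded)
  have gm: "g \<in> borel_measurable borel" using g by (simp add: even_L1_def)
  have "(\<lambda>y. g (x - y)) \<in> borel_measurable borel"
    by (rule measurable_compose[OF _ gm], intro borel_measurable_continuous_onI continuous_intros)
  then show "(\<lambda>y. g (x - y)) \<in> borel_measurable padic_haar" by simp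
  show "(\<integral>\<^sup>+y. ennreal (norm (g (x - y))) \<partial>padic_haar) < \<infinity>"
    using even_L1_translate(2)[OF g, of x] by (simp add: le_less_trans)
qed

text \<open>In direction \<open>i\<close> this is the one-variable formula. In the other coordinates
  the ball kernels have mass 1 and average over balls on which \<open>u\<close> is constant, so they
  reproduce the section of \<open>u\<close> through \<open>x\<close>.\<close>

lemma vladimirov_level:
  fixes u :: "('n::finite \<Rightarrow> 'p::prime_card padic) \<Rightarrow> complex"
  assumes \<beta>: "0 < \<beta>" and \<alpha>: "\<And>i. \<alpha> i = \<beta>" and u: "u \<in> test_functions" and lev: "level J u"
  shows "vladimirov \<alpha> u = kernel_op padic_haar_n (vlad_cut \<beta> J) u"
proof
  fix x :: "'n \<Rightarrow> 'p padic"
  let ?k = "\<lambda>i. prod_kernel (\<lambda>k. if k = i then frac1_cut \<beta> J else heat1_cut \<beta> J 0) :: ('n \<Rightarrow> 'p padic) \<Rightarrow> _"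
  have uL2: "u \<in> L2_functions padic_haar_n" by (rule test_function_L2[OF u])
  obtain J' N where N: "\<And>x. u x \<noteq> 0 \<Longrightarrow> x \<in> cube (\<lambda>_. 0) (int N)" using test_function_level[OF u] by metis
  have e1: "even_L1 1 (heat1_cut \<beta> J 0 :: 'p padic \<Rightarrow> real)" by (rule even_L1_heat1_cut[OF \<beta>]) simp
  have e2: "even_L1 (2 * symb (real CARD('p)) \<beta> J) (frac1_cut \<beta> J :: 'p padic \<Rightarrow> real)" by (rule even_L1_frac1_cut[OF \<beta>])
  have frac_eq: "padic_fractional_derivative \<beta> (\<lambda>s. u (x(i := s))) (x i) = kernel_op padic_haar_n (?k i) u x" for i
  proof -
    let ?f = "\<lambda>s. u (x(i := s))"
    have flev: "?f t = ?f s" if "t \<in> pball s J" for s t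
    proof -
      have "x(i := t) \<in> cube (x(i := s)) J" using that by (auto simp: cube_def)
      then show ?thesis using lev by (simp add: level_def)
    qed
    have fsupp: "s \<in> pball 0 (int N)" if "?f s \<noteq> 0" for s
      using N[OF that] by (auto simp: cube_def dest: spec[of _ i])
    have fm: "?f \<in> borel_measurable borel" by (rule locally_constant_measurable(2)[OF flev])
    have "continuous_on (pball 0 (int N)) ?f"
      by (rule continuous_on_subset[OF locally_constant_measurable(1)[OF flev]]) auto
    then have "bounded (?f ` pball 0 (int N))"
      by (intro compact_imp_bounded compact_continuous_image compact_pball)
    then obtain B0 where B0: "\<And>s. s \<in> pball 0 (int N) \<Longrightarrow> cmod (?f s) \<le> B0" by (auto simp: bounded_iff)
    have B: "cmod (?f s) \<le> max 0 B0" for s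
    proof (cases "?f s = 0")
      case False
      then show ?thesis using B0[OF fsupp[OF False]] by simp
    qed simp
    let ?\<phi> = "\<lambda>k s. if k = i then complex_of_real (frac1_cut \<beta> J (x i - s)) * ?f s else complex_of_real (ball_kernel J (x k - s))"
    have h0: "heat1_cut \<beta> J 0 = (ball_kernel J :: 'p padic \<Rightarrow> real)" using heat1_cut_0[OF \<beta>] by auto
    have int: "integrable padic_haar (?\<phi> k)" for k
    proof (cases "k = i")
      case True
      have "integrable padic_haar (\<lambda>s. complex_of_real (frac1_cut \<beta> J (x i - s)) * ?f s)"
      proof (rule Bochner_Integration.integrable_bound)
        show "integrable padic_haar (\<lambda>s. max 0 B0 * \<bar>frac1_cut \<beta> J (x i - s)\<bar>)"
          using even_L1_integrable[OF e2, of "x i"] by auto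
        show "(\<lambda>s. complex_of_real (frac1_cut \<beta> J (x i - s)) * ?f s) \<in> borel_measurable padic_haar"
          using fm borel_measurable_integrable[OF even_L1_integrable[OF e2, of "x i"]] by simp
        show "AE s in padic_haar. norm (complex_of_real (frac1_cut \<beta> J (x i - s)) * ?f s) \<le> norm (max 0 B0 * \<bar>frac1_cut \<beta> J (x i - s)\<bar>)"
          using B by (intro AE_I2) (auto simp: norm_mult abs_mult mult.commute intro!: mult_right_mono)
      qed
      then show ?thesis using True by simp
    next
      case False
      then show ?thesis using even_L1_integrable[OF e1, of "x k"] by (simp add: h0)
    qed
    have one: "(LINT s|padic_haar. complex_of_real (ball_kernel J (a - s))) = 1" for a :: "'p padic"
    proof -
      have "ball_kernel J (a - s) = ball_kernel J (s - a)" for s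
        using ball_kernel_minus[of J "a - s"] by simp
      then have "(\<integral>\<^sup>+s. ennreal (ball_kernel J (a - s)) \<partial>padic_haar) = 1"
        using nn_integral_padic_translate[of "\<lambda>y. ennreal (ball_kernel J y)" a] by (simp add: nn_integral_ball_kernel)
      moreover have "integrable padic_haar (\<lambda>s. ball_kernel J (a - s))"
        using even_L1_integrable[OF e1, of a] by (simp add: h0)
      ultimately have "(LINT s|padic_haar. ball_kernel J (a - s)) = 1"
        by (simp add: integral_eq_nn_integral borel_measurable_integrable)
      then show ?thesis by (simp only: integral_complex_of_real of_real_1)
    qed
    have "kernel_op padic_haar_n (?k i) u x = (LINT y|padic_haar_n. (\<Prod>k\<in>UNIV. ?\<phi> k (y k)))"
      unfolding kernel_op_def
    proof (rule Bochner_Integration.integral_cong[OF refl])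
      fix y :: "'n \<Rightarrow> 'p padic"
      let ?R = "\<Prod>k\<in>UNIV - {i}. complex_of_real (ball_kernel J (x k - y k))"
      have "(\<Prod>k\<in>UNIV. ?\<phi> k (y k)) = ?\<phi> i (y i) * (\<Prod>k\<in>UNIV - {i}. ?\<phi> k (y k))"
        by (rule prod.remove) auto
      also have "(\<Prod>k\<in>UNIV - {i}. ?\<phi> k (y k)) = ?R" by (rule prod.cong) auto
      finally have r: "(\<Prod>k\<in>UNIV. ?\<phi> k (y k)) = complex_of_real (frac1_cut \<beta> J (x i - y i)) * ?f (y i) * ?R" by simp
      have "?k i x y = frac1_cut \<beta> J (x i - y i) * (\<Prod>k\<in>UNIV - {i}. ball_kernel J (x k - y k))"
        unfolding prod_kernel_def by (subst prod.remove[of _ i]) (auto simp: h0 intro!: prod.cong)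
      then have l: "complex_of_real (?k i x y) * u y = complex_of_real (frac1_cut \<beta> J (x i - y i)) * u y * ?R"
        by simp
      \<comment> \<open>Where the product of ball kernels does not vanish, \<open>y\<close> lies in
        the cube around \<open>x(i := y i)\<close>, hence \<open>u y\<close> is the value of the
        section; elsewhere both sides are 0.\<close>
      show "complex_of_real (?k i x y) * u y = (\<Prod>k\<in>UNIV. ?\<phi> k (y k))"
      proof (cases "\<forall>k. k \<noteq> i \<longrightarrow> y k \<in> pball (x k) J")
        case True
        then have "y \<in> cube (x(i := y i)) J" by (auto simp: cube_def)
        then have "u y = ?f (y i)" using lev by (simp add: level_def)
        then show ?thesis unfolding l r by simp
      next
        case False
        then obtain k where k: "k \<noteq> i" "y k \<notin> pball (x k) J" by auto
        then have "ball_kernel J (x k - y k) = 0"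
          using pball_commute[of "y k" "x k" J] by (simp add: ball_kernel_def mem_pball)
        then have "?R = 0" using k(1) by (intro prod_zero) auto
        then show ?thesis unfolding l r by simp
      qed
    qed
    also have "\<dots> = (\<Prod>k\<in>UNIV. LINT s|padic_haar. ?\<phi> k s)"
      unfolding padic_haar_n_def by (rule padic_prod.product_integral_prod) (use int in auto)
    also have "\<dots> = (LINT s|padic_haar. ?\<phi> i s) * (\<Prod>k\<in>UNIV - {i}. LINT s|padic_haar. ?\<phi> k s)"
      by (rule prod.remove) auto
    also have "(\<Prod>k\<in>UNIV - {i}. LINT s|padic_haar. ?\<phi> k s) = 1"
    proof (rule prod.neutral, rule ballI)
      fix k assume "k \<in> UNIV - {i}"
      then have k: "(k = i) = False" by simp
      show "(LINT s|padic_haar. ?\<phi> k s) = 1" unfolding k if_False by (rule one)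
    qed
    also have "(LINT s|padic_haar. ?\<phi> i s) = padic_fractional_derivative \<beta> ?f (x i)"
      using fractional_derivative_level[of \<beta> J ?f "int N" "x i", OF \<beta> flev fsupp] by simp
    finally show ?thesis by simp
  qed
  have "schur_kernel padic_haar_n (\<Prod>k\<in>UNIV. if k = i then 2 * symb (real CARD('p)) \<beta> J else 1) (?k i)" for i
    by (rule schur_kernel_prod) (auto intro: e1 e2)
  note integ = padic_n.schur_kernel_integrable(1)[OF this uL2, of x]
  have "kernel_op padic_haar_n (vlad_cut \<beta> J) u x = (LINT y|padic_haar_n. (\<Sum>i\<in>UNIV. complex_of_real (?k i x y) * u y))"
    unfolding kernel_op_def vlad_cut_def by (simp add: sum_distrib_right)
  also have "\<dots> = (\<Sum>i\<in>UNIV. kernel_op padic_haar_n (?k i) u x)"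
    unfolding kernel_op_def by (rule Bochner_Integration.integral_sum) (use integ in auto)
  finally show "vladimirov \<alpha> u x = kernel_op padic_haar_n (vlad_cut \<beta> J) u x"
    by (simp add: vladimirov_def \<alpha> frac_eq)
qed

subsection \<open>Green function\<close>

text \<open>\<open>heat_sg\<close> has the property under the choice operator, so the chosen
  semigroup has it too. Both then have the same generator values, on a dense domain.\<close>

lemma vladimirov_semigroup_eq:
  fixes f :: "('n::finite \<Rightarrow> 'p::prime_card padic) \<Rightarrow> complex"
  assumes \<beta>: "0 < \<beta>" and \<alpha>: "\<And>i. \<alpha> i = \<beta>" and f: "f \<in> L2_functions padic_haar_n" and t: "0 \<le> t"
  shows "AE x in padic_haar_n. vladimirov_semigroup \<alpha> t f x = heat_sg \<beta> t f x"
proof -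
  let ?M = "padic_haar_n :: ('n \<Rightarrow> 'p padic) measure"
  let ?S = "vladimirov_semigroup \<alpha> :: real \<Rightarrow> (('n \<Rightarrow> 'p padic) \<Rightarrow> complex) \<Rightarrow> _"
  let ?P = "\<lambda>T. contraction_semigroup ?M T \<and> (\<forall>f\<in>L2_functions ?M. \<forall>g\<in>L2_functions ?M.
    has_generator_value ?M T f (\<lambda>x. - g x) \<longleftrightarrow> has_closure_value ?M test_functions (vladimirov \<alpha>) f g)"
  have gen: "has_generator_value ?M (heat_sg \<beta>) u (\<lambda>x. - v x)
      \<longleftrightarrow> has_closure_value ?M test_functions (vladimirov \<alpha>) u v"
    if "u \<in> L2_functions ?M" "v \<in> L2_functions ?M" for u v
    by (rule heat_sg_generator_iff_closure[OF \<beta> _ that]) (rule vladimirov_level[OF \<beta> \<alpha>])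
  then have "?P (heat_sg \<beta>)" using heat_sg_contraction_semigroup[OF \<beta>] by blast
  then have P: "?P ?S" unfolding vladimirov_semigroup_def exp_semigroup_def by (rule someI[where P = ?P])
  show ?thesis
  proof (rule contraction_semigroups_eq[OF conjunct1[OF P] heat_sg_contraction_semigroup[OF \<beta>] _ f _ t])
    fix u v assume u: "u \<in> L2_functions ?M" and v: "v \<in> L2_functions ?M" and g: "has_generator_value ?M (heat_sg \<beta>) u v"
    have v': "(\<lambda>x. - v x) \<in> L2_functions ?M" by (intro L2_intros v)
    have "has_closure_value ?M test_functions (vladimirov \<alpha>) u (\<lambda>x. - v x)"
      using gen[OF u v'] g by simp
    then have "has_generator_value ?M ?S u (\<lambda>x. - (- v x))"
      using bspec[OF bspec[OF conjunct2[OF P] u] v'] by simp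
    then show "has_generator_value ?M ?S u v" by simp
  next
    fix \<epsilon> :: real assume "\<epsilon> > 0"
    then show "\<exists>u\<in>L2_functions ?M. \<exists>v\<in>L2_functions ?M. has_generator_value ?M (heat_sg \<beta>) u v \<and> L2_norm ?M (\<lambda>x. u x - f x) < \<epsilon>"
      by (rule heat_sg_domain_dense[OF \<beta> f])
  qed
qed

section \<open>Uniqueness and identification of the heat kernel\<close>

lemma measurable_padic_n_diff:
  assumes "(k :: ('n::finite \<Rightarrow> 'p::prime_card padic) \<Rightarrow> real) \<in> borel_measurable borel"
  shows "(\<lambda>y. k (x - y)) \<in> borel_measurable borel"
proof (rule measurable_compose[OF _ assms])
  have "continuous_on UNIV (\<lambda>y. x - y)"
  proof (rule continuous_on_coordinatewise_then_product)
    fix i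
    have "continuous_on UNIV (\<lambda>y :: 'n \<Rightarrow> 'p padic. x i - y i)"
      by (intro continuous_intros continuous_on_product_coordinates)
    then show "continuous_on UNIV (\<lambda>y :: 'n \<Rightarrow> 'p padic. (x - y) i)" by simp
  qed
  then show "(\<lambda>y. x - y) \<in> borel \<rightarrow>\<^sub>M borel" by (rule borel_measurable_continuous_onI)
qed

lemma cube_diff:
  assumes "x \<in> cube (z :: 'n::finite \<Rightarrow> 'p::prime_card padic) J" "y \<in> cube (\<lambda>_. 0) J"
  shows "x - y \<in> cube z J"
proof -
  have "x i - y i \<in> pball (z i) J" for i
  proof -
    have "padic_norm (x i - z i) \<le> real CARD('p) powi J" "padic_norm (y i) \<le> real CARD('p) powi J"
      using assms by (auto simp: cube_def mem_pball)
    then show ?thesis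
      using padic_norm_diff_ultra[of "x i - z i" "y i"] by (simp add: mem_pball algebra_simps)
  qed
  then show ?thesis by (simp add: cube_def)
qed

text \<open>The test function is the indicator of a cube around 0, so for \<open>x\<close> in the
  cube around \<open>z\<close> the integral only sees values of \<open>k\<close> in that
  cube.\<close>

lemma convolution_cube_close:
  fixes k :: "('n::finite \<Rightarrow> 'p::prime_card padic) \<Rightarrow> real"
  assumes m: "k \<in> borel_measurable borel" and k: "\<And>y. y \<in> cube z J \<Longrightarrow> \<bar>k y - a\<bar> \<le> e" and x: "x \<in> cube z J"
  shows "cmod ((LINT y|padic_haar_n. complex_of_real (k (x - y)) * indicator (cube (\<lambda>_. 0) J) y)
    - of_real (a * measure padic_haar_n (cube (\<lambda>_ :: 'n. 0 :: 'p padic) J)))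
    \<le> e * measure padic_haar_n (cube (\<lambda>_ :: 'n. 0 :: 'p padic) J)"
proof -
  let ?C = "cube (\<lambda>_. 0) J :: ('n \<Rightarrow> 'p padic) set"
  note [measurable] = measurable_padic_n_diff[OF m, of x]
  have fin: "emeasure padic_haar_n ?C < \<infinity>" by (simp add: emeasure_cube)
  have i0: "integrable padic_haar_n (\<lambda>y. c * indicator ?C y)" for c :: real
    using fin by (intro integrable_mult_right integrable_real_indicator) auto
  have ia: "integrable padic_haar_n (\<lambda>y. complex_of_real (a * indicator ?C y))"
    by (rule integrable_of_real[OF i0])
  have bd: "\<bar>k (x - y) - a\<bar> \<le> e" if "y \<in> ?C" for y using k[OF cube_diff[OF x that]] .
  have ik: "integrable padic_haar_n (\<lambda>y. complex_of_real (k (x - y)) * indicator ?C y)"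
  proof (rule Bochner_Integration.integrable_bound[OF i0[of "\<bar>a\<bar> + e"]])
    show "AE y in padic_haar_n. norm (complex_of_real (k (x - y)) * indicator ?C y) \<le> norm ((\<bar>a\<bar> + e) * indicator ?C y)"
    proof (rule AE_I2)
      fix y show "norm (complex_of_real (k (x - y)) * indicator ?C y) \<le> norm ((\<bar>a\<bar> + e) * indicator ?C y)"
        using bd[of y] by (auto simp: indicator_def)
    qed
  qed simp
  have "(LINT y|padic_haar_n. complex_of_real (k (x - y)) * indicator ?C y) - of_real (a * measure padic_haar_n ?C)
      = (LINT y|padic_haar_n. complex_of_real (k (x - y)) * indicator ?C y - complex_of_real (a * indicator ?C y))"
    by (subst Bochner_Integration.integral_diff[OF ik ia]) (simp only: integral_complex_of_real, simp)
  also have "cmod \<dots> \<le> (LINT y|padic_haar_n. e * indicator ?C y)"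
  proof (intro order_trans[OF integral_norm_bound] integral_mono integrable_norm Bochner_Integration.integrable_diff ik ia i0)
    fix y
    show "norm (complex_of_real (k (x - y)) * indicator ?C y - complex_of_real (a * indicator ?C y)) \<le> e * indicator ?C y"
    proof (cases "y \<in> ?C")
      case True
      then have "norm (complex_of_real (k (x - y)) * indicator ?C y - complex_of_real (a * indicator ?C y)) = \<bar>k (x - y) - a\<bar>"
        by (simp flip: of_real_diff)
      then show ?thesis using bd[OF True] True by simp
    qed simp
  qed
  finally show ?thesis by simp
qed

text \<open>The operators agree at almost every point, and a cube around \<open>z\<close> has
  positive measure, so they agree at some point of it. Continuity brings both integrals close to the
  values at \<open>z\<close> times the volume of the cube.\<close>

lemma convolution_kernel_unique:
  fixes k l :: "('n::finite \<Rightarrow> 'p::prime_card padic) \<Rightarrow> real"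
  assumes k: "continuous_on UNIV k" and l: "continuous_on UNIV l"
    and eq: "\<And>f. f \<in> L2_functions padic_haar_n \<Longrightarrow> AE x in padic_haar_n.
      (LINT y|padic_haar_n. complex_of_real (k (x - y)) * f y) = (LINT y|padic_haar_n. complex_of_real (l (x - y)) * f y)"
  shows "k = l"
proof
  fix z
  show "k z = l z"
  proof (rule ccontr)
    assume ne: "k z \<noteq> l z"
    \<comment> \<open>A third of the gap: two errors of at most \<open>e\<close> cannot bridge 3
      e.\<close>
    define e where "e = \<bar>k z - l z\<bar> / 3"
    have e: "e > 0" using ne by (simp add: e_def)
    have "open {y. \<bar>k y - k z\<bar> < e \<and> \<bar>l y - l z\<bar> < e}"
      by (intro open_Collect_conj open_Collect_less continuous_intros k l)
    moreover have "z \<in> {y. \<bar>k y - k z\<bar> < e \<and> \<bar>l y - l z\<bar> < e}" using e by simp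
    ultimately obtain J where J: "J \<le> 0" "cube z J \<subseteq> {y. \<bar>k y - k z\<bar> < e \<and> \<bar>l y - l z\<bar> < e}"
      by (rule open_contains_cube)
    let ?C = "cube (\<lambda>_. 0) J :: ('n \<Rightarrow> 'p padic) set"
    let ?V = "measure padic_haar_n ?C"
    have V: "?V > 0" using real_card_gt_0[where 'p='p] by (simp add: measure_def emeasure_cube)
    have f: "(\<lambda>y. indicator ?C y) \<in> L2_functions padic_haar_n"
      by (rule indicator_L2) (simp_all add: emeasure_cube)
    have "\<exists>x\<in>cube z J. (LINT y|padic_haar_n. complex_of_real (k (x - y)) * indicator ?C y)
        = (LINT y|padic_haar_n. complex_of_real (l (x - y)) * indicator ?C y)"
    proof (rule ccontr)
      assume "\<not> ?thesis"
      then have "AE x in padic_haar_n. x \<notin> cube z J" using eq[OF f] by (auto elim!: eventually_mono)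
      then have "emeasure padic_haar_n (cube z J) = 0" by (subst (asm) AE_iff_measurable) auto
      then show False using real_card_gt_0[where 'p='p] by (simp add: emeasure_cube)
    qed
    then obtain x where x: "x \<in> cube z J" and xeq: "(LINT y|padic_haar_n. complex_of_real (k (x - y)) * indicator ?C y)
        = (LINT y|padic_haar_n. complex_of_real (l (x - y)) * indicator ?C y)" (is "?a = ?b") by blast
    have "cmod (?a - of_real (k z * ?V)) \<le> e * ?V"
      by (rule convolution_cube_close[OF borel_measurable_continuous_onI[OF k] _ x]) (use J(2) in \<open>auto intro: less_imp_le\<close>)
    moreover have "cmod (?b - of_real (l z * ?V)) \<le> e * ?V"
      by (rule convolution_cube_close[OF borel_measurable_continuous_onI[OF l] _ x]) (use J(2) in \<open>auto intro: less_imp_le\<close>)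
    moreover have "cmod (complex_of_real (k z * ?V) - of_real (l z * ?V))
        \<le> cmod (?a - of_real (k z * ?V)) + cmod (?b - of_real (l z * ?V))"
      using norm_triangle_ineq4[of "?b - of_real (l z * ?V)" "?a - of_real (k z * ?V)"] unfolding xeq by simp
    moreover have "cmod (complex_of_real (k z * ?V) - of_real (l z * ?V)) = \<bar>k z * ?V - l z * ?V\<bar>"
      by (simp only: norm_of_real flip: of_real_diff)
    moreover have "\<bar>k z * ?V - l z * ?V\<bar> = 3 * e * ?V"
      using V by (simp add: e_def abs_mult flip: left_diff_distrib)
    moreover have "3 * e * ?V > 2 * (e * ?V)" using e V by simp
    ultimately show False by linarith
  qed
qed

lemma continuous_heat_product:
  assumes "0 < \<beta>" "0 < t"
  shows "continuous_on UNIV (\<lambda>z :: 'n::finite \<Rightarrow> 'p::prime_card padic. \<Prod>i\<in>UNIV. heat1 \<beta> t (z i))"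
proof (rule continuous_on_prod)
  fix i
  show "continuous_on UNIV (\<lambda>z :: 'n \<Rightarrow> 'p padic. heat1 \<beta> t (z i))"
    by (rule continuous_on_compose2[OF continuous_heat1[OF assms] continuous_on_product_coordinates]) simp
qed

lemma heat_kernel_eq:
  fixes \<alpha> :: "'n::finite \<Rightarrow> real"
  assumes \<beta>: "0 < \<beta>" and \<alpha>: "\<And>i. \<alpha> i = \<beta>" and t: "0 < t"
  shows "heat_kernel padic_haar_n (vladimirov_semigroup \<alpha>) t = (\<lambda>z :: 'n \<Rightarrow> 'p::prime_card padic. \<Prod>i\<in>UNIV. heat1 \<beta> t (z i))"
proof -
  let ?K = "\<lambda>z :: 'n \<Rightarrow> 'p padic. \<Prod>i\<in>UNIV. heat1 \<beta> t (z i)"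
  have c: "continuous_on UNIV ?K" by (rule continuous_heat_product[OF \<beta> t])
  have r: "AE x in padic_haar_n. vladimirov_semigroup \<alpha> t f x = (LINT y|padic_haar_n. complex_of_real (?K (x - y)) * f y)"
    if "f \<in> L2_functions padic_haar_n" for f :: "('n \<Rightarrow> 'p padic) \<Rightarrow> complex"
    using vladimirov_semigroup_eq[of \<beta> \<alpha> f t, OF \<beta> \<alpha> that] t
    by (simp add: heat_sg_def kernel_op_def heat_n_def prod_kernel_def)
  show ?thesis
    unfolding heat_kernel_def
  proof (rule the_equality)
    show "continuous_on UNIV ?K \<and> (\<forall>f\<in>L2_functions padic_haar_n. AE x in padic_haar_n.
        vladimirov_semigroup \<alpha> t f x = (LINT y|padic_haar_n. complex_of_real (?K (x - y)) * f y))"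
      using c r by blast
    fix k :: "('n \<Rightarrow> 'p padic) \<Rightarrow> real"
    assume k: "continuous_on UNIV k \<and> (\<forall>f\<in>L2_functions padic_haar_n. AE x in padic_haar_n.
        vladimirov_semigroup \<alpha> t f x = (LINT y|padic_haar_n. complex_of_real (k (x - y)) * f y))"
    show "k = ?K"
    proof (rule convolution_kernel_unique[OF conjunct1[OF k] c])
      fix f :: "('n \<Rightarrow> 'p padic) \<Rightarrow> complex" assume f: "f \<in> L2_functions padic_haar_n"
      show "AE x in padic_haar_n. (LINT y|padic_haar_n. complex_of_real (k (x - y)) * f y)
          = (LINT y|padic_haar_n. complex_of_real (?K (x - y)) * f y)"
        using bspec[OF conjunct2[OF k] f] r[OF f] by eventually_elim simp
    qed
  qed
qed

section \<open>Time integrals, transience and the Green function\<close>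

lemma nn_integral_powr_from_0:
  assumes "b > - 1" "s \<ge> 0"
  shows "(\<integral>\<^sup>+t. ennreal (t powr b) * indicator {0..s} t \<partial>lborel) = ennreal (s powr (b + 1) / (b + 1))"
proof -
  have "((\<lambda>t. if t \<in> {0..s} then t powr b else 0) has_integral (s powr (b + 1) / (b + 1))) UNIV"
    using has_integral_powr_from_0[OF assms] by (subst has_integral_restrict_UNIV)
  then have "(\<integral>\<^sup>+t. ennreal (if t \<in> {0..s} then t powr b else 0) \<partial>lborel) = ennreal (s powr (b + 1) / (b + 1))"
    by (intro nn_integral_has_integral_lborel) auto
  then show ?thesis by (subst nn_integral_cong) (auto simp: indicator_def)
qed

lemma nn_integral_powr_to_inf:
  assumes "a > 1" "s > 0"
  shows "(\<integral>\<^sup>+t. ennreal (t powr (- a)) * indicator {s..} t \<partial>lborel) = ennreal (s powr (1 - a) / (a - 1))"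
proof -
  have e: "- (s powr (- a + 1)) / (- a + 1) = s powr (1 - a) / (a - 1)"
    using assms(1) by (simp add: field_simps)
  have "((\<lambda>t. if t \<in> {s..} then t powr (- a) else 0) has_integral (s powr (1 - a) / (a - 1))) UNIV"
    using has_integral_powr_to_inf[of "- a" s] assms unfolding e by (subst has_integral_restrict_UNIV) simp
  then have "(\<integral>\<^sup>+t. ennreal (if t \<in> {s..} then t powr (- a) else 0) \<partial>lborel) = ennreal (s powr (1 - a) / (a - 1))"
    by (intro nn_integral_has_integral_lborel) auto
  then show ?thesis by (subst nn_integral_cong) (auto simp: indicator_def)
qed

text \<open>Small and large times are majorised by separate powers; the point \<open>s\<close> is
  counted in both pieces, which only enlarges the upper bound.\<close>

lemma nn_integral_powr_split:
  fixes h :: "real \<Rightarrow> real"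
  assumes s: "0 < s" and b: "b > - 1" and a: "a > 1" and D: "0 \<le> D" "0 \<le> E"
    and small: "\<And>t. 0 < t \<Longrightarrow> t \<le> s \<Longrightarrow> h t \<le> D * t powr b"
    and large: "\<And>t. s \<le> t \<Longrightarrow> h t \<le> E * t powr (- a)"
  shows "(\<integral>\<^sup>+t\<in>{0<..}. ennreal (h t) \<partial>lborel) \<le> ennreal (D * (s powr (b + 1) / (b + 1)) + E * (s powr (1 - a) / (a - 1)))"
proof -
  have "(\<integral>\<^sup>+t\<in>{0<..}. ennreal (h t) \<partial>lborel)
      \<le> (\<integral>\<^sup>+t. ennreal D * (ennreal (t powr b) * indicator {0..s} t) + ennreal E * (ennreal (t powr (- a)) * indicator {s..} t) \<partial>lborel)"
  proof (rule nn_integral_mono)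
    fix t :: real
    consider "t \<le> 0" | "0 < t" "t \<le> s" | "0 < t" "s \<le> t" by linarith
    then show "ennreal (h t) * indicator {0<..} t \<le> ennreal D * (ennreal (t powr b) * indicator {0..s} t) + ennreal E * (ennreal (t powr (- a)) * indicator {s..} t)"
    proof cases
      case 2
      have "ennreal (h t) \<le> ennreal D * ennreal (t powr b)"
        using small[OF 2] D by (simp add: ennreal_leI flip: ennreal_mult)
      then show ?thesis using 2 by (simp add: add_increasing2)
    next
      case 3
      have "ennreal (h t) \<le> ennreal E * ennreal (t powr (- a))"
        using large[OF 3(2)] D by (simp add: ennreal_leI flip: ennreal_mult)
      then show ?thesis using 3 by (simp add: add_increasing)
    qed simp
  qed
  also have "\<dots> = ennreal D * ennreal (s powr (b + 1) / (b + 1)) + ennreal E * ennreal (s powr (1 - a) / (a - 1))"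
    using s by (subst nn_integral_add) (simp_all add: nn_integral_cmult nn_integral_powr_from_0[OF b] nn_integral_powr_to_inf[OF a])
  also have "\<dots> = ennreal (D * (s powr (b + 1) / (b + 1)) + E * (s powr (1 - a) / (a - 1)))"
    using D a b by (simp add: ennreal_plus flip: ennreal_mult)
  finally show ?thesis .
qed

context
  fixes \<beta> :: real
  assumes \<beta>: "0 < \<beta>"
begin

lemma heat_product_le:
  "\<exists>C>0. \<forall>t>0. \<forall>z :: 'n::finite \<Rightarrow> 'p::prime_card padic.
    (\<Prod>i\<in>UNIV. heat1 \<beta> t (z i)) \<le> C * t powr (- (real CARD('n) / \<beta>))"
proof -
  obtain C where C: "C > 0" "\<And>t x. t > 0 \<Longrightarrow> heat1 \<beta> t (x :: 'p padic) \<le> C * t powr (- 1 / \<beta>)"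
    using heat1_le[OF \<beta>, where 'p='p] by blast
  have "(\<Prod>i\<in>UNIV. heat1 \<beta> t (z i)) \<le> C ^ CARD('n) * t powr (- (real CARD('n) / \<beta>))"
    if t: "t > 0" for t and z :: "'n \<Rightarrow> 'p padic"
  proof -
    have "(\<Prod>i\<in>UNIV. heat1 \<beta> t (z i)) \<le> (\<Prod>i\<in>(UNIV :: 'n set). C * t powr (- 1 / \<beta>))"
      using C(2)[OF t] heat1_nonneg[OF \<beta> t] by (intro prod_mono) auto
    also have "\<dots> = C ^ CARD('n) * t powr (- (real CARD('n) / \<beta>))"
      using t by (simp add: power_mult_distrib powr_realpow[symmetric] powr_powr)
    finally show ?thesis .
  qed
  then show ?thesis using C(1) by (intro exI[of _ "C ^ CARD('n)"]) auto
qed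

text \<open>The coordinate \<open>i\<close> uses the bound linear in \<open>t\<close>, the other n -
  1 coordinates the bound t^(-1/\<beta>), whence the exponent 1 - (n - 1)/\<beta>.\<close>

lemma heat_product_off_diagonal_le:
  "\<exists>D>0. \<forall>t>0. \<forall>z :: 'n::finite \<Rightarrow> 'p::prime_card padic. \<forall>i. z i \<noteq> 0 \<longrightarrow>
    (\<Prod>i\<in>UNIV. heat1 \<beta> t (z i)) \<le> D * padic_norm (z i) powr (- (1 + \<beta>)) * t powr (1 - (real CARD('n) - 1) / \<beta>)"
proof -
  obtain C where C: "C > 0" "\<And>t x. t > 0 \<Longrightarrow> heat1 \<beta> t (x :: 'p padic) \<le> C * t powr (- 1 / \<beta>)"
    using heat1_le[OF \<beta>, where 'p='p] by blast
  obtain C' where C': "C' > 0" "\<And>t x. t > 0 \<Longrightarrow> x \<noteq> 0 \<Longrightarrow> heat1 \<beta> t (x :: 'p padic) \<le> C' * t * padic_norm x powr (- (1 + \<beta>))"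
    using heat1_off_diagonal_le[OF \<beta>, where 'p='p] by blast
  let ?m = "CARD('n) - 1"
  have "(\<Prod>i\<in>UNIV. heat1 \<beta> t (z i)) \<le> (C' * C ^ ?m) * padic_norm (z i) powr (- (1 + \<beta>)) * t powr (1 - (real CARD('n) - 1) / \<beta>)"
    if t: "t > 0" and z: "z i \<noteq> 0" for t and z :: "'n \<Rightarrow> 'p padic" and i
  proof -
    have m: "real ?m = real CARD('n) - 1" by simp
    have "(\<Prod>i\<in>UNIV. heat1 \<beta> t (z i)) = heat1 \<beta> t (z i) * (\<Prod>k\<in>UNIV - {i}. heat1 \<beta> t (z k))"
      by (rule prod.remove) auto
    also have "\<dots> \<le> (C' * t * padic_norm (z i) powr (- (1 + \<beta>))) * (\<Prod>k\<in>UNIV - {i}. C * t powr (- 1 / \<beta>))"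
      using C(2)[OF t] C'(1) C'(2)[of t "z i", OF t z] heat1_nonneg[OF \<beta> t] t
      by (intro mult_mono prod_mono prod_nonneg) auto
    also have "(\<Prod>k\<in>UNIV - {i}. C * t powr (- 1 / \<beta>)) = C ^ ?m * t powr (- ((real CARD('n) - 1) / \<beta>))"
      using t by (simp add: power_mult_distrib powr_realpow[symmetric] powr_powr card_Diff_singleton m)
    also have "(C' * t * padic_norm (z i) powr (- (1 + \<beta>))) * (C ^ ?m * t powr (- ((real CARD('n) - 1) / \<beta>)))
        = (C' * C ^ ?m) * padic_norm (z i) powr (- (1 + \<beta>)) * (t powr 1 * t powr (- ((real CARD('n) - 1) / \<beta>)))"
      using t by (simp add: mult_ac)
    also have "t powr 1 * t powr (- ((real CARD('n) - 1) / \<beta>)) = t powr (1 - (real CARD('n) - 1) / \<beta>)"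
      by (simp only: powr_add[symmetric]) simp
    finally show ?thesis .
  qed
  then show ?thesis using C(1) C'(1) by (intro exI[of _ "C' * C ^ ?m"]) auto
qed

lemma heat_product_ge:
  "\<exists>c>0. \<forall>t>0. \<forall>z :: 'n::finite \<Rightarrow> 'p::prime_card padic. (\<forall>i. padic_norm (z i) powr \<beta> \<le> t) \<longrightarrow>
    c * t powr (- (real CARD('n) / \<beta>)) \<le> (\<Prod>i\<in>UNIV. heat1 \<beta> t (z i))"
proof -
  obtain c where c: "c > 0" "\<And>t x. t > 0 \<Longrightarrow> padic_norm x powr \<beta> \<le> t \<Longrightarrow> c * t powr (- 1 / \<beta>) \<le> heat1 \<beta> t (x :: 'p padic)"
    using heat1_ge[OF \<beta>, where 'p='p] by blast
  have "c ^ CARD('n) * t powr (- (real CARD('n) / \<beta>)) \<le> (\<Prod>i\<in>UNIV. heat1 \<beta> t (z i))"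
    if t: "t > 0" and z: "\<And>i. padic_norm (z i) powr \<beta> \<le> t" for t and z :: "'n \<Rightarrow> 'p padic"
  proof -
    have "c ^ CARD('n) * t powr (- (real CARD('n) / \<beta>)) = (\<Prod>i\<in>(UNIV :: 'n set). c * t powr (- 1 / \<beta>))"
      using t by (simp add: power_mult_distrib powr_realpow[symmetric] powr_powr)
    also have "\<dots> \<le> (\<Prod>i\<in>UNIV. heat1 \<beta> t (z i))"
      using c(2)[OF t z] c(1) by (intro prod_mono) auto
    finally show ?thesis .
  qed
  then show ?thesis using c(1) by (intro exI[of _ "c ^ CARD('n)"]) auto
qed

lemma heat_product_integral_le:
  assumes "0 < t"
  shows "(\<integral>\<^sup>+y. ennreal (\<Prod>i\<in>UNIV. heat1 \<beta> t ((x - y) i)) \<partial>(padic_haar_n :: ('n::finite \<Rightarrow> 'p::prime_card padic) measure)) \<le> 1"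
proof -
  have "(\<integral>\<^sup>+y. ennreal \<bar>heat_n \<beta> t x y\<bar> \<partial>(padic_haar_n :: ('n \<Rightarrow> 'p padic) measure)) \<le> 1"
    using schur_heat_n[OF \<beta> assms, where 'n='n and 'p='p] by (simp add: schur_kernel_def)
  then show ?thesis
    by (simp add: heat_n_def prod_kernel_def abs_prod heat1_nonneg[OF \<beta> assms])
qed

text \<open>For small times the kernel has mass at most 1, so the integrand is at most the bound of
  \<open>f\<close>. For large times the kernel is at most a multiple of t^(-n/\<beta>), the support
  of \<open>f\<close> has finite volume, and n/\<beta> > 1.\<close>

lemma transient_vladimirov:
  assumes \<alpha>: "\<And>i. \<alpha> i = \<beta>" and less: "\<beta> < real CARD('n)"
  shows "transient_semigroup (padic_haar_n :: ('n::finite \<Rightarrow> 'p::prime_card padic) measure) (vladimirov_semigroup \<alpha>)"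
  unfolding transient_semigroup_def
proof (intro allI impI)
  fix f :: "('n \<Rightarrow> 'p padic) \<Rightarrow> real"
  assume "f \<in> borel_measurable borel \<and> (\<forall>x. 0 \<le> f x) \<and> bounded (range f) \<and> compact (closure {x. f x \<noteq> 0})"
  then have f[measurable]: "f \<in> borel_measurable borel" and f0: "\<And>x. 0 \<le> f x" and fb: "bounded (range f)"
    and supp: "compact (closure {x. f x \<noteq> 0})" by auto
  obtain B where B: "0 < B" "\<And>x. f x \<le> B"
    using fb unfolding bounded_pos by (auto simp: f0)
  obtain N :: nat where "closure {x. f x \<noteq> 0} \<subseteq> cube (\<lambda>_. 0) (int N)" by (rule compact_subset_cube[OF supp])
  then have N: "{x. f x \<noteq> 0} \<subseteq> cube (\<lambda>_. 0) (int N)" by (rule subset_trans[OF closure_subset])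
  let ?Q = "cube (\<lambda>_. 0) (int N) :: ('n \<Rightarrow> 'p padic) set"
  define V where "V = (real CARD('p) powi int N) ^ CARD('n)"
  have V: "V \<ge> 0" by (simp add: V_def)
  have fQ: "f y \<le> B * indicator ?Q y" for y
  proof (cases "y \<in> ?Q")
    case False
    then have "f y = 0" using N by blast
    then show ?thesis using False by simp
  qed (use B(2) in simp)
  let ?K = "\<lambda>t (z :: 'n \<Rightarrow> 'p padic). \<Prod>i\<in>UNIV. heat1 \<beta> t (z i)"
  obtain C where C: "C > 0" "\<And>t z. t > 0 \<Longrightarrow> ?K t z \<le> C * t powr (- (real CARD('n) / \<beta>))"
    using heat_product_le[where 'n='n and 'p='p] by blast
  have K0: "0 \<le> ?K t z" if "t > 0" for t z using heat1_nonneg[OF \<beta> that] by (intro prod_nonneg) auto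
  have m: "(\<lambda>y. ?K t (x - y)) \<in> borel_measurable borel" if t: "t > 0" for t x
    by (rule measurable_padic_n_diff[OF borel_measurable_continuous_onI[OF continuous_heat_product[OF \<beta> t]]])
  let ?h = "\<lambda>t x. LINT y|padic_haar_n. heat_kernel padic_haar_n (vladimirov_semigroup \<alpha>) t (x - y) * f y"
  \<comment> \<open>The inequality holds even when the right-hand side is infinite, where
    \<open>enn2real\<close> returns 0.\<close>
  have h: "ennreal (?h t x) \<le> (\<integral>\<^sup>+y. ennreal (?K t (x - y) * f y) \<partial>padic_haar_n)" if t: "t > 0" for t x
  proof -
    have "?h t x = enn2real (\<integral>\<^sup>+y. ennreal (?K t (x - y) * f y) \<partial>padic_haar_n)"
      unfolding heat_kernel_eq[of \<beta> \<alpha> t, OF \<beta> \<alpha> t]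
      by (rule integral_eq_nn_integral) (use K0[OF t] f0 borel_measurable_times[OF m[OF t] f] in auto)
    then show ?thesis by (simp add: ennreal_enn2real_if)
  qed
  have small: "?h t x \<le> B * t powr 0" if t: "t > 0" for t x
  proof -
    have "ennreal (?h t x) \<le> (\<integral>\<^sup>+y. ennreal B * ennreal (?K t (x - y)) \<partial>padic_haar_n)"
    proof (intro order_trans[OF h[OF t]] nn_integral_mono)
      fix y
      have "?K t (x - y) * f y \<le> B * ?K t (x - y)"
        using mult_left_mono[OF B(2) K0[OF t]] by (subst mult.commute[of B])
      then show "ennreal (?K t (x - y) * f y) \<le> ennreal B * ennreal (?K t (x - y))"
        using K0[OF t] B(1) by (subst ennreal_mult[symmetric]) (auto simp: ennreal_leI simp del: fun_diff_def minus_apply)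
    qed
    also have "\<dots> \<le> ennreal B * 1"
      using m[OF t, of x] heat_product_integral_le[OF t, of x] 
      by (subst nn_integral_cmult) (auto intro: mult_left_mono[of _ 1 "ennreal B", simplified])
    finally show ?thesis using B(1) t by simp
  qed
  have large: "?h t x \<le> (C * B * V) * t powr (- (real CARD('n) / \<beta>))" if t: "t > 0" for t x
  proof -
    let ?c = "C * t powr (- (real CARD('n) / \<beta>))"
    have "ennreal (?h t x) \<le> (\<integral>\<^sup>+y. ennreal (?c * B) * indicator ?Q y \<partial>padic_haar_n)"
    proof (intro order_trans[OF h[OF t]] nn_integral_mono)
      fix y
      have "?K t (x - y) * f y \<le> ?c * (B * indicator ?Q y)"
        by (rule mult_mono[OF C(2)[OF t] fQ]) (use C(1) f0 in auto)
      then show "ennreal (?K t (x - y) * f y) \<le> ennreal (?c * B) * indicator ?Q y"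
        by (cases "y \<in> ?Q") (auto intro!: ennreal_leI simp: ennreal_neg)
    qed
    also have "\<dots> = ennreal (?c * B) * ennreal V" by (simp add: nn_integral_cmult emeasure_cube V_def)
    also have "\<dots> = ennreal (?c * B * V)" using B(1) C(1) V by (simp flip: ennreal_mult)
    finally have "?h t x \<le> ?c * B * V" using B(1) C(1) V by (subst (asm) ennreal_le_iff) auto
    then show ?thesis by (simp add: mult_ac)
  qed
  have a: "real CARD('n) / \<beta> > 1" using less \<beta> by simp
  \<comment> \<open>The split point is 1, and the constant bound for small times is the power with
    exponent 0.\<close>
  show "\<exists>D. \<forall>x. (\<integral>\<^sup>+t\<in>{0<..}. ennreal (?h t x) \<partial>lborel) \<le> ennreal D"
    by (rule exI, rule allI, rule nn_integral_powr_split[OF zero_less_one _ a, where b = 0 and D = B and E = "C * B * V"])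
      (use small large B(1) C(1) V in auto)
qed

text \<open>A coordinate at which the maximum is attained supplies the decay for t \<le> s. For the
  lower bound, t \<ge> s makes the on-diagonal estimate available in every coordinate at once, and
  smaller times are discarded.\<close>

lemma green_function_estimate:
  fixes \<alpha> :: "'n::finite \<Rightarrow> real"
  assumes \<alpha>: "\<And>i. \<alpha> i = \<beta>" and gt: "(real CARD('n) - 1) / 2 < \<beta>" and less: "\<beta> < real CARD('n)"
  shows "\<exists>c>0. \<exists>C>0. \<forall>z :: 'n \<Rightarrow> 'p::prime_card padic. z \<noteq> (\<lambda>_. 0) \<longrightarrow>
    ennreal (c * padic_alpha_norm \<alpha> z powr (1 - real CARD('n) / \<beta>)) \<le> green_function padic_haar_n (vladimirov_semigroup \<alpha>) z \<and>
    green_function padic_haar_n (vladimirov_semigroup \<alpha>) z \<le> ennreal (C * padic_alpha_norm \<alpha> z powr (1 - real CARD('n) / \<beta>))"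
proof -
  let ?a = "real CARD('n) / \<beta>" and ?b = "1 - (real CARD('n) - 1) / \<beta>"
  let ?K = "\<lambda>t (z :: 'n \<Rightarrow> 'p padic). \<Prod>i\<in>UNIV. heat1 \<beta> t (z i)"
  have a: "?a > 1" using less \<beta> by simp
  \<comment> \<open>This is the lower bound on \<beta>: the small-time power of t is integrable at
    0.\<close>
  have b: "?b > - 1" using gt \<beta> by (simp add: field_simps)
  obtain C where C: "C > 0" "\<And>t z. t > 0 \<Longrightarrow> ?K t z \<le> C * t powr (- ?a)"
    using heat_product_le[where 'n='n and 'p='p] by blast
  obtain D where D: "D > 0" "\<And>t z i. t > 0 \<Longrightarrow> z i \<noteq> 0 \<Longrightarrow> ?K t z \<le> D * padic_norm (z i) powr (- (1 + \<beta>)) * t powr ?b"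
    using heat_product_off_diagonal_le[where 'n='n and 'p='p] by blast
  obtain c where c: "c > 0" "\<And>t z. t > 0 \<Longrightarrow> (\<And>i. padic_norm (z i) powr \<beta> \<le> t) \<Longrightarrow> c * t powr (- ?a) \<le> ?K t z"
    using heat_product_ge[where 'n='n and 'p='p] by blast
  have K0: "0 \<le> ?K t z" if "t > 0" for t z using heat1_nonneg[OF \<beta> that] by (intro prod_nonneg) auto
  have green: "green_function padic_haar_n (vladimirov_semigroup \<alpha>) z = (\<integral>\<^sup>+t\<in>{0<..}. ennreal (?K t z) \<partial>lborel)" for z
    unfolding green_function_def
    by (rule nn_integral_cong) (simp add: heat_kernel_eq[of \<beta> \<alpha>, OF \<beta> \<alpha>] indicator_def)
  define E where "E = D / (?b + 1) + C / (?a - 1)"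
  have "ennreal (c / (?a - 1) * padic_alpha_norm \<alpha> z powr (1 - ?a)) \<le> green_function padic_haar_n (vladimirov_semigroup \<alpha>) z \<and>
    green_function padic_haar_n (vladimirov_semigroup \<alpha>) z \<le> ennreal (E * padic_alpha_norm \<alpha> z powr (1 - ?a))"
    if z: "z \<noteq> (\<lambda>_. 0)" for z :: "'n \<Rightarrow> 'p padic"
  proof -
    define s where "s = padic_alpha_norm \<alpha> z"
    have s_eq: "s = Max (range (\<lambda>i. padic_norm (z i) powr \<beta>))" by (simp add: s_def padic_alpha_norm_def \<alpha>)
    have le: "padic_norm (z i) powr \<beta> \<le> s" for i unfolding s_eq by (intro Max_ge) auto
    have "s \<in> range (\<lambda>i. padic_norm (z i) powr \<beta>)" unfolding s_eq by (rule Max_in) auto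
    then obtain i where i: "s = padic_norm (z i) powr \<beta>" by auto
    obtain k where "z k \<noteq> 0" using z by auto
    then have "padic_norm (z k) powr \<beta> > 0" by (simp add: padic_norm_eq_0_iff)
    then have s: "s > 0" using le[of k] by linarith
    then have zi: "z i \<noteq> 0" "padic_norm (z i) \<noteq> 0" using i by (auto simp: padic_norm_eq_0_iff)
    \<comment> \<open>The norm of \<open>z i\<close> is s^(1/\<beta>).\<close>
    have r: "padic_norm (z i) powr (- (1 + \<beta>)) = s powr (- (1 + 1 / \<beta>))"
    proof -
      have "- (1 + \<beta>) = \<beta> * - (1 + 1 / \<beta>)" using \<beta> by (simp add: algebra_simps)
      then show ?thesis unfolding i powr_powr by (rule arg_cong)
    qed
    have "green_function padic_haar_n (vladimirov_semigroup \<alpha>) z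
        \<le> ennreal ((D * s powr (- (1 + 1 / \<beta>))) * (s powr (?b + 1) / (?b + 1)) + C * (s powr (1 - ?a) / (?a - 1)))"
      unfolding green
    proof (rule nn_integral_powr_split[OF s b a])
      fix t :: real assume t: "0 < t"
      show "?K t z \<le> D * s powr (- (1 + 1 / \<beta>)) * t powr ?b" using D(2)[of t z i, OF t zi(1)] by (simp only: r)
    next
      fix t :: real assume "s \<le> t"
      then show "?K t z \<le> C * t powr (- ?a)" using s by (intro C(2)) simp
    qed (use C(1) D(1) in auto)
    also have "(D * s powr (- (1 + 1 / \<beta>))) * (s powr (?b + 1) / (?b + 1)) = D / (?b + 1) * (s powr (- (1 + 1 / \<beta>)) * s powr (?b + 1))"
      by simp
    \<comment> \<open>The exponents add up: -(1 + 1/\<beta>) + 2 - (n - 1)/\<beta> = 1 -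
      n/\<beta>.\<close>
    also have "s powr (- (1 + 1 / \<beta>)) * s powr (?b + 1) = s powr (1 - ?a)"
      unfolding powr_add[symmetric] using \<beta> by (intro arg_cong[where f = "(powr) s"]) (simp add: field_simps)
    also have "D / (?b + 1) * s powr (1 - ?a) + C * (s powr (1 - ?a) / (?a - 1)) = E * s powr (1 - ?a)"
      by (simp add: E_def distrib_right)
    finally have upper: "green_function padic_haar_n (vladimirov_semigroup \<alpha>) z \<le> ennreal (E * s powr (1 - ?a))" .
    have "ennreal (c / (?a - 1) * s powr (1 - ?a)) = ennreal c * ennreal (s powr (1 - ?a) / (?a - 1))"
      using c(1) a by (simp flip: ennreal_mult)
    also have "\<dots> = (\<integral>\<^sup>+t. ennreal c * (ennreal (t powr (- ?a)) * indicator {s..} t) \<partial>lborel)"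
      by (simp add: nn_integral_cmult nn_integral_powr_to_inf[OF a s])
    also have "\<dots> \<le> (\<integral>\<^sup>+t\<in>{0<..}. ennreal (?K t z) \<partial>lborel)"
    proof (rule nn_integral_mono)
      fix t :: real
      show "ennreal c * (ennreal (t powr (- ?a)) * indicator {s..} t) \<le> ennreal (?K t z) * indicator {0<..} t"
      proof (cases "s \<le> t")
        case True
        then have "c * t powr (- ?a) \<le> ?K t z" using s le by (intro c(2)) (auto intro: order_trans)
        then show ?thesis using True s c(1) by (simp add: ennreal_leI flip: ennreal_mult)
      qed simp
    qed
    finally have "ennreal (c / (?a - 1) * s powr (1 - ?a)) \<le> green_function padic_haar_n (vladimirov_semigroup \<alpha>) z"
      unfolding green .
    with upper show ?thesis by (simp only: s_def)
  qed
  moreover have "c / (?a - 1) > 0" using c(1) a by simp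
  moreover have "D / (?b + 1) > 0" "C / (?a - 1) > 0"
    by (rule divide_pos_pos[OF D(1)], use b in linarith, rule divide_pos_pos[OF C(1)], use a in linarith)
  then have "E > 0" unfolding E_def by (rule add_pos_pos)
  ultimately show ?thesis by blast
qed

end

theorem proposition5p15:
  fixes \<alpha> :: "'n::finite \<Rightarrow> real" and \<beta> A :: real
  assumes "\<And>i. \<alpha> i = \<beta>"
    and "(real CARD('n) - 1) / 2 < \<beta>"
    and "\<beta> < real CARD('n)"
    and "A = (\<Sum>i\<in>UNIV. 1 / \<alpha> i)"
  shows "transient_semigroup (padic_haar_n :: ('n \<Rightarrow> 'p::prime_card padic) measure)
           (vladimirov_semigroup \<alpha>) \<and>
         (\<exists>c\<^sub>1>0. \<exists>c\<^sub>2>0. \<forall>z :: 'n \<Rightarrow> 'p padic. z \<noteq> (\<lambda>_. 0) \<longrightarrow>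
            ennreal (c\<^sub>1 * (1 / padic_alpha_norm \<alpha> z) powr (A - 1))
              \<le> green_function padic_haar_n (vladimirov_semigroup \<alpha>) z \<and>
            green_function padic_haar_n (vladimirov_semigroup \<alpha>) z
              \<le> ennreal (c\<^sub>2 * (1 / padic_alpha_norm \<alpha> z) powr (A - 1)))"
proof -
  \<comment> \<open>The index type is nonempty, so n \<ge> 1 and the lower bound on \<beta> makes it
    positive.\<close>
  have "0 \<le> (real CARD('n) - 1) / 2" by (simp add: Suc_le_eq card_gt_0_iff)
  then have \<beta>: "0 < \<beta>" using assms(2) by (rule order_le_less_trans)
  have A: "A = real CARD('n) / \<beta>" by (simp add: assms(4,1))
  have "(1 / padic_alpha_norm \<alpha> z) powr (A - 1) = padic_alpha_norm \<alpha> z powr (1 - real CARD('n) / \<beta>)" for z :: "'n \<Rightarrow> 'p padic"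
  proof -
    \<comment> \<open>Nonnegativity of the base is what allows its inverse to be moved into the
      exponent.\<close>
    have "0 \<le> padic_norm (z i) powr \<alpha> i" for i by simp
    then have "padic_alpha_norm \<alpha> z \<ge> 0"
      unfolding padic_alpha_norm_def by (subst Max_ge_iff) auto
    then show ?thesis unfolding A by (simp add: powr_divide powr_minus_divide[symmetric])
  qed
  then show ?thesis
    using transient_vladimirov[of \<beta> \<alpha>, OF \<beta> assms(1,3), where 'p='p]
      green_function_estimate[of \<beta> \<alpha>, OF \<beta> assms(1,2,3), where 'p='p] by simp
qed

end
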